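(* Let $P\subset A$ be an inclusion of unital, separable, infinite-dimensional $C^*$-algebras, and let $E:A\to P$ be an outer conditional expectation of index-finite type. Let $B=C^*\langle A,e_P\rangle$ be the basic construction and let $\widehat E:B\to A$ be the dual conditional expectation. Suppose that $A$ is simple and that $\widehat E$ is outer. Then $E$ has the weak tracial Rokhlin property if and only if $\widehat E$ is weakly tracially approximately representable.
   Context: Ultrapowers and comparison. Fix a free ultrafilter $\omega$ on $\mathbb N$. For a $C^*$-algebra $A$, $A_\omega=\ell^\infty(\mathbb N,A)/\{(a_n)_n:\lim_{n\to\omega}\|a_n\|=0\}$; $A$ is identified with the constant sequences and $A_\omega\cap A'$ is the relative commutant of $A$ in $A_\omega$. A subalgebra $P\subset A$ gives $P_\omega\subset A_\omega$, and a bounded linear map $E:A\to P$ induces $E_\omega:A_\omega\to P_\omega$ coordinatewise. For positive $a,b$ in a $C^*$-algebra $C$, $a\lesssim b$ (in $C$) means that there is a sequence $(x_n)$ in $C$ with $x_nbx_n^*\to a$. Index. Inclusions $P\subset A$ share the same unit. A conditional expectation $E:A\to P$ is of index-finite type if there is a finite family $\{(u_j,v_j)\}_j\subset A\times A$ (a quasi-basis) with $x=\sum_j u_jE(v_jx)=\sum_jE(xu_j)v_j$ for all $x\in A$; then $\operatorname{Index}E:=\sum_ju_jv_j\in Z(A)$, a positive scalar when $A$ is simple. Such an $E$ is automatically faithful. Basic construction. Let $\mathcal E_E$ be the Hilbert $P$-module completion of $A$ for $\langle x,y\rangle_P=E(x^*y)$, with $A$ acting (faithfully) by left multiplication, and let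 $e_P$ be the Jones projection, the adjointable operator on $\mathcal E_E$ extending $x\mapsto E(x)$. The basic construction is $B=C^*\langle A,e_P\rangle=\{\sum_{i=1}^n x_ie_Py_i: x_i,y_i\in A, n\in\mathbb N\}$. The dual conditional expectation $\widehat E:B\to A$ is given by $\widehat E(xe_Py)=(\operatorname{Index}E)^{-1}xy$; it is again of index-finite type. Outer expectation. $E:A\to P$ is outer if for every $x\in A$ and every nonzero hereditary $C^*$-subalgebra $C\subset P$, $\inf\{\|c(x-E(x))c\|: c\in C_+,\ \|c\|=1\}=0$. Weak tracial Rokhlin property. For $A$ simple and $E:A\to P$ of index-finite type, $E$ has the weak tracial Rokhlin property if for every nonzero positive $a\in A_\omega$ there is a nonzero positive contraction $e\in A_\omega\cap A'$ such that (1) $(\operatorname{Index}E)\,e^{1/2}e_Pe^{1/2}=e$ (in the ultrapower of the basic construction), and (2) $1-(\operatorname{Index}E)E_\omega(e)\lesssim a$ in $A_\omega$. Weak tracial approximate representability. An index-finite type $E:A\to P$ is weakly tracially approximately representable if for every nonzero positive $a\in A_\omega$ there are positive contractions $e\in P_\omega\cap P'$ and $r\in A_\omega\cap A'$ and a finite set $\{u_i\}\subset A$ such that (1) $e^{1/2}xe^{1/2}=E(x)e$ for all $x\in A$; (2) $\sum_iu_ieu_i^*=r$ and $re^{1/2}=e^{3/2}=e^{1/2}r$; (3) $1-r\lesssim a$ in $A_\omega$; (4) the map $P\ni x\mapsto xe$ is injective. All these definitions apply also to $\widehat E:B\to A$, with $(B,A)$ in place of $(A,P)$. *)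

theory Defs
  imports Complex_Main "HOL-Library.Countable_Set" "HOL-Algebra.QuotRing"
begin

section \<open>Unital C*-algebras\<close>

text \<open>
  Unital C*-algebras are rings of \<open>HOL-Algebra\<close> with further operations; a subalgebra of \<open>A\<close>
  sharing the operations of \<open>A\<close> is \<open>A\<lparr>carrier := P\<rparr>\<close>. Types would not do here, because ultrapowers
  depend on a variable filter and the basic construction on a variable map.
\<close>

record 'a cstar = "'a ring" +
  cscale :: "complex \<Rightarrow> 'a \<Rightarrow> 'a"
  cadj :: "'a \<Rightarrow> 'a"
  cnorm :: "'a \<Rightarrow> real"

definition ctendsto :: "'a cstar \<Rightarrow> (nat \<Rightarrow> 'a) \<Rightarrow> 'a \<Rightarrow> bool" where
  "ctendsto A x a \<longleftrightarrow> (\<lambda>n. cnorm A (x n \<ominus>\<^bsub>A\<^esub> a)) \<longlonglongrightarrow> 0"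

locale cstar_algebra = ring A for A :: "'a cstar" (structure) +
  assumes scale_closed: "x \<in> carrier A \<Longrightarrow> cscale A c x \<in> carrier A"
    and scale_one: "x \<in> carrier A \<Longrightarrow> cscale A 1 x = x"
    and scale_scale: "x \<in> carrier A \<Longrightarrow> cscale A c (cscale A d x) = cscale A (c * d) x"
    and scale_add_left: "x \<in> carrier A \<Longrightarrow> cscale A (c + d) x = cscale A c x \<oplus> cscale A d x"
    and scale_add_right:
      "\<lbrakk>x \<in> carrier A; y \<in> carrier A\<rbrakk> \<Longrightarrow> cscale A c (x \<oplus> y) = cscale A c x \<oplus> cscale A c y"
    and scale_mult_left:
      "\<lbrakk>x \<in> carrier A; y \<in> carrier A\<rbrakk> \<Longrightarrow> cscale A c (x \<otimes> y) = cscale A c x \<otimes> y"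
    and scale_mult_right:
      "\<lbrakk>x \<in> carrier A; y \<in> carrier A\<rbrakk> \<Longrightarrow> cscale A c (x \<otimes> y) = x \<otimes> cscale A c y"
    and adj_closed: "x \<in> carrier A \<Longrightarrow> cadj A x \<in> carrier A"
    and adj_adj: "x \<in> carrier A \<Longrightarrow> cadj A (cadj A x) = x"
    and adj_add: "\<lbrakk>x \<in> carrier A; y \<in> carrier A\<rbrakk> \<Longrightarrow> cadj A (x \<oplus> y) = cadj A x \<oplus> cadj A y"
    and adj_mult: "\<lbrakk>x \<in> carrier A; y \<in> carrier A\<rbrakk> \<Longrightarrow> cadj A (x \<otimes> y) = cadj A y \<otimes> cadj A x"
    and adj_scale: "x \<in> carrier A \<Longrightarrow> cadj A (cscale A c x) = cscale A (cnj c) (cadj A x)"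
    and norm_nonneg: "x \<in> carrier A \<Longrightarrow> 0 \<le> cnorm A x"
    and norm_eq_zero: "x \<in> carrier A \<Longrightarrow> cnorm A x = 0 \<longleftrightarrow> x = \<zero>"
    and norm_scale: "x \<in> carrier A \<Longrightarrow> cnorm A (cscale A c x) = cmod c * cnorm A x"
    and norm_triangle:
      "\<lbrakk>x \<in> carrier A; y \<in> carrier A\<rbrakk> \<Longrightarrow> cnorm A (x \<oplus> y) \<le> cnorm A x + cnorm A y"
    and norm_mult:
      "\<lbrakk>x \<in> carrier A; y \<in> carrier A\<rbrakk> \<Longrightarrow> cnorm A (x \<otimes> y) \<le> cnorm A x * cnorm A y"
    and cstar_identity: "x \<in> carrier A \<Longrightarrow> cnorm A (cadj A x \<otimes> x) = (cnorm A x)\<^sup>2"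
    and complete:
      "\<lbrakk>\<And>n. s n \<in> carrier A;
        \<And>\<epsilon>. 0 < \<epsilon> \<Longrightarrow> \<exists>N. \<forall>m\<ge>N. \<forall>n\<ge>N. cnorm A (s m \<ominus> s n) < \<epsilon>\<rbrakk>
       \<Longrightarrow> \<exists>a\<in>carrier A. ctendsto A s a"

definition cclosed :: "'a cstar \<Rightarrow> 'a set \<Rightarrow> bool" where
  "cclosed A S \<longleftrightarrow> (\<forall>x a. (\<forall>n. x n \<in> S) \<and> a \<in> carrier A \<and> ctendsto A x a \<longrightarrow> a \<in> S)"

definition cstar_subalgebra :: "'a set \<Rightarrow> 'a cstar \<Rightarrow> bool" where
  "cstar_subalgebra C A \<longleftrightarrow>
     C \<subseteq> carrier A \<and> \<zero>\<^bsub>A\<^esub> \<in> C \<and>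
     (\<forall>x\<in>C. \<forall>y\<in>C. x \<oplus>\<^bsub>A\<^esub> y \<in> C \<and> x \<otimes>\<^bsub>A\<^esub> y \<in> C) \<and>
     (\<forall>x\<in>C. cadj A x \<in> C \<and> (\<forall>c. cscale A c x \<in> C)) \<and>
     cclosed A C"

definition unital_cstar_subalgebra :: "'a set \<Rightarrow> 'a cstar \<Rightarrow> bool" where
  "unital_cstar_subalgebra P A \<longleftrightarrow> cstar_subalgebra P A \<and> \<one>\<^bsub>A\<^esub> \<in> P"

definition cseparable :: "'a cstar \<Rightarrow> bool" where
  "cseparable A \<longleftrightarrow>
     (\<exists>D\<subseteq>carrier A. countable D \<and>
        (\<forall>x\<in>carrier A. \<forall>\<epsilon>>0. \<exists>d\<in>D. cnorm A (x \<ominus>\<^bsub>A\<^esub> d) < \<epsilon>))"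

definition cfinite_dimensional :: "'a cstar \<Rightarrow> bool" where
  "cfinite_dimensional A \<longleftrightarrow>
     (\<exists>S\<subseteq>carrier A. finite S \<and>
        (\<forall>x\<in>carrier A. \<exists>c. x = (\<Oplus>\<^bsub>A\<^esub>s\<in>S. cscale A (c s) s)))"

text \<open>In a unital algebra every ring ideal is closed under complex scalars.\<close>

definition csimple :: "'a cstar \<Rightarrow> bool" where
  "csimple A \<longleftrightarrow> \<one>\<^bsub>A\<^esub> \<noteq> \<zero>\<^bsub>A\<^esub> \<and>
     (\<forall>I. ideal I A \<and> cclosed A I \<longrightarrow> I = {\<zero>\<^bsub>A\<^esub>} \<or> I = carrier A)"

definition cpos :: "'a cstar \<Rightarrow> 'a set" where
  "cpos A = {cadj A x \<otimes>\<^bsub>A\<^esub> x | x. x \<in> carrier A}"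

definition csqroot :: "'a cstar \<Rightarrow> 'a \<Rightarrow> 'a" where
  "csqroot A a = (THE b. b \<in> cpos A \<and> b \<otimes>\<^bsub>A\<^esub> b = a)"

definition cuntz_le :: "'a cstar \<Rightarrow> 'a \<Rightarrow> 'a \<Rightarrow> bool" where
  "cuntz_le A a b \<longleftrightarrow>
     (\<exists>x. (\<forall>n. x n \<in> carrier A) \<and> ctendsto A (\<lambda>n. x n \<otimes>\<^bsub>A\<^esub> b \<otimes>\<^bsub>A\<^esub> cadj A (x n)) a)"

definition hereditary_subalgebra :: "'a set \<Rightarrow> 'a cstar \<Rightarrow> bool" where
  "hereditary_subalgebra C A \<longleftrightarrow> cstar_subalgebra C A \<and>
     (\<forall>b\<in>cpos A. \<forall>c\<in>C. c \<ominus>\<^bsub>A\<^esub> b \<in> cpos A \<longrightarrow> b \<in> C)"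


section \<open>Conditional expectations\<close>

definition conditional_expectation :: "'a cstar \<Rightarrow> 'a set \<Rightarrow> ('a \<Rightarrow> 'a) \<Rightarrow> bool" where
  "conditional_expectation A P E \<longleftrightarrow>
     (\<forall>x\<in>carrier A. E x \<in> P) \<and>
     (\<forall>x\<in>carrier A. \<forall>y\<in>carrier A. E (x \<oplus>\<^bsub>A\<^esub> y) = E x \<oplus>\<^bsub>A\<^esub> E y) \<and>
     (\<forall>c. \<forall>x\<in>carrier A. E (cscale A c x) = cscale A c (E x)) \<and>
     (\<forall>p\<in>P. E p = p) \<and>
     (\<forall>p\<in>P. \<forall>q\<in>P. \<forall>x\<in>carrier A. E (p \<otimes>\<^bsub>A\<^esub> x \<otimes>\<^bsub>A\<^esub> q) = p \<otimes>\<^bsub>A\<^esub> E x \<otimes>\<^bsub>A\<^esub> q) \<and>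
     (\<forall>x\<in>cpos A. E x \<in> cpos (A\<lparr>carrier := P\<rparr>)) \<and>
     (\<forall>x\<in>carrier A. cnorm A (E x) \<le> cnorm A x)"

definition outer :: "'a cstar \<Rightarrow> 'a set \<Rightarrow> ('a \<Rightarrow> 'a) \<Rightarrow> bool" where
  "outer A P E \<longleftrightarrow>
     (\<forall>x\<in>carrier A. \<forall>C. hereditary_subalgebra C (A\<lparr>carrier := P\<rparr>) \<and> C \<noteq> {\<zero>\<^bsub>A\<^esub>} \<longrightarrow>
        Inf {cnorm A (c \<otimes>\<^bsub>A\<^esub> (x \<ominus>\<^bsub>A\<^esub> E x) \<otimes>\<^bsub>A\<^esub> c) | c. c \<in> cpos (A\<lparr>carrier := C\<rparr>) \<and> cnorm A c = 1} = 0)"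

definition quasi_basis ::
    "'a cstar \<Rightarrow> ('a \<Rightarrow> 'a) \<Rightarrow> nat \<Rightarrow> (nat \<Rightarrow> 'a) \<Rightarrow> (nat \<Rightarrow> 'a) \<Rightarrow> bool" where
  "quasi_basis A E n u v \<longleftrightarrow>
     (\<forall>j<n. u j \<in> carrier A \<and> v j \<in> carrier A) \<and>
     (\<forall>x\<in>carrier A. x = (\<Oplus>\<^bsub>A\<^esub>j\<in>{..<n}. u j \<otimes>\<^bsub>A\<^esub> E (v j \<otimes>\<^bsub>A\<^esub> x)) \<and>
                    x = (\<Oplus>\<^bsub>A\<^esub>j\<in>{..<n}. E (x \<otimes>\<^bsub>A\<^esub> u j) \<otimes>\<^bsub>A\<^esub> v j))"

definition index_finite_type :: "'a cstar \<Rightarrow> ('a \<Rightarrow> 'a) \<Rightarrow> bool" where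
  "index_finite_type A E \<longleftrightarrow> (\<exists>n u v. quasi_basis A E n u v)"

text \<open>The value does not depend on the quasi-basis.\<close>

definition Index :: "'a cstar \<Rightarrow> ('a \<Rightarrow> 'a) \<Rightarrow> 'a" where
  "Index A E =
     (THE z. \<exists>n u v. quasi_basis A E n u v \<and> z = (\<Oplus>\<^bsub>A\<^esub>j\<in>{..<n}. u j \<otimes>\<^bsub>A\<^esub> v j))"


section \<open>The basic construction\<close>

text \<open>
  The right action of the coefficient algebra is not recorded: the adjointable operators of a
  Hilbert module are determined by its inner product.
\<close>

record ('a, 'h) hilbert_module =
  hcarrier :: "'h set"
  hzero :: 'h
  hadd :: "'h \<Rightarrow> 'h \<Rightarrow> 'h"
  hscale :: "complex \<Rightarrow> 'h \<Rightarrow> 'h"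
  hinner :: "'h \<Rightarrow> 'h \<Rightarrow> 'a"

definition hnorm :: "'a cstar \<Rightarrow> ('a, 'h) hilbert_module \<Rightarrow> 'h \<Rightarrow> real" where
  "hnorm A H X = sqrt (cnorm A (hinner H X X))"

definition is_adjoint :: "('a, 'h) hilbert_module \<Rightarrow> ('h \<Rightarrow> 'h) \<Rightarrow> ('h \<Rightarrow> 'h) \<Rightarrow> bool" where
  "is_adjoint H T S \<longleftrightarrow>
     (\<forall>X\<in>hcarrier H. \<forall>Y\<in>hcarrier H. hinner H (T X) Y = hinner H X (S Y))"

definition adjointable_operators ::
    "'a cstar \<Rightarrow> ('a, 'h) hilbert_module \<Rightarrow> ('h \<Rightarrow> 'h) cstar" where
  "adjointable_operators A H =
     \<lparr>carrier = {T \<in> hcarrier H \<rightarrow>\<^sub>E hcarrier H. \<exists>S \<in> hcarrier H \<rightarrow>\<^sub>E hcarrier H. is_adjoint H T S},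
      monoid.mult = (\<lambda>S T. compose (hcarrier H) S T),
      one = (\<lambda>X\<in>hcarrier H. X),
      zero = (\<lambda>X\<in>hcarrier H. hzero H),
      add = (\<lambda>S T. \<lambda>X\<in>hcarrier H. hadd H (S X) (T X)),
      cscale = (\<lambda>c T. \<lambda>X\<in>hcarrier H. hscale H c (T X)),
      cadj = (\<lambda>T. THE S. S \<in> hcarrier H \<rightarrow>\<^sub>E hcarrier H \<and> is_adjoint H T S),
      cnorm = (\<lambda>T. SUP X\<in>{X \<in> hcarrier H. hnorm A H X \<le> 1}. hnorm A H (T X))\<rparr>"

definition enorm :: "'a cstar \<Rightarrow> ('a \<Rightarrow> 'a) \<Rightarrow> 'a \<Rightarrow> real" where
  "enorm A E x = sqrt (cnorm A (E (cadj A x \<otimes>\<^bsub>A\<^esub> x)))"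

text \<open>
  The completion of \<open>A\<close> for \<open>\<langle>x, y\<rangle> = E (x* y)\<close>, as the \<open>enorm\<close>-Cauchy sequences modulo the null ones.
\<close>

definition ecauchy :: "'a cstar \<Rightarrow> ('a \<Rightarrow> 'a) \<Rightarrow> (nat \<Rightarrow> 'a) set" where
  "ecauchy A E =
     {x. (\<forall>n. x n \<in> carrier A) \<and>
         (\<forall>\<epsilon>>0. \<exists>N. \<forall>m\<ge>N. \<forall>n\<ge>N. enorm A E (x m \<ominus>\<^bsub>A\<^esub> x n) < \<epsilon>)}"

definition erel :: "'a cstar \<Rightarrow> ('a \<Rightarrow> 'a) \<Rightarrow> ((nat \<Rightarrow> 'a) \<times> (nat \<Rightarrow> 'a)) set" where
  "erel A E =
     {(x, y). x \<in> ecauchy A E \<and> y \<in> ecauchy A E \<and> (\<lambda>n. enorm A E (x n \<ominus>\<^bsub>A\<^esub> y n)) \<longlonglongrightarrow> 0}"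

definition emodule :: "'a cstar \<Rightarrow> ('a \<Rightarrow> 'a) \<Rightarrow> ('a, (nat \<Rightarrow> 'a) set) hilbert_module" where
  "emodule A E =
     \<lparr>hcarrier = ecauchy A E // erel A E,
      hzero = erel A E `` {\<lambda>_. \<zero>\<^bsub>A\<^esub>},
      hadd = (\<lambda>X Y. \<Union>x\<in>X. \<Union>y\<in>Y. erel A E `` {\<lambda>n. x n \<oplus>\<^bsub>A\<^esub> y n}),
      hscale = (\<lambda>c X. \<Union>x\<in>X. erel A E `` {\<lambda>n. cscale A c (x n)}),
      hinner = (\<lambda>X Y. THE p. p \<in> carrier A \<and>
                  (\<forall>x\<in>X. \<forall>y\<in>Y. ctendsto A (\<lambda>n. E (cadj A (x n) \<otimes>\<^bsub>A\<^esub> y n)) p))\<rparr>"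

text \<open>The extension to the completion of an \<open>enorm\<close>-bounded linear map on \<open>A\<close>.\<close>

definition eextend :: "'a cstar \<Rightarrow> ('a \<Rightarrow> 'a) \<Rightarrow> ('a \<Rightarrow> 'a) \<Rightarrow> (nat \<Rightarrow> 'a) set \<Rightarrow> (nat \<Rightarrow> 'a) set" where
  "eextend A E f = (\<lambda>X\<in>hcarrier (emodule A E). \<Union>x\<in>X. erel A E `` {\<lambda>n. f (x n)})"

definition left_mult :: "'a cstar \<Rightarrow> ('a \<Rightarrow> 'a) \<Rightarrow> 'a \<Rightarrow> (nat \<Rightarrow> 'a) set \<Rightarrow> (nat \<Rightarrow> 'a) set" where
  "left_mult A E a = eextend A E (\<lambda>x. a \<otimes>\<^bsub>A\<^esub> x)"

definition jones :: "'a cstar \<Rightarrow> ('a \<Rightarrow> 'a) \<Rightarrow> (nat \<Rightarrow> 'a) set \<Rightarrow> (nat \<Rightarrow> 'a) set" where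
  "jones A E = eextend A E E"

definition jones_sum ::
    "'a cstar \<Rightarrow> ('a \<Rightarrow> 'a) \<Rightarrow> nat \<Rightarrow> (nat \<Rightarrow> 'a) \<Rightarrow> (nat \<Rightarrow> 'a) \<Rightarrow> (nat \<Rightarrow> 'a) set \<Rightarrow> (nat \<Rightarrow> 'a) set" where
  "jones_sum A E n x y =
     (let L = adjointable_operators A (emodule A E)
      in \<Oplus>\<^bsub>L\<^esub>i\<in>{..<n}. left_mult A E (x i) \<otimes>\<^bsub>L\<^esub> jones A E \<otimes>\<^bsub>L\<^esub> left_mult A E (y i))"

text \<open>For \<open>E\<close> of index-finite type these sums contain the identity operator.\<close>

definition basic_construction ::
    "'a cstar \<Rightarrow> ('a \<Rightarrow> 'a) \<Rightarrow> ((nat \<Rightarrow> 'a) set \<Rightarrow> (nat \<Rightarrow> 'a) set) cstar" where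
  "basic_construction A E =
     (adjointable_operators A (emodule A E))
       \<lparr>carrier := {jones_sum A E n x y | n x y. \<forall>i<n. x i \<in> carrier A \<and> y i \<in> carrier A}\<rparr>"

text \<open>
  \<open>A\<close> is the subalgebra \<open>left_mult A E ` carrier A\<close> of the basic construction, and the dual
  expectation takes its values there.
\<close>

definition dual_expectation ::
    "'a cstar \<Rightarrow> ('a \<Rightarrow> 'a) \<Rightarrow> ((nat \<Rightarrow> 'a) set \<Rightarrow> (nat \<Rightarrow> 'a) set)
      \<Rightarrow> ((nat \<Rightarrow> 'a) set \<Rightarrow> (nat \<Rightarrow> 'a) set)" where
  "dual_expectation A E T =
     left_mult A E
       (THE z. \<exists>n x y. (\<forall>i<n. x i \<in> carrier A \<and> y i \<in> carrier A) \<and> T = jones_sum A E n x y \<and>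
                z = inv\<^bsub>A\<^esub> (Index A E) \<otimes>\<^bsub>A\<^esub> (\<Oplus>\<^bsub>A\<^esub>i\<in>{..<n}. x i \<otimes>\<^bsub>A\<^esub> y i))"


section \<open>Ultrapowers\<close>

definition free_ultrafilter :: "nat filter \<Rightarrow> bool" where
  "free_ultrafilter \<omega> \<longleftrightarrow> \<omega> \<noteq> bot \<and>
     (\<forall>Q. (\<forall>\<^sub>F n in \<omega>. Q n) \<or> (\<forall>\<^sub>F n in \<omega>. \<not> Q n)) \<and>
     (\<forall>m. \<forall>\<^sub>F n in \<omega>. n \<noteq> m)"

definition ell_infty :: "'a cstar \<Rightarrow> (nat \<Rightarrow> 'a) cstar" where
  "ell_infty A =
     \<lparr>carrier = {x. (\<forall>n. x n \<in> carrier A) \<and> (\<exists>M. \<forall>n. cnorm A (x n) \<le> M)},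
      monoid.mult = (\<lambda>x y n. x n \<otimes>\<^bsub>A\<^esub> y n),
      one = (\<lambda>n. \<one>\<^bsub>A\<^esub>),
      zero = (\<lambda>n. \<zero>\<^bsub>A\<^esub>),
      add = (\<lambda>x y n. x n \<oplus>\<^bsub>A\<^esub> y n),
      cscale = (\<lambda>c x n. cscale A c (x n)),
      cadj = (\<lambda>x n. cadj A (x n)),
      cnorm = (\<lambda>x. SUP n. cnorm A (x n))\<rparr>"

definition null_ideal :: "nat filter \<Rightarrow> 'a cstar \<Rightarrow> (nat \<Rightarrow> 'a) set" where
  "null_ideal \<omega> A = {x \<in> carrier (ell_infty A). ((\<lambda>n. cnorm A (x n)) \<longlongrightarrow> 0) \<omega>}"

definition ultra_class :: "nat filter \<Rightarrow> 'a cstar \<Rightarrow> (nat \<Rightarrow> 'a) \<Rightarrow> (nat \<Rightarrow> 'a) set" where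
  "ultra_class \<omega> A x = null_ideal \<omega> A +>\<^bsub>ell_infty A\<^esub> x"

definition ultrapower :: "nat filter \<Rightarrow> 'a cstar \<Rightarrow> (nat \<Rightarrow> 'a) set cstar" where
  "ultrapower \<omega> A =
     (let L = ell_infty A; Q = L Quot null_ideal \<omega> A
      in \<lparr>carrier = carrier Q, monoid.mult = monoid.mult Q, one = one Q, zero = zero Q, add = add Q,
          cscale = (\<lambda>c X. \<Union>x\<in>X. ultra_class \<omega> A (cscale L c x)),
          cadj = (\<lambda>X. \<Union>x\<in>X. ultra_class \<omega> A (cadj L x)),
          cnorm = (\<lambda>X. INF x\<in>X. cnorm L x)\<rparr>)"

abbreviation ultra_const :: "nat filter \<Rightarrow> 'a cstar \<Rightarrow> 'a \<Rightarrow> (nat \<Rightarrow> 'a) set" where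
  "ultra_const \<omega> A a \<equiv> ultra_class \<omega> A (\<lambda>_. a)"

definition ultra_map ::
    "nat filter \<Rightarrow> 'b cstar \<Rightarrow> ('a \<Rightarrow> 'b) \<Rightarrow> (nat \<Rightarrow> 'a) set \<Rightarrow> (nat \<Rightarrow> 'b) set" where
  "ultra_map \<omega> B f X = (\<Union>x\<in>X. ultra_class \<omega> B (\<lambda>n. f (x n)))"

text \<open>\<open>P\<^sub>\<omega>\<close> as a subset of \<open>A\<^sub>\<omega>\<close>.\<close>

definition ultra_sub :: "nat filter \<Rightarrow> 'a cstar \<Rightarrow> 'a set \<Rightarrow> (nat \<Rightarrow> 'a) set set" where
  "ultra_sub \<omega> A P = ultra_class \<omega> A ` {x \<in> carrier (ell_infty A). \<forall>n. x n \<in> P}"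

text \<open>\<open>A\<^sub>\<omega> \<inter> S'\<close>\<close>

definition ultra_commutant :: "nat filter \<Rightarrow> 'a cstar \<Rightarrow> 'a set \<Rightarrow> (nat \<Rightarrow> 'a) set set" where
  "ultra_commutant \<omega> A S =
     {X \<in> carrier (ultrapower \<omega> A).
        \<forall>s\<in>S. X \<otimes>\<^bsub>ultrapower \<omega> A\<^esub> ultra_const \<omega> A s = ultra_const \<omega> A s \<otimes>\<^bsub>ultrapower \<omega> A\<^esub> X}"


section \<open>The two approximation properties\<close>

text \<open>
  That the expectations in question are of index-finite type is a hypothesis, or a consequence of
  the hypotheses, wherever these properties are used; it is not repeated inside them.
  Condition (1) of the Rokhlin property lives in \<open>B\<^sub>\<omega>\<close>, for \<open>B\<close> the basic construction; elements of
  \<open>A\<^sub>\<omega>\<close> are carried there by the map \<open>\<iota>\<close> that the inclusion of \<open>A\<close> in \<open>B\<close> induces.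
\<close>

definition weak_tracial_Rokhlin :: "nat filter \<Rightarrow> 'a cstar \<Rightarrow> ('a \<Rightarrow> 'a) \<Rightarrow> bool" where
  "weak_tracial_Rokhlin \<omega> A E \<longleftrightarrow>
     (let A\<omega> = ultrapower \<omega> A;
          B = basic_construction A E;
          B\<omega> = ultrapower \<omega> B;
          \<iota> = ultra_map \<omega> B (left_mult A E);
          ind = ultra_const \<omega> A (Index A E)
      in \<forall>a \<in> cpos A\<omega> - {\<zero>\<^bsub>A\<omega>\<^esub>}.
           \<exists>e \<in> ultra_commutant \<omega> A (carrier A).
             e \<in> cpos A\<omega> \<and> e \<noteq> \<zero>\<^bsub>A\<omega>\<^esub> \<and> cnorm A\<omega> e \<le> 1 \<and>
             \<iota> ind \<otimes>\<^bsub>B\<omega>\<^esub> (\<iota> (csqroot A\<omega> e) \<otimes>\<^bsub>B\<omega>\<^esub> ultra_const \<omega> B (jones A E) \<otimes>\<^bsub>B\<omega>\<^esub> \<iota> (csqroot A\<omega> e)) = \<iota> e \<and>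
             cuntz_le A\<omega> (\<one>\<^bsub>A\<omega>\<^esub> \<ominus>\<^bsub>A\<omega>\<^esub> ind \<otimes>\<^bsub>A\<omega>\<^esub> ultra_map \<omega> A E e) a)"

definition weakly_tracially_approx_representable ::
    "nat filter \<Rightarrow> 'a cstar \<Rightarrow> 'a set \<Rightarrow> ('a \<Rightarrow> 'a) \<Rightarrow> bool" where
  "weakly_tracially_approx_representable \<omega> A P E \<longleftrightarrow>
     (let A\<omega> = ultrapower \<omega> A; \<kappa> = ultra_const \<omega> A
      in \<forall>a \<in> cpos A\<omega> - {\<zero>\<^bsub>A\<omega>\<^esub>}.
           \<exists>e \<in> ultra_sub \<omega> A P \<inter> ultra_commutant \<omega> A P.
           \<exists>r \<in> ultra_commutant \<omega> A (carrier A).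
           \<exists>n u. (\<forall>i<n. u i \<in> carrier A) \<and>
             e \<in> cpos A\<omega> \<and> cnorm A\<omega> e \<le> 1 \<and> r \<in> cpos A\<omega> \<and> cnorm A\<omega> r \<le> 1 \<and>
             (\<forall>x\<in>carrier A. csqroot A\<omega> e \<otimes>\<^bsub>A\<omega>\<^esub> \<kappa> x \<otimes>\<^bsub>A\<omega>\<^esub> csqroot A\<omega> e = \<kappa> (E x) \<otimes>\<^bsub>A\<omega>\<^esub> e) \<and>
             (\<Oplus>\<^bsub>A\<omega>\<^esub>i\<in>{..<n::nat}. \<kappa> (u i) \<otimes>\<^bsub>A\<omega>\<^esub> e \<otimes>\<^bsub>A\<omega>\<^esub> cadj A\<omega> (\<kappa> (u i))) = r \<and>
             r \<otimes>\<^bsub>A\<omega>\<^esub> csqroot A\<omega> e = csqroot A\<omega> e [^]\<^bsub>A\<omega>\<^esub> (3::nat) \<and>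
             csqroot A\<omega> e [^]\<^bsub>A\<omega>\<^esub> (3::nat) = csqroot A\<omega> e \<otimes>\<^bsub>A\<omega>\<^esub> r \<and>
             cuntz_le A\<omega> (\<one>\<^bsub>A\<omega>\<^esub> \<ominus>\<^bsub>A\<omega>\<^esub> r) a \<and>
             inj_on (\<lambda>x. \<kappa> x \<otimes>\<^bsub>A\<omega>\<^esub> e) P)"

end

theory Submission
  imports Defs
begin

text \<open>
  No spectral theory is used: an element \<open>h = h*\<close> is positive when \<open>\<parallel>t - h\<parallel> \<le> t\<close> for some \<open>t \<ge> 0\<close>,
  and square roots, positive parts and the positivity of \<open>x* x\<close> come from iteration and from the
  growth of powers. The quasi-basis makes the Hilbert module equal to \<open>A\<close> and the basic construction
  equal to the algebra of all adjointable operators, with \<open>1 = \<Sigma> u\<^sub>j e\<^sub>P u\<^sub>j*\<close> for some \<open>u\<^sub>j\<close> in \<open>A\<close>.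

  For \<open>p\<close> in \<open>A\<^sub>\<omega> \<inter> A'\<close> the element \<open>\<Phi>(p) = \<Sigma> u\<^sub>j e\<^sub>P p e\<^sub>P u\<^sub>j*\<close> commutes with \<open>B\<close>. If \<open>p\<close> satisfies the
  Rokhlin equation, then \<open>p\<close> and \<open>r = Index E \<Phi>(p)\<close> are as in approximate representability, and
  \<open>1 - r = \<Phi>(1 - Index E E(p))\<close>. Given \<open>b\<close> in \<open>B\<^sub>\<omega>\<close>, outerness of the dual expectation compresses \<open>b\<close> to a
  nonzero \<open>c b c\<close> in \<open>A\<^sub>\<omega>\<close>, and simplicity of \<open>A\<close> provides \<open>z\<^sub>i\<close> with \<open>z\<^sub>i c b c z\<^sub>j* = \<delta>\<^sub>i\<^sub>j a\<close>; then
  \<open>1 - Index E E(p) \<lesssim> a\<close> implies \<open>1 - r \<lesssim> b\<close>. Conversely, outerness of \<open>E\<close> compresses \<open>a\<close> to a nonzero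
  \<open>d = c a c\<close> in \<open>P\<^sub>\<omega>\<close>. Representability for \<open>e\<^sub>P d e\<^sub>P\<close> gives \<open>p\<close> satisfying the Rokhlin equation,
  necessarily with \<open>r = Index E \<Phi>(p)\<close>, and compressing \<open>1 - r\<close> by \<open>e\<^sub>P\<close> gives
  \<open>1 - Index E E(p) \<lesssim> d \<lesssim> a\<close>.
\<close>

text \<open>\<Phi> is a sum of N conjugates, one for each element of the quasi-basis. This is the
  obstacle in the first implication: f \<lesssim> a puts each summand of \<Phi>(f) below b, but not
  their sum. Hence the N copies of a with vanishing cross terms, for which infinite dimension of A
  is used: a corner without two orthogonal positive elements would be one-dimensional. In the other
  implication r is only known to exist, and 1 - r can be compressed to A only after r has been
  computed. That r is a contraction cannot be read off from r = Index E \<Phi>(p), where a direct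
  estimate loses the factor Index E; but the n-th power of r is Index E \<Phi>(p^n), and a
  self-adjoint element whose powers stay bounded has norm at most 1. The same principle, powers in
  place of the spectral radius, carries the theory of positive elements and shows that A embeds
  isometrically in B. The quasi-basis is made self-adjoint because \<Phi> is then unital and a sum
  of conjugations, hence positive.\<close>

definition csa :: "'a cstar \<Rightarrow> 'a set" where
  "csa A = {x \<in> carrier A. cadj A x = x}"

abbreviation creal :: "'a cstar \<Rightarrow> real \<Rightarrow> 'a" where
  "creal A t \<equiv> cscale A (complex_of_real t) \<one>\<^bsub>A\<^esub>"

section \<open>Algebra, norm estimates and limits in a C*-algebra\<close>

context cstar_algebra
begin

declare scale_closed [simp, intro] adj_closed [simp, intro] adj_adj [simp] scale_one [simp]
  norm_nonneg [simp]

lemma scale_zero_right [simp]: "cscale A c \<zero> = \<zero>"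
proof -
  have "cscale A c \<zero> \<oplus> cscale A c \<zero> = cscale A c \<zero>"
    using scale_add_right[of \<zero> \<zero> c] by simp
  then show ?thesis by (simp add: add.r_cancel_one')
qed

lemma scale_zero_left [simp]: "x \<in> carrier A \<Longrightarrow> cscale A 0 x = \<zero>"
  using scale_add_left[of x 0 0] by (simp add: add.r_cancel_one')

lemma scale_minus1: assumes "x \<in> carrier A" shows "cscale A (-1) x = \<ominus> x"
proof -
  have "cscale A (-1) x \<oplus> x = \<zero>"
    using scale_add_left[of x "-1" 1] assms by simp
  then show ?thesis using assms by (metis minus_equality scale_closed)
qed

lemma scale_minus_left: "x \<in> carrier A \<Longrightarrow> cscale A (- c) x = \<ominus> cscale A c x"
  using scale_scale[of x "-1" c] scale_minus1[of "cscale A c x"] by simp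

lemma scale_minus_right: "x \<in> carrier A \<Longrightarrow> cscale A c (\<ominus> x) = \<ominus> cscale A c x"
  using scale_scale[of x c "-1"] scale_minus1[of x] scale_minus_left[of x c] by simp

lemma scale_diff_right: "\<lbrakk>x \<in> carrier A; y \<in> carrier A\<rbrakk> \<Longrightarrow> cscale A c (x \<ominus> y) = cscale A c x \<ominus> cscale A c y"
  by (simp add: minus_eq scale_add_right scale_minus_right)

lemma scale_diff_left: "x \<in> carrier A \<Longrightarrow> cscale A (c - d) x = cscale A c x \<ominus> cscale A d x"
  using scale_add_left[of x c "-d"] by (simp add: minus_eq scale_minus_left)

lemma scale_one_mult: "x \<in> carrier A \<Longrightarrow> cscale A c \<one> \<otimes> x = cscale A c x"
  "x \<in> carrier A \<Longrightarrow> x \<otimes> cscale A c \<one> = cscale A c x"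
  using scale_mult_left[of \<one> x c] scale_mult_right[of x \<one> c] by simp_all

lemma scale_two: "x \<in> carrier A \<Longrightarrow> cscale A 2 x = x \<oplus> x"
  using scale_add_left[of x 1 1] by simp

lemma adj_zero [simp]: "cadj A \<zero> = \<zero>"
  using adj_add[of \<zero> \<zero>] by (simp add: add.r_cancel_one')

lemma adj_one [simp]: "cadj A \<one> = \<one>"
proof -
  have "cadj A (cadj A \<one> \<otimes> \<one>) = cadj A \<one> \<otimes> \<one>" by (subst adj_mult) auto
  then show ?thesis by simp
qed

lemma adj_neg: "x \<in> carrier A \<Longrightarrow> cadj A (\<ominus> x) = \<ominus> cadj A x"
  using adj_scale[of x "-1"] by (simp add: scale_minus1)

lemma adj_diff: "\<lbrakk>x \<in> carrier A; y \<in> carrier A\<rbrakk> \<Longrightarrow> cadj A (x \<ominus> y) = cadj A x \<ominus> cadj A y"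
  by (simp add: minus_eq adj_add adj_neg)

lemma norm_zero [simp]: "cnorm A \<zero> = 0"
  by (simp add: norm_eq_zero)

lemma norm_neg [simp]: "x \<in> carrier A \<Longrightarrow> cnorm A (\<ominus> x) = cnorm A x"
  using norm_scale[of x "-1"] by (simp add: scale_minus1)

lemma norm_minus_commute: "\<lbrakk>x \<in> carrier A; y \<in> carrier A\<rbrakk> \<Longrightarrow> cnorm A (x \<ominus> y) = cnorm A (y \<ominus> x)"
  using norm_neg[of "x \<ominus> y"] by (simp add: minus_eq minus_add a_comm)

lemma norm_diff_le: "\<lbrakk>x \<in> carrier A; y \<in> carrier A\<rbrakk> \<Longrightarrow> cnorm A (x \<ominus> y) \<le> cnorm A x + cnorm A y"
  using norm_triangle[of x "\<ominus> y"] by (simp add: minus_eq)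

lemma diff_split: "\<lbrakk>x \<in> carrier A; y \<in> carrier A; z \<in> carrier A\<rbrakk> \<Longrightarrow> x \<ominus> z = (x \<ominus> y) \<oplus> (y \<ominus> z)"
  by algebra

lemma norm_diff_triangle:
  "\<lbrakk>x \<in> carrier A; y \<in> carrier A; z \<in> carrier A\<rbrakk> \<Longrightarrow> cnorm A (x \<ominus> z) \<le> cnorm A (x \<ominus> y) + cnorm A (y \<ominus> z)"
  by (subst diff_split[of x y z]) (auto intro: norm_triangle)

lemma norm_reverse_triangle:
  assumes "x \<in> carrier A" "y \<in> carrier A"
  shows "\<bar>cnorm A x - cnorm A y\<bar> \<le> cnorm A (x \<ominus> y)"
proof -
  have "x = (x \<ominus> y) \<oplus> y" "y = (y \<ominus> x) \<oplus> x" using assms by algebra+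
  then have "cnorm A x \<le> cnorm A (x \<ominus> y) + cnorm A y" "cnorm A y \<le> cnorm A (y \<ominus> x) + cnorm A x"
    using norm_triangle[of "x \<ominus> y" y] norm_triangle[of "y \<ominus> x" x] assms by auto
  then show ?thesis using norm_minus_commute[of x y] assms by auto
qed

text \<open>The adjoint is not assumed to be isometric. By the C*-identity and submultiplicativity
  the square of the norm of y is at most the norm of y* times the norm of y; exchanging y and y*
  gives equality.\<close>

lemma norm_adj [simp]: assumes "x \<in> carrier A" shows "cnorm A (cadj A x) = cnorm A x"
proof -
  have le: "cnorm A y \<le> cnorm A (cadj A y)" if y: "y \<in> carrier A" for y
  proof (cases "cnorm A y = 0")
    case False
    have "(cnorm A y)\<^sup>2 \<le> cnorm A (cadj A y) * cnorm A y"
      using cstar_identity[OF y] norm_mult[of "cadj A y" y] y by simp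
    then show ?thesis using False y norm_nonneg[OF y] by (simp add: power2_eq_square)
  qed (use y in simp)
  show ?thesis using le[of x] le[of "cadj A x"] assms by simp
qed

lemma cstar_identity': "x \<in> carrier A \<Longrightarrow> cnorm A (x \<otimes> cadj A x) = (cnorm A x)\<^sup>2"
  using cstar_identity[of "cadj A x"] by simp

text \<open>Only an inequality, because the zero algebra is allowed and its unit has norm 0. The
  C*-identity makes the norm of 1 an idempotent real number.\<close>

lemma norm_one_le: "cnorm A \<one> \<le> 1"
proof -
  have "cnorm A \<one> = (cnorm A \<one>)\<^sup>2" using cstar_identity[of \<one>] by simp
  then show ?thesis by (metis power2_eq_square mult_cancel_left2 order_refl zero_le_one)
qed

lemma norm_real_le: "t \<ge> 0 \<Longrightarrow> cnorm A (creal A t) \<le> t"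
  using mult_left_mono[OF norm_one_le, of t] by (simp add: norm_scale)

lemma norm_mult_le: "\<lbrakk>x \<in> carrier A; y \<in> carrier A; cnorm A x \<le> a; cnorm A y \<le> b\<rbrakk> \<Longrightarrow> cnorm A (x \<otimes> y) \<le> a * b"
  using norm_mult[of x y] by (smt (verit) mult_mono norm_nonneg)

lemma diff_eq_zero: "\<lbrakk>x \<in> carrier A; y \<in> carrier A\<rbrakk> \<Longrightarrow> x \<ominus> y = \<zero> \<longleftrightarrow> x = y"
  by (metis a_minus_def minus_equality r_neg minus_minus a_inv_closed)

lemma mult_diff_split:
  "\<lbrakk>x \<in> carrier A; y \<in> carrier A; a \<in> carrier A; b \<in> carrier A\<rbrakk>
    \<Longrightarrow> x \<otimes> y \<ominus> a \<otimes> b = (x \<ominus> a) \<otimes> y \<oplus> a \<otimes> (y \<ominus> b)"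
  by algebra

lemma norm_mult_diff:
  assumes "x \<in> carrier A" "y \<in> carrier A" "a \<in> carrier A" "b \<in> carrier A"
  shows "cnorm A (x \<otimes> y \<ominus> a \<otimes> b) \<le> cnorm A (x \<ominus> a) * cnorm A y + cnorm A a * cnorm A (y \<ominus> b)"
  using norm_triangle[of "(x \<ominus> a) \<otimes> y" "a \<otimes> (y \<ominus> b)"] norm_mult[of "x \<ominus> a" y] norm_mult[of a "y \<ominus> b"] assms
  by (simp add: mult_diff_split)

lemma add_diff_split:
  "\<lbrakk>x \<in> carrier A; y \<in> carrier A; a \<in> carrier A; b \<in> carrier A\<rbrakk>
    \<Longrightarrow> (x \<oplus> y) \<ominus> (a \<oplus> b) = (x \<ominus> a) \<oplus> (y \<ominus> b)"
  by algebra

lemma norm_add_diff: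
  assumes "x \<in> carrier A" "y \<in> carrier A" "a \<in> carrier A" "b \<in> carrier A"
  shows "cnorm A ((x \<oplus> y) \<ominus> (a \<oplus> b)) \<le> cnorm A (x \<ominus> a) + cnorm A (y \<ominus> b)"
  using norm_triangle[of "x \<ominus> a" "y \<ominus> b"] assms by (simp add: add_diff_split)

lemma ctendstoI:
  assumes "\<And>n. cnorm A (s n \<ominus> a) \<le> f n" "f \<longlonglongrightarrow> 0" "\<And>n. s n \<in> carrier A" "a \<in> carrier A"
  shows "ctendsto A s a"
  unfolding ctendsto_def
  by (rule tendsto_sandwich[of "\<lambda>_. 0" _ _ f]) (use assms in auto)

lemma ctendsto_const: "a \<in> carrier A \<Longrightarrow> ctendsto A (\<lambda>_. a) a"
  unfolding ctendsto_def by (simp add: minus_eq r_neg)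

lemma ctendsto_unique:
  assumes "ctendsto A s a" "ctendsto A s b" "\<And>n. s n \<in> carrier A" "a \<in> carrier A" "b \<in> carrier A"
  shows "a = b"
proof -
  have "(\<lambda>n. cnorm A (s n \<ominus> a) + cnorm A (s n \<ominus> b)) \<longlonglongrightarrow> 0"
    using tendsto_add[OF assms(1,2)[unfolded ctendsto_def]] by simp
  moreover have "cnorm A (a \<ominus> b) \<le> cnorm A (s n \<ominus> a) + cnorm A (s n \<ominus> b)" for n
    using norm_diff_triangle[of a "s n" b] norm_minus_commute[of a "s n"] assms by simp
  ultimately have "cnorm A (a \<ominus> b) \<le> 0"
    by (meson LIMSEQ_le_const)
  then have "cnorm A (a \<ominus> b) = 0" using norm_nonneg[OF minus_closed[OF assms(4,5)]] by linarith
  then show ?thesis using assms by (simp add: norm_eq_zero diff_eq_zero)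
qed

lemma ctendsto_norm:
  assumes "ctendsto A s a" "\<And>n. s n \<in> carrier A" "a \<in> carrier A"
  shows "(\<lambda>n. cnorm A (s n)) \<longlonglongrightarrow> cnorm A a"
proof -
  have "(\<lambda>n. cnorm A (s n) - cnorm A a) \<longlonglongrightarrow> 0"
    by (rule tendsto_rabs_zero_cancel, rule tendsto_sandwich[OF _ _ tendsto_const assms(1)[unfolded ctendsto_def]])
       (use norm_reverse_triangle assms in auto)
  then show ?thesis using LIM_zero_iff by blast
qed

lemma ctendsto_add:
  assumes "ctendsto A s a" "ctendsto A r b" "\<And>n. s n \<in> carrier A" "\<And>n. r n \<in> carrier A"
    "a \<in> carrier A" "b \<in> carrier A"
  shows "ctendsto A (\<lambda>n. s n \<oplus> r n) (a \<oplus> b)"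
  using norm_add_diff assms tendsto_add[OF assms(1,2)[unfolded ctendsto_def]]
  by (intro ctendstoI) auto

lemma ctendsto_mult:
  assumes "ctendsto A s a" "ctendsto A r b" "\<And>n. s n \<in> carrier A" "\<And>n. r n \<in> carrier A"
    "a \<in> carrier A" "b \<in> carrier A"
  shows "ctendsto A (\<lambda>n. s n \<otimes> r n) (a \<otimes> b)"
proof (rule ctendstoI)
  have "(\<lambda>n. cnorm A (s n \<ominus> a) * cnorm A (r n) + cnorm A a * cnorm A (r n \<ominus> b)) \<longlonglongrightarrow> 0 * cnorm A b + cnorm A a * 0"
    by (intro tendsto_intros assms(1,2)[unfolded ctendsto_def] ctendsto_norm assms)
  then show "(\<lambda>n. cnorm A (s n \<ominus> a) * cnorm A (r n) + cnorm A a * cnorm A (r n \<ominus> b)) \<longlonglongrightarrow> 0" by simp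
qed (use norm_mult_diff assms in auto)

lemma ctendsto_scale:
  assumes "ctendsto A s a" "\<And>n. s n \<in> carrier A" "a \<in> carrier A"
  shows "ctendsto A (\<lambda>n. cscale A c (s n)) (cscale A c a)"
  using tendsto_mult_left[OF assms(1)[unfolded ctendsto_def], of "cmod c"] assms
  by (simp add: ctendsto_def scale_diff_right[symmetric] norm_scale)

lemma ctendsto_adj:
  assumes "ctendsto A s a" "\<And>n. s n \<in> carrier A" "a \<in> carrier A"
  shows "ctendsto A (\<lambda>n. cadj A (s n)) (cadj A a)"
  using assms by (simp add: ctendsto_def adj_diff[symmetric])

lemma ctendsto_neg:
  assumes "ctendsto A s a" "\<And>n. s n \<in> carrier A" "a \<in> carrier A"
  shows "ctendsto A (\<lambda>n. \<ominus> s n) (\<ominus> a)"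
  using ctendsto_scale[OF assms, of "-1"] assms by (simp add: scale_minus1)

lemma ctendsto_diff:
  assumes "ctendsto A s a" "ctendsto A r b" "\<And>n. s n \<in> carrier A" "\<And>n. r n \<in> carrier A"
    "a \<in> carrier A" "b \<in> carrier A"
  shows "ctendsto A (\<lambda>n. s n \<ominus> r n) (a \<ominus> b)"
  unfolding minus_eq using assms by (intro ctendsto_add ctendsto_neg) auto

lemma ctendsto_Suc: "ctendsto A s a \<Longrightarrow> ctendsto A (\<lambda>n. s (Suc n)) a"
  unfolding ctendsto_def by (rule LIMSEQ_Suc)

lemma finsum_adj:
  assumes "finite I" "\<And>i. i \<in> I \<Longrightarrow> f i \<in> carrier A"
  shows "cadj A (\<Oplus>i\<in>I. f i) = (\<Oplus>i\<in>I. cadj A (f i))"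
  using assms by (induction I rule: finite_induct) (auto simp: adj_add Pi_def)

lemma finsum_scale:
  assumes "finite I" "\<And>i. i \<in> I \<Longrightarrow> f i \<in> carrier A"
  shows "cscale A c (\<Oplus>i\<in>I. f i) = (\<Oplus>i\<in>I. cscale A c (f i))"
  using assms by (induction I rule: finite_induct) (auto simp: scale_add_right Pi_def)

lemma finsum_norm:
  assumes "finite I" "\<And>i. i \<in> I \<Longrightarrow> f i \<in> carrier A"
  shows "cnorm A (\<Oplus>i\<in>I. f i) \<le> (\<Sum>i\<in>I. cnorm A (f i))"
  using assms
proof (induction I rule: finite_induct)
  case (insert i I)
  have "cnorm A (f i \<oplus> (\<Oplus>i\<in>I. f i)) \<le> cnorm A (f i) + cnorm A (\<Oplus>i\<in>I. f i)"
    using insert by (intro norm_triangle) auto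
  then show ?case using insert by (simp add: Pi_def)
qed simp

lemma csa_closed: "x \<in> csa A \<Longrightarrow> x \<in> carrier A" by (simp add: csa_def)
lemma csa_adj: "x \<in> csa A \<Longrightarrow> cadj A x = x" by (simp add: csa_def)
lemma csa_zero [simp]: "\<zero> \<in> csa A" and csa_one [simp]: "\<one> \<in> csa A" by (simp_all add: csa_def)
lemma csa_add: "\<lbrakk>x \<in> csa A; y \<in> csa A\<rbrakk> \<Longrightarrow> x \<oplus> y \<in> csa A" by (simp add: csa_def adj_add)
lemma csa_diff: "\<lbrakk>x \<in> csa A; y \<in> csa A\<rbrakk> \<Longrightarrow> x \<ominus> y \<in> csa A" by (simp add: csa_def adj_diff)
lemma csa_neg: "x \<in> csa A \<Longrightarrow> \<ominus> x \<in> csa A" by (simp add: csa_def adj_neg)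
lemma csa_scale: "x \<in> csa A \<Longrightarrow> cscale A (complex_of_real t) x \<in> csa A" by (simp add: csa_def adj_scale)
lemma csa_real: "creal A t \<in> csa A" by (simp add: csa_scale)
lemma csa_mult: "\<lbrakk>x \<in> csa A; y \<in> csa A; x \<otimes> y = y \<otimes> x\<rbrakk> \<Longrightarrow> x \<otimes> y \<in> csa A" by (simp add: csa_def adj_mult)
lemma csa_star: "x \<in> carrier A \<Longrightarrow> cadj A x \<otimes> x \<in> csa A" by (simp add: csa_def adj_mult)
lemma csa_norm_sq: "x \<in> csa A \<Longrightarrow> cnorm A (x \<otimes> x) = (cnorm A x)\<^sup>2"
  using cstar_identity[of x] by (simp add: csa_adj csa_closed)
lemma csa_pow: "x \<in> csa A \<Longrightarrow> x [^] (n::nat) \<in> csa A"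
proof (induction n)
  case (Suc n)
  then show ?case using nat_pow_Suc2[of x n] by (simp add: csa_def adj_mult)
qed simp
lemma csa_limit: "\<lbrakk>ctendsto A s a; \<And>n. s n \<in> csa A; a \<in> carrier A\<rbrakk> \<Longrightarrow> a \<in> csa A"
  using ctendsto_adj[of s a] ctendsto_unique[of s a "cadj A a"] by (simp add: csa_def)

declare csa_closed [simp]

lemma norm_pow_le: "\<lbrakk>x \<in> carrier A; cnorm A x \<le> 1\<rbrakk> \<Longrightarrow> cnorm A (x [^] (n::nat)) \<le> 1"
proof (induction n)
  case (Suc n)
  then show ?case using norm_mult_le[of "x [^] n" x 1 1] by simp
qed (simp add: norm_one_le)

text \<open>Squaring is exact for self-adjoint elements, so along the exponents \<open>2^j\<close>
  the norm is multiplicative. This stands in for the spectral radius: growth estimates below only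
  test these exponents.\<close>

lemma csa_pow2_norm: "x \<in> csa A \<Longrightarrow> cnorm A (x [^] ((2::nat)^j)) = (cnorm A x)^(2^j)"
proof (induction j)
  case (Suc j)
  have "x [^] ((2::nat)^Suc j) = x [^] ((2::nat)^j) \<otimes> x [^] ((2::nat)^j)"
    using Suc.prems by (simp add: nat_pow_mult mult_2)
  then show ?case using Suc csa_norm_sq[OF csa_pow[OF Suc.prems]]
    by (simp add: power_mult[symmetric] mult.commute)
qed simp

end

section \<open>Positive elements\<close>

text \<open>Positivity is first defined through the norm, so that no spectral theory is needed;
  \<open>cpos_eq_npos\<close> below shows that this gives the elements \<open>x* x\<close>.\<close>

definition npos :: "'a cstar \<Rightarrow> 'a set" where
  "npos A = {h \<in> csa A. \<exists>t\<ge>0. cnorm A (creal A t \<ominus>\<^bsub>A\<^esub> h) \<le> t}"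

context cstar_algebra
begin

lemma comm_one_minus:
  "\<lbrakk>k \<in> carrier A; b \<in> carrier A; k \<otimes> b = b \<otimes> k\<rbrakk> \<Longrightarrow> k \<otimes> (\<one> \<ominus> b) = (\<one> \<ominus> b) \<otimes> k"
  by (simp add: minus_eq l_distr r_distr l_minus r_minus)

lemma half_double: "x \<in> carrier A \<Longrightarrow> cscale A (1/2) (x \<oplus> x) = x"
  using scale_add_left[of x "1/2" "1/2"] by (simp add: scale_add_right)

lemma telescoping_norm:
  assumes [simp]: "\<And>n. Y n \<in> carrier A"
    and diff: "\<And>n. cnorm A (Y (Suc n) \<ominus> Y n) \<le> t (Suc n) - (t n :: real)"
  shows "cnorm A (Y (n + k) \<ominus> Y n) \<le> t (n + k) - t n"
proof (induction k)
  case (Suc k)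
  then show ?case
    using norm_diff_triangle[of "Y (Suc (n+k))" "Y (n + k)" "Y n"] diff[of "n + k"] by simp
qed (simp add: minus_eq r_neg)

text \<open>The increments are bounded by those of a convergent real sequence, which makes Y Cauchy
  by telescoping. The square root iteration and the Neumann series are both of this kind.\<close>

lemma ctendsto_dominated:
  assumes Y [simp]: "\<And>n. Y n \<in> carrier A" and t: "convergent (t :: nat \<Rightarrow> real)"
    and diff: "\<And>n. cnorm A (Y (Suc n) \<ominus> Y n) \<le> t (Suc n) - t n"
  shows "\<exists>b\<in>carrier A. ctendsto A Y b"
proof (rule complete)
  have tel': "cnorm A (Y m \<ominus> Y n) \<le> \<bar>t m - t n\<bar>" for m n
    using telescoping_norm[of Y t n "m - n", OF Y diff] telescoping_norm[of Y t m "n - m", OF Y diff] norm_minus_commute[of "Y m" "Y n"]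
    by (cases "n \<le> m") (auto simp: not_le)
  fix \<epsilon> :: real assume "0 < \<epsilon>"
  then obtain N where "\<forall>m\<ge>N. \<forall>n\<ge>N. dist (t m) (t n) < \<epsilon>"
    using t by (auto simp: Cauchy_convergent_iff[symmetric] Cauchy_def)
  then show "\<exists>N. \<forall>m\<ge>N. \<forall>n\<ge>N. cnorm A (Y m \<ominus> Y n) < \<epsilon>"
    using tel' by (metis dist_real_def order_le_less_trans)
qed simp

text \<open>The iteration \<open>y := (1 - h + y\<^sup>2)/2\<close> solves \<open>(1 - y)\<^sup>2 = h\<close>; it is dominated by its
  scalar version, whence convergence.\<close>

lemma sqrt_near_one:
  assumes h: "h \<in> csa A" and le: "cnorm A (\<one> \<ominus> h) \<le> 1"
  shows "\<exists>k\<in>csa A. k \<otimes> k = h \<and> cnorm A (\<one> \<ominus> k) \<le> 1 \<and>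
    (\<forall>y\<in>carrier A. y \<otimes> h = h \<otimes> y \<longrightarrow> y \<otimes> k = k \<otimes> y)"
proof -
  define a where "a = \<one> \<ominus> h"
  define Y where "Y = rec_nat \<zero> (\<lambda>_ y. cscale A (1/2) (a \<oplus> y \<otimes> y))"
  define t :: "nat \<Rightarrow> real" where "t = rec_nat 0 (\<lambda>_ r. (1 + r\<^sup>2) / 2)"
  have Y0: "Y 0 = \<zero>" and YS: "Y (Suc n) = cscale A (1/2) (a \<oplus> Y n \<otimes> Y n)" for n
    by (simp_all add: Y_def)
  have t0: "t 0 = 0" and tS: "t (Suc n) = (1 + (t n)\<^sup>2) / 2" for n
    by (simp_all add: t_def)
  have a: "a \<in> csa A" "cnorm A a \<le> 1"
    using h le by (simp_all add: a_def csa_diff)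
  have Ysa: "Y n \<in> csa A" for n
  proof (induction n)
    case (Suc n)
    show ?case unfolding YS
      using csa_scale[of "a \<oplus> Y n \<otimes> Y n" "1/2"] csa_add csa_mult Suc a by simp
  qed (simp add: Y0)
  then have Y [simp]: "Y n \<in> carrier A" for n by simp
  have ac [simp]: "a \<in> carrier A" using a by simp
  have comm: "c \<otimes> Y n = Y n \<otimes> c" if "c \<in> carrier A" "c \<otimes> a = a \<otimes> c" for c n
  proof (induction n)
    case (Suc n)
    have "c \<otimes> (Y n \<otimes> Y n) = (Y n \<otimes> Y n) \<otimes> c"
      using that Suc by (metis Y m_assoc)
    then show ?case using that
      by (simp add: YS scale_mult_left[symmetric] scale_mult_right[symmetric] r_distr l_distr)
  qed (use that in \<open>simp add: Y0\<close>)
  have comm': "Y m \<otimes> Y n = Y n \<otimes> Y m" for m n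
    by (intro comm) (simp_all add: comm)
  have t01: "0 \<le> t n \<and> t n \<le> 1" for n
  proof (induction n)
    case (Suc n)
    then show ?case by (simp add: tS power_le_one)
  qed (simp add: t0)
  have tinc: "t n \<le> t (Suc n)" for n
    using sum_squares_ge_zero[of "t n - 1" 0] by (simp add: tS power2_eq_square algebra_simps)
  have Yt: "cnorm A (Y n) \<le> t n" for n
  proof (induction n)
    case (Suc n)
    have "cnorm A (a \<oplus> Y n \<otimes> Y n) \<le> 1 + t n * t n"
      using norm_triangle[of a "Y n \<otimes> Y n"] a norm_mult_le[OF Y Y Suc Suc] by simp
    then show ?case by (simp add: YS tS norm_scale power2_eq_square)
  qed (simp add: Y0 t0)
  \<comment> \<open>The iterates commute, so the difference of two squares factors into sum times
    difference; t satisfies the same recursion, and its factorisation gives exactly the next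
    increment of t.\<close>
  have diff: "cnorm A (Y (Suc n) \<ominus> Y n) \<le> t (Suc n) - t n" for n
  proof (induction n)
    case 0
    show ?case using Yt[of 1] t01 by (simp add: Y0 t0 minus_eq)
  next
    case (Suc n)
    have "Y (Suc (Suc n)) \<ominus> Y (Suc n)
        = cscale A (1/2) ((a \<oplus> Y (Suc n) \<otimes> Y (Suc n)) \<ominus> (a \<oplus> Y n \<otimes> Y n))"
      by (simp only: YS[of "Suc n"] YS[of n]) (simp add: scale_diff_right)
    also have "(a \<oplus> Y (Suc n) \<otimes> Y (Suc n)) \<ominus> (a \<oplus> Y n \<otimes> Y n)
        = Y (Suc n) \<otimes> Y (Suc n) \<oplus> Y n \<otimes> Y (Suc n) \<ominus> (Y n \<otimes> Y (Suc n) \<oplus> Y n \<otimes> Y n)"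
      using ac Y by algebra
    also have "Y (Suc n) \<otimes> Y (Suc n) \<oplus> Y n \<otimes> Y (Suc n) \<ominus> (Y n \<otimes> Y (Suc n) \<oplus> Y n \<otimes> Y n)
        = Y (Suc n) \<otimes> Y (Suc n) \<oplus> Y n \<otimes> Y (Suc n) \<ominus> (Y (Suc n) \<otimes> Y n \<oplus> Y n \<otimes> Y n)"
      by (simp add: comm'[of n "Suc n"])
    also have "\<dots> = (Y (Suc n) \<oplus> Y n) \<otimes> (Y (Suc n) \<ominus> Y n)"
      using Y by algebra
    finally have "cnorm A (Y (Suc (Suc n)) \<ominus> Y (Suc n))
        = cnorm A ((Y (Suc n) \<oplus> Y n) \<otimes> (Y (Suc n) \<ominus> Y n)) / 2"
      by (simp add: norm_scale)
    also have "\<dots> \<le> (t (Suc n) + t n) * (t (Suc n) - t n) / 2"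
      using norm_mult_le[OF _ _ order_trans[OF norm_triangle] Suc, of "Y (Suc n)" "Y n"] Yt[of n] Yt[of "Suc n"]
      by (auto intro: add_mono)
    also have "\<dots> = t (Suc (Suc n)) - t (Suc n)"
      by (simp add: tS[of "Suc n"] tS[of n] power2_eq_square field_simps)
    finally show ?case .
  qed
  have "incseq t" using tinc by (simp add: incseq_Suc_iff)
  then have "convergent t"
    using t01 by (metis Bseq_monoseq_convergent BseqI' abs_of_nonneg incseq_imp_monoseq real_norm_def)
  then have "\<exists>b\<in>carrier A. ctendsto A Y b"
    using diff by (intro ctendsto_dominated) auto
  then obtain y where y [simp]: "y \<in> carrier A" and lim: "ctendsto A Y y" by blast
  have lim2: "ctendsto A (\<lambda>n. Y (Suc n)) (cscale A (1/2) (a \<oplus> y \<otimes> y))"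
    unfolding YS by (intro ctendsto_scale ctendsto_add ctendsto_mult ctendsto_const lim) auto
  have "y = cscale A (1/2) (a \<oplus> y \<otimes> y)"
    by (rule ctendsto_unique[OF ctendsto_Suc[OF lim] lim2]) simp_all
  then have "cscale A 2 y = cscale A 2 (cscale A (1/2) (a \<oplus> y \<otimes> y))" by (rule arg_cong)
  then have dbl: "y \<oplus> y = a \<oplus> y \<otimes> y" by (simp add: scale_scale scale_two)
  have ysa: "y \<in> csa A" using csa_limit[OF lim Ysa] by simp
  have "(\<one> \<ominus> y) \<otimes> (\<one> \<ominus> y) = \<one> \<ominus> (y \<oplus> y) \<oplus> y \<otimes> y"
    using y by (simp add: minus_eq l_distr r_distr l_minus r_minus minus_add a_ac)
  also have "\<dots> = \<one> \<ominus> a"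
    unfolding dbl using ac y one_closed m_closed[of y y] by algebra
  also have "\<dots> = h" using h[THEN csa_closed] one_closed unfolding a_def by algebra
  finally have sq: "(\<one> \<ominus> y) \<otimes> (\<one> \<ominus> y) = h" .
  \<comment> \<open>Read for k = 1 - y, this bounds 1 - k by 1, which is how
    \<open>npos_sqrt\<close> sees that the root is positive.\<close>
  have "cnorm A y \<le> 1"
    using ctendsto_norm[OF lim] Yt t01 by (intro LIMSEQ_le_const2) (auto intro: order_trans)
  moreover have "\<one> \<ominus> (\<one> \<ominus> y) = y" using y one_closed by algebra
  \<comment> \<open>What commutes with h commutes with every iterate and so with the limit. This
    clause does the work of functional calculus later on.\<close>
  moreover have "c \<otimes> (\<one> \<ominus> y) = (\<one> \<ominus> y) \<otimes> c" if c: "c \<in> carrier A" "c \<otimes> h = h \<otimes> c" for c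
  proof -
    have "c \<otimes> a = a \<otimes> c" using c h unfolding a_def
      by (simp add: minus_eq l_distr r_distr l_minus r_minus)
    moreover have "ctendsto A (\<lambda>n. Y n \<otimes> c) (y \<otimes> c)"
      by (intro ctendsto_mult ctendsto_const lim) (use c in auto)
    ultimately have "ctendsto A (\<lambda>n. c \<otimes> Y n) (y \<otimes> c)"
      by (simp only: comm[OF c(1)])
    moreover have "ctendsto A (\<lambda>n. c \<otimes> Y n) (c \<otimes> y)"
      by (intro ctendsto_mult ctendsto_const lim) (use c in auto)
    ultimately have "y \<otimes> c = c \<otimes> y"
      by (rule ctendsto_unique) (use c(1) in simp_all)
    then show ?thesis using c(1) comm_one_minus[of c y] y by simp
  qed
  ultimately show ?thesis
    using sq ysa by (intro bexI[of _ "\<one> \<ominus> y"]) (auto simp: csa_diff)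
qed

text \<open>For commuting k and l the element u = k + i l has u* u = 1, and k and l are the real and
  imaginary parts of this contraction.\<close>

lemma circle_norm_le:
  assumes k: "k \<in> csa A" and l: "l \<in> csa A" and comm: "k \<otimes> l = l \<otimes> k" and sum: "k \<otimes> k \<oplus> l \<otimes> l = \<one>"
  shows "cnorm A k \<le> 1 \<and> cnorm A l \<le> 1"
proof -
  define u where "u = k \<oplus> cscale A \<i> l"
  have kl [simp]: "k \<in> carrier A" "l \<in> carrier A" using k l by auto
  have u [simp]: "u \<in> carrier A" by (simp add: u_def)
  have us: "cadj A u = k \<ominus> cscale A \<i> l"
    using k l by (simp add: u_def adj_add adj_scale csa_adj minus_eq scale_minus_left)
  have "cadj A u \<otimes> u = k \<otimes> k \<oplus> l \<otimes> l"
  proof -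
    have "cadj A u \<otimes> u = k \<otimes> k \<oplus> cscale A \<i> (k \<otimes> l) \<ominus> cscale A \<i> (l \<otimes> k) \<ominus> cscale A \<i> (cscale A \<i> (l \<otimes> l))"
      unfolding us by (simp add: u_def minus_eq l_distr r_distr l_minus r_minus minus_add a_ac scale_add_right
        scale_minus_right scale_mult_left[symmetric] scale_mult_right[symmetric])
    also have "\<dots> = k \<otimes> k \<ominus> cscale A \<i> (cscale A \<i> (l \<otimes> l))"
      using comm by (simp add: minus_eq r_neg a_assoc)
    also have "\<dots> = k \<otimes> k \<oplus> l \<otimes> l" by (simp add: scale_scale scale_minus1 minus_eq)
    finally show ?thesis .
  qed
  then have "(cnorm A u)\<^sup>2 \<le> 1" using cstar_identity[OF u] sum norm_one_le by simp
  then have u1: "cnorm A u \<le> 1" by (simp add: power_le_one_iff)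
  have "u \<oplus> cadj A u = k \<oplus> k" unfolding us unfolding u_def
    using kl scale_closed[of l \<i>] by algebra
  moreover have "cnorm A (u \<oplus> cadj A u) \<le> 2" using norm_triangle[of u "cadj A u"] u1 by simp
  ultimately have kk: "cnorm A k \<le> 1"
    using norm_scale[of k 2] by (simp add: scale_two)
  have "u \<ominus> cadj A u = cscale A \<i> l \<oplus> cscale A \<i> l" unfolding us unfolding u_def
    using kl scale_closed[of l \<i>] by algebra
  moreover have "cnorm A (u \<ominus> cadj A u) \<le> 2" using norm_diff_le[of u "cadj A u"] u1 by simp
  ultimately have "cnorm A l \<le> 1"
    using norm_scale[of "cscale A \<i> l" 2] norm_scale[of l \<i>] by (simp add: scale_two)
  then show ?thesis using kk by simp
qed

text \<open>The root l of 1 - k^2 exists because k^2 has norm at most 1, and it commutes with k. So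
  k and l are as in \<open>circle_norm_le\<close>, and l^2 = 1 - k^2 is bounded by 1. It is the
  reason why squares are positive.\<close>

lemma norm_one_minus_square:
  assumes k: "k \<in> csa A" and le: "cnorm A k \<le> 1"
  shows "cnorm A (\<one> \<ominus> k \<otimes> k) \<le> 1"
proof -
  have kc [simp]: "k \<in> carrier A" using k by simp
  have "\<one> \<ominus> (\<one> \<ominus> k \<otimes> k) = k \<otimes> k" using kc one_closed by algebra
  moreover have "cnorm A (k \<otimes> k) \<le> 1" using csa_norm_sq[OF k] le by (simp add: power_le_one)
  ultimately have l1: "cnorm A (\<one> \<ominus> (\<one> \<ominus> k \<otimes> k)) \<le> 1" by simp
  have "\<one> \<ominus> k \<otimes> k \<in> csa A" using k by (simp add: csa_diff csa_mult)
  from sqrt_near_one[OF this l1]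
  obtain l where l: "l \<in> csa A" "l \<otimes> l = \<one> \<ominus> k \<otimes> k"
      "\<forall>y\<in>carrier A. y \<otimes> (\<one> \<ominus> k \<otimes> k) = (\<one> \<ominus> k \<otimes> k) \<otimes> y \<longrightarrow> y \<otimes> l = l \<otimes> y"
    by (elim bexE conjE)
  have "k \<otimes> l = l \<otimes> k" using l(3) comm_one_minus[of k "k \<otimes> k"] by (simp add: m_assoc)
  moreover have "k \<otimes> k \<oplus> l \<otimes> l = \<one>" unfolding l(2) using kc one_closed by algebra
  ultimately have "cnorm A l \<le> 1" using circle_norm_le[OF k l(1)] by blast
  then show ?thesis using csa_norm_sq[OF l(1)] l(1,2) by (simp add: power_le_one)
qed

lemma npos_csa: "h \<in> npos A \<Longrightarrow> h \<in> csa A" by (simp add: npos_def)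
lemma npos_closed [simp]: "h \<in> npos A \<Longrightarrow> h \<in> carrier A" by (simp add: npos_def)

lemma creal_add: "creal A (s + t) = creal A s \<oplus> creal A t"
  by (simp add: scale_add_left)

lemma real_diff_rescale:
  assumes "s > 0" "h \<in> carrier A"
  shows "creal A s \<ominus> h = cscale A (complex_of_real s) (\<one> \<ominus> cscale A (complex_of_real (1/s)) h)"
  using assms by (simp add: scale_diff_right scale_scale flip: of_real_mult)

lemma norm_real_diff:
  assumes "s > 0" "h \<in> carrier A"
  shows "cnorm A (creal A s \<ominus> h) = s * cnorm A (\<one> \<ominus> cscale A (complex_of_real (1/s)) h)"
  using assms by (simp add: real_diff_rescale norm_scale)

text \<open>Witnesses may be enlarged. Therefore \<open>nposI\<close> accepts any real t and
  \<open>nposE\<close> can deliver a strictly positive one.\<close>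

lemma npos_mono:
  assumes "h \<in> carrier A" "cnorm A (creal A t \<ominus> h) \<le> t" "t \<le> s"
  shows "cnorm A (creal A s \<ominus> h) \<le> s"
proof -
  have "creal A s \<ominus> h = creal A (s - t) \<oplus> (creal A t \<ominus> h)"
    using creal_add[of "s - t" t] assms by (simp add: minus_eq a_assoc)
  then show ?thesis
    using norm_triangle[of "creal A (s - t)" "creal A t \<ominus> h"] norm_real_le[of "s - t"] assms by simp
qed

lemma nposI: "\<lbrakk>h \<in> csa A; cnorm A (creal A t \<ominus> h) \<le> t\<rbrakk> \<Longrightarrow> h \<in> npos A"
  unfolding npos_def using npos_mono[of h t "max t 0"] by (auto intro!: exI[of _ "max t 0"])

lemma nposE:
  assumes "h \<in> npos A"
  obtains t where "t > 0" "cnorm A (creal A t \<ominus> h) \<le> t"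
proof -
  obtain t where "t \<ge> 0" "cnorm A (creal A t \<ominus> h) \<le> t" using assms by (auto simp: npos_def)
  then show ?thesis using npos_mono[of h t "t + 1"] that[of "t + 1"] assms by simp
qed

lemma npos_zero [simp]: "\<zero> \<in> npos A"
  by (rule nposI[of _ 0]) (simp_all add: minus_eq)

lemma npos_scale:
  assumes h: "h \<in> npos A" and s: "s \<ge> 0"
  shows "cscale A (complex_of_real s) h \<in> npos A"
proof -
  obtain t where t: "t > 0" "cnorm A (creal A t \<ominus> h) \<le> t" using h by (rule nposE)
  have "creal A (s * t) \<ominus> cscale A (complex_of_real s) h = cscale A (complex_of_real s) (creal A t \<ominus> h)"
    using h by (simp add: scale_diff_right scale_scale)
  then have "cnorm A (creal A (s * t) \<ominus> cscale A (complex_of_real s) h) \<le> s * t"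
    using h t s by (simp add: norm_scale mult_left_mono)
  then show ?thesis using h by (intro nposI[of _ "s * t"]) (auto intro: csa_scale npos_csa)
qed

text \<open>Dividing by the witness t brings h within distance 1 of the unit, where
  \<open>sqrt_near_one\<close> applies; the root is then scaled back by the square root of
  t.\<close>

lemma npos_sqrt:
  assumes h: "h \<in> npos A"
  shows "\<exists>k\<in>npos A. k \<otimes> k = h \<and> (\<forall>y\<in>carrier A. y \<otimes> h = h \<otimes> y \<longrightarrow> y \<otimes> k = k \<otimes> y)"
proof -
  obtain t where t: "t > 0" "cnorm A (creal A t \<ominus> h) \<le> t" using h by (rule nposE)
  define c where "c = complex_of_real (1/t)"
  define d where "d = complex_of_real (sqrt t)"
  have cd: "d * (d * c) = 1" using t by (simp add: c_def d_def flip: of_real_mult)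
  have hc [simp]: "h \<in> carrier A" using h by simp
  have c1: "cnorm A (\<one> \<ominus> cscale A c h) \<le> 1"
    using t norm_real_diff[of t h] unfolding c_def by simp
  have "cscale A c h \<in> csa A" unfolding c_def by (rule csa_scale[OF npos_csa[OF h]])
  from sqrt_near_one[OF this c1]
  obtain k where k: "k \<in> csa A" "k \<otimes> k = cscale A c h" "cnorm A (\<one> \<ominus> k) \<le> 1"
     "\<forall>y\<in>carrier A. y \<otimes> cscale A c h = cscale A c h \<otimes> y \<longrightarrow> y \<otimes> k = k \<otimes> y"
    by (elim bexE conjE)
  have "k \<in> npos A" using k(1,3) by (intro nposI[of _ 1]) auto
  then have 1: "cscale A d k \<in> npos A" using t by (auto simp: d_def intro!: npos_scale)
  have 2: "cscale A d k \<otimes> cscale A d k = h"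
    using k(1,2) cd by (simp add: scale_mult_left[symmetric] scale_mult_right[symmetric] scale_scale)
  have 3: "y \<otimes> cscale A d k = cscale A d k \<otimes> y" if y: "y \<in> carrier A" "y \<otimes> h = h \<otimes> y" for y
  proof -
    have "y \<otimes> k = k \<otimes> y"
      using k(4) y by (simp only: hc flip: scale_mult_left scale_mult_right)
    then show ?thesis using y(1) k(1) by (simp flip: scale_mult_left scale_mult_right)
  qed
  show ?thesis using 1 2 3 by blast
qed

text \<open>Every bound s of the norm is a witness: h/s is the square of an element of norm at most
  1, so \<open>norm_one_minus_square\<close> applies. A witness chosen by the norm alone is what
  passes to limits in \<open>npos_limit\<close>.\<close>

lemma npos_norm:
  assumes h: "h \<in> npos A" and s: "cnorm A h \<le> s"
  shows "cnorm A (creal A s \<ominus> h) \<le> s"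
proof (cases "s > 0")
  case True
  obtain k where k: "k \<in> npos A" "k \<otimes> k = h" using npos_sqrt[OF h] by blast
  define c where "c = complex_of_real (1 / sqrt s)"
  have cc: "c * c = complex_of_real (1/s)"
    unfolding c_def of_real_mult[symmetric] using True by (simp del: of_real_mult of_real_divide)
  have ck: "cscale A c k \<in> csa A" unfolding c_def using k(1) by (intro csa_scale npos_csa)
  have "(cnorm A k)\<^sup>2 \<le> s" using csa_norm_sq[of k] k s by (simp add: npos_csa)
  then have "cnorm A k \<le> sqrt s" by (simp add: real_le_rsqrt)
  then have "cnorm A (cscale A c k) \<le> 1" using k True by (simp add: norm_scale c_def norm_divide)
  then have "cnorm A (\<one> \<ominus> cscale A c k \<otimes> cscale A c k) \<le> 1"
    by (rule norm_one_minus_square[OF ck])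
  moreover have "cscale A c k \<otimes> cscale A c k = cscale A (complex_of_real (1/s)) h"
    using k h cc by (simp add: scale_mult_left[symmetric] scale_mult_right[symmetric] scale_scale)
  ultimately show ?thesis using True h norm_real_diff[of s h] by simp
next
  case False
  then have "cnorm A h = 0" "s = 0" using s norm_nonneg[OF npos_closed[OF h]] by linarith+
  then have "h = \<zero>" using h by (simp add: norm_eq_zero)
  then show ?thesis using \<open>s = 0\<close> by (simp add: minus_eq)
qed

lemma square_npos: assumes k: "k \<in> csa A" shows "k \<otimes> k \<in> npos A"
proof -
  define s where "s = cnorm A k + 1"
  have s: "s > 0" "cnorm A k \<le> s" using norm_nonneg[of k] k by (auto simp: s_def simp del: norm_nonneg)
  define c where "c = complex_of_real (1 / s)"
  have ck: "cscale A c k \<in> csa A" unfolding c_def using k by (intro csa_scale)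
  have "cnorm A (cscale A c k) \<le> 1" using k s by (simp add: norm_scale c_def norm_divide)
  then have "cnorm A (creal A 1 \<ominus> cscale A c k \<otimes> cscale A c k) \<le> 1"
    using norm_one_minus_square[OF ck] by simp
  then have "cscale A c k \<otimes> cscale A c k \<in> npos A"
    by (rule nposI[rotated]) (use ck in \<open>simp add: csa_mult\<close>)
  then have "cscale A (complex_of_real (s*s)) (cscale A c k \<otimes> cscale A c k) \<in> npos A"
    by (rule npos_scale) simp
  then show ?thesis
    using k s by (simp add: scale_mult_left[symmetric] scale_mult_right[symmetric] scale_scale c_def)
qed

lemma npos_add: assumes h: "h \<in> npos A" and k: "k \<in> npos A" shows "h \<oplus> k \<in> npos A"
proof -
  obtain s where s: "s > 0" "cnorm A (creal A s \<ominus> h) \<le> s" using h by (rule nposE)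
  obtain t where t: "t > 0" "cnorm A (creal A t \<ominus> k) \<le> t" using k by (rule nposE)
  have "cnorm A (creal A (s + t) \<ominus> (h \<oplus> k)) \<le> s + t"
    unfolding creal_add using norm_add_diff[of "creal A s" "creal A t" h k] s t h k by simp
  then show ?thesis using h k by (intro nposI[of _ "s + t"]) (auto intro: csa_add npos_csa)
qed

lemma npos_limit:
  assumes "ctendsto A s a" "\<And>n. s n \<in> npos A" "a \<in> carrier A"
  shows "a \<in> npos A"
proof -
  have "Bseq (\<lambda>n. cnorm A (s n))"
    using ctendsto_norm[of s a] assms by (intro convergent_imp_Bseq) (auto simp: convergent_def)
  then obtain M where M: "\<And>n. cnorm A (s n) \<le> M" by (auto simp: Bseq_def)
     (metis abs_le_D1)
  have "ctendsto A (\<lambda>n. creal A M \<ominus> s n) (creal A M \<ominus> a)"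
    using assms by (intro ctendsto_diff ctendsto_const) auto
  then have "(\<lambda>n. cnorm A (creal A M \<ominus> s n)) \<longlonglongrightarrow> cnorm A (creal A M \<ominus> a)"
    using assms by (intro ctendsto_norm) auto
  then have "cnorm A (creal A M \<ominus> a) \<le> M"
    using npos_norm[OF assms(2) M] by (meson LIMSEQ_le_const2)
  then show ?thesis using csa_limit[of s a] assms by (intro nposI) (auto simp: npos_csa)
qed

text \<open>The root of h commutes with k, hence with the root of k; the product is the square of
  the product of the roots.\<close>

lemma npos_mult:
  assumes h: "h \<in> npos A" and k: "k \<in> npos A" and comm: "h \<otimes> k = k \<otimes> h"
  shows "h \<otimes> k \<in> npos A"
proof -
  obtain a where a: "a \<in> npos A" "a \<otimes> a = h" "\<forall>y\<in>carrier A. y \<otimes> h = h \<otimes> y \<longrightarrow> y \<otimes> a = a \<otimes> y"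
    using npos_sqrt[OF h] by blast
  obtain b where b: "b \<in> npos A" "b \<otimes> b = k" "\<forall>y\<in>carrier A. y \<otimes> k = k \<otimes> y \<longrightarrow> y \<otimes> b = b \<otimes> y"
    using npos_sqrt[OF k] by blast
  have "k \<otimes> a = a \<otimes> k" using a k comm by simp
  then have ab: "a \<otimes> b = b \<otimes> a" using b a by simp
  have "a \<otimes> b \<in> csa A" using a b ab by (intro csa_mult) (auto simp: npos_csa)
  then have "(a \<otimes> b) \<otimes> (a \<otimes> b) \<in> npos A" by (rule square_npos)
  also have "(a \<otimes> b) \<otimes> (a \<otimes> b) = a \<otimes> a \<otimes> (b \<otimes> b)"
    using a b ab by (metis m_assoc m_closed npos_closed)
  finally show ?thesis using a b by simp
qed

lemma real_minus_npos:
  assumes "h \<in> csa A" "cnorm A h \<le> s" shows "creal A s \<ominus> h \<in> npos A"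
proof (rule nposI)
  have "creal A s \<ominus> (creal A s \<ominus> h) = h"
    using csa_closed[OF assms(1)] scale_closed[OF one_closed] by algebra
  then show "cnorm A (creal A s \<ominus> (creal A s \<ominus> h)) \<le> s" using assms by simp
qed (use assms csa_diff csa_real in blast)

lemma npos_real: "s \<ge> 0 \<Longrightarrow> creal A s \<in> npos A"
  using npos_scale[OF square_npos[OF csa_one]] by simp

lemma npos_one [simp]: "\<one> \<in> npos A"
  using npos_real[of 1] by simp

text \<open>From order to norm: the roots of a/s and 1 - a/s commute and their squares add up to 1,
  so \<open>circle_norm_le\<close> bounds them. Division needs s > 0; s = 0 is reached through s +
  e.\<close>

lemma npos_le_real:
  assumes a: "a \<in> npos A" and le: "creal A s \<ominus> a \<in> npos A" and s: "s \<ge> 0"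
  shows "cnorm A a \<le> s"
proof -
  have pos: "cnorm A a \<le> s" if s: "s > 0" and le: "creal A s \<ominus> a \<in> npos A" for s
  proof -
    define b where "b = cscale A (complex_of_real (1/s)) a"
    have b: "b \<in> npos A" unfolding b_def using a s by (intro npos_scale) auto
    have "cscale A (complex_of_real (1/s)) (creal A s \<ominus> a) \<in> npos A"
      using le s by (intro npos_scale) auto
    then have b1: "\<one> \<ominus> b \<in> npos A"
      using s a by (simp add: b_def scale_diff_right scale_scale flip: of_real_mult)
    obtain k where k: "k \<in> npos A" "k \<otimes> k = b" "\<forall>y\<in>carrier A. y \<otimes> b = b \<otimes> y \<longrightarrow> y \<otimes> k = k \<otimes> y"
      using npos_sqrt[OF b] by blast
    obtain l where l: "l \<in> npos A" "l \<otimes> l = \<one> \<ominus> b"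
        "\<forall>y\<in>carrier A. y \<otimes> (\<one> \<ominus> b) = (\<one> \<ominus> b) \<otimes> y \<longrightarrow> y \<otimes> l = l \<otimes> y"
      using npos_sqrt[OF b1] by blast
    have "k \<otimes> b = b \<otimes> k" unfolding k(2)[symmetric] using k(1) by (simp add: m_assoc)
    then have "k \<otimes> l = l \<otimes> k" using l(3) k(1) b comm_one_minus[of k b] by simp
    moreover have "k \<otimes> k \<oplus> l \<otimes> l = \<one>"
      unfolding k(2) l(2) using npos_closed[OF b] one_closed by algebra
    ultimately have "cnorm A k \<le> 1" using circle_norm_le k l npos_csa by blast
    then have "cnorm A b \<le> 1" using csa_norm_sq[of k] k by (simp add: npos_csa power_le_one)
    then show ?thesis using a s by (simp add: b_def norm_scale norm_divide field_simps)
  qed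
  show ?thesis
  proof (rule field_le_epsilon)
    fix e :: real assume e: "0 < e"
    have "creal A e \<oplus> (creal A s \<ominus> a) \<in> npos A" using e le by (intro npos_add npos_real) auto
    then have "creal A (s + e) \<ominus> a \<in> npos A"
      using a by (simp add: scale_add_left minus_eq a_ac)
    then show "cnorm A a \<le> s + e" using pos e s by simp
  qed
qed

lemma npos_norm_mono:
  assumes a: "a \<in> npos A" and b: "b \<in> carrier A" and le: "b \<ominus> a \<in> npos A"
  shows "cnorm A a \<le> cnorm A b"
proof -
  have "a \<oplus> (b \<ominus> a) = b" using npos_closed[OF a] b by algebra
  then have bp: "b \<in> npos A" using npos_add[OF a le] by simp
  have "(creal A (cnorm A b) \<ominus> b) \<oplus> (b \<ominus> a) \<in> npos A"
    by (intro npos_add real_minus_npos le) (use bp npos_csa in auto)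
  then have "creal A (cnorm A b) \<ominus> a \<in> npos A"
    using diff_split[of "creal A (cnorm A b)" b a] a b by simp
  then show ?thesis using a b by (intro npos_le_real) auto
qed

lemma npos_antisym: assumes "h \<in> npos A" "\<ominus> h \<in> npos A" shows "h = \<zero>"
proof -
  have "cnorm A h \<le> 0" using npos_norm_mono[of h \<zero>] assms by (simp add: minus_eq)
  then have "cnorm A h = 0" using norm_nonneg[of h] assms(1)[THEN npos_closed] by linarith
  then show ?thesis using assms by (simp add: norm_eq_zero)
qed

lemma npos_add_zero:
  assumes "h \<in> npos A" "k \<in> npos A" "h \<oplus> k = \<zero>" shows "h = \<zero>" "k = \<zero>"
proof -
  have "k = \<ominus> h" "h = \<ominus> k" using assms minus_equality[of h k] minus_equality[of k h] by (simp_all add: a_comm)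
  then show "h = \<zero>" "k = \<zero>" using assms npos_antisym by metis+
qed

section \<open>Norm bounds from the growth of powers\<close>

text \<open>Bernoulli's inequality alone gives linear growth, which does not contradict a linear
  bound. Squaring it gives growth quadratic in \<open>2^j\<close> against a bound linear in
  \<open>2^Suc j\<close>.\<close>

lemma pow_bounded_imp_le_one:
  fixes r K :: real
  assumes r: "0 \<le> r" and le: "\<And>j::nat. r ^ (2^j) \<le> 1 + 2^j * K"
  shows "r \<le> 1"
proof (rule ccontr)
  assume "\<not> r \<le> 1"
  define \<delta> where "\<delta> = r - 1"
  have \<delta>: "\<delta> > 0" using \<open>\<not> r \<le> 1\<close> by (simp add: \<delta>_def)
  have bd: "2^j * \<delta>\<^sup>2 \<le> 2 * K" for j :: nat
  proof -
    have "1 + 2^j * \<delta> \<le> r ^ (2^j)"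
      using Bernoulli_inequality[of \<delta> "2^j"] \<delta> by (simp add: \<delta>_def)
    then have "(1 + 2^j * \<delta>)\<^sup>2 \<le> (r ^ (2^j))\<^sup>2" using \<delta> by (intro power_mono) auto
    also have "\<dots> \<le> 1 + 2 ^ Suc j * K"
      using le[of "Suc j"] by (simp add: power_mult[symmetric] mult.commute)
    finally have "(2^j * \<delta>)\<^sup>2 \<le> 2 ^ Suc j * K" using \<delta> by (simp add: power2_sum)
      (smt (verit) zero_le_power mult_nonneg_nonneg)
    then have "2^j * (2^j * \<delta>\<^sup>2) \<le> 2^j * (2 * K)" by (simp add: power2_eq_square algebra_simps)
    then show ?thesis by simp
  qed
  obtain j where "2 * K / \<delta>\<^sup>2 < 2 ^ j" using real_arch_pow[of 2 "2*K/\<delta>\<^sup>2"] by auto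
  then show False using bd[of j] \<delta> by (simp add: field_simps)
qed

lemma norm_le_one_of_powers:
  assumes x: "x \<in> csa A" and K: "\<And>j::nat. cnorm A (x [^] ((2::nat)^j)) \<le> 1 + 2^j * K"
  shows "cnorm A x \<le> 1"
  using pow_bounded_imp_le_one[of "cnorm A x" K] K csa_pow2_norm[OF x] x by simp

text \<open>This replaces the spectral radius formula.\<close>

lemma norm_le_one_of_increments:
  assumes x: "x \<in> csa A" and K: "\<And>n::nat. cnorm A ((\<one> \<ominus> x) \<otimes> x [^] n) \<le> K"
  shows "cnorm A x \<le> 1"
proof -
  have xc [simp]: "x \<in> carrier A" using x by simp
  have "cnorm A (x [^] n) \<le> 1 + real n * K" for n :: nat
  proof (induction n)
    case (Suc n)
    have "x [^] Suc n = x [^] n \<ominus> (\<one> \<ominus> x) \<otimes> x [^] n"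
      using nat_pow_Suc2[of x n] xc nat_pow_closed[OF xc, of n] m_closed[OF xc nat_pow_closed[OF xc, of n]]
      by (simp add: minus_eq l_distr l_minus minus_add r_neg1 a_assoc[symmetric] r_neg)
    then have "cnorm A (x [^] Suc n) \<le> cnorm A (x [^] n) + K"
      using norm_diff_le[of "x [^] n" "(\<one> \<ominus> x) \<otimes> x [^] n"] K[of n] by simp
    then show ?case using Suc by (simp add: algebra_simps)
  qed (simp add: norm_one_le)
  then have "cnorm A (x [^] ((2::nat)^j)) \<le> 1 + 2^j * K" for j :: nat
    by (metis of_nat_numeral of_nat_power)
  then show ?thesis using norm_le_one_of_powers[OF x] by blast
qed

text \<open>Here m is the absolute value of h. Since (m + h)^2 = 2m (m + h), the scaled elements p
  and n satisfy p^2 = n p, and p (1 - p)^j = p (1 - n)^j stays bounded because 1 - n is a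
  contraction. So the powers of 1 - p have bounded increments, 1 - p is a contraction and p is
  positive.\<close>

lemma abs_plus_npos:
  assumes h: "h \<in> csa A" and m: "m \<in> npos A" and sq: "m \<otimes> m = h \<otimes> h" and comm: "m \<otimes> h = h \<otimes> m"
  shows "m \<oplus> h \<in> npos A"
proof -
  \<comment> \<open>Large enough that n = 2m/t is a positive contraction; the summand 1 keeps t
    positive when m = 0.\<close>
  define t where "t = cnorm A (m \<oplus> m) + 1"
  have t: "t > 0" "cnorm A (m \<oplus> m) \<le> t" using norm_nonneg[of "m \<oplus> m"] m by (auto simp: t_def simp del: norm_nonneg)
  define c where "c = complex_of_real (1/t)"
  define p where "p = cscale A c (m \<oplus> h)"
  define n where "n = cscale A c (m \<oplus> m)"
  have hm [simp]: "h \<in> carrier A" "m \<in> carrier A" using h m by auto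
  have pc [simp]: "p \<in> carrier A" "n \<in> carrier A" by (simp_all add: p_def n_def)
  have psa: "p \<in> csa A" unfolding p_def c_def using h m by (intro csa_scale csa_add) (auto simp: npos_csa)
  have nn: "n \<in> npos A" unfolding n_def c_def using m t by (intro npos_scale npos_add) auto
  have "cnorm A n \<le> 1" unfolding n_def using t by (simp add: norm_scale c_def norm_divide)
  then have n1: "cnorm A (\<one> \<ominus> n) \<le> 1" using npos_norm[OF nn] by force
  have "(m \<oplus> h) \<otimes> (m \<oplus> h) = (m \<oplus> m) \<otimes> (m \<oplus> h)"
    using sq comm by (simp add: l_distr r_distr a_ac)
  then have pp: "p \<otimes> p = n \<otimes> p"
    by (simp add: p_def n_def scale_mult_left[symmetric] scale_mult_right[symmetric])
  have "(m \<oplus> m) \<otimes> (m \<oplus> h) = (m \<oplus> h) \<otimes> (m \<oplus> m)"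
    using sq comm by (simp add: l_distr r_distr a_ac)
  then have np: "n \<otimes> p = p \<otimes> n"
    by (simp add: p_def n_def scale_mult_left[symmetric] scale_mult_right[symmetric])
  have pw: "p \<otimes> (\<one> \<ominus> p) [^] j = p \<otimes> (\<one> \<ominus> n) [^] j" for j :: nat
  proof (induction j)
    case (Suc j)
    have "p \<otimes> (\<one> \<ominus> p) [^] Suc j = (p \<ominus> p \<otimes> p) \<otimes> (\<one> \<ominus> p) [^] j"
      using nat_pow_Suc2[of "\<one> \<ominus> p" j] by (simp add: minus_eq r_distr r_minus m_assoc[symmetric])
    also have "\<dots> = (\<one> \<ominus> n) \<otimes> (p \<otimes> (\<one> \<ominus> p) [^] j)"
      unfolding pp by (simp add: minus_eq l_distr l_minus m_assoc)
    also have "\<dots> = (\<one> \<ominus> n) \<otimes> p \<otimes> (\<one> \<ominus> n) [^] j"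
      unfolding Suc by (simp add: m_assoc)
    also have "(\<one> \<ominus> n) \<otimes> p = p \<otimes> (\<one> \<ominus> n)"
      using np by (simp add: minus_eq l_distr r_distr l_minus r_minus)
    finally show ?case using nat_pow_Suc2[of "\<one> \<ominus> n" j] by (simp add: m_assoc)
  qed simp
  have p1: "\<one> \<ominus> (\<one> \<ominus> p) = p" using pc one_closed by algebra
  have "cnorm A ((\<one> \<ominus> (\<one> \<ominus> p)) \<otimes> (\<one> \<ominus> p) [^] j) \<le> cnorm A p" for j :: nat
    unfolding p1 pw using norm_mult_le[of p "(\<one> \<ominus> n) [^] j" "cnorm A p" 1] norm_pow_le[OF _ n1] by simp
  then have "cnorm A (\<one> \<ominus> p) \<le> 1"
    using psa by (intro norm_le_one_of_increments) (auto simp: csa_diff)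
  then have "p \<in> npos A" using psa by (intro nposI[of p 1]) auto
  then have "cscale A (complex_of_real t) p \<in> npos A" using t by (intro npos_scale) auto
  then show ?thesis using t by (simp add: p_def c_def scale_scale flip: of_real_mult)
qed

text \<open>The parts are half of m + h and half of m - h, where m is the root of h^2;
  \<open>abs_plus_npos\<close> for h and for -h makes them positive. What commutes with h commutes
  with h^2, hence with m and with both parts.\<close>

lemma jordan_decomposition:
  assumes h: "h \<in> csa A"
  shows "\<exists>p\<in>npos A. \<exists>q\<in>npos A. h = p \<ominus> q \<and> p \<otimes> q = \<zero> \<and> q \<otimes> p = \<zero> \<and>
    (\<forall>y\<in>carrier A. y \<otimes> h = h \<otimes> y \<longrightarrow> y \<otimes> p = p \<otimes> y \<and> y \<otimes> q = q \<otimes> y)"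
proof -
  obtain m where m: "m \<in> npos A" "m \<otimes> m = h \<otimes> h"
      "\<forall>y\<in>carrier A. y \<otimes> (h \<otimes> h) = (h \<otimes> h) \<otimes> y \<longrightarrow> y \<otimes> m = m \<otimes> y"
    using npos_sqrt[OF square_npos[OF h]] by blast
  have hm [simp]: "h \<in> carrier A" "m \<in> carrier A" using h m(1) by auto
  have mh: "h \<otimes> m = m \<otimes> h" using m(3) by (simp add: m_assoc)
  have q: "m \<ominus> h \<in> npos A"
    unfolding minus_eq using h m(1,2) mh by (intro abs_plus_npos) (simp_all add: csa_neg l_minus r_minus)
  have p: "m \<oplus> h \<in> npos A" using h m(1,2) mh by (intro abs_plus_npos) simp_all
  define c where "c = complex_of_real (1/2)"
  have d: "cscale A c (m \<oplus> h) \<ominus> cscale A c (m \<ominus> h) = h"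
  proof -
    have "(m \<oplus> h) \<ominus> (m \<ominus> h) = h \<oplus> h" using hm by algebra
    then have "cscale A c ((m \<oplus> h) \<ominus> (m \<ominus> h)) = h" using half_double[of h] by (simp add: c_def)
    then show ?thesis by (simp add: scale_diff_right)
  qed
  have "(m \<oplus> h) \<otimes> (m \<ominus> h) = \<zero>" "(m \<ominus> h) \<otimes> (m \<oplus> h) = \<zero>"
    using mh m(2) by (simp_all add: minus_eq l_distr r_distr l_minus r_minus a_ac r_neg r_neg1 r_neg2 l_neg)
  then have pq: "cscale A c (m \<oplus> h) \<otimes> cscale A c (m \<ominus> h) = \<zero>" "cscale A c (m \<ominus> h) \<otimes> cscale A c (m \<oplus> h) = \<zero>"
    by (simp_all add: scale_mult_left[symmetric] scale_mult_right[symmetric])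
  have comm: "y \<otimes> cscale A c (m \<oplus> h) = cscale A c (m \<oplus> h) \<otimes> y" "y \<otimes> cscale A c (m \<ominus> h) = cscale A c (m \<ominus> h) \<otimes> y"
    if y: "y \<in> carrier A" "y \<otimes> h = h \<otimes> y" for y
  proof -
    have "y \<otimes> (h \<otimes> h) = (h \<otimes> h) \<otimes> y" using y by (metis hm(1) m_assoc)
    then have "y \<otimes> m = m \<otimes> y" using m(3) y(1) by blast
    then show "y \<otimes> cscale A c (m \<oplus> h) = cscale A c (m \<oplus> h) \<otimes> y" "y \<otimes> cscale A c (m \<ominus> h) = cscale A c (m \<ominus> h) \<otimes> y"
      using y by (simp_all add: scale_mult_left[symmetric] scale_mult_right[symmetric]
        minus_eq l_distr r_distr l_minus r_minus)
  qed
  have "cscale A c (m \<oplus> h) \<in> npos A" "cscale A c (m \<ominus> h) \<in> npos A"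
    using p q by (auto simp: c_def intro!: npos_scale simp del: of_real_divide)
  then show ?thesis using d pq comm by (metis)
qed

lemma csaI: "\<lbrakk>x \<in> carrier A; cadj A x = x\<rbrakk> \<Longrightarrow> x \<in> csa A"
  by (simp add: csa_def del: csa_closed)

lemma star_zero_iff: "x \<in> carrier A \<Longrightarrow> cadj A x \<otimes> x = \<zero> \<longleftrightarrow> x = \<zero>"
  using cstar_identity[of x] norm_eq_zero[of x] norm_eq_zero[of "cadj A x \<otimes> x"] by auto

lemma csa_sq_zero: "\<lbrakk>x \<in> csa A; x \<otimes> x = \<zero>\<rbrakk> \<Longrightarrow> x = \<zero>"
  using star_zero_iff[of x] by (simp add: csa_adj)

text \<open>The formulas for a and b belong to the conclusion because
  \<open>thin_corner_scalar\<close> reads off from them that the two parts stay in a given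
  annihilator.\<close>

lemma csa_decomp:
  assumes x: "x \<in> carrier A"
  shows "\<exists>a\<in>csa A. \<exists>b\<in>csa A. x = a \<oplus> cscale A \<i> b \<and> a = cscale A (1/2) (x \<oplus> cadj A x) \<and>
    b = cscale A (-\<i>/2) (x \<ominus> cadj A x)"
proof -
  have 1: "cscale A (1/2) (x \<oplus> cadj A x) \<in> csa A"
    using x by (intro csaI) (simp_all add: adj_scale adj_add a_comm[of x])
  have "cadj A (x \<ominus> cadj A x) = \<ominus> (x \<ominus> cadj A x)"
    using x by (simp add: minus_eq adj_add adj_neg minus_add a_comm)
  then have 2: "cscale A (-\<i>/2) (x \<ominus> cadj A x) \<in> csa A"
    using x by (intro csaI) (simp_all add: adj_scale scale_minus_right scale_minus_left[symmetric])
  have "(x \<oplus> cadj A x) \<oplus> (x \<ominus> cadj A x) = x \<oplus> x"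
    using x adj_closed[OF x] by algebra
  then have "x = cscale A (1/2) (x \<oplus> cadj A x) \<oplus> cscale A \<i> (cscale A (-\<i>/2) (x \<ominus> cadj A x))"
    using x half_double[of x] by (simp add: scale_scale scale_add_right[symmetric])
  then show ?thesis using 1 2 by blast
qed

lemma npos_cube: assumes q: "q \<in> npos A" shows "q \<otimes> q \<otimes> q \<in> npos A"
  using q by (intro npos_mult square_npos) (auto simp: npos_csa m_assoc)

lemma power_intertwine:
  assumes [simp]: "z \<in> carrier A" "x \<in> carrier A" "y \<in> carrier A" and e: "z \<otimes> x = y \<otimes> z"
  shows "z \<otimes> x [^] (n::nat) = y [^] n \<otimes> z"
proof (induction n)
  case (Suc n)
  have "z \<otimes> x [^] Suc n = (z \<otimes> x [^] n) \<otimes> x" by (simp add: m_assoc)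
  also have "\<dots> = y [^] n \<otimes> (z \<otimes> x)" unfolding Suc by (simp add: m_assoc)
  also have "\<dots> = y [^] Suc n \<otimes> z" unfolding e by (simp add: m_assoc)
  finally show ?case .
qed simp

text \<open>Classically z* z and z z* share their nonzero spectrum. Here z z* is positive because z*
  z + z z* is a sum of squares, and z intertwines 1 + c with 1 - z z*. Once z is scaled to a
  contraction, the powers of 1 - z z* are contractions, so those of 1 + c have bounded increments;
  thus 1 + c has norm at most 1 and c = 0.\<close>

lemma star_negative_zero:
  assumes z: "z \<in> carrier A" and c: "c \<in> npos A" and zz: "cadj A z \<otimes> z = \<ominus> c"
  shows "c = \<zero>"
proof -
  obtain a b where ab: "a \<in> csa A" "b \<in> csa A" "z = a \<oplus> cscale A \<i> b" using csa_decomp[OF z] by blast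
  have abc [simp]: "a \<in> carrier A" "b \<in> carrier A" using ab by auto
  have cc [simp]: "c \<in> carrier A" using c by simp
  have zs: "cadj A z = a \<oplus> \<ominus> cscale A \<i> b"
    using ab by (simp add: adj_add adj_scale csa_adj scale_minus_left)
  have sum: "cadj A z \<otimes> z \<oplus> z \<otimes> cadj A z = (a \<otimes> a \<oplus> a \<otimes> a) \<oplus> (b \<otimes> b \<oplus> b \<otimes> b)"
    unfolding zs unfolding ab(3)
    by (simp add: l_distr r_distr l_minus r_minus a_ac scale_mult_left[symmetric]
      scale_mult_right[symmetric] scale_scale scale_minus1 r_neg r_neg1 r_neg2 minus_add
      scale_add_right scale_minus_right)
  have "z \<otimes> cadj A z = (cadj A z \<otimes> z \<oplus> z \<otimes> cadj A z) \<oplus> c"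
    unfolding zz using z cc adj_closed[OF z] m_closed[OF z adj_closed[OF z]] by algebra
  also have "\<dots> \<in> npos A"
    unfolding sum using ab c by (intro npos_add square_npos) auto
  finally have d: "z \<otimes> cadj A z \<in> npos A" .
  \<comment> \<open>Scales z to a contraction w, so that both w w* and 1 - w w* have norm at most
    1.\<close>
  define s where "s = 1 / (cnorm A z + 1)"
  have s: "s > 0" unfolding s_def using norm_nonneg[OF z] by (simp add: add_nonneg_pos)
  have sz: "s * cnorm A z \<le> 1" unfolding s_def using norm_nonneg[OF z] by (simp add: field_simps)
  define w where "w = cscale A (complex_of_real s) z"
  have w [simp]: "w \<in> carrier A" unfolding w_def using z by simp
  have w1: "cnorm A w \<le> 1"
    unfolding w_def using z s sz by (simp add: norm_scale)
  define c' where "c' = cscale A (complex_of_real (s*s)) c"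
  have c' [simp]: "c' \<in> carrier A" and c'p: "c' \<in> npos A"
    unfolding c'_def using c by (simp, intro npos_scale) auto
  have ww: "cadj A w \<otimes> w = \<ominus> c'"
    unfolding w_def c'_def using z zz
    by (simp add: adj_scale scale_mult_left[symmetric] scale_mult_right[symmetric] scale_scale scale_minus_right)
  define d' where "d' = w \<otimes> cadj A w"
  have d'c [simp]: "d' \<in> carrier A" by (simp add: d'_def)
  have d'p: "d' \<in> npos A"
  proof -
    have "d' = cscale A (complex_of_real (s*s)) (z \<otimes> cadj A z)"
      unfolding d'_def w_def using z
      by (simp add: adj_scale scale_mult_left[symmetric] scale_mult_right[symmetric] scale_scale)
    then show ?thesis using npos_scale[OF d, of "s*s"] by simp
  qed
  have "cnorm A d' \<le> 1" unfolding d'_def using cstar_identity'[OF w] w1 by (simp add: power_le_one)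
  then have d1: "cnorm A (\<one> \<ominus> d') \<le> 1" using npos_norm[OF d'p, of 1] by simp
  have "w \<otimes> (\<ominus> c') = d' \<otimes> w" unfolding ww[symmetric] d'_def by (simp add: m_assoc)
  then have "w \<otimes> (\<one> \<oplus> c') = (\<one> \<ominus> d') \<otimes> w"
    by (simp add: r_distr l_distr minus_eq l_minus r_minus) (metis minus_minus m_closed w c')
  then have pw: "w \<otimes> (\<one> \<oplus> c') [^] n = (\<one> \<ominus> d') [^] n \<otimes> w" for n :: nat
    by (intro power_intertwine) auto
  have "(\<one> \<ominus> (\<one> \<oplus> c')) \<otimes> (\<one> \<oplus> c') [^] n = cadj A w \<otimes> ((\<one> \<ominus> d') [^] n \<otimes> w)" for n :: nat
  proof -
    have "\<one> \<ominus> (\<one> \<oplus> c') = cadj A w \<otimes> w" unfolding ww using c' one_closed by algebra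
    then show ?thesis by (simp add: m_assoc flip: pw)
  qed
  moreover have "cnorm A (cadj A w \<otimes> ((\<one> \<ominus> d') [^] n \<otimes> w)) \<le> 1 * (1 * 1)" for n :: nat
    using w1 norm_pow_le[OF _ d1] by (intro norm_mult_le) auto
  ultimately have "cnorm A ((\<one> \<ominus> (\<one> \<oplus> c')) \<otimes> (\<one> \<oplus> c') [^] n) \<le> 1" for n :: nat
    by simp
  then have "cnorm A (\<one> \<oplus> c') \<le> 1"
    by (rule norm_le_one_of_increments[rotated]) (use c'p in \<open>simp add: csa_add npos_csa\<close>)
  then have "\<one> \<ominus> (\<one> \<oplus> c') \<in> npos A"
    using real_minus_npos[of "\<one> \<oplus> c'" 1] c'p by (simp add: csa_add npos_csa)
  moreover have "\<one> \<ominus> (\<one> \<oplus> c') = \<ominus> c'" using c' one_closed by algebra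
  ultimately have "c' = \<zero>" using npos_antisym[OF c'p] by simp
  then have "cnorm A c = 0" using s norm_scale[OF cc, of "complex_of_real (s*s)"] by (simp add: c'_def)
  then show ?thesis by (simp add: norm_eq_zero)
qed

text \<open>Kaplansky's argument: with \<open>q\<close> the negative part of \<open>x* x\<close> and \<open>z = x q\<close> one has
  \<open>z* z = - q\<^sup>3\<close>.\<close>

lemma star_npos: assumes x: "x \<in> carrier A" shows "cadj A x \<otimes> x \<in> npos A"
proof -
  obtain p q where pq: "p \<in> npos A" "q \<in> npos A" "cadj A x \<otimes> x = p \<ominus> q" "p \<otimes> q = \<zero>" "q \<otimes> p = \<zero>"
    using jordan_decomposition[OF csa_star[OF x]] by blast
  have [simp]: "p \<in> carrier A" "q \<in> carrier A" using pq by auto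
  have "cadj A (x \<otimes> q) \<otimes> (x \<otimes> q) = q \<otimes> (cadj A x \<otimes> x) \<otimes> q"
    using x pq(1,2) by (simp add: adj_mult csa_adj npos_csa m_assoc)
  also have "\<dots> = \<ominus> (q \<otimes> q \<otimes> q)"
    unfolding pq(3) using pq(5) by (simp add: minus_eq r_distr l_distr r_minus l_minus)
  finally have "q \<otimes> q \<otimes> q = \<zero>"
    using star_negative_zero[of "x \<otimes> q" "q \<otimes> q \<otimes> q"] x npos_cube pq by simp
  then have "(q \<otimes> q) \<otimes> (q \<otimes> q) = \<zero>" by (simp add: m_assoc[symmetric])
  moreover have qsa: "q \<in> csa A" "q \<otimes> q \<in> csa A" using pq by (simp_all add: npos_csa csa_mult)
  ultimately have "q = \<zero>" using csa_sq_zero by blast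
  then show ?thesis using pq by (simp add: minus_eq)
qed

lemma star_npos': "x \<in> carrier A \<Longrightarrow> x \<otimes> cadj A x \<in> npos A"
  using star_npos[of "cadj A x"] by simp

lemma cpos_eq_npos: "cpos A = npos A"
proof
  show "cpos A \<subseteq> npos A" using star_npos by (auto simp: cpos_def)
  show "npos A \<subseteq> cpos A"
  proof
    fix h assume "h \<in> npos A"
    then obtain k where "k \<in> npos A" "k \<otimes> k = h" using npos_sqrt by blast
    then show "h \<in> cpos A" unfolding cpos_def by (auto intro!: exI[of _ k] simp: csa_adj npos_csa)
  qed
qed

lemma npos_conj:
  assumes h: "h \<in> npos A" and x: "x \<in> carrier A" shows "cadj A x \<otimes> h \<otimes> x \<in> npos A"
proof -
  obtain k where k: "k \<in> npos A" "k \<otimes> k = h" using npos_sqrt[OF h] by blast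
  have "cadj A (k \<otimes> x) \<otimes> (k \<otimes> x) = cadj A x \<otimes> h \<otimes> x"
    using k x unfolding k(2)[symmetric] by (simp add: adj_mult csa_adj npos_csa m_assoc)
  then show ?thesis using star_npos[of "k \<otimes> x"] k x by simp
qed

lemma npos_conj': "\<lbrakk>h \<in> npos A; x \<in> carrier A\<rbrakk> \<Longrightarrow> x \<otimes> h \<otimes> cadj A x \<in> npos A"
  using npos_conj[of h "cadj A x"] by simp

lemma npos_conj_csa: "\<lbrakk>h \<in> npos A; x \<in> csa A\<rbrakk> \<Longrightarrow> x \<otimes> h \<otimes> x \<in> npos A"
  using npos_conj[of h x] by (simp add: csa_adj)

lemma npos_conj_zero:
  assumes h: "h \<in> npos A" and x: "x \<in> carrier A" and z: "cadj A x \<otimes> h \<otimes> x = \<zero>"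
  shows "h \<otimes> x = \<zero>"
proof -
  obtain k where k: "k \<in> npos A" "k \<otimes> k = h" using npos_sqrt[OF h] by blast
  have "cadj A (k \<otimes> x) \<otimes> (k \<otimes> x) = \<zero>"
    using k x z unfolding k(2)[symmetric] by (simp add: adj_mult csa_adj npos_csa m_assoc)
  then have "k \<otimes> x = \<zero>" using star_zero_iff[of "k \<otimes> x"] k x by simp
  then show ?thesis using k x by (metis m_assoc npos_closed r_null)
qed

lemma sqrt_mult_zero:
  assumes k: "k \<in> npos A" and x: "x \<in> carrier A" and z: "k \<otimes> k \<otimes> x = \<zero>"
  shows "k \<otimes> x = \<zero>"
proof -
  have "cadj A (k \<otimes> x) \<otimes> (k \<otimes> x) = cadj A x \<otimes> (k \<otimes> k \<otimes> x)"
    using k x by (simp add: adj_mult csa_adj npos_csa m_assoc)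
  then show ?thesis using star_zero_iff[of "k \<otimes> x"] k x z by simp
qed

lemma npos_finsum:
  assumes "finite I" "\<And>i. i \<in> I \<Longrightarrow> f i \<in> npos A" shows "(\<Oplus>i\<in>I. f i) \<in> npos A"
  using assms
proof (induction I rule: finite_induct)
  case (insert i I)
  then show ?case by (simp add: Pi_def npos_add)
qed simp

text \<open>Two arbitrary roots need not obviously commute, so each is compared with the root from
  \<open>npos_sqrt\<close>, which commutes with both. For d = x - k the positive elements d x d and
  d k d add up to (x^2 - k^2) d = 0, so both vanish and d^2 = 0.\<close>

lemma npos_sqrt_unique:
  assumes a: "a \<in> npos A" and b: "b \<in> npos A" and ab: "a \<otimes> a = b \<otimes> b"
  shows "a = b"
proof -
  have uniq: "x = k" if x: "x \<in> npos A" "x \<otimes> x = h" and k: "k \<in> npos A" "k \<otimes> k = h"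
    "\<forall>y\<in>carrier A. y \<otimes> h = h \<otimes> y \<longrightarrow> y \<otimes> k = k \<otimes> y" for x k h
  proof -
    have c [simp]: "x \<in> carrier A" "k \<in> carrier A" using x k(1) by auto
    have "x \<otimes> h = h \<otimes> x" unfolding x(2)[symmetric] by (simp add: m_assoc)
    then have xk: "x \<otimes> k = k \<otimes> x" using k(3) by simp
    define d where "d = x \<ominus> k"
    have dc [simp]: "d \<in> carrier A" by (simp add: d_def)
    have dsa: "d \<in> csa A" unfolding d_def using x k(1) by (intro csa_diff npos_csa)
    have "d \<otimes> (x \<oplus> k) = x \<otimes> x \<oplus> x \<otimes> k \<ominus> (k \<otimes> x \<oplus> k \<otimes> k)"
      unfolding d_def using c by algebra
    also have "\<dots> = \<zero>" unfolding x(2) k(2) xk using c m_closed[OF c(2,1)] m_closed[OF c(2,2)] k(2)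
      by (simp add: minus_eq a_comm[of h] r_neg)
    finally have "d \<otimes> x \<otimes> d \<oplus> d \<otimes> k \<otimes> d = \<zero>"
      by (simp add: r_distr[symmetric] l_distr[symmetric])
    moreover have "d \<otimes> x \<otimes> d \<in> npos A" "d \<otimes> k \<otimes> d \<in> npos A"
      using npos_conj_csa[OF x(1) dsa] npos_conj_csa[OF k(1) dsa] by auto
    ultimately have "d \<otimes> x \<otimes> d = \<zero>" "d \<otimes> k \<otimes> d = \<zero>" using npos_add_zero by blast+
    then have "x \<otimes> d = \<zero>" "k \<otimes> d = \<zero>" using npos_conj_zero[of x d] npos_conj_zero[of k d] x(1) k(1) dsa
      by (auto simp: csa_adj)
    then have "d \<otimes> d = \<zero>" by (subst (1) d_def) (simp add: minus_eq l_distr l_minus)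
    then have "d = \<zero>" using csa_sq_zero[OF dsa] by simp
    then show ?thesis by (simp add: d_def diff_eq_zero)
  qed
  obtain k where k: "k \<in> npos A" "k \<otimes> k = b \<otimes> b"
    "\<forall>y\<in>carrier A. y \<otimes> (b \<otimes> b) = (b \<otimes> b) \<otimes> y \<longrightarrow> y \<otimes> k = k \<otimes> y"
    using npos_sqrt[of "b \<otimes> b"] square_npos[OF npos_csa[OF b]] by blast
  show ?thesis using uniq[OF a ab k] uniq[OF b refl k] by simp
qed

lemma csqroot_props:
  assumes a: "a \<in> npos A"
  shows "csqroot A a \<in> npos A" "csqroot A a \<otimes> csqroot A a = a"
    "\<And>y. \<lbrakk>y \<in> carrier A; y \<otimes> a = a \<otimes> y\<rbrakk> \<Longrightarrow> y \<otimes> csqroot A a = csqroot A a \<otimes> y"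
proof -
  obtain k where k: "k \<in> npos A" "k \<otimes> k = a" "\<forall>y\<in>carrier A. y \<otimes> a = a \<otimes> y \<longrightarrow> y \<otimes> k = k \<otimes> y"
    using npos_sqrt[OF a] by blast
  have eq: "csqroot A a = k"
    unfolding csqroot_def cpos_eq_npos using k(1,2) npos_sqrt_unique by (intro the_equality) auto
  show "csqroot A a \<in> npos A" "csqroot A a \<otimes> csqroot A a = a" unfolding eq by (rule k)+
  show "y \<otimes> csqroot A a = csqroot A a \<otimes> y" if "y \<in> carrier A" "y \<otimes> a = a \<otimes> y" for y
    unfolding eq using k(3) that by blast
qed

lemma csqroot_unique: "\<lbrakk>b \<in> npos A; b \<otimes> b = a\<rbrakk> \<Longrightarrow> csqroot A a = b"
  using npos_sqrt_unique csqroot_props(1,2)[of a] square_npos[of b] npos_csa[of b] by metis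

lemma norm_sq_npos: "k \<in> npos A \<Longrightarrow> cnorm A (k \<otimes> k) = (cnorm A k)\<^sup>2"
  by (simp add: csa_norm_sq npos_csa)

lemma npos_eps:
  assumes x: "x \<in> carrier A" and e: "\<And>\<epsilon>. 0 < \<epsilon> \<Longrightarrow> \<epsilon> < 1 \<Longrightarrow> x \<oplus> creal A \<epsilon> \<in> npos A"
  shows "x \<in> npos A"
proof (rule npos_limit)
  \<comment> \<open>Starting at 1/2 keeps all values strictly between 0 and 1, where the hypothesis
    is available.\<close>
  define f :: "nat \<Rightarrow> real" where "f n = 1 / real (n + 2)" for n
  have f: "0 < f n" "f n < 1" for n by (simp_all add: f_def)
  show "x \<oplus> creal A (f n) \<in> npos A" for n using e f by blast
  show "ctendsto A (\<lambda>n. x \<oplus> creal A (f n)) x"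
  proof (rule ctendstoI)
    show "cnorm A ((x \<oplus> creal A (f n)) \<ominus> x) \<le> f n" for n
    proof -
      have "(x \<oplus> creal A (f n)) \<ominus> x = creal A (f n)" using x scale_closed[OF one_closed] by algebra
      then show ?thesis using norm_real_le[of "f n"] f[of n] by simp
    qed
    show "f \<longlonglongrightarrow> 0" unfolding f_def using LIMSEQ_ignore_initial_segment[OF lim_1_over_n, of 2] by simp
  qed (use x in auto)
qed (use x in auto)

text \<open>The Neumann series of w = 1 - x, written as the iteration y := 1 + w y. The iterates
  commute with w, so the limit is an inverse on both sides.\<close>

lemma invertible_near_one:
  assumes x: "x \<in> carrier A" and lt: "cnorm A (\<one> \<ominus> x) < 1"
  shows "x \<in> Units A"
proof -
  define w where "w = \<one> \<ominus> x"
  have w [simp]: "w \<in> carrier A" using x by (simp add: w_def)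
  define \<rho> where "\<rho> = cnorm A w"
  have \<rho>: "0 \<le> \<rho>" "\<rho> < 1" using lt by (simp_all add: \<rho>_def w_def[symmetric])
  define Y where "Y = rec_nat \<zero> (\<lambda>_ y. \<one> \<oplus> w \<otimes> y)"
  have Y0: "Y 0 = \<zero>" and YS: "Y (Suc n) = \<one> \<oplus> w \<otimes> Y n" for n by (simp_all add: Y_def)
  have Y [simp]: "Y n \<in> carrier A" for n by (induction n) (simp_all add: Y0 YS)
  have comm: "w \<otimes> Y n = Y n \<otimes> w" for n
  proof (induction n)
    case (Suc n)
    have "w \<otimes> (w \<otimes> Y n) = (w \<otimes> Y n) \<otimes> w" by (subst (1) Suc) (simp add: m_assoc)
    then show ?case by (simp add: YS r_distr l_distr)
  qed (simp add: Y0)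
  have diff: "cnorm A (Y (Suc n) \<ominus> Y n) \<le> \<rho> ^ n" for n
  proof (induction n)
    case (Suc n)
    have "Y (Suc (Suc n)) \<ominus> Y (Suc n) = w \<otimes> (Y (Suc n) \<ominus> Y n)"
      unfolding YS[of "Suc n"] by (subst (2) YS) (use w Y[of "Suc n"] Y[of n] one_closed in algebra)
    then show ?case using norm_mult_le[OF w _ _ Suc, of \<rho>] by (simp add: \<rho>_def)
  qed (simp add: Y0 YS minus_eq norm_one_le)
  define t where "t n = (\<Sum>i<n. \<rho> ^ i)" for n
  have "convergent t"
    unfolding t_def using \<rho> summable_geometric[of \<rho>] by (simp add: summable_iff_convergent)
  then have "\<exists>b\<in>carrier A. ctendsto A Y b"
    using diff by (intro ctendsto_dominated[of Y t]) (auto simp: t_def)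
  then obtain y where y [simp]: "y \<in> carrier A" and lim: "ctendsto A Y y" by blast
  have lim2: "ctendsto A (\<lambda>n. Y (Suc n)) (\<one> \<oplus> w \<otimes> y)"
    unfolding YS by (intro ctendsto_add ctendsto_mult ctendsto_const lim) auto
  have 1: "y = \<one> \<oplus> w \<otimes> y"
    by (rule ctendsto_unique[OF ctendsto_Suc[OF lim] lim2]) simp_all
  have "ctendsto A (\<lambda>n. Y (Suc n)) (\<one> \<oplus> y \<otimes> w)"
    unfolding YS comm by (intro ctendsto_add ctendsto_mult ctendsto_const lim) auto
  then have 2: "y = \<one> \<oplus> y \<otimes> w"
    by (rule ctendsto_unique[OF ctendsto_Suc[OF lim]]) simp_all
  have xw: "x = \<one> \<ominus> w" unfolding w_def using x one_closed by algebra
  have "x \<otimes> y = y \<ominus> w \<otimes> y" unfolding xw by (simp add: minus_eq l_distr l_minus)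
  also have "\<dots> = \<one>" by (subst (1) 1) (simp add: minus_eq a_assoc r_neg)
  finally have xy: "x \<otimes> y = \<one>" .
  have "y \<otimes> x = y \<ominus> y \<otimes> w" unfolding xw by (simp add: minus_eq r_distr r_minus)
  also have "\<dots> = \<one>" by (subst (1) 2) (simp add: minus_eq a_assoc r_neg)
  finally show ?thesis using xy x unfolding Units_def by auto
qed

end

section \<open>Annihilators of self-adjoint elements and linear spans\<close>

text \<open>The annihilator of the negative part of h - t takes the place of the closed corner
  generated by the positive part g: it contains g, h acts on it as g + t, and it is closed without
  passing to a closure.\<close>

definition ann :: "'a cstar \<Rightarrow> 'a set \<Rightarrow> 'a set" where
  "ann A K = {x \<in> carrier A. \<forall>k\<in>K. x \<otimes>\<^bsub>A\<^esub> k = \<zero>\<^bsub>A\<^esub> \<and> k \<otimes>\<^bsub>A\<^esub> x = \<zero>\<^bsub>A\<^esub>}"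

text \<open>Linear spans, built up inductively so that closure properties need no reindexing of sums.\<close>

inductive_set cspan :: "'a cstar \<Rightarrow> 'a set \<Rightarrow> 'a set" for A S where
  cspan_zero: "\<zero>\<^bsub>A\<^esub> \<in> cspan A S"
| cspan_add: "\<lbrakk>x \<in> cspan A S; s \<in> S\<rbrakk> \<Longrightarrow> x \<oplus>\<^bsub>A\<^esub> cscale A c s \<in> cspan A S"

definition fin_dim :: "'a cstar \<Rightarrow> 'a set \<Rightarrow> bool" where
  "fin_dim A V \<longleftrightarrow> (\<exists>S\<subseteq>carrier A. finite S \<and> V \<subseteq> cspan A S)"

context cstar_algebra
begin

lemma closed_subset_limit: "\<lbrakk>cclosed A S; \<And>n. x n \<in> S; a \<in> carrier A; ctendsto A x a\<rbrakk> \<Longrightarrow> a \<in> S"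
  unfolding cclosed_def by blast

lemma mult_zero_limit:
  assumes "ctendsto A x a" "\<And>n. x n \<in> carrier A" "a \<in> carrier A" "k \<in> carrier A" "m \<in> carrier A"
    "\<And>n. k \<otimes> x n \<otimes> m = \<zero>"
  shows "k \<otimes> a \<otimes> m = \<zero>"
proof -
  have "ctendsto A (\<lambda>n. k \<otimes> x n \<otimes> m) (k \<otimes> a \<otimes> m)"
    using assms by (intro ctendsto_mult ctendsto_const) auto
  moreover have "ctendsto A (\<lambda>n. k \<otimes> x n \<otimes> m) \<zero>" using assms(6) ctendsto_const[of \<zero>] by simp
  ultimately show ?thesis by (rule ctendsto_unique) (use assms in auto)
qed

lemma annD: "x \<in> ann A K \<Longrightarrow> x \<in> carrier A" "\<lbrakk>x \<in> ann A K; k \<in> K\<rbrakk> \<Longrightarrow> x \<otimes> k = \<zero>"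
  "\<lbrakk>x \<in> ann A K; k \<in> K\<rbrakk> \<Longrightarrow> k \<otimes> x = \<zero>"
  by (auto simp: ann_def)

text \<open>For the order condition: if c - b is positive and k annihilates c, then k b k and its
  negative are positive, so k b k = 0 and hence b k = 0.\<close>

lemma ann_hereditary:
  assumes K: "K \<subseteq> csa A"
  shows "hereditary_subalgebra (ann A K) A"
  unfolding hereditary_subalgebra_def cstar_subalgebra_def
proof (intro conjI ballI impI allI)
  have kc: "k \<in> carrier A" if "k \<in> K" for k using K that by auto
  show "ann A K \<subseteq> carrier A" by (auto simp: ann_def)
  show "\<zero> \<in> ann A K" using kc by (simp add: ann_def)
  fix x assume x: "x \<in> ann A K"
  note [simp] = annD(1)[OF x]
  {
    fix y assume y: "y \<in> ann A K"
    note [simp] = annD(1)[OF y]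
    show "x \<oplus> y \<in> ann A K" using annD(2,3)[OF x] annD(2,3)[OF y] kc by (simp add: ann_def l_distr r_distr)
    show "x \<otimes> y \<in> ann A K" using annD(2,3)[OF x] annD(2,3)[OF y] kc
      by (simp add: ann_def) (simp add: m_assoc flip: m_assoc[of _ x y])
  }
  show "cadj A x \<in> ann A K"
  proof -
    have "cadj A x \<otimes> k = \<zero>" "k \<otimes> cadj A x = \<zero>" if "k \<in> K" for k
    proof -
      have "cadj A k = k" "k \<in> carrier A" using K that by (auto simp: csa_adj)
      then have "cadj A x \<otimes> k = cadj A (k \<otimes> x)" "k \<otimes> cadj A x = cadj A (x \<otimes> k)"
        by (simp_all add: adj_mult)
      then show "cadj A x \<otimes> k = \<zero>" "k \<otimes> cadj A x = \<zero>" using annD(2,3)[OF x that] by simp_all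
    qed
    then show ?thesis by (simp add: ann_def)
  qed
  show "cscale A c x \<in> ann A K" for c
    using annD(2,3)[OF x] kc by (simp add: ann_def flip: scale_mult_left scale_mult_right)
next
  show "cclosed A (ann A K)" unfolding cclosed_def
  proof (intro allI impI)
    fix x a assume *: "(\<forall>n. x n \<in> ann A K) \<and> a \<in> carrier A \<and> ctendsto A x a"
    have "k \<otimes> a = \<zero>" "a \<otimes> k = \<zero>" if k: "k \<in> K" for k
    proof -
      have kc [simp]: "k \<in> carrier A" using K k by auto
      have "\<And>n. x n \<in> carrier A" using * annD(1) by blast
      moreover have "\<And>n. k \<otimes> x n = \<zero>" "\<And>n. x n \<otimes> k = \<zero>" using * annD(2,3) k by blast+
      ultimately show "k \<otimes> a = \<zero>" "a \<otimes> k = \<zero>"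
        using mult_zero_limit[of x a k \<one>] mult_zero_limit[of x a \<one> k] * by simp_all
    qed
    then show "a \<in> ann A K" using * by (simp add: ann_def)
  qed
next
  fix b c assume b: "b \<in> cpos A" and c: "c \<in> ann A K" and cb: "c \<ominus> b \<in> cpos A"
  note [simp] = annD(1)[OF c]
  have bp: "b \<in> npos A" "c \<ominus> b \<in> npos A" using b cb cpos_eq_npos by auto
  have bc [simp]: "b \<in> carrier A" using bp by simp
  have "b \<otimes> k = \<zero> \<and> k \<otimes> b = \<zero>" if k: "k \<in> K" for k
  proof -
    have ks: "k \<in> csa A" and kc [simp]: "k \<in> carrier A" using K k by auto
    have "k \<otimes> (c \<ominus> b) \<otimes> k = \<ominus> (k \<otimes> b \<otimes> k)"
      using annD(2,3)[OF c k] by (simp add: minus_eq r_distr l_distr r_minus l_minus)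
    then have "k \<otimes> b \<otimes> k = \<zero>"
      using npos_conj_csa[OF bp(2) ks] npos_conj_csa[OF bp(1) ks] npos_antisym[of "k \<otimes> b \<otimes> k"] by simp
    then have bk: "b \<otimes> k = \<zero>" using npos_conj_zero[OF bp(1) kc] ks by (simp add: csa_adj)
    have "k \<otimes> b = cadj A (b \<otimes> k)" using ks bp(1) by (simp add: adj_mult csa_adj npos_csa)
    then show ?thesis using bk by simp
  qed
  then show "b \<in> ann A K" by (simp add: ann_def)
qed

lemma hereditaryD:
  assumes "hereditary_subalgebra C A"
  shows "C \<subseteq> carrier A" "\<zero> \<in> C" "\<lbrakk>x \<in> C; y \<in> C\<rbrakk> \<Longrightarrow> x \<oplus> y \<in> C" "\<lbrakk>x \<in> C; y \<in> C\<rbrakk> \<Longrightarrow> x \<otimes> y \<in> C"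
    "x \<in> C \<Longrightarrow> cadj A x \<in> C" "x \<in> C \<Longrightarrow> cscale A c x \<in> C"
  using assms unfolding hereditary_subalgebra_def cstar_subalgebra_def by blast+

lemmas ann_ops = hereditaryD[OF ann_hereditary]

lemma ann_sandwich: "\<lbrakk>K \<subseteq> csa A; x \<in> ann A K; y \<in> ann A K; z \<in> carrier A\<rbrakk> \<Longrightarrow> x \<otimes> z \<otimes> y \<in> ann A K"
  unfolding ann_def
  by (auto simp: subset_iff m_assoc) (simp flip: m_assoc)

lemma ann_diff: "\<lbrakk>K \<subseteq> csa A; x \<in> ann A K; y \<in> ann A K\<rbrakk> \<Longrightarrow> x \<ominus> y \<in> ann A K"
  using ann_ops(3)[of K x "\<ominus> y"] ann_ops(6)[of K y "-1"] annD(1)[of y K] by (simp add: minus_eq scale_minus1)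

section \<open>Simple algebras\<close>

text \<open>\<open>csimple\<close> concerns closed ideals. The closure of I is all of A, so some
  element of I is within distance less than 1 of the unit and is invertible. Ideals given by an
  algebraic condition can then be used as they are.\<close>

lemma simple_dense_ideal:
  assumes s: "csimple A" and I: "ideal I A" and d: "d \<in> I" "d \<noteq> \<zero>"
  shows "\<one> \<in> I"
proof -
  interpret I: ideal I A by fact
  define J where "J = {a \<in> carrier A. \<forall>\<epsilon>>0. \<exists>x\<in>I. cnorm A (a \<ominus> x) < \<epsilon>}"
  have Ic: "x \<in> carrier A" if "x \<in> I" for x using that by (rule I.a_Hcarr)
  have IJ: "I \<subseteq> J" unfolding J_def using Ic by (auto simp: minus_eq r_neg intro!: bexI)
  have J_add: "a \<oplus> b \<in> J" if a: "a \<in> J" and b: "b \<in> J" for a b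
    unfolding J_def
  proof (intro CollectI conjI allI impI)
    fix \<epsilon> :: real assume "\<epsilon> > 0"
    then have "\<epsilon> / 2 > 0" by simp
    then obtain x y where xy: "x \<in> I" "y \<in> I" "cnorm A (a \<ominus> x) < \<epsilon>/2" "cnorm A (b \<ominus> y) < \<epsilon>/2"
      using a b unfolding J_def by blast
    moreover have "cnorm A ((a \<oplus> b) \<ominus> (x \<oplus> y)) \<le> cnorm A (a \<ominus> x) + cnorm A (b \<ominus> y)"
      using xy Ic a b by (intro norm_add_diff) (auto simp: J_def)
    ultimately show "\<exists>z\<in>I. cnorm A ((a \<oplus> b) \<ominus> z) < \<epsilon>"
      by (intro bexI[of _ "x \<oplus> y"]) auto
  qed (use a b in \<open>auto simp: J_def\<close>)
  have J_mult: "y \<otimes> a \<in> J \<and> a \<otimes> y \<in> J" if a: "a \<in> J" and y: "y \<in> carrier A" for a y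
  proof -
    have ac: "a \<in> carrier A" using a by (simp add: J_def)
    have "\<exists>z\<in>I. cnorm A (y \<otimes> a \<ominus> z) < \<epsilon> \<and> (\<exists>w\<in>I. cnorm A (a \<otimes> y \<ominus> w) < \<epsilon>)" if "\<epsilon> > 0" for \<epsilon> :: real
    proof -
      have yn: "cnorm A y + 1 > 0" using norm_nonneg[OF y] by simp
      then have "\<epsilon> / (cnorm A y + 1) > 0" using that by simp
      then obtain x where x: "x \<in> I" "cnorm A (a \<ominus> x) < \<epsilon> / (cnorm A y + 1)"
        using a unfolding J_def by blast
      have xc: "x \<in> carrier A" using Ic x by blast
      have e: "cnorm A y * cnorm A (a \<ominus> x) < \<epsilon>"
      proof -
        have "cnorm A y * cnorm A (a \<ominus> x) \<le> (cnorm A y + 1) * cnorm A (a \<ominus> x)"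
          using ac xc by (intro mult_right_mono) auto
        also have "\<dots> < \<epsilon>" using x(2) yn by (simp add: field_simps)
        finally show ?thesis .
      qed
      have "y \<otimes> a \<ominus> y \<otimes> x = y \<otimes> (a \<ominus> x)" "a \<otimes> y \<ominus> x \<otimes> y = (a \<ominus> x) \<otimes> y"
        using y ac xc by algebra+
      then have "cnorm A (y \<otimes> a \<ominus> y \<otimes> x) < \<epsilon>" "cnorm A (a \<otimes> y \<ominus> x \<otimes> y) < \<epsilon>"
        using e norm_mult[of y "a \<ominus> x"] norm_mult[of "a \<ominus> x" y] y ac xc by (simp_all add: mult.commute)
      then show ?thesis using x y I.I_l_closed I.I_r_closed by blast
    qed
    then show ?thesis using ac y unfolding J_def by blast
  qed
  have idJ: "ideal J A"
  proof (rule idealI)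
    show "ring A" ..
    show "subgroup J (add_monoid A)"
    proof
      show "J \<subseteq> carrier (add_monoid A)" by (auto simp: J_def)
      show "x \<otimes>\<^bsub>add_monoid A\<^esub> y \<in> J" if "x \<in> J" "y \<in> J" for x y using J_add that by simp
      show "\<one>\<^bsub>add_monoid A\<^esub> \<in> J" using IJ I.zero_closed by auto
      show "inv\<^bsub>add_monoid A\<^esub> x \<in> J" if "x \<in> J" for x
      proof -
        have "x \<in> carrier A" using that by (simp add: J_def)
        then have "\<ominus> x \<in> J" using J_mult[OF that, of "\<ominus> \<one>"] by (simp add: l_minus)
        then show ?thesis by (simp add: a_inv_def)
      qed
    qed
  qed (use J_mult in auto)
  moreover have "cclosed A J" unfolding cclosed_def
  proof (intro allI impI)
    fix x a assume *: "(\<forall>n. x n \<in> J) \<and> a \<in> carrier A \<and> ctendsto A x a"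
    have "\<exists>y\<in>I. cnorm A (a \<ominus> y) < \<epsilon>" if "\<epsilon> > 0" for \<epsilon>
    proof -
      have "eventually (\<lambda>n. cnorm A (x n \<ominus> a) < \<epsilon>/2) sequentially"
        using * that order_tendstoD(2)[of "\<lambda>n. cnorm A (x n \<ominus> a)" 0 sequentially "\<epsilon>/2"]
        by (simp add: ctendsto_def)
      then obtain n where n: "cnorm A (x n \<ominus> a) < \<epsilon>/2" by (auto simp: eventually_sequentially)
      have xn: "x n \<in> J" using * by blast
      then obtain y where y: "y \<in> I" "cnorm A (x n \<ominus> y) < \<epsilon>/2"
        using half_gt_zero[OF \<open>\<epsilon> > 0\<close>] unfolding J_def by blast
      have "cnorm A (a \<ominus> y) \<le> cnorm A (a \<ominus> x n) + cnorm A (x n \<ominus> y)"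
        using * y Ic xn by (intro norm_diff_triangle) (auto simp: J_def)
      then show ?thesis using n y norm_minus_commute[of a "x n"] * xn by (intro bexI[of _ y]) (auto simp: J_def)
    qed
    then show "a \<in> J" using * by (simp add: J_def)
  qed
  ultimately have "J = carrier A" using s IJ d unfolding csimple_def by blast
  then have "\<one> \<in> J" by simp
  then obtain x where x: "x \<in> I" "cnorm A (\<one> \<ominus> x) < 1" using zero_less_one unfolding J_def by blast
  have "x \<in> Units A" using invertible_near_one x Ic by blast
  then show ?thesis using I.I_r_closed[OF x(1), of "inv x"] by simp
qed

lemma idealI':
  assumes "I \<subseteq> carrier A" "\<zero> \<in> I" "\<And>x y. \<lbrakk>x \<in> I; y \<in> I\<rbrakk> \<Longrightarrow> x \<oplus> y \<in> I"
    "\<And>x y. \<lbrakk>x \<in> I; y \<in> carrier A\<rbrakk> \<Longrightarrow> y \<otimes> x \<in> I" "\<And>x y. \<lbrakk>x \<in> I; y \<in> carrier A\<rbrakk> \<Longrightarrow> x \<otimes> y \<in> I"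
  shows "ideal I A"
proof (rule idealI)
  show "ring A" ..
  show "subgroup I (add_monoid A)"
  proof
    show "inv\<^bsub>add_monoid A\<^esub> x \<in> I" if "x \<in> I" for x
    proof -
      have "x \<in> carrier A" using that assms(1) by blast
      then have "\<ominus> x \<in> I" using assms(4)[OF that, of "\<ominus> \<one>"] by (simp add: l_minus)
      then show ?thesis by (simp add: a_inv_def)
    qed
  qed (use assms in auto)
qed (use assms in auto)

text \<open>The y with v x y = 0 for all x form an ideal; it contains d, therefore 1, and x = y = 1
  gives v = 0.\<close>

lemma simple_prime:
  assumes s: "csimple A" and d: "d \<in> carrier A" "d \<noteq> \<zero>" and v: "v \<in> carrier A"
    and z: "\<And>x. x \<in> carrier A \<Longrightarrow> v \<otimes> x \<otimes> d = \<zero>"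
  shows "v = \<zero>"
proof -
  have "ideal {y \<in> carrier A. \<forall>x\<in>carrier A. v \<otimes> x \<otimes> y = \<zero>} A"
  proof (rule idealI', goal_cases)
    case (4 y w)
    then show ?case using v by (auto simp: m_assoc) (metis m_assoc m_closed)
  next
    case (5 y w)
    then show ?case using v by (auto simp flip: m_assoc)
  qed (use v in \<open>auto simp: r_distr\<close>)
  from simple_dense_ideal[OF s this, of d] have "v \<otimes> \<one> \<otimes> \<one> = \<zero>" using d z by blast
  then show ?thesis using v by simp
qed

text \<open>For t below the norm of c the parts p and q of c - t commute with A and q p = 0, so q x
  p = 0 for all x and one of them vanishes. It cannot be p, since then c would be bounded by t. So c
  dominates every such t and is itself dominated by its norm.\<close>

lemma central_npos_scalar:
  assumes s: "csimple A" and c: "c \<in> npos A" and central: "\<And>x. x \<in> carrier A \<Longrightarrow> c \<otimes> x = x \<otimes> c"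
  shows "c = creal A (cnorm A c)"
proof -
  have cc [simp]: "c \<in> carrier A" using c by simp
  have alt: "c \<ominus> creal A t \<in> npos A" if t: "0 \<le> t" "t < cnorm A c" for t
  proof -
    have hs: "c \<ominus> creal A t \<in> csa A" using c by (intro csa_diff csa_real npos_csa)
    obtain p q where pq: "p \<in> npos A" "q \<in> npos A" "c \<ominus> creal A t = p \<ominus> q" "p \<otimes> q = \<zero>" "q \<otimes> p = \<zero>"
       "\<forall>y\<in>carrier A. y \<otimes> (c \<ominus> creal A t) = (c \<ominus> creal A t) \<otimes> y \<longrightarrow> y \<otimes> p = p \<otimes> y \<and> y \<otimes> q = q \<otimes> y"
      using jordan_decomposition[OF hs] by (elim bexE conjE)
    have pqc [simp]: "p \<in> carrier A" "q \<in> carrier A" using pq(1,2) by auto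
    have "y \<otimes> p = p \<otimes> y" if y: "y \<in> carrier A" for y
    proof -
      have "y \<otimes> (c \<ominus> creal A t) = (c \<ominus> creal A t) \<otimes> y"
        using y central[OF y] by (simp add: minus_eq r_distr l_distr r_minus l_minus scale_one_mult)
      then show ?thesis using pq(6) y by blast
    qed
    then have "q \<otimes> x \<otimes> p = \<zero>" if "x \<in> carrier A" for x
      using that pq(5) by (simp add: m_assoc) (simp flip: m_assoc)
    then have "p = \<zero> \<or> q = \<zero>" using simple_prime[OF s, of p q] by auto
    then show ?thesis
    proof
      assume "p = \<zero>"
      then have "c \<ominus> creal A t = \<ominus> q" using pq(3) by (simp add: minus_eq)
      moreover have "creal A t \<ominus> c = \<ominus> (c \<ominus> creal A t)" by (simp add: minus_eq minus_add a_comm)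
      ultimately have "creal A t \<ominus> c \<in> npos A" using pq(2) by simp
      then have "cnorm A c \<le> t" using npos_le_real[OF c] t by blast
      then show ?thesis using t by simp
    qed (use pq(1,3) in \<open>simp add: minus_eq\<close>)
  qed
  have "c \<ominus> creal A (cnorm A c) \<in> npos A"
  proof (rule npos_eps)
    fix \<epsilon> :: real assume \<epsilon>: "0 < \<epsilon>"
    have mx: "(c \<ominus> creal A (cnorm A c)) \<oplus> creal A \<epsilon> = c \<ominus> creal A (cnorm A c - \<epsilon>)"
      by (simp add: scale_diff_left minus_eq a_assoc minus_add)
    show "(c \<ominus> creal A (cnorm A c)) \<oplus> creal A \<epsilon> \<in> npos A"
    proof (cases "\<epsilon> \<le> cnorm A c")
      case True
      then show ?thesis unfolding mx using alt[of "cnorm A c - \<epsilon>"] \<epsilon> by simp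
    next
      case False
      have "c \<ominus> creal A (cnorm A c - \<epsilon>) = c \<oplus> creal A (\<epsilon> - cnorm A c)"
        by (simp add: scale_diff_left minus_eq minus_add a_comm)
      also have "\<dots> \<in> npos A" using c False by (intro npos_add npos_real) auto
      finally show ?thesis unfolding mx .
    qed
  qed simp
  moreover have "\<ominus> (c \<ominus> creal A (cnorm A c)) = creal A (cnorm A c) \<ominus> c"
    by (simp add: minus_eq minus_add a_comm)
  ultimately have "c \<ominus> creal A (cnorm A c) = \<zero>"
    using npos_antisym real_minus_npos[OF npos_csa[OF c] order_refl] by metis
  then show ?thesis by (simp add: diff_eq_zero)
qed

subsection \<open>Finite-dimensional spans\<close>

lemma cspan_closed: assumes "S \<subseteq> carrier A" "x \<in> cspan A S" shows "x \<in> carrier A"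
  using assms(2) by induction (use assms(1) in auto)

lemma cspan_mono: assumes "S \<subseteq> T" "x \<in> cspan A S" shows "x \<in> cspan A T"
  using assms(2) by induction (use assms(1) in \<open>auto intro: cspan.intros\<close>)

lemma cspan_plus:
  assumes "S \<subseteq> carrier A" "x \<in> cspan A S" "y \<in> cspan A S" shows "x \<oplus> y \<in> cspan A S"
  using assms(3)
proof (induction rule: cspan.induct)
  case cspan_zero
  then show ?case using assms cspan_closed by simp
next
  case (cspan_add z s c)
  have "x \<oplus> (z \<oplus> cscale A c s) = (x \<oplus> z) \<oplus> cscale A c s"
    using assms cspan_closed[OF assms(1)] cspan_add by (intro a_assoc[symmetric]) auto
  then show ?case using cspan_add by (simp add: cspan.cspan_add)
qed

lemma cspan_mult:
  assumes S: "S \<subseteq> carrier A" and z: "z \<in> carrier A" and x: "x \<in> cspan A S"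
  shows "z \<otimes> x \<in> cspan A ((\<lambda>s. z \<otimes> s) ` S)" "x \<otimes> z \<in> cspan A ((\<lambda>s. s \<otimes> z) ` S)"
  using x
proof (induction rule: cspan.induct)
  case cspan_zero
  show "z \<otimes> \<zero> \<in> cspan A ((\<lambda>s. z \<otimes> s) ` S)" "\<zero> \<otimes> z \<in> cspan A ((\<lambda>s. s \<otimes> z) ` S)"
    using z by (auto intro: cspan.cspan_zero)
next
  case (cspan_add x s c)
  have "x \<in> carrier A" "s \<in> carrier A" using cspan_add S cspan_closed by auto
  then show "z \<otimes> (x \<oplus> cscale A c s) \<in> cspan A ((\<lambda>s. z \<otimes> s) ` S)"
      "(x \<oplus> cscale A c s) \<otimes> z \<in> cspan A ((\<lambda>s. s \<otimes> z) ` S)"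
    using cspan_add z
    by (auto simp: l_distr r_distr scale_mult_left[symmetric] scale_mult_right[symmetric] intro: cspan.cspan_add)
qed

lemma cspan_finsum:
  assumes S: "S \<subseteq> carrier A" "finite S" and x: "x \<in> cspan A S"
  shows "\<exists>c. x = (\<Oplus>s\<in>S. cscale A (c s) s)"
  using x
proof (induction rule: cspan.induct)
  case cspan_zero
  have "(\<Oplus>s\<in>S. cscale A 0 s) = (\<Oplus>s\<in>S. \<zero>)" using S by (intro finsum_cong') (auto simp: subset_iff)
  then show ?case by (intro exI[of _ "\<lambda>_. 0"]) simp
next
  case (cspan_add x t d)
  then obtain c where c: "x = (\<Oplus>s\<in>S. cscale A (c s) s)" by blast
  have T: "S = insert t (S - {t})" "finite (S - {t})" "t \<notin> S - {t}" using cspan_add S by auto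
  have cl: "(\<lambda>s. cscale A (c s) s) \<in> S - {t} \<rightarrow> carrier A" "t \<in> carrier A" using S cspan_add by auto
  let ?c = "c(t := c t + d)"
  have "(\<Oplus>s\<in>S. cscale A (?c s) s) = cscale A (c t + d) t \<oplus> (\<Oplus>s\<in>S - {t}. cscale A (?c s) s)"
    by (subst T(1), subst finsum_insert) (use T cl S in auto)
  also have "(\<Oplus>s\<in>S - {t}. cscale A (?c s) s) = (\<Oplus>s\<in>S - {t}. cscale A (c s) s)"
    using cl by (intro finsum_cong') auto
  also have "cscale A (c t + d) t \<oplus> (\<Oplus>s\<in>S - {t}. cscale A (c s) s) =
      (cscale A (c t) t \<oplus> (\<Oplus>s\<in>S - {t}. cscale A (c s) s)) \<oplus> cscale A d t"
    using cl by (simp add: scale_add_left a_ac)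
  also have "cscale A (c t) t \<oplus> (\<Oplus>s\<in>S - {t}. cscale A (c s) s) = x"
    unfolding c by (subst (2) T(1), subst finsum_insert) (use T cl S in auto)
  finally show ?case by metis
qed

lemma fin_dim_carrier: "fin_dim A (carrier A) \<Longrightarrow> cfinite_dimensional A"
  unfolding fin_dim_def cfinite_dimensional_def using cspan_finsum by (meson subsetD)

lemma fin_dim_add:
  assumes "fin_dim A V" "fin_dim A W" "U \<subseteq> {v \<oplus> w | v w. v \<in> V \<and> w \<in> W}"
  shows "fin_dim A U"
proof -
  obtain S T where ST: "S \<subseteq> carrier A" "finite S" "V \<subseteq> cspan A S" "T \<subseteq> carrier A" "finite T" "W \<subseteq> cspan A T"
    using assms(1,2) unfolding fin_dim_def by blast
  have "U \<subseteq> cspan A (S \<union> T)"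
  proof
    fix u assume "u \<in> U"
    then obtain v w where "u = v \<oplus> w" "v \<in> V" "w \<in> W" using assms(3) by blast
    moreover from this have "v \<in> cspan A (S \<union> T)" "w \<in> cspan A (S \<union> T)"
      using ST cspan_mono[of S "S \<union> T"] cspan_mono[of T "S \<union> T"] by auto
    ultimately show "u \<in> cspan A (S \<union> T)" using cspan_plus ST by simp
  qed
  then show ?thesis unfolding fin_dim_def using ST by (intro exI[of _ "S \<union> T"]) auto
qed

lemma fin_dim_mult:
  assumes "fin_dim A V" "z \<in> carrier A"
  shows "U \<subseteq> (\<lambda>v. z \<otimes> v) ` V \<Longrightarrow> fin_dim A U" "U \<subseteq> (\<lambda>v. v \<otimes> z) ` V \<Longrightarrow> fin_dim A U"
proof -
  obtain S where S: "S \<subseteq> carrier A" "finite S" "V \<subseteq> cspan A S"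
    using assms(1) unfolding fin_dim_def by blast
  have c: "(\<lambda>s. z \<otimes> s) ` S \<subseteq> carrier A" "(\<lambda>s. s \<otimes> z) ` S \<subseteq> carrier A" using S assms by auto
  {
    assume "U \<subseteq> (\<lambda>v. z \<otimes> v) ` V"
    then have "U \<subseteq> cspan A ((\<lambda>s. z \<otimes> s) ` S)" using S cspan_mult(1)[OF S(1) assms(2)] by auto
    then show "fin_dim A U" unfolding fin_dim_def using S c by (intro exI[of _ "(\<lambda>s. z \<otimes> s) ` S"]) auto
  next
    assume "U \<subseteq> (\<lambda>v. v \<otimes> z) ` V"
    then have "U \<subseteq> cspan A ((\<lambda>s. s \<otimes> z) ` S)" using S cspan_mult(2)[OF S(1) assms(2)] by auto
    then show "fin_dim A U" unfolding fin_dim_def using S c by (intro exI[of _ "(\<lambda>s. s \<otimes> z) ` S"]) auto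
  }
qed

lemma fin_dim_subset: "fin_dim A V \<Longrightarrow> U \<subseteq> V \<Longrightarrow> fin_dim A U"
  unfolding fin_dim_def by blast

text \<open>One factor d is removed at a time. The w for which w A d is finite-dimensional form an
  ideal containing d, hence 1, so A d is finite-dimensional; then the v for which A v is
  finite-dimensional form an ideal containing d, hence 1.\<close>

lemma simple_fin_dim:
  assumes s: "csimple A" and d: "d \<in> carrier A" "d \<noteq> \<zero>"
    and f: "fin_dim A ((\<lambda>x. d \<otimes> x \<otimes> d) ` carrier A)"
  shows "cfinite_dimensional A"
proof -
  define W where "W = {w \<in> carrier A. fin_dim A ((\<lambda>x. w \<otimes> x \<otimes> d) ` carrier A)}"
  have zero: "fin_dim A ((\<lambda>x. \<zero>) ` X)" for X :: "'a set"
    unfolding fin_dim_def by (auto intro!: exI[of _ "{}"] cspan.cspan_zero)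
  have "ideal W A"
  proof (rule idealI')
    show "\<zero> \<in> W" using zero[of "carrier A"] d by (simp add: W_def cong: image_cong)
    show "v \<oplus> w \<in> W" if "v \<in> W" "w \<in> W" for v w
      using that d unfolding W_def
      by (auto intro!: fin_dim_add[of "(\<lambda>x. v \<otimes> x \<otimes> d) ` carrier A" "(\<lambda>x. w \<otimes> x \<otimes> d) ` carrier A"] simp: l_distr)
    show "y \<otimes> w \<in> W" if "w \<in> W" "y \<in> carrier A" for w y
      using that d unfolding W_def
      by (auto intro!: fin_dim_mult(1)[of "(\<lambda>x. w \<otimes> x \<otimes> d) ` carrier A" y] simp: m_assoc)
    show "w \<otimes> y \<in> W" if "w \<in> W" "y \<in> carrier A" for w y
    proof -
      have "w \<otimes> y \<otimes> x \<otimes> d = w \<otimes> (y \<otimes> x) \<otimes> d" if "x \<in> carrier A" for x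
        using \<open>w \<in> W\<close> \<open>y \<in> carrier A\<close> that d by (simp add: W_def m_assoc)
      then have "(\<lambda>x. w \<otimes> y \<otimes> x \<otimes> d) ` carrier A \<subseteq> (\<lambda>x. w \<otimes> x \<otimes> d) ` carrier A"
        using that by auto
      from fin_dim_subset[OF _ this] show ?thesis using that by (simp add: W_def)
    qed
  qed (auto simp: W_def)
  moreover have "d \<in> W" using d f by (simp add: W_def)
  ultimately have "\<one> \<in> W" using simple_dense_ideal[OF s] d by blast
  then have f2: "fin_dim A ((\<lambda>x. x \<otimes> d) ` carrier A)" using d by (simp add: W_def cong: image_cong)
  define V where "V = {v \<in> carrier A. fin_dim A ((\<lambda>x. x \<otimes> v) ` carrier A)}"
  have "ideal V A"
  proof (rule idealI')
    show "\<zero> \<in> V" using zero[of "carrier A"] by (simp add: V_def cong: image_cong)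
    show "v \<oplus> w \<in> V" if "v \<in> V" "w \<in> V" for v w
      using that d unfolding V_def
      by (auto intro!: fin_dim_add[of "(\<lambda>x. x \<otimes> v) ` carrier A" "(\<lambda>x. x \<otimes> w) ` carrier A"] simp: r_distr)
    show "w \<otimes> y \<in> V" if "w \<in> V" "y \<in> carrier A" for w y
      using that d unfolding V_def
      by (auto intro!: fin_dim_mult(2)[of "(\<lambda>x. x \<otimes> w) ` carrier A" y] simp: m_assoc image_image)
    show "y \<otimes> w \<in> V" if "w \<in> V" "y \<in> carrier A" for w y
    proof -
      have "x \<otimes> (y \<otimes> w) = (x \<otimes> y) \<otimes> w" if "x \<in> carrier A" for x
        using \<open>w \<in> V\<close> \<open>y \<in> carrier A\<close> that by (simp add: V_def m_assoc)
      then have "(\<lambda>x. x \<otimes> (y \<otimes> w)) ` carrier A \<subseteq> (\<lambda>x. x \<otimes> w) ` carrier A"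
        using that by auto
      from fin_dim_subset[OF _ this] show ?thesis using that by (simp add: V_def)
    qed
  qed (auto simp: V_def)
  moreover have "d \<in> V" using d f2 by (simp add: V_def)
  ultimately have "\<one> \<in> V" using simple_dense_ideal[OF s] d by blast
  then show ?thesis using fin_dim_carrier by (simp add: V_def cong: image_cong)
qed

lemma scale_eq_zero: "x \<in> carrier A \<Longrightarrow> cscale A c x = \<zero> \<longleftrightarrow> c = 0 \<or> x = \<zero>"
  using norm_eq_zero[of "cscale A c x"] norm_eq_zero[of x] by (auto simp: norm_scale)

lemma npos_normalize:
  assumes "x \<in> npos A" "x \<noteq> \<zero>"
  shows "cscale A (complex_of_real (1 / cnorm A x)) x \<in> npos A"
    "cnorm A (cscale A (complex_of_real (1 / cnorm A x)) x) = 1"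
    "x = cscale A (complex_of_real (cnorm A x)) (cscale A (complex_of_real (1 / cnorm A x)) x)"
proof -
  have "cnorm A x \<noteq> 0" using assms by (simp add: norm_eq_zero)
  moreover have "cnorm A x \<ge> 0" using assms by simp
  ultimately have p: "cnorm A x > 0" by linarith
  show "cscale A (complex_of_real (1 / cnorm A x)) x \<in> npos A"
    using assms p by (intro npos_scale) auto
  show "cnorm A (cscale A (complex_of_real (1 / cnorm A x)) x) = 1"
    using assms p by (simp add: norm_scale norm_divide)
  show "x = cscale A (complex_of_real (cnorm A x)) (cscale A (complex_of_real (1 / cnorm A x)) x)"
    using assms p by (simp add: scale_scale)
qed

text \<open>From p^2 = p x and q^2 = - q x the squares of the parts annihilate K, and a positive
  element annihilates whatever its square annihilates.\<close>

lemma ann_jordan: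
  assumes K: "K \<subseteq> csa A" and x: "x \<in> csa A" "x \<in> ann A K"
  shows "\<exists>p\<in>npos A \<inter> ann A K. \<exists>q\<in>npos A \<inter> ann A K. x = p \<ominus> q"
proof -
  obtain p q where pq: "p \<in> npos A" "q \<in> npos A" "x = p \<ominus> q" "p \<otimes> q = \<zero>" "q \<otimes> p = \<zero>"
      "\<forall>y\<in>carrier A. y \<otimes> x = x \<otimes> y \<longrightarrow> y \<otimes> p = p \<otimes> y \<and> y \<otimes> q = q \<otimes> y"
    using jordan_decomposition[OF x(1)] by (elim bexE conjE)
  note [simp] = npos_closed[OF pq(1)] npos_closed[OF pq(2)]
  have pp: "p \<otimes> p = p \<otimes> x" "q \<otimes> q = \<ominus> (q \<otimes> x)"
    using pq(4,5) unfolding pq(3) by (simp_all add: minus_eq r_distr r_minus)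
  have "p \<otimes> k = \<zero> \<and> k \<otimes> p = \<zero> \<and> q \<otimes> k = \<zero> \<and> k \<otimes> q = \<zero>" if k: "k \<in> K" for k
  proof -
    have kc [simp]: "k \<in> carrier A" using K k by auto
    have xc [simp]: "x \<in> carrier A" using x by simp
    have xk: "x \<otimes> k = \<zero>" "k \<otimes> x = \<zero>" using annD(2,3)[OF x(2) k] by auto
    then have "k \<otimes> p = p \<otimes> k \<and> k \<otimes> q = q \<otimes> k" using pq(6) kc by (metis (no_types))
    moreover have "p \<otimes> k = \<zero>" "q \<otimes> k = \<zero>"
      using sqrt_mult_zero[OF pq(1), of k] sqrt_mult_zero[OF pq(2), of k] xk unfolding pp
      by (simp_all add: m_assoc l_minus)
    ultimately show ?thesis by simp
  qed
  then have "p \<in> ann A K" "q \<in> ann A K" by (auto simp: ann_def)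
  then show ?thesis using pq(1-3) by blast
qed

section \<open>Corners without two orthogonal positive elements\<close>

context
  fixes K assumes K: "K \<subseteq> csa A"
    and no_orth: "\<And>x y. \<lbrakk>x \<in> npos A; x \<in> ann A K; y \<in> npos A; y \<in> ann A K; x \<otimes> y = \<zero>\<rbrakk> \<Longrightarrow> x = \<zero> \<or> y = \<zero>"
begin

text \<open>The positive part p of x - t and the product x q with the negative part are orthogonal
  elements of the corner. Since t is less than the norm of x, p is nonzero, so x q = 0 and x (x - t)
  = x p is positive.\<close>

lemma thin_corner_gap:
  assumes x: "x \<in> npos A" "x \<in> ann A K" "cnorm A x = 1" and t: "0 < t" "t < 1"
  shows "x \<otimes> x \<ominus> cscale A (complex_of_real t) x \<in> npos A"
proof -
  define h where "h = x \<ominus> creal A t"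
  have xc [simp]: "x \<in> carrier A" using x by simp
  have hs: "h \<in> csa A" unfolding h_def using x by (intro csa_diff csa_real npos_csa)
  then have hc [simp]: "h \<in> carrier A" by simp
  obtain p q where pq: "p \<in> npos A" "q \<in> npos A" "h = p \<ominus> q" "p \<otimes> q = \<zero>" "q \<otimes> p = \<zero>"
      "\<forall>y\<in>carrier A. y \<otimes> h = h \<otimes> y \<longrightarrow> y \<otimes> p = p \<otimes> y \<and> y \<otimes> q = q \<otimes> y"
    using jordan_decomposition[OF hs] by (elim bexE conjE)
  have pqc [simp]: "p \<in> carrier A" "q \<in> carrier A" using pq(1,2) by auto
  have "x \<otimes> h = h \<otimes> x"
    by (simp add: h_def minus_eq l_distr r_distr l_minus r_minus scale_one_mult)
  then have xp: "x \<otimes> p = p \<otimes> x" "x \<otimes> q = q \<otimes> x" using pq(6) xc by (metis (no_types))+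
  have ph: "p \<otimes> p = p \<otimes> h" using pq(4) unfolding pq(3) by (simp add: minus_eq r_distr r_minus)
  \<comment> \<open>On k the element h acts as -t, so k p^2 k = - t k p k; the two sides have
    opposite signs and are zero.\<close>
  have pK: "p \<otimes> k = \<zero> \<and> k \<otimes> p = \<zero>" if k: "k \<in> K" for k
  proof -
    have ks: "k \<in> csa A" and kc [simp]: "k \<in> carrier A" using K k by auto
    have xk: "x \<otimes> k = \<zero>" "k \<otimes> x = \<zero>" using annD(2,3)[OF x(2) k] by auto
    have hk: "h \<otimes> k = \<ominus> cscale A (complex_of_real t) k" "k \<otimes> h = \<ominus> cscale A (complex_of_real t) k"
      using xk by (simp_all add: h_def minus_eq l_distr r_distr l_minus r_minus scale_one_mult)
    then have kp: "k \<otimes> p = p \<otimes> k" using pq(6) kc by (metis (no_types))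
    let ?tp = "cscale A (complex_of_real t) p"
    have tp: "?tp \<in> npos A" using pq(1) t by (intro npos_scale) auto
    have "p \<otimes> p \<otimes> k = \<ominus> (?tp \<otimes> k)"
      unfolding ph by (simp add: m_assoc hk r_minus flip: scale_mult_left scale_mult_right)
    then have "k \<otimes> (p \<otimes> p) \<otimes> k = \<ominus> (k \<otimes> ?tp \<otimes> k)" by (simp add: m_assoc r_minus del: scale_mult_left)
    then have "k \<otimes> ?tp \<otimes> k = \<zero>"
      using npos_conj_csa[OF square_npos[OF npos_csa[OF pq(1)]] ks] npos_conj_csa[OF tp ks]
        npos_antisym[of "k \<otimes> ?tp \<otimes> k"] by simp
    then have "?tp \<otimes> k = \<zero>" using npos_conj_zero[OF tp kc] ks by (simp add: csa_adj)
    then have "p \<otimes> k = \<zero>" using t by (simp add: scale_eq_zero flip: scale_mult_left)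
    then show ?thesis using kp by simp
  qed
  then have pA: "p \<in> ann A K" by (simp add: ann_def)
  \<comment> \<open>The negative part q itself lies outside the corner, because it acts as t on k;
    the factor x brings it back.\<close>
  have xq: "x \<otimes> q \<in> npos A" using x(1) pq(2) xp(2) by (rule npos_mult)
  have xqA: "x \<otimes> q \<in> ann A K"
  proof -
    have "x \<otimes> q \<otimes> k = \<zero> \<and> k \<otimes> (x \<otimes> q) = \<zero>" if k: "k \<in> K" for k
    proof -
      have kc: "k \<in> carrier A" using K k by auto
      have "x \<otimes> q \<otimes> k = q \<otimes> (x \<otimes> k)" "k \<otimes> (x \<otimes> q) = (k \<otimes> x) \<otimes> q"
        unfolding xp(2) using kc xp(2) by (simp_all add: m_assoc)
      then show ?thesis using annD(2,3)[OF x(2) k] by simp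
    qed
    then show ?thesis by (simp add: ann_def)
  qed
  have "p \<otimes> (x \<otimes> q) = (x \<otimes> p) \<otimes> q" unfolding xp(1) by (simp add: m_assoc)
  also have "\<dots> = \<zero>" using pq(4) by (simp add: m_assoc)
  finally have "p = \<zero> \<or> x \<otimes> q = \<zero>" using no_orth[OF pq(1) pA xq xqA] by blast
  then show ?thesis
  proof
    assume "p = \<zero>"
    then have "h = \<ominus> q" using pq(3) by (simp add: minus_eq)
    moreover have "creal A t \<ominus> x = \<ominus> h" by (simp add: h_def minus_eq minus_add a_comm)
    ultimately have "creal A t \<ominus> x \<in> npos A" using pq(2) by simp
    then have "cnorm A x \<le> t" using npos_le_real[OF x(1)] t by simp
    then show ?thesis using x t by simp
  next
    assume xq0: "x \<otimes> q = \<zero>"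
    have "x \<otimes> x \<ominus> cscale A (complex_of_real t) x = x \<otimes> h"
      by (simp add: h_def minus_eq r_distr r_minus scale_one_mult)
    also have "\<dots> = x \<otimes> p" using xq0 unfolding pq(3) by (simp add: minus_eq r_distr r_minus)
    also have "\<dots> \<in> npos A" using x(1) pq(1) xp(1) by (rule npos_mult)
    finally show ?thesis .
  qed
qed

text \<open>Letting t tend to 1 in \<open>thin_corner_gap\<close> shows that x^2 - x is positive; x
  - x^2 = x (1 - x) is positive because x has norm 1.\<close>

lemma thin_corner_projection:
  assumes x: "x \<in> npos A" "x \<in> ann A K" "cnorm A x = 1"
  shows "x \<otimes> x = x"
proof -
  have xc [simp]: "x \<in> carrier A" using x by simp
  have u: "\<one> \<ominus> x \<in> npos A" using real_minus_npos[of x 1] x by (simp add: npos_csa)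
  have 1: "x \<otimes> x \<ominus> x \<in> npos A"
  proof (rule npos_eps)
    fix \<epsilon> :: real assume \<epsilon>: "0 < \<epsilon>" "\<epsilon> < 1"
    have "(x \<otimes> x \<ominus> x) \<oplus> creal A \<epsilon>
        = (x \<otimes> x \<ominus> cscale A (complex_of_real (1 - \<epsilon>)) x) \<oplus> cscale A (complex_of_real \<epsilon>) (\<one> \<ominus> x)"
    proof -
      have "(X \<ominus> y) \<oplus> c = (X \<ominus> (y \<ominus> e)) \<oplus> (c \<ominus> e)"
        if "X \<in> carrier A" "y \<in> carrier A" "e \<in> carrier A" "c \<in> carrier A" for X y e c
        using that by algebra
      from this[of "x \<otimes> x" x "cscale A (complex_of_real \<epsilon>) x" "creal A \<epsilon>"]
      show ?thesis by (simp add: scale_diff_left scale_diff_right)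
    qed
    also have "\<dots> \<in> npos A"
      using thin_corner_gap[OF x, of "1 - \<epsilon>"] u \<epsilon> by (intro npos_add npos_scale) auto
    finally show "(x \<otimes> x \<ominus> x) \<oplus> creal A \<epsilon> \<in> npos A" .
  qed simp
  have "x \<otimes> (\<one> \<ominus> x) \<in> npos A"
    using x(1) u by (rule npos_mult) (simp add: minus_eq l_distr r_distr l_minus r_minus)
  also have "x \<otimes> (\<one> \<ominus> x) = \<ominus> (x \<otimes> x \<ominus> x)" by (simp add: minus_eq minus_add r_distr r_minus a_comm)
  finally have "x \<otimes> x \<ominus> x = \<zero>" using npos_antisym[OF 1] by blast
  then show ?thesis by (simp add: diff_eq_zero)
qed

text \<open>The normalised sum r of p and q is again a projection. As 1 - r annihilates p + q, it
  annihilates each positive summand x, so r - x is a projection of the corner orthogonal to x and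
  must be zero. Hence both summands equal r.\<close>

lemma thin_corner_unique:
  assumes p: "p \<in> npos A" "p \<in> ann A K" "cnorm A p = 1" and q: "q \<in> npos A" "q \<in> ann A K" "cnorm A q = 1"
  shows "p = q"
proof -
  define s where "s = cnorm A (p \<oplus> q)"
  define r where "r = cscale A (complex_of_real (1/s)) (p \<oplus> q)"
  have [simp]: "p \<in> carrier A" "q \<in> carrier A" using p q by auto
  have "cnorm A p \<le> s" unfolding s_def
  proof (rule npos_norm_mono)
    have "(p \<oplus> q) \<ominus> p = q" using npos_closed[OF p(1)] npos_closed[OF q(1)] by algebra
    then show "(p \<oplus> q) \<ominus> p \<in> npos A" using q by simp
  qed (use p in auto)
  then have s: "s > 0" using p by simp
  have ne: "p \<oplus> q \<noteq> \<zero>" using s unfolding s_def by auto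
  have pqn: "p \<oplus> q \<in> npos A" using p q npos_add by blast
  note r = npos_normalize[OF pqn ne, folded s_def, folded r_def]
  have rA: "r \<in> ann A K" unfolding r_def using p q by (intro ann_ops(6)[OF K] ann_ops(3)[OF K])
  have rc [simp]: "r \<in> carrier A" using r by simp
  have rr: "r \<otimes> r = r" using thin_corner_projection r(1,2) rA by blast
  have dom: "r = x" if x: "x \<in> npos A" "x \<in> ann A K" "cnorm A x = 1" and y: "y \<in> npos A" and xy: "x \<oplus> y = p \<oplus> q" for x y
  proof -
    have [simp]: "x \<in> carrier A" "y \<in> carrier A" using x y by auto
    define u where "u = \<one> \<ominus> r"
    have us: "u \<in> csa A" unfolding u_def using r by (intro csa_diff npos_csa) auto
    have uc [simp]: "u \<in> carrier A" using us by simp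
    have "u \<otimes> r = \<zero>" unfolding u_def using rr by (simp add: minus_eq l_distr l_minus r_neg)
    then have "u \<otimes> (x \<oplus> y) \<otimes> u = \<zero>" unfolding xy
      by (subst r(3)) (simp flip: scale_mult_left scale_mult_right)
    then have "u \<otimes> x \<otimes> u \<oplus> u \<otimes> y \<otimes> u = \<zero>" by (simp add: l_distr r_distr)
    then have "u \<otimes> x \<otimes> u = \<zero>"
      using npos_add_zero(1) npos_conj_csa[OF x(1) us] npos_conj_csa[OF y us] by blast
    then have "x \<otimes> u = \<zero>" using npos_conj_zero[OF x(1) uc] us by (simp add: csa_adj)
    then have xr: "x \<otimes> r = x" unfolding u_def by (simp add: minus_eq r_distr r_minus)
      (metis \<open>x \<in> carrier A\<close> add.inv_closed m_closed minus_equality minus_minus rc)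
    have "r \<otimes> x = cadj A (x \<otimes> r)" using x r by (simp add: adj_mult csa_adj npos_csa)
    also have "\<dots> = x" unfolding xr using x by (simp add: csa_adj npos_csa)
    finally have rx: "r \<otimes> x = x" .
    have xx: "x \<otimes> x = x" using thin_corner_projection x by blast
    define e where "e = r \<ominus> x"
    have es: "e \<in> csa A" unfolding e_def using x r by (intro csa_diff npos_csa)
    have "e \<otimes> e = e" unfolding e_def using rr rx xr xx
      by (simp add: minus_eq l_distr r_distr l_minus r_minus a_ac r_neg r_neg1 r_neg2 l_neg)
    then have en: "e \<in> npos A" using square_npos[OF es] by simp
    have "x \<otimes> e = \<zero>" unfolding e_def using xr xx by (simp add: minus_eq r_distr r_minus r_neg)
    moreover have "e \<in> ann A K" unfolding e_def using ann_diff[OF K] rA x by blast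
    ultimately have "x = \<zero> \<or> e = \<zero>" using no_orth x en by blast
    then show "r = x" using x by (auto simp: e_def diff_eq_zero)
  qed
  have "r = p" using dom[OF p q(1)] by simp
  moreover have "r = q" using dom[OF q p(1)] by (simp add: a_comm)
  ultimately show ?thesis by simp
qed

lemma thin_corner_scalar:
  assumes p: "p \<in> npos A" "p \<in> ann A K" "cnorm A p = 1" and x: "x \<in> ann A K"
  shows "\<exists>c. x = cscale A c p"
proof -
  have pc [simp]: "p \<in> carrier A" using p by simp
  have pos: "\<exists>c. y = cscale A c p" if y: "y \<in> npos A" "y \<in> ann A K" for y
  proof (cases "y = \<zero>")
    case True
    then show ?thesis by (intro exI[of _ 0]) simp
  next
    case False
    note n = npos_normalize[OF y(1) False]
    have "cscale A (complex_of_real (1 / cnorm A y)) y = p"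
      using thin_corner_unique n(1,2) ann_ops(6)[OF K y(2)] p by blast
    then show ?thesis using n(3) by metis
  qed
  have sa: "\<exists>c. y = cscale A c p" if y: "y \<in> csa A" "y \<in> ann A K" for y
  proof -
    obtain a b where "a \<in> npos A \<inter> ann A K" "b \<in> npos A \<inter> ann A K" "y = a \<ominus> b"
      using ann_jordan[OF K y] by blast
    then obtain c d where "y = cscale A c p \<ominus> cscale A d p" using pos by (metis IntD1 IntD2)
    then show ?thesis by (metis scale_diff_left pc)
  qed
  have xc: "x \<in> carrier A" using x annD by blast
  obtain a b where ab: "a \<in> csa A" "b \<in> csa A" "x = a \<oplus> cscale A \<i> b"
     "a = cscale A (1/2) (x \<oplus> cadj A x)" "b = cscale A (-\<i>/2) (x \<ominus> cadj A x)"
    using csa_decomp[OF xc] by blast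
  have "a \<in> ann A K" unfolding ab(4) by (intro ann_ops(6)[OF K] ann_ops(3)[OF K] ann_ops(5)[OF K] x)
  moreover have "b \<in> ann A K" unfolding ab(5) by (intro ann_ops(6)[OF K] ann_diff[OF K] ann_ops(5)[OF K] x)
  ultimately obtain c d where "a = cscale A c p" "b = cscale A d p" using sa ab(1,2) by metis
  then have "x = cscale A (c + \<i> * d) p" using ab(3) by (simp add: scale_scale scale_add_left)
  then show ?thesis by blast
qed

end

section \<open>Orthogonal elements and orthogonal copies in a simple algebra\<close>

text \<open>Otherwise the corner consists of the multiples of one projection p, so p A p is
  one-dimensional and \<open>simple_fin_dim\<close> contradicts infinite dimension.\<close>

lemma corner_orthogonal_pair:
  assumes s: "csimple A" and inf: "\<not> cfinite_dimensional A" and K: "K \<subseteq> csa A"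
    and d: "d \<in> ann A K" "d \<noteq> \<zero>"
  shows "\<exists>x y. x \<in> npos A \<and> x \<in> ann A K \<and> y \<in> npos A \<and> y \<in> ann A K \<and> x \<otimes> y = \<zero> \<and> x \<noteq> \<zero> \<and> y \<noteq> \<zero>"
proof (rule ccontr)
  assume "\<not> ?thesis"
  then have no: "\<And>x y. \<lbrakk>x \<in> npos A; x \<in> ann A K; y \<in> npos A; y \<in> ann A K; x \<otimes> y = \<zero>\<rbrakk> \<Longrightarrow> x = \<zero> \<or> y = \<zero>"
    by blast
  have dc: "d \<in> carrier A" using d annD by blast
  have dd: "cadj A d \<otimes> d \<in> npos A" "cadj A d \<otimes> d \<noteq> \<zero>" "cadj A d \<otimes> d \<in> ann A K"
    using star_npos[OF dc] star_zero_iff[OF dc] d ann_ops(4,5)[OF K] by auto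
  define p where "p = cscale A (complex_of_real (1 / cnorm A (cadj A d \<otimes> d))) (cadj A d \<otimes> d)"
  have p: "p \<in> npos A" "p \<in> ann A K" "cnorm A p = 1"
    unfolding p_def using npos_normalize[OF dd(1,2)] ann_ops(6)[OF K dd(3)] by auto
  have pc: "p \<in> carrier A" "p \<noteq> \<zero>" using p by auto
  have "(\<lambda>x. p \<otimes> x \<otimes> p) ` carrier A \<subseteq> cspan A {p}"
  proof safe
    fix x assume "x \<in> carrier A"
    then have "p \<otimes> x \<otimes> p \<in> ann A K" using ann_sandwich[OF K p(2) p(2)] by blast
    then obtain c where c: "p \<otimes> x \<otimes> p = cscale A c p" using thin_corner_scalar[OF K no p] by blast
    have "\<zero> \<oplus> cscale A c p \<in> cspan A {p}" by (intro cspan.intros) simp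
    then show "p \<otimes> x \<otimes> p \<in> cspan A {p}" unfolding c using pc by simp
  qed
  then have "fin_dim A ((\<lambda>x. p \<otimes> x \<otimes> p) ` carrier A)"
    unfolding fin_dim_def using pc by (intro exI[of _ "{p}"]) auto
  then show False using simple_fin_dim[OF s pc] inf by blast
qed

text \<open>Of an orthogonal pair x, y the element x is kept and added to K. The smaller annihilator
  still contains y, so it is nonzero and the induction continues inside it; this is why K is an
  arbitrary set.\<close>

lemma corner_orthogonal_family:
  assumes s: "csimple A" and inf: "\<not> cfinite_dimensional A" and K: "K \<subseteq> csa A"
    and d: "d \<in> ann A K" "d \<noteq> \<zero>"
  shows "\<exists>e. (\<forall>i<n::nat. e i \<in> npos A \<and> e i \<in> ann A K \<and> e i \<noteq> \<zero>) \<and> (\<forall>i<n. \<forall>j<n. i \<noteq> j \<longrightarrow> e i \<otimes> e j = \<zero>)"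
  using K d
proof (induction n arbitrary: K d)
  case (Suc n)
  obtain x y where xy: "x \<in> npos A" "x \<in> ann A K" "y \<in> npos A" "y \<in> ann A K" "x \<otimes> y = \<zero>" "x \<noteq> \<zero>" "y \<noteq> \<zero>"
    using corner_orthogonal_pair[OF s inf Suc.prems] by blast
  have "y \<otimes> x = cadj A (x \<otimes> y)" using xy(1,3) by (simp add: adj_mult csa_adj npos_csa)
  then have yx: "y \<otimes> x = \<zero>" using xy by simp
  have "insert x K \<subseteq> csa A" using Suc.prems xy by (simp add: npos_csa)
  moreover have "y \<in> ann A (insert x K)" using xy yx annD(2,3)[OF xy(4)] by (simp add: ann_def)
  ultimately have "\<exists>e. (\<forall>i<n. e i \<in> npos A \<and> e i \<in> ann A (insert x K) \<and> e i \<noteq> \<zero>) \<and> (\<forall>i<n. \<forall>j<n. i \<noteq> j \<longrightarrow> e i \<otimes> e j = \<zero>)"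
    using xy(7) by (rule Suc.IH)
  then obtain e where e: "\<forall>i<n. e i \<in> npos A \<and> e i \<in> ann A (insert x K) \<and> e i \<noteq> \<zero>"
      "\<forall>i<n. \<forall>j<n. i \<noteq> j \<longrightarrow> e i \<otimes> e j = \<zero>"
    by (elim exE conjE)
  define f where "f = e(n := x)"
  have "\<forall>i<Suc n. f i \<in> npos A \<and> f i \<in> ann A K \<and> f i \<noteq> \<zero>"
    using e(1) xy unfolding f_def by (auto simp: less_Suc_eq ann_def)
  moreover have "\<forall>i<n. e i \<otimes> x = \<zero> \<and> x \<otimes> e i = \<zero>" using e(1) by (auto simp: ann_def)
  then have "\<forall>i<Suc n. \<forall>j<Suc n. i \<noteq> j \<longrightarrow> f i \<otimes> f j = \<zero>"
    using e(2) unfolding f_def by (auto simp: less_Suc_eq)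
  ultimately show ?case by blast
qed simp

text \<open>If \<open>v i v i* = a\<close> for \<open>i < m\<close>, then \<open>q = d\<^sub>m x* \<close> with \<open>a' = q a q* \<noteq> 0\<close> and
  \<open>v m = a'\<^sup>1\<^sup>/\<^sup>2\<close> extend the family.\<close>

lemma corner_orthogonal_rows:
  assumes s: "csimple A" and K: "K \<subseteq> csa A"
    and d: "\<forall>i<n. d i \<in> npos A \<and> d i \<in> ann A K \<and> d i \<noteq> \<zero>" "\<forall>i<n. \<forall>j<n. i \<noteq> j \<longrightarrow> d i \<otimes> d j = \<zero>"
    and m: "m \<le> (n::nat)"
  shows "\<exists>v a. a \<in> npos A \<and> a \<noteq> \<zero> \<and> (\<forall>i<m. v i \<in> carrier A \<and> v i \<otimes> cadj A (v i) = a \<and> (\<forall>k\<in>K. v i \<otimes> k = \<zero>)) \<and>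
    (\<forall>i<m. \<forall>j<m. i \<noteq> j \<longrightarrow> v i \<otimes> cadj A (v j) = \<zero>) \<and> (\<forall>i<m. \<forall>j<n. i \<noteq> j \<longrightarrow> v i \<otimes> d j = \<zero>)"
  using m
proof (induction m)
  case 0
  have "\<one> \<noteq> \<zero>" using s by (simp add: csimple_def)
  then show ?case by (intro exI[of _ undefined] exI[of _ \<one>]) auto
next
  case (Suc m)
  from Suc.IH[OF Suc_leD[OF Suc.prems]] obtain v a where a: "a \<in> npos A" "a \<noteq> \<zero>"
     and V: "\<forall>i<m. v i \<in> carrier A \<and> v i \<otimes> cadj A (v i) = a \<and> (\<forall>k\<in>K. v i \<otimes> k = \<zero>)"
      "\<forall>i<m. \<forall>j<m. i \<noteq> j \<longrightarrow> v i \<otimes> cadj A (v j) = \<zero>" "\<forall>i<m. \<forall>j<n. i \<noteq> j \<longrightarrow> v i \<otimes> d j = \<zero>"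
    by (elim exE conjE)
  have v: "\<And>i. i < m \<Longrightarrow> v i \<in> carrier A" "\<And>i. i < m \<Longrightarrow> v i \<otimes> cadj A (v i) = a"
      "\<And>i k. \<lbrakk>i < m; k \<in> K\<rbrakk> \<Longrightarrow> v i \<otimes> k = \<zero>" "\<And>i j. \<lbrakk>i < m; j < m; i \<noteq> j\<rbrakk> \<Longrightarrow> v i \<otimes> cadj A (v j) = \<zero>"
      "\<And>i j. \<lbrakk>i < m; j < n; i \<noteq> j\<rbrakk> \<Longrightarrow> v i \<otimes> d j = \<zero>"
    using V by blast+
  have dm: "d m \<in> npos A" "d m \<in> ann A K" "d m \<noteq> \<zero>" using d Suc.prems by auto
  obtain l where l: "l \<in> npos A" "l \<otimes> l = a" using npos_sqrt[OF a(1)] by blast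
  have [simp]: "d m \<in> carrier A" "l \<in> carrier A" "a \<in> carrier A" using dm l a by auto
  have "l \<noteq> \<zero>" using l a by auto
  then obtain x where x [simp]: "x \<in> carrier A" and nz: "l \<otimes> x \<otimes> d m \<noteq> \<zero>"
    using simple_prime[OF s, of "d m" l] dm by auto
  define q where "q = d m \<otimes> cadj A x"
  define b where "b = q \<otimes> a \<otimes> cadj A q"
  have q [simp]: "q \<in> carrier A" by (simp add: q_def)
  have bn: "b \<in> npos A" unfolding b_def using npos_conj'[OF a(1) q] .
  have bc [simp]: "b \<in> carrier A" using bn by simp
  have dms: "cadj A (d m) = d m" using dm by (simp add: csa_adj npos_csa)
  have b_eq: "b = d m \<otimes> (cadj A x \<otimes> a \<otimes> x \<otimes> d m)"
    unfolding b_def q_def by (simp add: adj_mult dms m_assoc)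
  have "b = cadj A (l \<otimes> x \<otimes> d m) \<otimes> (l \<otimes> x \<otimes> d m)"
    unfolding b_eq l(2)[symmetric] using l(1) by (simp add: adj_mult dms m_assoc csa_adj npos_csa)
  then have b0: "b \<noteq> \<zero>" using nz star_zero_iff[of "l \<otimes> x \<otimes> d m"] by simp
  obtain c where c: "c \<in> npos A" "c \<otimes> c = b" using npos_sqrt[OF bn] by blast
  have cc [simp]: "c \<in> carrier A" using c by simp
  have cs: "cadj A c = c" using c by (simp add: csa_adj npos_csa)
  \<comment> \<open>The right factor of b is d m, so b kills what d m kills, and its root c does the
    same.\<close>
  have bz: "c \<otimes> y = \<zero>" if "y \<in> carrier A" "d m \<otimes> y = \<zero>" for y
  proof -
    have "b \<otimes> y = d m \<otimes> (cadj A x \<otimes> a \<otimes> x) \<otimes> (d m \<otimes> y)" unfolding b_eq using that(1) by (simp add: m_assoc)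
    then show ?thesis using sqrt_mult_zero[OF c(1) that(1)] that(2) c(2) by simp
  qed
  have vc: "v i \<otimes> c = \<zero>" if i: "i < m" for i
  proof -
    have "v i \<otimes> d m = \<zero>" using v(5)[OF i] i Suc.prems by simp
    then have "v i \<otimes> b = \<zero>" unfolding b_eq using v(1)[OF i] by (simp flip: m_assoc)
    moreover have "(v i \<otimes> c) \<otimes> cadj A (v i \<otimes> c) = v i \<otimes> b \<otimes> cadj A (v i)"
      using v(1)[OF i] cs c(2) by (simp add: adj_mult m_assoc) (metis m_assoc adj_closed cc)
    ultimately have "cadj A (v i \<otimes> c) = \<zero>"
      using star_zero_iff[of "cadj A (v i \<otimes> c)"] v(1)[OF i] by simp
    then have "cadj A (cadj A (v i \<otimes> c)) = \<zero>" by simp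
    then show ?thesis using v(1)[OF i] by simp
  qed
  have cv: "c \<otimes> cadj A (v i) = \<zero>" if i: "i < m" for i
  proof -
    have "c \<otimes> cadj A (v i) = cadj A (v i \<otimes> c)" using v(1)[OF i] cs by (simp add: adj_mult)
    then show ?thesis using vc[OF i] by simp
  qed
  \<comment> \<open>Multiplying the old rows by q on the left changes their common value from a to b
    = q a q* and preserves the vanishing relations; the new row is the root of b.\<close>
  define w where "w i = (if i = m then c else q \<otimes> v i)" for i
  have wc: "w i \<in> carrier A" if "i < Suc m" for i using that v(1) by (auto simp: w_def less_Suc_eq)
  have conj: "(q \<otimes> v i) \<otimes> cadj A (q \<otimes> v j) = q \<otimes> (v i \<otimes> cadj A (v j)) \<otimes> cadj A q" if "i < m" "j < m" for i j
    using v(1)[OF that(1)] v(1)[OF that(2)] by (simp add: adj_mult m_assoc)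
  have "w i \<otimes> cadj A (w i) = b" if "i < Suc m" for i
    using that v(2) conj cs c(2) by (auto simp: w_def less_Suc_eq b_def)
  moreover have "w i \<otimes> k = \<zero>" if "i < Suc m" "k \<in> K" for i k
  proof (cases "i = m")
    case True
    have "k \<in> carrier A" "d m \<otimes> k = \<zero>" using K that annD(2)[OF dm(2)] by auto
    then show ?thesis using True bz by (simp add: w_def)
  next
    case False
    then have "k \<in> carrier A" "i < m" using K that by auto
    then show ?thesis using False v(1) v(3)[OF _ that(2)] by (simp add: w_def m_assoc)
  qed
  moreover have "w i \<otimes> cadj A (w j) = \<zero>" if "i < Suc m" "j < Suc m" "i \<noteq> j" for i j
  proof -
    note ij = that
    consider "i < m" "j < m" | "i < m" "j = m" | "i = m" "j < m" using ij by (auto simp: less_Suc_eq)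
    then show ?thesis
    proof cases
      case 1
      then show ?thesis using conj[of i j] v(4)[of i j] that by (simp add: w_def)
    next
      case 2
      then show ?thesis using vc[of i] v(1)[of i] cs by (simp add: w_def m_assoc)
    next
      case 3
      then show ?thesis using cv[of j] v(1)[of j] by (simp add: w_def adj_mult flip: m_assoc)
    qed
  qed
  moreover have "w i \<otimes> d j = \<zero>" if "i < Suc m" "j < n" "i \<noteq> j" for i j
  proof -
    have dj: "d j \<in> carrier A" using d that by auto
    show ?thesis
    proof (cases "i = m")
      case True
      then have "d m \<otimes> d j = \<zero>" using d(2) that Suc.prems by auto
      then show ?thesis using True bz dj by (simp add: w_def)
    next
      case False
      then show ?thesis using v(1)[of i] v(5)[of i j] that dj by (simp add: w_def m_assoc)
    qed
  qed
  ultimately show ?case using bn b0 wc by (intro exI[of _ w] exI[of _ b]) auto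
qed

text \<open>The part p of h above t satisfies p h = p^2 + t p. Multiplying p by the positive element
  (norm of h) - h shows that p^2 is at most (norm of h - t) p.\<close>

lemma positive_part_bound:
  assumes h: "h \<in> npos A" and t: "0 \<le> t"
    and p: "p \<in> npos A" "q \<in> npos A" "h \<ominus> creal A t = p \<ominus> q" "p \<otimes> q = \<zero>" "q \<otimes> p = \<zero>"
  shows "cnorm A h - t > 0 \<Longrightarrow> p \<noteq> \<zero>" "t \<le> cnorm A h \<Longrightarrow> cnorm A p \<le> cnorm A h - t"
proof -
  have c [simp]: "h \<in> carrier A" "p \<in> carrier A" "q \<in> carrier A" using h p by auto
  show "p \<noteq> \<zero>" if "cnorm A h - t > 0"
  proof
    assume "p = \<zero>"
    then have "h \<ominus> creal A t = \<ominus> q" using p by (simp add: minus_eq)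
    moreover have "creal A t \<ominus> h = \<ominus> (h \<ominus> creal A t)" by (simp add: minus_eq minus_add a_comm)
    ultimately have "creal A t \<ominus> h \<in> npos A" using p by simp
    then show False using npos_le_real[OF h _ t] that by simp
  qed
  assume le: "t \<le> cnorm A h"
  define s where "s = cnorm A h - t"
  have pp: "p \<otimes> p = p \<otimes> (h \<ominus> creal A t)" "p \<otimes> p = (h \<ominus> creal A t) \<otimes> p"
    using p(4,5) unfolding p(3) by (simp_all add: minus_eq l_distr r_distr l_minus r_minus)
  have "p \<otimes> h = p \<otimes> p \<oplus> cscale A (complex_of_real t) p"
    unfolding pp(1) by (simp add: minus_eq r_distr r_minus scale_one_mult a_assoc l_neg)
  moreover have "h \<otimes> p = p \<otimes> p \<oplus> cscale A (complex_of_real t) p"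
    unfolding pp(2) by (simp add: minus_eq l_distr l_minus scale_one_mult a_assoc l_neg)
  ultimately have ph: "p \<otimes> h = p \<otimes> p \<oplus> cscale A (complex_of_real t) p" "h \<otimes> p = p \<otimes> h" by simp_all
  have hn: "creal A (cnorm A h) \<ominus> h \<in> npos A" using h by (intro real_minus_npos npos_csa) auto
  have "p \<otimes> (creal A (cnorm A h) \<ominus> h) \<in> npos A"
    using p(1) hn by (rule npos_mult) (simp add: minus_eq l_distr r_distr l_minus r_minus ph(2) scale_one_mult)
  also have "p \<otimes> (creal A (cnorm A h) \<ominus> h) = cscale A (complex_of_real s) p \<ominus> p \<otimes> p"
    by (simp add: s_def minus_eq r_distr r_minus ph(1) scale_one_mult scale_diff_left minus_add a_ac)
  finally have "cnorm A (p \<otimes> p) \<le> cnorm A (cscale A (complex_of_real s) p)"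
    using p(1) square_npos[OF npos_csa] by (intro npos_norm_mono) auto
  moreover have "s \<ge> 0" using le by (simp add: s_def)
  ultimately have "(cnorm A p)\<^sup>2 \<le> s * cnorm A p" using p(1) by (simp add: norm_sq_npos norm_scale)
  moreover have "cnorm A p \<ge> 0" by simp
  ultimately show "cnorm A p \<le> cnorm A h - t"
    using le unfolding s_def power2_eq_square by (cases "cnorm A p = 0") auto
qed

text \<open>The rows are taken in the annihilator of the negative part of h - t, with t just below
  the norm of h. There h acts as t + g with g between 0 and \<delta>, so up to \<epsilon> it is the
  scalar given by its norm, and conjugating h preserves the orthogonality of the rows.\<close>

lemma simple_orthogonal_copies:
  assumes s: "csimple A" and inf: "\<not> cfinite_dimensional A" and h: "h \<in> npos A" "h \<noteq> \<zero>" and \<epsilon>: "0 < \<epsilon>"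
  shows "\<exists>z a. a \<in> npos A \<and> cnorm A a = 1 \<and> (\<forall>i<n::nat. z i \<in> carrier A \<and> cnorm A (z i) \<le> 1 \<and> z i \<otimes> cadj A (z i) = a) \<and>
    (\<forall>i<n. \<forall>j<n. i \<noteq> j \<longrightarrow> z i \<otimes> cadj A (z j) = \<zero>) \<and>
    (\<forall>i<n. \<forall>j<n. cnorm A (z i \<otimes> h \<otimes> cadj A (z j) \<ominus> cscale A (complex_of_real (cnorm A h)) (z i \<otimes> cadj A (z j))) \<le> \<epsilon>)"
proof -
  have "cnorm A h \<noteq> 0" using h by (simp add: norm_eq_zero)
  moreover have "cnorm A h \<ge> 0" using h by simp
  ultimately have hp: "cnorm A h > 0" by linarith
  \<comment> \<open>The minimum keeps t = norm of h - \<delta> nonnegative when \<epsilon> is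
    large.\<close>
  define \<delta> where "\<delta> = min \<epsilon> (cnorm A h)"
  have \<delta>: "0 < \<delta>" "\<delta> \<le> \<epsilon>" "\<delta> \<le> cnorm A h" using hp \<epsilon> by (auto simp: \<delta>_def)
  define t where "t = cnorm A h - \<delta>"
  have t: "0 \<le> t" "t < cnorm A h" "cnorm A h - t = \<delta>" using \<delta> by (auto simp: t_def)
  have hc [simp]: "h \<in> carrier A" using h by simp
  have hs: "h \<ominus> creal A t \<in> csa A" using h by (intro csa_diff csa_real npos_csa)
  obtain g k where gk: "g \<in> npos A" "k \<in> npos A" "h \<ominus> creal A t = g \<ominus> k" "g \<otimes> k = \<zero>" "k \<otimes> g = \<zero>"
    using jordan_decomposition[OF hs] by blast
  have gkc [simp]: "g \<in> carrier A" "k \<in> carrier A" using gk by auto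
  have g0: "g \<noteq> \<zero>" and gn: "cnorm A g \<le> \<delta>"
    using positive_part_bound[OF h(1) t(1) gk] t by auto
  have K: "{k} \<subseteq> csa A" using gk by (simp add: npos_csa)
  have gA: "g \<in> ann A {k}" using gk by (simp add: ann_def)
  obtain d where d: "\<forall>i<n. d i \<in> npos A \<and> d i \<in> ann A {k} \<and> d i \<noteq> \<zero>" "\<forall>i<n. \<forall>j<n. i \<noteq> j \<longrightarrow> d i \<otimes> d j = \<zero>"
    using corner_orthogonal_family[OF s inf K gA g0] by blast
  from corner_orthogonal_rows[OF s K d order_refl] obtain v a where a: "a \<in> npos A" "a \<noteq> \<zero>"
     and V: "\<forall>i<n. v i \<in> carrier A \<and> v i \<otimes> cadj A (v i) = a \<and> (\<forall>k'\<in>{k}. v i \<otimes> k' = \<zero>)"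
      "\<forall>i<n. \<forall>j<n. i \<noteq> j \<longrightarrow> v i \<otimes> cadj A (v j) = \<zero>" "\<forall>i<n. \<forall>j<n. i \<noteq> j \<longrightarrow> v i \<otimes> d j = \<zero>"
    by (elim exE conjE)
  have v: "\<And>i. i < n \<Longrightarrow> v i \<in> carrier A" "\<And>i. i < n \<Longrightarrow> v i \<otimes> cadj A (v i) = a"
      "\<And>i. i < n \<Longrightarrow> v i \<otimes> k = \<zero>" "\<And>i j. \<lbrakk>i < n; j < n; i \<noteq> j\<rbrakk> \<Longrightarrow> v i \<otimes> cadj A (v j) = \<zero>"
    using V by blast+
  define c where "c = complex_of_real (1 / sqrt (cnorm A a))"
  have an: "cnorm A a > 0" using a norm_eq_zero[of a] norm_nonneg[of a] by (smt (verit) npos_closed)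
  have cc: "c * cnj c = complex_of_real (1 / cnorm A a)"
    unfolding c_def using an by (simp flip: of_real_mult add: real_sqrt_mult_self)
  define z where "z i = cscale A c (v i)" for i
  define b where "b = cscale A (complex_of_real (1 / cnorm A a)) a"
  note b = npos_normalize(1,2)[OF a, folded b_def]
  have zz: "z i \<otimes> cadj A (z j) = cscale A (complex_of_real (1 / cnorm A a)) (v i \<otimes> cadj A (v j))"
    if "i < n" "j < n" for i j
    using v(1)[OF that(1)] v(1)[OF that(2)] unfolding z_def cc[symmetric]
    by (simp add: adj_scale scale_scale mult.commute flip: scale_mult_left scale_mult_right)
  have z1: "z i \<in> carrier A" if "i < n" for i using v(1)[OF that] by (simp add: z_def)
  have z2: "z i \<otimes> cadj A (z i) = b" if "i < n" for i using zz[OF that that] v(2)[OF that] by (simp add: b_def)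
  have z3: "cnorm A (z i) \<le> 1" if "i < n" for i
  proof -
    have "(cnorm A (z i))\<^sup>2 = 1" using cstar_identity'[OF z1[OF that]] z2[OF that] b by simp
    then show ?thesis by (simp add: power2_eq_1_iff)
       (metis abs_1 abs_minus_cancel abs_ge_self order_trans)
  qed
  have z4: "z i \<otimes> cadj A (z j) = \<zero>" if "i < n" "j < n" "i \<noteq> j" for i j
    using zz[OF that(1,2)] v(4)[OF that] by simp
  have z5: "cnorm A (z i \<otimes> h \<otimes> cadj A (z j) \<ominus> cscale A (complex_of_real (cnorm A h)) (z i \<otimes> cadj A (z j))) \<le> \<epsilon>"
    if i: "i < n" and j: "j < n" for i j
  proof -
    note [simp] = z1[OF i] z1[OF j]
    have zk: "z i \<otimes> k = \<zero>" unfolding z_def using v(1,3)[OF i] by (simp flip: scale_mult_left)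
    have gen: "(G \<oplus> (H \<ominus> D)) \<ominus> H = G \<ominus> D" if "G \<in> carrier A" "H \<in> carrier A" "D \<in> carrier A" for G H D
      using that by algebra
    have "h = (h \<ominus> creal A t) \<oplus> creal A t" using hc scale_closed[OF one_closed] by algebra
    then have hd: "h = g \<ominus> k \<oplus> creal A t" unfolding gk(3) .
    have "z i \<otimes> h = z i \<otimes> g \<oplus> cscale A (complex_of_real t) (z i)"
      by (subst hd) (simp add: minus_eq r_distr r_minus zk scale_one_mult)
    then have "z i \<otimes> h \<otimes> cadj A (z j) = z i \<otimes> g \<otimes> cadj A (z j) \<oplus> cscale A (complex_of_real t) (z i \<otimes> cadj A (z j))"
      by (simp add: l_distr scale_mult_left)
    moreover have "cscale A (complex_of_real t) (z i \<otimes> cadj A (z j)) =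
        cscale A (complex_of_real (cnorm A h)) (z i \<otimes> cadj A (z j)) \<ominus> cscale A (complex_of_real \<delta>) (z i \<otimes> cadj A (z j))"
      by (simp add: t_def scale_diff_left)
    moreover have "\<ominus> (z i \<otimes> (creal A \<delta> \<ominus> g) \<otimes> cadj A (z j)) = z i \<otimes> g \<otimes> cadj A (z j) \<ominus> cscale A (complex_of_real \<delta>) (z i \<otimes> cadj A (z j))"
      by (simp add: minus_eq r_distr l_distr r_minus l_minus minus_add scale_one_mult a_comm flip: scale_mult_left)
    ultimately have zh: "z i \<otimes> h \<otimes> cadj A (z j) \<ominus> cscale A (complex_of_real (cnorm A h)) (z i \<otimes> cadj A (z j))
        = \<ominus> (z i \<otimes> (creal A \<delta> \<ominus> g) \<otimes> cadj A (z j))"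
      by (simp add: gen)
    moreover have "cnorm A (z i \<otimes> (creal A \<delta> \<ominus> g) \<otimes> cadj A (z j)) \<le> (1 * \<delta>) * 1"
      using z3[OF i] z3[OF j] npos_norm[OF gk(1) gn] by (intro norm_mult_le) auto
    ultimately show ?thesis using \<delta> by simp
  qed
  show ?thesis using b z1 z2 z3 z4 z5 by (intro exI[of _ z] exI[of _ b]) auto
qed

end

section \<open>Subalgebras and compression by an outer expectation\<close>

text \<open>Negation is a description over the carrier, so for the smaller carrier its agreement
  with the negation of A is a statement of its own; distances and limits in P depend on it.\<close>

lemma (in cstar_algebra) subalgebra_cstar:
  assumes "unital_cstar_subalgebra P A"
  shows "cstar_algebra (A\<lparr>carrier := P\<rparr>)" "x \<in> P \<Longrightarrow> \<ominus>\<^bsub>A\<lparr>carrier := P\<rparr>\<^esub> x = \<ominus> x"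
    "\<lbrakk>x \<in> P; y \<in> P\<rbrakk> \<Longrightarrow> x \<ominus>\<^bsub>A\<lparr>carrier := P\<rparr>\<^esub> y = x \<ominus> y"
proof -
  have P: "P \<subseteq> carrier A" "\<zero> \<in> P" "\<one> \<in> P" "cclosed A P" "\<And>x y. \<lbrakk>x \<in> P; y \<in> P\<rbrakk> \<Longrightarrow> x \<oplus> y \<in> P"
    "\<And>x y. \<lbrakk>x \<in> P; y \<in> P\<rbrakk> \<Longrightarrow> x \<otimes> y \<in> P" "\<And>x. x \<in> P \<Longrightarrow> cadj A x \<in> P" "\<And>x c. x \<in> P \<Longrightarrow> cscale A c x \<in> P"
    using assms by (auto simp: unital_cstar_subalgebra_def cstar_subalgebra_def)
  have Pc: "x \<in> carrier A" if "x \<in> P" for x using that P by blast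
  have Pn: "\<ominus> x \<in> P" if "x \<in> P" for x using P(8)[OF that, of "-1"] Pc[OF that] by (simp add: scale_minus1)
  let ?P = "A\<lparr>carrier := P\<rparr>"
  interpret R: ring ?P
  proof (rule ringI)
    show "abelian_group ?P"
    proof (rule abelian_groupI)
      fix x assume "x \<in> carrier ?P"
      then show "\<exists>y\<in>carrier ?P. y \<oplus>\<^bsub>?P\<^esub> x = \<zero>\<^bsub>?P\<^esub>"
        using Pc Pn by (intro bexI[of _ "\<ominus> x"]) (auto simp: l_neg)
    qed (use P Pc in \<open>auto simp: a_ac\<close>)
    show "monoid ?P"
      by (rule monoidI) (use P Pc in \<open>auto simp: m_assoc\<close>)
  qed (use P Pc in \<open>auto simp: l_distr r_distr\<close>)
  show neg: "\<ominus>\<^bsub>?P\<^esub> x = \<ominus> x" if "x \<in> P" for x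
    by (rule R.minus_equality) (use that Pn Pc in \<open>auto simp: l_neg\<close>)
  show diff: "x \<ominus>\<^bsub>?P\<^esub> y = x \<ominus> y" if "x \<in> P" "y \<in> P" for x y
    unfolding R.minus_eq minus_eq using neg that by simp
  show "cstar_algebra ?P"
  proof
    fix s :: "nat \<Rightarrow> 'a" assume s: "\<And>n. s n \<in> carrier ?P"
      and C: "\<And>\<epsilon>. 0 < \<epsilon> \<Longrightarrow> \<exists>N. \<forall>m\<ge>N. \<forall>n\<ge>N. cnorm ?P (s m \<ominus>\<^bsub>?P\<^esub> s n) < \<epsilon>"
    have "\<exists>a\<in>carrier A. ctendsto A s a"
    proof (rule complete)
      show "s n \<in> carrier A" for n using s Pc by simp
      show "\<exists>N. \<forall>m\<ge>N. \<forall>n\<ge>N. cnorm A (s m \<ominus> s n) < \<epsilon>" if "0 < \<epsilon>" for \<epsilon>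
        using C[OF that] s diff by simp
    qed
    then obtain a where a: "a \<in> carrier A" "ctendsto A s a" by blast
    have "a \<in> P" using closed_subset_limit[OF P(4) _ a] s by simp
    then show "\<exists>a\<in>carrier ?P. ctendsto ?P s a"
      using a s diff by (auto simp: ctendsto_def)
  qed (use P Pc in \<open>auto simp: scale_scale scale_add_left scale_add_right adj_add adj_mult adj_scale
      norm_eq_zero norm_scale norm_triangle norm_mult cstar_identity
      intro: scale_mult_left scale_mult_right\<close>)
qed

text \<open>The norm criterion refers only to the norm, the adjoint and the unit, which P shares
  with A. So no spectral permanence is required for positivity in P and in A to agree.\<close>

lemma (in cstar_algebra) subalgebra_npos:
  assumes P: "unital_cstar_subalgebra P A"
  shows "npos (A\<lparr>carrier := P\<rparr>) = npos A \<inter> P"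
proof -
  have P': "P \<subseteq> carrier A" "\<one> \<in> P" "\<And>x c. x \<in> P \<Longrightarrow> cscale A c x \<in> P"
    using P by (auto simp: unital_cstar_subalgebra_def cstar_subalgebra_def)
  then show ?thesis
    unfolding npos_def csa_def by (auto simp: subalgebra_cstar(3)[OF P] subset_iff del: csa_closed)
qed

text \<open>Outerness makes c (b - F b) c small but by itself could choose c where F b is small as
  well. Applied to the annihilator of the negative part of F b - t, with t close to the norm of F b,
  it yields c F b c at least t c^2.\<close>

lemma (in cstar_algebra) outer_cut:
  assumes P: "unital_cstar_subalgebra P A" and out: "outer A P F"
    and b: "b \<in> carrier A" and h: "F b \<in> npos A" "F b \<in> P" and \<epsilon>: "0 < \<epsilon>"
  shows "\<exists>c\<in>P. c \<in> csa A \<and> cnorm A c \<le> 1 \<and> cnorm A (c \<otimes> b \<otimes> c \<ominus> c \<otimes> F b \<otimes> c) < \<epsilon> \<and>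
    cnorm A (F b) - \<epsilon> \<le> cnorm A (c \<otimes> F b \<otimes> c)"
proof (cases "F b = \<zero>")
  case True
  have "\<zero> \<in> P" using P by (auto simp: unital_cstar_subalgebra_def cstar_subalgebra_def)
  then show ?thesis using True b \<epsilon> by (intro bexI[of _ \<zero>]) (auto simp: minus_eq)
next
  case False
  let ?P = "A\<lparr>carrier := P\<rparr>"
  interpret P: cstar_algebra ?P by (rule subalgebra_cstar[OF P])
  have Pc: "x \<in> carrier A" if "x \<in> P" for x
    using P that by (auto simp: unital_cstar_subalgebra_def cstar_subalgebra_def)
  define h where "h = F b"
  have hp: "h \<in> npos A" "h \<in> P" "h \<in> npos ?P" using assms subalgebra_npos[OF P] by (auto simp: h_def)
  have hc [simp]: "h \<in> carrier A" using hp by simp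
  have "cnorm A h \<noteq> 0" using False hc by (simp add: norm_eq_zero h_def)
  moreover have "cnorm A h \<ge> 0" by simp
  ultimately have hpos: "cnorm A h > 0" by linarith
  define \<delta> where "\<delta> = min \<epsilon> (cnorm A h)"
  have \<delta>: "0 < \<delta>" "\<delta> \<le> \<epsilon>" "\<delta> \<le> cnorm A h" using hpos \<epsilon> by (auto simp: \<delta>_def)
  define t where "t = cnorm A h - \<delta>"
  have t: "0 \<le> t" "t < cnorm A h" "cnorm A h - t = \<delta>" using \<delta> by (auto simp: t_def)
  have rP: "creal A t \<in> P" using P by (auto simp: unital_cstar_subalgebra_def cstar_subalgebra_def)
  have hs: "h \<ominus>\<^bsub>?P\<^esub> creal ?P t \<in> csa ?P" using P.csa_diff[OF P.npos_csa[OF hp(3)] P.csa_real] .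
  \<comment> \<open>The decomposition is taken inside P, so that the annihilator of k is a
    hereditary subalgebra of P.\<close>
  obtain g k where gk: "g \<in> npos ?P" "k \<in> npos ?P" "h \<ominus>\<^bsub>?P\<^esub> creal ?P t = g \<ominus>\<^bsub>?P\<^esub> k"
      "g \<otimes>\<^bsub>?P\<^esub> k = \<zero>\<^bsub>?P\<^esub>" "k \<otimes>\<^bsub>?P\<^esub> g = \<zero>\<^bsub>?P\<^esub>"
    using P.jordan_decomposition[OF hs] by blast
  have gkP: "g \<in> P" "k \<in> P" using P.npos_closed gk by auto
  have gkA: "g \<in> npos A" "k \<in> npos A" "h \<ominus> creal A t = g \<ominus> k" "g \<otimes> k = \<zero>" "k \<otimes> g = \<zero>"
    using gk subalgebra_npos[OF P] subalgebra_cstar(3)[OF P] gkP rP hp by auto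
  have g0: "g \<noteq> \<zero>" using positive_part_bound(1)[OF hp(1) t(1) gkA] t by simp
  have gc [simp]: "g \<in> carrier A" "k \<in> carrier A" using gkA by auto
  define C where "C = ann ?P {k}"
  have K: "{k} \<subseteq> csa ?P" using gk P.npos_csa by simp
  have her: "hereditary_subalgebra C ?P" unfolding C_def by (rule P.ann_hereditary[OF K])
  have gC: "g \<in> C" unfolding C_def ann_def using gkA gkP by simp
  have Cne: "C \<noteq> {\<zero>}" using gC g0 by blast
  let ?S = "{cnorm A (c \<otimes> (b \<ominus> F b) \<otimes> c) | c. c \<in> cpos (A\<lparr>carrier := C\<rparr>) \<and> cnorm A c = 1}"
  have Inf0: "Inf ?S = 0" using out her Cne b unfolding outer_def by blast
  \<comment> \<open>An element of norm 1 in C shows that the set is nonempty; only then does the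
    infimum 0 provide values below \<epsilon>.\<close>
  define y where "y = cscale A (complex_of_real (1 / cnorm A g)) g"
  have yC: "y \<in> C" unfolding y_def using P.hereditaryD(6)[OF her gC] by simp
  have y: "y \<in> npos A" "cnorm A y = 1" unfolding y_def using npos_normalize[OF gkA(1) g0] by auto
  have "cnorm A (cadj A y \<otimes> y) = 1" using cstar_identity[of y] y by simp
  then have "?S \<noteq> {}" using yC by (auto simp: cpos_def)
  then obtain s where "s \<in> ?S" "s < \<epsilon>" using cInf_lessD[of ?S \<epsilon>] Inf0 \<epsilon> by auto
  then obtain c where c: "c \<in> cpos (A\<lparr>carrier := C\<rparr>)" "cnorm A c = 1" "cnorm A (c \<otimes> (b \<ominus> h) \<otimes> c) < \<epsilon>"
    unfolding h_def by blast
  then obtain z where z: "z \<in> C" "c = cadj A z \<otimes> z" by (auto simp: cpos_def)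
  have cC: "c \<in> C" unfolding z(2) using P.hereditaryD(4,5)[OF her] z(1) by simp
  have cP: "c \<in> P" using P.hereditaryD(1)[OF her] cC by auto
  then have cc [simp]: "c \<in> carrier A" using Pc by blast
  have zc: "z \<in> carrier A" using P.hereditaryD(1)[OF her] z(1) Pc by auto
  have cs: "c \<in> csa A" unfolding z(2) using zc csa_star by blast
  have ck: "c \<otimes> k = \<zero>" using cC unfolding C_def ann_def by simp
  have "c \<otimes> b \<otimes> c \<ominus> c \<otimes> h \<otimes> c = c \<otimes> (b \<ominus> h) \<otimes> c"
    using b by (simp add: minus_eq l_distr r_distr l_minus r_minus)
  then have 1: "cnorm A (c \<otimes> b \<otimes> c \<ominus> c \<otimes> h \<otimes> c) < \<epsilon>" using c(3) by simp
  have "h = (h \<ominus> creal A t) \<oplus> creal A t" using hc scale_closed[OF one_closed] by algebra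
  then have hd: "h = g \<ominus> k \<oplus> creal A t" unfolding gkA(3) .
  have chc: "c \<otimes> h \<otimes> c = c \<otimes> g \<otimes> c \<oplus> cscale A (complex_of_real t) (c \<otimes> c)"
    by (subst hd) (simp add: minus_eq r_distr l_distr r_minus ck scale_one_mult flip: scale_mult_left)
  have "cnorm A (cscale A (complex_of_real t) (c \<otimes> c)) \<le> cnorm A (c \<otimes> h \<otimes> c)"
  proof (rule npos_norm_mono)
    show "cscale A (complex_of_real t) (c \<otimes> c) \<in> npos A"
      using t by (intro npos_scale square_npos cs)
    have "c \<otimes> h \<otimes> c \<ominus> cscale A (complex_of_real t) (c \<otimes> c) = c \<otimes> g \<otimes> c"
      unfolding chc by (simp add: minus_eq a_assoc r_neg)
    then show "c \<otimes> h \<otimes> c \<ominus> cscale A (complex_of_real t) (c \<otimes> c) \<in> npos A"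
      using npos_conj_csa[OF gkA(1) cs] by simp
  qed simp
  then have "t \<le> cnorm A (c \<otimes> h \<otimes> c)"
    using csa_norm_sq[OF cs] c(2) t by (simp add: norm_scale)
  then have "cnorm A h - \<epsilon> \<le> cnorm A (c \<otimes> h \<otimes> c)" using \<delta> by (simp add: t_def)
  then show ?thesis using 1 cP cs c(2) unfolding h_def by (intro bexI[of _ c]) auto
qed

text \<open>Stated for rings: while its completeness is being proved, the ultrapower is only known
  to be a ring.\<close>

lemma (in ring) add_diff_cancel: "\<lbrakk>x \<in> carrier R; y \<in> carrier R\<rbrakk> \<Longrightarrow> x \<oplus> (y \<ominus> x) = y"
  by algebra

lemma (in ring) diff_split_ring:
  "\<lbrakk>x \<in> carrier R; y \<in> carrier R; z \<in> carrier R\<rbrakk> \<Longrightarrow> x \<ominus> z = (x \<ominus> y) \<oplus> (y \<ominus> z)"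
  by algebra

section \<open>Ultrapowers\<close>

lemma ell_simps:
  "x \<otimes>\<^bsub>ell_infty A\<^esub> y = (\<lambda>n. x n \<otimes>\<^bsub>A\<^esub> y n)" "x \<oplus>\<^bsub>ell_infty A\<^esub> y = (\<lambda>n. x n \<oplus>\<^bsub>A\<^esub> y n)"
  "\<one>\<^bsub>ell_infty A\<^esub> = (\<lambda>n. \<one>\<^bsub>A\<^esub>)" "\<zero>\<^bsub>ell_infty A\<^esub> = (\<lambda>n. \<zero>\<^bsub>A\<^esub>)"
  "cscale (ell_infty A) c x = (\<lambda>n. cscale A c (x n))" "cadj (ell_infty A) x = (\<lambda>n. cadj A (x n))"
  "cnorm (ell_infty A) x = (SUP n. cnorm A (x n))"
  by (simp_all add: ell_infty_def)

abbreviation bdseq :: "'a cstar \<Rightarrow> (nat \<Rightarrow> 'a) set" where "bdseq A \<equiv> carrier (ell_infty A)"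

lemma bdseqI: "\<lbrakk>\<And>n. x n \<in> carrier A; \<And>n. cnorm A (x n) \<le> M\<rbrakk> \<Longrightarrow> x \<in> bdseq A"
  by (auto simp: ell_infty_def)

lemma bdseqD: "x \<in> bdseq A \<Longrightarrow> x n \<in> carrier A" by (simp add: ell_infty_def)

lemma bdseq_bound: "x \<in> bdseq A \<Longrightarrow> \<exists>M. \<forall>n. cnorm A (x n) \<le> M" by (simp add: ell_infty_def)

lemma UN_constant_on: "\<lbrakk>a \<in> X; \<And>y. y \<in> X \<Longrightarrow> f y = c\<rbrakk> \<Longrightarrow> (\<Union>y\<in>X. f y) = c"
  by auto

text \<open>The limit is the supremum of the r that lie below f along \<omega>. Above it the
  ultrafilter decides: if a is not eventually below f, then f is eventually below a.\<close>

lemma ultrafilter_limit: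
  assumes U: "free_ultrafilter \<omega>" and f: "\<And>n. \<bar>f n\<bar> \<le> (M::real)"
  shows "\<exists>l. (f \<longlongrightarrow> l) \<omega>"
proof -
  define S where "S = {r. \<forall>\<^sub>F n in \<omega>. r \<le> f n}"
  have nb: "\<omega> \<noteq> bot" using U by (simp add: free_ultrafilter_def)
  have "- M \<le> f n \<and> f n \<le> M" for n using f[of n] by auto
  then have fM: "- M \<le> f n" "f n \<le> M" for n by auto
  have MS: "- M \<in> S" unfolding S_def using fM by (auto intro!: always_eventually)
  have bd: "bdd_above S"
  proof (rule bdd_aboveI)
    fix r assume "r \<in> S"
    then have "\<forall>\<^sub>F n in \<omega>. r \<le> M" unfolding S_def using fM(2)
      by (auto elim!: eventually_mono intro: order_trans)
    then show "r \<le> M" using nb by (simp add: eventually_const)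
  qed
  have "(f \<longlongrightarrow> Sup S) \<omega>"
  proof (rule order_tendstoI)
    fix a assume "a < Sup S"
    then obtain r where "r \<in> S" "a < r" using MS bd less_cSup_iff[of S a] by auto
    then show "\<forall>\<^sub>F n in \<omega>. a < f n" unfolding S_def by (auto elim!: eventually_mono)
  next
    fix a assume "Sup S < a"
    then have "a \<notin> S" using cSup_upper[OF _ bd] by (meson not_le)
    then have "\<forall>\<^sub>F n in \<omega>. \<not> a \<le> f n" using U unfolding S_def free_ultrafilter_def by blast
    then show "\<forall>\<^sub>F n in \<omega>. f n < a" by (simp add: not_le)
  qed
  then show ?thesis by blast
qed

locale cstar_ultra = cstar_algebra A for A :: "'a cstar" (structure) +
  fixes \<omega> :: "nat filter"
  assumes free: "free_ultrafilter \<omega>"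
begin

lemma omega_nontrivial [simp]: "\<omega> \<noteq> bot" using free by (simp add: free_ultrafilter_def)

lemma tendsto_omega: "(f \<longlonglongrightarrow> l) \<Longrightarrow> (f \<longlongrightarrow> l) \<omega>"
proof -
  assume f: "f \<longlonglongrightarrow> l"
  have "\<omega> \<le> sequentially"
    unfolding le_filter_def eventually_sequentially
  proof (intro allI impI)
    fix P :: "nat \<Rightarrow> bool" assume "\<exists>N. \<forall>n\<ge>N. P n"
    then obtain N where N: "\<And>n. n \<ge> N \<Longrightarrow> P n" by blast
    have "\<forall>\<^sub>F n in \<omega>. \<forall>m\<in>{..<N}. n \<noteq> m"
      by (rule eventually_ball_finite) (use free in \<open>auto simp: free_ultrafilter_def\<close>)
    then show "eventually P \<omega>" by eventually_elim (use N in \<open>auto simp: not_less[symmetric]\<close>)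
  qed
  then show ?thesis using f tendsto_mono by blast
qed

abbreviation "A\<omega> \<equiv> ultrapower \<omega> A"
abbreviation "uc \<equiv> ultra_class \<omega> A"
abbreviation "L \<equiv> ell_infty A"

lemma bd_const [simp]: "a \<in> carrier A \<Longrightarrow> (\<lambda>_. a) \<in> carrier L"
  by (rule bdseqI[of _ _ "cnorm A a"]) auto

lemma bd_add [simp]: assumes "x \<in> carrier L" "y \<in> carrier L" shows "(\<lambda>n. x n \<oplus> y n) \<in> carrier L"
proof -
  obtain M N where MN: "\<And>n. cnorm A (x n) \<le> M" "\<And>n. cnorm A (y n) \<le> N"
    using bdseq_bound[OF assms(1)] bdseq_bound[OF assms(2)] by blast
  have c: "x n \<in> carrier A" "y n \<in> carrier A" for n using assms bdseqD by blast+
  have "cnorm A (x n \<oplus> y n) \<le> M + N" for n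
    using norm_triangle[OF c[of n]] MN(1)[of n] MN(2)[of n] by linarith
  then show ?thesis using c by (intro bdseqI[of _ _ "M + N"]) auto
qed

lemma bd_mult [simp]: assumes "x \<in> carrier L" "y \<in> carrier L" shows "(\<lambda>n. x n \<otimes> y n) \<in> carrier L"
proof -
  obtain M N where MN: "\<And>n. cnorm A (x n) \<le> M" "\<And>n. cnorm A (y n) \<le> N"
    using bdseq_bound[OF assms(1)] bdseq_bound[OF assms(2)] by blast
  have c: "x n \<in> carrier A" "y n \<in> carrier A" for n using assms bdseqD by blast+
  then show ?thesis using norm_mult_le[OF c MN] by (intro bdseqI[of _ _ "M * N"]) auto
qed

lemma bd_scale [simp]: assumes "x \<in> carrier L" shows "(\<lambda>n. cscale A c (x n)) \<in> carrier L"
proof -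
  obtain M where "\<And>n. cnorm A (x n) \<le> M" using assms bdseq_bound by blast
  then show ?thesis using assms[THEN bdseqD] by (intro bdseqI[of _ _ "cmod c * M"]) (auto simp: norm_scale mult_left_mono)
qed

lemma bd_adj [simp]: assumes "x \<in> carrier L" shows "(\<lambda>n. cadj A (x n)) \<in> carrier L"
proof -
  obtain M where "\<And>n. cnorm A (x n) \<le> M" using assms bdseq_bound by blast
  then show ?thesis using assms[THEN bdseqD] by (intro bdseqI[of _ _ M]) auto
qed

lemma bd_neg [simp]: assumes "x \<in> carrier L" shows "(\<lambda>n. \<ominus> x n) \<in> carrier L"
  using bd_scale[OF assms, of "-1"] assms[THEN bdseqD] by (simp add: scale_minus1)

lemma bd_diff [simp]: "\<lbrakk>x \<in> carrier L; y \<in> carrier L\<rbrakk> \<Longrightarrow> (\<lambda>n. x n \<ominus> y n) \<in> carrier L"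
  unfolding minus_eq by (intro bd_add bd_neg)

lemma ring_L: "ring L"
proof (rule ringI)
  show "abelian_group L"
  proof (rule abelian_groupI)
    fix x assume x: "x \<in> carrier L"
    show "\<exists>y\<in>carrier L. y \<oplus>\<^bsub>L\<^esub> x = \<zero>\<^bsub>L\<^esub>"
      using x x[THEN bdseqD] by (intro bexI[of _ "\<lambda>n. \<ominus> x n"]) (auto simp: ell_simps l_neg)
  qed (auto simp: ell_simps bdseqD a_ac intro!: ext)
  show "monoid L"
    by (rule monoidI) (auto simp: ell_simps bdseqD m_assoc)
qed (auto simp: ell_simps bdseqD l_distr r_distr)

lemma L_minus: assumes "x \<in> carrier L" "y \<in> carrier L" shows "x \<ominus>\<^bsub>L\<^esub> y = (\<lambda>n. x n \<ominus> y n)"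
proof -
  interpret L: ring L by (rule ring_L)
  have "\<ominus>\<^bsub>L\<^esub> y = (\<lambda>n. \<ominus> y n)"
    by (rule L.minus_equality) (use assms in \<open>auto simp: ell_simps bdseqD l_neg\<close>)
  then show ?thesis by (simp add: L.minus_eq minus_eq ell_simps)
qed

lemma null_idealD: "x \<in> null_ideal \<omega> A \<Longrightarrow> x \<in> carrier L \<and> ((\<lambda>n. cnorm A (x n)) \<longlongrightarrow> 0) \<omega>"
  by (simp add: null_ideal_def)

lemma tendsto_zero_le:
  fixes f g :: "nat \<Rightarrow> real"
  shows "\<lbrakk>(g \<longlongrightarrow> 0) \<omega>; \<And>n. 0 \<le> f n; \<And>n. f n \<le> g n\<rbrakk> \<Longrightarrow> (f \<longlongrightarrow> 0) \<omega>"
  by (rule tendsto_sandwich[of "\<lambda>_. 0" _ _ g]) auto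

lemma null_mult:
  assumes "((\<lambda>n. cnorm A (x n)) \<longlongrightarrow> 0) \<omega>" "x \<in> carrier L" "y \<in> carrier L"
  shows "((\<lambda>n. cnorm A (x n \<otimes> y n)) \<longlongrightarrow> 0) \<omega>" "((\<lambda>n. cnorm A (y n \<otimes> x n)) \<longlongrightarrow> 0) \<omega>"
proof -
  obtain M where M: "\<And>n. cnorm A (y n) \<le> M" using assms bdseq_bound by blast
  have xy: "x n \<in> carrier A" "y n \<in> carrier A" for n using assms bdseqD by blast+
  have "((\<lambda>n. cnorm A (x n) * M) \<longlongrightarrow> 0) \<omega>" using tendsto_mult_left_zero[OF assms(1)] .
  moreover have "cnorm A (x n \<otimes> y n) \<le> cnorm A (x n) * M" "cnorm A (y n \<otimes> x n) \<le> cnorm A (x n) * M" for n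
    using norm_mult_le[OF xy(1) xy(2) order_refl M] norm_mult_le[OF xy(2) xy(1) M order_refl]
    by (simp_all add: mult.commute)
  ultimately show "((\<lambda>n. cnorm A (x n \<otimes> y n)) \<longlongrightarrow> 0) \<omega>" "((\<lambda>n. cnorm A (y n \<otimes> x n)) \<longlongrightarrow> 0) \<omega>"
    using xy by (auto intro: tendsto_zero_le)
qed

lemma ideal_null: "ideal (null_ideal \<omega> A) L"
proof (rule idealI)
  show "ring L" by (rule ring_L)
  interpret L: ring L by (rule ring_L)
  show "subgroup (null_ideal \<omega> A) (add_monoid L)"
  proof
    show "null_ideal \<omega> A \<subseteq> carrier (add_monoid L)" by (auto simp: null_ideal_def)
    show "\<one>\<^bsub>add_monoid L\<^esub> \<in> null_ideal \<omega> A" by (simp add: null_ideal_def ell_simps)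
    fix x assume x: "x \<in> null_ideal \<omega> A"
    then have xc: "x n \<in> carrier A" for n using null_idealD bdseqD by blast
    show "inv\<^bsub>add_monoid L\<^esub> x \<in> null_ideal \<omega> A"
    proof -
      have "\<ominus>\<^bsub>L\<^esub> x = (\<lambda>n. \<ominus> x n)"
        by (rule L.minus_equality) (use x xc in \<open>auto simp: ell_simps l_neg null_ideal_def\<close>)
      then show ?thesis using null_idealD[OF x] xc by (simp add: null_ideal_def flip: a_inv_def)
    qed
    fix y assume y: "y \<in> null_ideal \<omega> A"
    then have yc: "y n \<in> carrier A" for n using null_idealD bdseqD by blast
    have "((\<lambda>n. cnorm A (x n) + cnorm A (y n)) \<longlongrightarrow> 0) \<omega>"
      using tendsto_add[of "\<lambda>n. cnorm A (x n)" 0 \<omega> "\<lambda>n. cnorm A (y n)" 0] x y null_idealD by simp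
    then have "((\<lambda>n. cnorm A (x n \<oplus> y n)) \<longlongrightarrow> 0) \<omega>"
      by (rule tendsto_zero_le) (use xc yc norm_triangle in auto)
    then show "x \<otimes>\<^bsub>add_monoid L\<^esub> y \<in> null_ideal \<omega> A"
      using x y by (simp add: null_ideal_def ell_simps)
  qed
qed (auto simp: null_ideal_def ell_simps null_mult)

lemma uc_eq_iff:
  assumes "x \<in> carrier L" "y \<in> carrier L"
  shows "uc x = uc y \<longleftrightarrow> ((\<lambda>n. cnorm A (x n \<ominus> y n)) \<longlongrightarrow> 0) \<omega>"
proof -
  have "uc x = uc y \<longleftrightarrow> (\<lambda>n. x n \<ominus> y n) \<in> null_ideal \<omega> A"
    using ring.quotient_eq_iff_same_a_r_cos[OF ring_L ideal_null assms]
    unfolding ultra_class_def L_minus[OF assms] by (rule sym)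
  then show ?thesis unfolding null_ideal_def using bd_diff[OF assms] by blast
qed

lemma mem_uc: assumes "x \<in> carrier L"
  shows "y \<in> uc x \<longleftrightarrow> y \<in> carrier L \<and> uc y = uc x"
proof -
  interpret I: ideal "null_ideal \<omega> A" L by (rule ideal_null)
  have "y \<in> carrier L" if "y \<in> null_ideal \<omega> A +>\<^bsub>L\<^esub> x"
    using I.a_elemrcos_carrier[OF assms that] .
  moreover have "null_ideal \<omega> A +>\<^bsub>L\<^esub> x = null_ideal \<omega> A +>\<^bsub>L\<^esub> y" if "y \<in> null_ideal \<omega> A +>\<^bsub>L\<^esub> x"
    using I.a_repr_independence'[OF that assms] .
  moreover have "y \<in> null_ideal \<omega> A +>\<^bsub>L\<^esub> y" if "y \<in> carrier L"
    using I.a_rcos_self[OF that] .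
  ultimately show ?thesis unfolding ultra_class_def by blast
qed

lemma uc_self: "x \<in> carrier L \<Longrightarrow> x \<in> uc x" using mem_uc by blast

lemma carrier_U: "carrier A\<omega> = uc ` carrier L"
  by (auto simp: ultrapower_def Let_def FactRing_def A_RCOSETS_defs ultra_class_def a_r_coset_def)

lemma U_obtain: assumes "X \<in> carrier A\<omega>" obtains x where "x \<in> carrier L" "X = uc x"
  using assms carrier_U by blast

lemma uc_closed [simp]: "x \<in> carrier L \<Longrightarrow> uc x \<in> carrier A\<omega>" by (simp add: carrier_U)

lemma uc_mult [simp]: "\<lbrakk>x \<in> carrier L; y \<in> carrier L\<rbrakk> \<Longrightarrow> uc x \<otimes>\<^bsub>A\<omega>\<^esub> uc y = uc (\<lambda>n. x n \<otimes> y n)"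
  using ring_hom_mult[OF ideal.rcos_ring_hom[OF ideal_null]] by (simp add: ultrapower_def Let_def ultra_class_def ell_simps)

lemma uc_add [simp]: "\<lbrakk>x \<in> carrier L; y \<in> carrier L\<rbrakk> \<Longrightarrow> uc x \<oplus>\<^bsub>A\<omega>\<^esub> uc y = uc (\<lambda>n. x n \<oplus> y n)"
  using ring_hom_add[OF ideal.rcos_ring_hom[OF ideal_null]] by (simp add: ultrapower_def Let_def ultra_class_def ell_simps)

lemma U_one: "\<one>\<^bsub>A\<omega>\<^esub> = uc (\<lambda>_. \<one>)"
  using ring_hom_one[OF ideal.rcos_ring_hom[OF ideal_null]] by (simp add: ultrapower_def Let_def ultra_class_def ell_simps)

lemma U_zero: "\<zero>\<^bsub>A\<omega>\<^esub> = uc (\<lambda>_. \<zero>)"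
proof -
  interpret I: ideal "null_ideal \<omega> A" L by (rule ideal_null)
  have "\<zero>\<^bsub>A\<omega>\<^esub> = null_ideal \<omega> A" by (simp add: ultrapower_def Let_def FactRing_def)
  also have "\<dots> = null_ideal \<omega> A +>\<^bsub>L\<^esub> \<zero>\<^bsub>L\<^esub>" by (simp add: I.a_rcos_zero[OF ideal_null] I.is_ideal)
  finally show ?thesis by (simp add: ultra_class_def ell_simps)
qed

lemma uc_scale [simp]: assumes x: "x \<in> carrier L" shows "cscale A\<omega> c (uc x) = uc (\<lambda>n. cscale A c (x n))"
proof -
  have "uc (\<lambda>n. cscale A c (y n)) = uc (\<lambda>n. cscale A c (x n))" if "y \<in> uc x" for y
  proof -
    have y: "y \<in> carrier L" "((\<lambda>n. cnorm A (y n \<ominus> x n)) \<longlongrightarrow> 0) \<omega>" using that mem_uc x uc_eq_iff by auto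
    have "((\<lambda>n. cmod c * cnorm A (y n \<ominus> x n)) \<longlongrightarrow> 0) \<omega>" using tendsto_mult_right_zero[OF y(2)] .
    then show ?thesis using x y(1) by (simp add: uc_eq_iff bdseqD norm_scale flip: scale_diff_right)
  qed
  then have "(\<Union>y\<in>uc x. uc (\<lambda>n. cscale A c (y n))) = uc (\<lambda>n. cscale A c (x n))"
    by (rule UN_constant_on[OF uc_self[OF x]])
  then show ?thesis by (simp add: ultrapower_def Let_def ell_simps)
qed

lemma uc_adj [simp]: assumes x: "x \<in> carrier L" shows "cadj A\<omega> (uc x) = uc (\<lambda>n. cadj A (x n))"
proof -
  have "uc (\<lambda>n. cadj A (y n)) = uc (\<lambda>n. cadj A (x n))" if "y \<in> uc x" for y
  proof -
    have y: "y \<in> carrier L" "((\<lambda>n. cnorm A (y n \<ominus> x n)) \<longlongrightarrow> 0) \<omega>" using that mem_uc x uc_eq_iff by auto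
    then show ?thesis using x by (simp add: uc_eq_iff bdseqD flip: adj_diff)
  qed
  then have "(\<Union>y\<in>uc x. uc (\<lambda>n. cadj A (y n))) = uc (\<lambda>n. cadj A (x n))"
    by (rule UN_constant_on[OF uc_self[OF x]])
  then show ?thesis by (simp add: ultrapower_def Let_def ell_simps)
qed

lemma norm_limit_exists:
  assumes x: "x \<in> carrier L" shows "\<exists>l. ((\<lambda>n. cnorm A (x n)) \<longlongrightarrow> l) \<omega>"
proof -
  obtain M where "\<And>n. cnorm A (x n) \<le> M" using x bdseq_bound by blast
  then show ?thesis using x[THEN bdseqD] by (intro ultrafilter_limit[OF free, of _ M]) auto
qed

text \<open>Coordinates of norm above c are replaced by 0. They form a set that \<omega> neglects,
  so the class does not change.\<close>

lemma norm_truncate: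
  assumes x: "x \<in> carrier L" and l: "((\<lambda>n. cnorm A (x n)) \<longlongrightarrow> l) \<omega>" "l < c" "0 \<le> c"
  shows "\<exists>y\<in>carrier L. uc y = uc x \<and> (\<forall>n. cnorm A (y n) \<le> c)"
proof -
  define y where "y n = (if cnorm A (x n) \<le> c then x n else \<zero>)" for n
  have y: "y \<in> carrier L" using x[THEN bdseqD] l by (intro bdseqI[of _ _ c]) (auto simp: y_def)
  have "\<forall>\<^sub>F n in \<omega>. cnorm A (x n) < c" using order_tendstoD(2)[OF l(1,2)] .
  then have "\<forall>\<^sub>F n in \<omega>. cnorm A (y n \<ominus> x n) = 0"
    by eventually_elim (use x[THEN bdseqD] in \<open>auto simp: y_def minus_eq r_neg\<close>)
  then have "((\<lambda>n. cnorm A (y n \<ominus> x n)) \<longlongrightarrow> 0) \<omega>" by (simp add: tendsto_eventually)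
  then show ?thesis using x y l by (intro bexI[of _ y]) (auto simp: uc_eq_iff y_def)
qed

text \<open>The norm of the ultrapower is an infimum of sup norms over representatives. Each
  representative has sup norm at least the limit, by the reverse triangle inequality, and truncation
  yields representatives arbitrarily close to it.\<close>

lemma uc_norm: assumes x: "x \<in> carrier L" shows "((\<lambda>n. cnorm A (x n)) \<longlongrightarrow> cnorm A\<omega> (uc x)) \<omega>"
proof -
  obtain l where l: "((\<lambda>n. cnorm A (x n)) \<longlongrightarrow> l) \<omega>" using norm_limit_exists[OF x] by blast
  have l0: "0 \<le> l" by (rule tendsto_lowerbound[OF l]) (use x[THEN bdseqD] in auto)
  have low: "l \<le> (SUP n. cnorm A (y n))" if "y \<in> uc x" for y
  proof -
    have y: "y \<in> carrier L" "((\<lambda>n. cnorm A (y n \<ominus> x n)) \<longlongrightarrow> 0) \<omega>" using that mem_uc x uc_eq_iff by auto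
    have "cnorm A (x n) - cnorm A (y n \<ominus> x n) \<le> (SUP n. cnorm A (y n))" for n
    proof -
      have "cnorm A (x n) - cnorm A (y n) \<le> cnorm A (y n \<ominus> x n)"
        using norm_reverse_triangle[of "y n" "x n"] x y bdseqD by (smt (verit))
      moreover have "cnorm A (y n) \<le> (SUP n. cnorm A (y n))"
        using bdseq_bound[OF y(1)] by (intro cSUP_upper bdd_aboveI2[where M="SOME M. \<forall>n. cnorm A (y n) \<le> M"])
          (auto intro: someI2_ex)
      ultimately show ?thesis by linarith
    qed
    moreover have "((\<lambda>n. cnorm A (x n) - cnorm A (y n \<ominus> x n)) \<longlongrightarrow> l - 0) \<omega>" by (intro tendsto_diff l y)
    ultimately show ?thesis by (intro tendsto_upperbound[of "\<lambda>n. cnorm A (x n) - cnorm A (y n \<ominus> x n)"]) auto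
  qed
  have "cnorm A\<omega> (uc x) = (INF y\<in>uc x. SUP n. cnorm A (y n))"
    by (simp add: ultrapower_def Let_def ell_simps)
  also have "\<dots> = l"
  proof (rule antisym)
    show "l \<le> (INF y\<in>uc x. SUP n. cnorm A (y n))" using uc_self[OF x] low by (intro cINF_greatest) auto
    show "(INF y\<in>uc x. SUP n. cnorm A (y n)) \<le> l"
    proof (rule field_le_epsilon)
      fix e :: real assume "0 < e"
      then obtain y where y: "y \<in> carrier L" "uc y = uc x" "\<forall>n. cnorm A (y n) \<le> l + e"
        using norm_truncate[OF x l, of "l + e"] l0 by auto
      have "(INF y\<in>uc x. SUP n. cnorm A (y n)) \<le> (SUP n. cnorm A (y n))"
        using y mem_uc[OF x] low by (intro cINF_lower bdd_belowI2[where m=l]) auto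
      also have "\<dots> \<le> l + e" using y by (intro cSUP_least) auto
      finally show "(INF y\<in>uc x. SUP n. cnorm A (y n)) \<le> l + e" .
    qed
  qed
  finally show ?thesis using l by simp
qed

lemma uc_norm_eqI: "\<lbrakk>x \<in> carrier L; ((\<lambda>n. cnorm A (x n)) \<longlongrightarrow> l) \<omega>\<rbrakk> \<Longrightarrow> cnorm A\<omega> (uc x) = l"
  using uc_norm tendsto_unique[OF omega_nontrivial] by blast

lemma uc_norm_le: "\<lbrakk>x \<in> carrier L; \<And>n. cnorm A (x n) \<le> c\<rbrakk> \<Longrightarrow> cnorm A\<omega> (uc x) \<le> c"
  using uc_norm[of x] by (rule tendsto_upperbound) auto

lemma U_lift:
  assumes "X \<in> carrier A\<omega>" "cnorm A\<omega> X < c"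
  obtains y where "y \<in> carrier L" "X = uc y" "\<And>n. cnorm A (y n) \<le> c"
proof -
  obtain x where x: "x \<in> carrier L" "X = uc x" using assms(1) by (rule U_obtain)
  have "0 \<le> cnorm A\<omega> (uc x)" using tendsto_lowerbound[OF uc_norm[OF x(1)]] x(1)[THEN bdseqD] by auto
  then show ?thesis using norm_truncate[OF x(1) uc_norm[OF x(1)], of c] assms(2) x that by fastforce
qed

lemma U_ring: "ring A\<omega>"
proof (rule ringI)
  show "abelian_group A\<omega>"
  proof (rule abelian_groupI)
    fix X assume "X \<in> carrier A\<omega>"
    then obtain x where x: "x \<in> carrier L" "X = uc x" by (rule U_obtain)
    then show "\<exists>Y\<in>carrier A\<omega>. Y \<oplus>\<^bsub>A\<omega>\<^esub> X = \<zero>\<^bsub>A\<omega>\<^esub>"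
      by (intro bexI[of _ "uc (\<lambda>n. \<ominus> x n)"]) (auto simp: U_zero bdseqD l_neg)
  qed (auto elim!: U_obtain simp: U_zero bdseqD a_ac)
  show "monoid A\<omega>"
    by (rule monoidI) (auto elim!: U_obtain simp: U_one bdseqD m_assoc)
qed (auto elim!: U_obtain simp: bdseqD l_distr r_distr)

lemma uc_neg [simp]: assumes x: "x \<in> carrier L" shows "\<ominus>\<^bsub>A\<omega>\<^esub> uc x = uc (\<lambda>n. \<ominus> x n)"
proof -
  interpret U: ring A\<omega> by (rule U_ring)
  show ?thesis by (rule U.minus_equality) (use x in \<open>auto simp: U_zero bdseqD l_neg\<close>)
qed

lemma uc_diff [simp]: "\<lbrakk>x \<in> carrier L; y \<in> carrier L\<rbrakk> \<Longrightarrow> uc x \<ominus>\<^bsub>A\<omega>\<^esub> uc y = uc (\<lambda>n. x n \<ominus> y n)"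
  by (simp add: a_minus_def)

lemma U_norm_triangle:
  assumes "X \<in> carrier A\<omega>" "Y \<in> carrier A\<omega>" shows "cnorm A\<omega> (X \<oplus>\<^bsub>A\<omega>\<^esub> Y) \<le> cnorm A\<omega> X + cnorm A\<omega> Y"
proof -
  obtain x y where x: "x \<in> carrier L" "X = uc x" and y: "y \<in> carrier L" "Y = uc y"
    using assms by (metis U_obtain)
  have a: "((\<lambda>n. cnorm A (x n \<oplus> y n)) \<longlongrightarrow> cnorm A\<omega> (X \<oplus>\<^bsub>A\<omega>\<^esub> Y)) \<omega>"
    using uc_norm[of "\<lambda>n. x n \<oplus> y n"] x y by simp
  have b: "((\<lambda>n. cnorm A (x n) + cnorm A (y n)) \<longlongrightarrow> cnorm A\<omega> X + cnorm A\<omega> Y) \<omega>"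
    using x y by (intro tendsto_add) (auto intro: uc_norm)
  show ?thesis
    by (rule tendsto_le[OF omega_nontrivial b a]) (use x y in \<open>auto simp: bdseqD norm_triangle\<close>)
qed

text \<open>The bound depends on t alone. \<open>U_complete\<close> uses it in all coordinates with
  one t, which makes the coordinatewise limits uniform.\<close>

lemma dominated_limit_bound:
  assumes Y [simp]: "\<And>n. Y n \<in> carrier A"
    and diff: "\<And>n. cnorm A (Y (Suc n) \<ominus> Y n) \<le> t (Suc n) - (t n :: real)"
    and t: "t \<longlonglongrightarrow> T" and b: "ctendsto A Y b" "b \<in> carrier A"
  shows "cnorm A (Y n \<ominus> b) \<le> T - t n"
proof -
  have "ctendsto A (\<lambda>k. Y (k + n) \<ominus> Y n) (b \<ominus> Y n)"
    using b LIMSEQ_ignore_initial_segment[OF b(1)[unfolded ctendsto_def], of n]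
    by (intro ctendsto_diff ctendsto_const) (auto simp: ctendsto_def)
  then have 1: "(\<lambda>k. cnorm A (Y (k + n) \<ominus> Y n)) \<longlonglongrightarrow> cnorm A (b \<ominus> Y n)"
    using b by (intro ctendsto_norm) auto
  have 2: "(\<lambda>k. t (k + n) - t n) \<longlonglongrightarrow> T - t n"
    by (rule tendsto_diff[OF LIMSEQ_ignore_initial_segment[OF t] tendsto_const])
  have "cnorm A (Y (k + n) \<ominus> Y n) \<le> t (k + n) - t n" for k
    using telescoping_norm[of Y t, OF Y diff, of n k] by (simp add: add.commute)
  then have "cnorm A (b \<ominus> Y n) \<le> T - t n" by (intro LIMSEQ_le[OF 1 2]) auto
  then show ?thesis using norm_minus_commute b by simp
qed

text \<open>Differences along a fast subsequence lift to bounded sequences with sup norm at most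
  2^-k. Adding these lifts coordinatewise gives representatives that converge uniformly, and their
  limit represents the limit of s.\<close>

lemma U_complete:
  assumes s: "\<And>n. s n \<in> carrier A\<omega>"
    and C: "\<And>\<epsilon>. 0 < \<epsilon> \<Longrightarrow> \<exists>N. \<forall>m\<ge>N. \<forall>n\<ge>N. cnorm A\<omega> (s m \<ominus>\<^bsub>A\<omega>\<^esub> s n) < \<epsilon>"
  shows "\<exists>a\<in>carrier A\<omega>. ctendsto A\<omega> s a"
proof -
  interpret U: ring A\<omega> by (rule U_ring)
  have "\<exists>N. \<forall>m\<ge>N. \<forall>n\<ge>N. cnorm A\<omega> (s m \<ominus>\<^bsub>A\<omega>\<^esub> s n) < (1/2)^k" for k :: nat
    using C[of "(1/2)^k"] by simp
  then obtain N where N: "\<And>k m n. \<lbrakk>m \<ge> N k; n \<ge> N k\<rbrakk> \<Longrightarrow> cnorm A\<omega> (s m \<ominus>\<^bsub>A\<omega>\<^esub> s n) < (1/2)^k" by metis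
  \<comment> \<open>Partial sums of N give increasing indices that are at least
    \<open>N k\<close>.\<close>
  define r where "r k = (\<Sum>i\<le>k. N i)" for k
  have rN: "N k \<le> r k" "r k \<le> r (Suc k)" for k
    unfolding r_def by (auto intro: member_le_sum)
  have "\<exists>y. y \<in> carrier L \<and> s (r (Suc k)) \<ominus>\<^bsub>A\<omega>\<^esub> s (r k) = uc y \<and> (\<forall>n. cnorm A (y n) \<le> (1/2)^k)" for k
  proof -
    have "cnorm A\<omega> (s (r (Suc k)) \<ominus>\<^bsub>A\<omega>\<^esub> s (r k)) < (1/2)^k"
      using N[of k "r (Suc k)" "r k"] rN[of k] by simp
    then show ?thesis using U_lift[of "s (r (Suc k)) \<ominus>\<^bsub>A\<omega>\<^esub> s (r k)" "(1/2)^k"] s by (metis U.minus_closed)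
  qed
  then obtain y where y: "\<And>k. y k \<in> carrier L" "\<And>k. s (r (Suc k)) \<ominus>\<^bsub>A\<omega>\<^esub> s (r k) = uc (y k)"
      "\<And>k n. cnorm A (y k n) \<le> (1/2)^k" by metis
  obtain x where x: "x \<in> carrier L" "s (r 0) = uc x" using s U_obtain by metis
  define S where "S k n = rec_nat (x n) (\<lambda>k z. z \<oplus> y k n) k" for k n
  have S0: "S 0 = x" and SS: "S (Suc k) = (\<lambda>n. S k n \<oplus> y k n)" for k by (auto simp: S_def)
  have SL [simp]: "S k \<in> carrier L" for k by (induction k) (simp_all add: S0 SS x y)
  have Sc [simp]: "S k n \<in> carrier A" for k n using SL bdseqD by blast
  have yc [simp]: "y k n \<in> carrier A" for k n using y bdseqD by blast
  have ucS: "uc (S k) = s (r k)" for k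
  proof (induction k)
    case (Suc k)
    have "uc (S (Suc k)) = uc (S k) \<oplus>\<^bsub>A\<omega>\<^esub> uc (y k)"
      unfolding SS using y(1) by simp
    also have "\<dots> = s (r k) \<oplus>\<^bsub>A\<omega>\<^esub> (s (r (Suc k)) \<ominus>\<^bsub>A\<omega>\<^esub> s (r k))"
      unfolding y(2) Suc ..
    also have "\<dots> = s (r (Suc k))" using s[of "r k"] s[of "r (Suc k)"] by (rule U.add_diff_cancel)
    finally show ?case .
  qed (simp add: S0 x)
  define t :: "nat \<Rightarrow> real" where "t k = (\<Sum>i<k. (1/2)^i)" for k
  have tT: "t \<longlonglongrightarrow> 2" unfolding t_def using geometric_sums[of "1/2::real"] by (simp add: sums_def)
  have t2: "2 - t k = 2 * (1/2)^k" for k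
    unfolding t_def by (induction k) simp_all
  have dS: "cnorm A (S (Suc k) n \<ominus> S k n) \<le> t (Suc k) - t k" for k n
  proof -
    have "S (Suc k) n \<ominus> S k n = y k n" unfolding SS using Sc[of k n] yc[of k n] by algebra
    then show ?thesis using y(3) by (simp add: t_def)
  qed
  have "\<exists>a\<in>carrier A. ctendsto A (\<lambda>k. S k n) a" for n
    using dS tT by (intro ctendsto_dominated[of _ t]) (auto simp: convergent_def)
  then obtain a where a: "\<And>n. a n \<in> carrier A" "\<And>n. ctendsto A (\<lambda>k. S k n) (a n)" by metis
  have Sa: "cnorm A (S k n \<ominus> a n) \<le> 2 * (1/2)^k" for k n
    using dominated_limit_bound[OF _ dS tT a(2) a(1)] by (simp add: t2)
  obtain M where M: "\<And>n. cnorm A (x n) \<le> M" using bdseq_bound[OF x(1)] by blast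
  have aL: "a \<in> carrier L"
  proof (rule bdseqI[OF a(1)])
    fix n
    have "x n \<ominus> (x n \<ominus> a n) = a n" using bdseqD[OF x(1), of n] a(1)[of n] by algebra
    then show "cnorm A (a n) \<le> M + 2"
      using norm_diff_le[of "x n" "x n \<ominus> a n"] Sa[of 0 n] M[of n] bdseqD[OF x(1), of n] a(1)[of n] by (simp add: S0)
  qed
  have sa: "cnorm A\<omega> (s (r k) \<ominus>\<^bsub>A\<omega>\<^esub> uc a) \<le> 2 * (1/2)^k" for k
    unfolding ucS[symmetric] using aL Sa by (simp add: uc_norm_le)
  have lim: "cnorm A\<omega> (s m \<ominus>\<^bsub>A\<omega>\<^esub> uc a) \<le> 3 * (1/2)^k" if "m \<ge> r k" for m k
  proof -
    have ac: "uc a \<in> carrier A\<omega>" using aL by simp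
    have "s m \<ominus>\<^bsub>A\<omega>\<^esub> uc a = (s m \<ominus>\<^bsub>A\<omega>\<^esub> s (r k)) \<oplus>\<^bsub>A\<omega>\<^esub> (s (r k) \<ominus>\<^bsub>A\<omega>\<^esub> uc a)"
      using s[of m] s[of "r k"] ac by (rule U.diff_split_ring)
    then have "cnorm A\<omega> (s m \<ominus>\<^bsub>A\<omega>\<^esub> uc a) \<le> cnorm A\<omega> (s m \<ominus>\<^bsub>A\<omega>\<^esub> s (r k)) + cnorm A\<omega> (s (r k) \<ominus>\<^bsub>A\<omega>\<^esub> uc a)"
      using U_norm_triangle s ac by simp
    also have "cnorm A\<omega> (s m \<ominus>\<^bsub>A\<omega>\<^esub> s (r k)) < (1/2)^k" using N[of k m "r k"] that rN(1)[of k] by simp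
    finally show ?thesis using sa[of k] by simp
  qed
  have "(\<lambda>n. cnorm A\<omega> (s n \<ominus>\<^bsub>A\<omega>\<^esub> uc a)) \<longlonglongrightarrow> 0"
  proof (rule LIMSEQ_I)
    fix e :: real assume e: "0 < e"
    obtain k where k: "(1/2::real)^k < e/3" using real_arch_pow_inv[of "e/3" "1/2"] e by auto
    have "norm (cnorm A\<omega> (s n \<ominus>\<^bsub>A\<omega>\<^esub> uc a) - 0) < e" if "n \<ge> r k" for n
    proof -
      have "0 \<le> cnorm A\<omega> (s n \<ominus>\<^bsub>A\<omega>\<^esub> uc a)"
      proof -
        obtain z where "z \<in> carrier L" "s n \<ominus>\<^bsub>A\<omega>\<^esub> uc a = uc z" using s aL U_obtain U.minus_closed uc_closed by metis
        then show ?thesis using tendsto_lowerbound[OF uc_norm[of z]] by (auto simp: bdseqD)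
      qed
      then show ?thesis using lim[OF that] k by simp
    qed
    then show "\<exists>no. \<forall>n\<ge>no. norm (cnorm A\<omega> (s n \<ominus>\<^bsub>A\<omega>\<^esub> uc a) - 0) < e" by blast
  qed
  then show ?thesis using aL by (intro bexI[of _ "uc a"]) (auto simp: ctendsto_def)
qed

lemma U_cstar: "cstar_algebra A\<omega>"
proof (intro cstar_algebra.intro cstar_algebra_axioms.intro U_ring, goal_cases)
  case (16 X Y)
  then show ?case by (rule U_norm_triangle)
next
  case (19 s)
  then show ?case by (rule U_complete)
next
  case (13 X)
  then obtain x where x: "x \<in> carrier L" "X = uc x" by (rule U_obtain)
  then show ?case using tendsto_lowerbound[OF uc_norm[of x]] by (auto simp: bdseqD)
next
  case (14 X)
  then obtain x where x: "x \<in> carrier L" "X = uc x" by (rule U_obtain)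
  have "cnorm A\<omega> X = 0 \<longleftrightarrow> ((\<lambda>n. cnorm A (x n)) \<longlongrightarrow> 0) \<omega>"
    unfolding x(2) using uc_norm_eqI[OF x(1), of 0] uc_norm[OF x(1)] by (intro iffI) simp_all
  also have "\<dots> \<longleftrightarrow> X = \<zero>\<^bsub>A\<omega>\<^esub>" unfolding U_zero x(2) using x by (simp add: uc_eq_iff bdseqD minus_eq)
  finally show ?case .
next
  case (15 X c)
  then obtain x where x: "x \<in> carrier L" "X = uc x" by (auto elim: U_obtain)
  have "((\<lambda>n. cmod c * cnorm A (x n)) \<longlongrightarrow> cmod c * cnorm A\<omega> X) \<omega>"
    using x by (auto intro!: tendsto_mult_left uc_norm)
  then show ?case using x by (simp add: uc_norm_eqI bdseqD norm_scale)
next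
  case (17 X Y)
  then obtain x y where x: "x \<in> carrier L" "X = uc x" and y: "y \<in> carrier L" "Y = uc y"
    by (metis U_obtain)
  have a: "((\<lambda>n. cnorm A (x n \<otimes> y n)) \<longlongrightarrow> cnorm A\<omega> (X \<otimes>\<^bsub>A\<omega>\<^esub> Y)) \<omega>"
    using uc_norm[of "\<lambda>n. x n \<otimes> y n"] x y by simp
  have b: "((\<lambda>n. cnorm A (x n) * cnorm A (y n)) \<longlongrightarrow> cnorm A\<omega> X * cnorm A\<omega> Y) \<omega>"
    using x y by (intro tendsto_mult) (auto intro: uc_norm)
  show ?case
    by (rule tendsto_le[OF omega_nontrivial b a]) (use x y in \<open>auto simp: bdseqD norm_mult\<close>)
next
  case (18 X)
  then obtain x where x: "x \<in> carrier L" "X = uc x" by (auto elim: U_obtain)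
  have "((\<lambda>n. (cnorm A (x n))\<^sup>2) \<longlongrightarrow> (cnorm A\<omega> X)\<^sup>2) \<omega>"
    using x by (auto intro!: tendsto_power uc_norm)
  then show ?case using x by (simp add: uc_norm_eqI bdseqD cstar_identity)
qed (auto elim!: U_obtain simp: bdseqD scale_scale scale_add_left scale_add_right adj_add adj_mult adj_scale
      scale_mult_left[symmetric] scale_mult_right[symmetric])

sublocale U: cstar_algebra A\<omega> by (rule U_cstar)

end

text \<open>\<open>ultra_map\<close> is a union over all representatives. A bounded map compatible
  with differences sends representatives that differ by a null sequence to such again, so the union
  is a single class.\<close>

lemma ultra_map_class:
  assumes A: "cstar_ultra A \<omega>" and B: "cstar_ultra B \<omega>"
    and f: "\<And>x. x \<in> carrier A \<Longrightarrow> f x \<in> carrier B"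
      "\<And>x y. \<lbrakk>x \<in> carrier A; y \<in> carrier A\<rbrakk> \<Longrightarrow> f (x \<ominus>\<^bsub>A\<^esub> y) = f x \<ominus>\<^bsub>B\<^esub> f y"
      "\<And>x. x \<in> carrier A \<Longrightarrow> cnorm B (f x) \<le> M * cnorm A x"
    and x: "x \<in> bdseq A"
  shows "(\<lambda>n. f (x n)) \<in> bdseq B"
    "ultra_map \<omega> B f (ultra_class \<omega> A x) = ultra_class \<omega> B (\<lambda>n. f (x n))"
proof -
  interpret A: cstar_ultra A \<omega> by fact
  interpret B: cstar_ultra B \<omega> by fact
  have f_bd: "(\<lambda>n. f (y n)) \<in> bdseq B" if y: "y \<in> bdseq A" for y
  proof -
    obtain N where N: "\<And>n. cnorm A (y n) \<le> N" using bdseq_bound[OF y] by blast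
    have "cnorm B (f (y n)) \<le> \<bar>M\<bar> * N" for n
    proof -
      have yc: "y n \<in> carrier A" using bdseqD[OF y] .
      have "cnorm B (f (y n)) \<le> \<bar>M\<bar> * cnorm A (y n)"
        using f(3)[OF yc] A.norm_nonneg[OF yc] by (meson abs_ge_self mult_right_mono order_trans)
      also have "\<dots> \<le> \<bar>M\<bar> * N" using N by (intro mult_left_mono) auto
      finally show ?thesis .
    qed
    then show ?thesis using f(1) bdseqD[OF y] by (intro bdseqI) auto
  qed
  show "(\<lambda>n. f (x n)) \<in> bdseq B" by (rule f_bd[OF x])
  show "ultra_map \<omega> B f (ultra_class \<omega> A x) = ultra_class \<omega> B (\<lambda>n. f (x n))"
    unfolding ultra_map_def
  proof (rule UN_constant_on[OF A.uc_self[OF x]])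
    fix y assume y: "y \<in> ultra_class \<omega> A x"
    then have yL: "y \<in> bdseq A" and "ultra_class \<omega> A y = ultra_class \<omega> A x" using A.mem_uc[OF x] by auto
    then have lim: "((\<lambda>n. cnorm A (y n \<ominus>\<^bsub>A\<^esub> x n)) \<longlongrightarrow> 0) \<omega>" using A.uc_eq_iff x by blast
    have yc: "y n \<in> carrier A" "x n \<in> carrier A" for n using bdseqD yL x by blast+
    have "((\<lambda>n. M * cnorm A (y n \<ominus>\<^bsub>A\<^esub> x n)) \<longlongrightarrow> 0) \<omega>" using tendsto_mult_right_zero[OF lim] .
    then have "((\<lambda>n. cnorm B (f (y n) \<ominus>\<^bsub>B\<^esub> f (x n))) \<longlongrightarrow> 0) \<omega>"
      by (rule A.tendsto_zero_le) (use yc f in \<open>auto simp flip: f(2)\<close>)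
    then show "ultra_class \<omega> B (\<lambda>n. f (y n)) = ultra_class \<omega> B (\<lambda>n. f (x n))"
      using B.uc_eq_iff[OF f_bd[OF yL] f_bd[OF x]] by simp
  qed
qed

section \<open>The basic construction\<close>

text \<open>The quasi-basis is a parameter, because several occur for one E: the given one, the
  self-adjoint one built from it, and an arbitrary one when the index is shown to be independent of
  the choice.\<close>

locale finite_index = cstar_algebra A for A :: "'a cstar" (structure) +
  fixes P :: "'a set" and E :: "'a \<Rightarrow> 'a" and N :: nat and u v :: "nat \<Rightarrow> 'a"
  assumes P: "unital_cstar_subalgebra P A" and E: "conditional_expectation A P E"
    and qb: "quasi_basis A E N u v"
begin

lemma P_props:
  "P \<subseteq> carrier A" "\<one> \<in> P" "\<zero> \<in> P" "\<lbrakk>x \<in> P; y \<in> P\<rbrakk> \<Longrightarrow> x \<oplus> y \<in> P"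
  "\<lbrakk>x \<in> P; y \<in> P\<rbrakk> \<Longrightarrow> x \<otimes> y \<in> P" "x \<in> P \<Longrightarrow> cadj A x \<in> P" "x \<in> P \<Longrightarrow> cscale A c x \<in> P"
  using P by (auto simp: unital_cstar_subalgebra_def cstar_subalgebra_def)

lemma P_carrier: "x \<in> P \<Longrightarrow> x \<in> carrier A" using P_props(1) by blast

lemma E_P [simp]: "x \<in> carrier A \<Longrightarrow> E x \<in> P"
  using E by (simp add: conditional_expectation_def)

lemma E_closed [simp, intro]: "x \<in> carrier A \<Longrightarrow> E x \<in> carrier A"
  using E_P P_carrier by blast

lemma E_add: "\<lbrakk>x \<in> carrier A; y \<in> carrier A\<rbrakk> \<Longrightarrow> E (x \<oplus> y) = E x \<oplus> E y"
  using E by (simp add: conditional_expectation_def)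

lemma E_scale: "x \<in> carrier A \<Longrightarrow> E (cscale A c x) = cscale A c (E x)"
  using E by (simp add: conditional_expectation_def)

lemma E_id: "p \<in> P \<Longrightarrow> E p = p"
  using E by (simp add: conditional_expectation_def)

lemma E_idem [simp]: "x \<in> carrier A \<Longrightarrow> E (E x) = E x" by (simp add: E_id)

lemma E_bimodule: "\<lbrakk>p \<in> P; q \<in> P; x \<in> carrier A\<rbrakk> \<Longrightarrow> E (p \<otimes> x \<otimes> q) = p \<otimes> E x \<otimes> q"
  using E by (simp add: conditional_expectation_def)

lemma E_left: "\<lbrakk>p \<in> P; x \<in> carrier A\<rbrakk> \<Longrightarrow> E (p \<otimes> x) = p \<otimes> E x"
  using E_bimodule[of p \<one> x] P_props(2) P_carrier[of p] by simp

lemma E_right: "\<lbrakk>p \<in> P; x \<in> carrier A\<rbrakk> \<Longrightarrow> E (x \<otimes> p) = E x \<otimes> p"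
  using E_bimodule[of \<one> p x] P_props(2) P_carrier[of p] by simp

lemma E_npos: "x \<in> npos A \<Longrightarrow> E x \<in> npos A"
proof -
  assume x: "x \<in> npos A"
  interpret P: cstar_algebra "A\<lparr>carrier := P\<rparr>" by (rule subalgebra_cstar[OF P])
  have "E x \<in> cpos (A\<lparr>carrier := P\<rparr>)" using E x cpos_eq_npos by (simp add: conditional_expectation_def)
  then show ?thesis using P.cpos_eq_npos subalgebra_npos[OF P] by simp
qed

lemma E_norm: "x \<in> carrier A \<Longrightarrow> cnorm A (E x) \<le> cnorm A x"
  using E by (simp add: conditional_expectation_def)

lemma E_neg: "x \<in> carrier A \<Longrightarrow> E (\<ominus> x) = \<ominus> E x"
  using E_scale[of x "-1"] by (simp add: scale_minus1)

lemma E_diff: "\<lbrakk>x \<in> carrier A; y \<in> carrier A\<rbrakk> \<Longrightarrow> E (x \<ominus> y) = E x \<ominus> E y"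
  by (simp add: minus_eq E_add E_neg)

lemma E_zero [simp]: "E \<zero> = \<zero>" by (simp add: E_id P_props)

lemma E_one [simp]: "E \<one> = \<one>" by (simp add: E_id P_props)

text \<open>Compatibility with the adjoint is not part of \<open>conditional_expectation\<close>.
  Positivity gives it on differences of positive elements, that is on self-adjoint elements.\<close>

lemma E_adj: assumes x: "x \<in> carrier A" shows "E (cadj A x) = cadj A (E x)"
proof -
  have sa: "E y \<in> csa A" if y: "y \<in> csa A" for y
  proof -
    obtain p q where "p \<in> npos A" "q \<in> npos A" "y = p \<ominus> q" using jordan_decomposition[OF y] by blast
    then show ?thesis using E_npos by (simp add: E_diff csa_diff npos_csa)
  qed
  obtain a b where ab: "a \<in> csa A" "b \<in> csa A" "x = a \<oplus> cscale A \<i> b" using csa_decomp[OF x] by blast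
  then show ?thesis using sa[OF ab(1)] sa[OF ab(2)]
    by (simp add: adj_add adj_scale csa_adj E_add E_scale)
qed

lemma uv [simp]: "j < N \<Longrightarrow> u j \<in> carrier A" "j < N \<Longrightarrow> v j \<in> carrier A"
  using qb by (auto simp: quasi_basis_def)

lemma qb_left: "x \<in> carrier A \<Longrightarrow> (\<Oplus>j\<in>{..<N}. u j \<otimes> E (v j \<otimes> x)) = x"
  using qb by (simp add: quasi_basis_def)

lemma qb_right: "x \<in> carrier A \<Longrightarrow> (\<Oplus>j\<in>{..<N}. E (x \<otimes> u j) \<otimes> v j) = x"
  using qb by (simp add: quasi_basis_def)

section \<open>The inner product with values in P and its norm\<close>

definition ip :: "'a \<Rightarrow> 'a \<Rightarrow> 'a" where "ip x y = E (cadj A x \<otimes> y)"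

lemma ip_closed [simp]: "\<lbrakk>x \<in> carrier A; y \<in> carrier A\<rbrakk> \<Longrightarrow> ip x y \<in> carrier A"
  by (simp add: ip_def)

lemma ip_P [simp]: "\<lbrakk>x \<in> carrier A; y \<in> carrier A\<rbrakk> \<Longrightarrow> ip x y \<in> P"
  by (simp add: ip_def)

lemma ip_npos [simp]: "x \<in> carrier A \<Longrightarrow> ip x x \<in> npos A"
  by (simp add: ip_def E_npos star_npos)

lemma ip_adj: "\<lbrakk>x \<in> carrier A; y \<in> carrier A\<rbrakk> \<Longrightarrow> cadj A (ip x y) = ip y x"
  by (simp add: ip_def adj_mult flip: E_adj)

lemma ip_add: "\<lbrakk>x \<in> carrier A; y \<in> carrier A; z \<in> carrier A\<rbrakk> \<Longrightarrow> ip x (y \<oplus> z) = ip x y \<oplus> ip x z"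
  "\<lbrakk>x \<in> carrier A; y \<in> carrier A; z \<in> carrier A\<rbrakk> \<Longrightarrow> ip (x \<oplus> y) z = ip x z \<oplus> ip y z"
  by (simp_all add: ip_def r_distr l_distr E_add adj_add)

lemma ip_scale: "\<lbrakk>x \<in> carrier A; y \<in> carrier A\<rbrakk> \<Longrightarrow> ip x (cscale A c y) = cscale A c (ip x y)"
  "\<lbrakk>x \<in> carrier A; y \<in> carrier A\<rbrakk> \<Longrightarrow> ip (cscale A c x) y = cscale A (cnj c) (ip x y)"
  by (simp_all add: ip_def adj_scale E_scale flip: scale_mult_left scale_mult_right)

lemma ip_diff: "\<lbrakk>x \<in> carrier A; y \<in> carrier A; z \<in> carrier A\<rbrakk> \<Longrightarrow> ip x (y \<ominus> z) = ip x y \<ominus> ip x z"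
  "\<lbrakk>x \<in> carrier A; y \<in> carrier A; z \<in> carrier A\<rbrakk> \<Longrightarrow> ip (x \<ominus> y) z = ip x z \<ominus> ip y z"
  by (simp_all add: ip_def minus_eq r_distr l_distr E_add E_neg adj_add adj_neg r_minus l_minus)

lemma ip_mult: "\<lbrakk>x \<in> carrier A; y \<in> carrier A; p \<in> P\<rbrakk> \<Longrightarrow> ip x (y \<otimes> p) = ip x y \<otimes> p"
  "\<lbrakk>x \<in> carrier A; y \<in> carrier A; p \<in> P\<rbrakk> \<Longrightarrow> ip (x \<otimes> p) y = cadj A p \<otimes> ip x y"
  by (simp_all add: ip_def adj_mult P_carrier E_right[symmetric] E_left[symmetric] m_assoc P_props)

abbreviation "en \<equiv> enorm A E"

lemma en_sq: "x \<in> carrier A \<Longrightarrow> (en x)\<^sup>2 = cnorm A (ip x x)"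
  by (simp add: enorm_def ip_def)

lemma en_nonneg [simp]: "x \<in> carrier A \<Longrightarrow> 0 \<le> en x"
  by (simp add: enorm_def)

lemma en_le: assumes x: "x \<in> carrier A" shows "en x \<le> cnorm A x"
proof -
  have "(en x)\<^sup>2 \<le> (cnorm A x)\<^sup>2"
    using E_norm[of "cadj A x \<otimes> x"] x by (simp add: en_sq ip_def cstar_identity)
  then show ?thesis using x by (simp add: power2_le_iff_abs_le)
qed

text \<open>Positivity of \<open>\<langle>y - s x p, y - s x p\<rangle>\<close> for \<open>p = \<langle>x, y\<rangle>\<close>.\<close>

lemma cauchy_schwarz:
  assumes x [simp]: "x \<in> carrier A" and y [simp]: "y \<in> carrier A"
  shows "cnorm A (ip x y) \<le> en x * en y"
proof -
  define p where "p = ip x y"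
  have p [simp]: "p \<in> P" "p \<in> carrier A" by (simp_all add: p_def)
  define a where "a = (en x)\<^sup>2"
  have a: "a = cnorm A (ip x x)" "a \<ge> 0" by (simp_all add: a_def en_sq)
  have key: "(2 * s - s\<^sup>2 * a) * (cnorm A p)\<^sup>2 \<le> (en y)\<^sup>2" if s: "0 \<le> 2 * s - s\<^sup>2 * a" for s :: real
  proof -
    let ?c = "complex_of_real"
    let ?q = "cadj A p \<otimes> p"
    have "ip y (x \<otimes> p) = ?q" "ip (x \<otimes> p) y = ?q" "ip (x \<otimes> p) (x \<otimes> p) = cadj A p \<otimes> ip x x \<otimes> p"
      by (simp_all add: ip_mult ip_adj[symmetric, of x y] p_def[symmetric] m_assoc)
    then have "ip (y \<ominus> cscale A (?c s) (x \<otimes> p)) (y \<ominus> cscale A (?c s) (x \<otimes> p)) =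
        ip y y \<ominus> cscale A (?c s) ?q \<ominus> (cscale A (?c s) ?q \<ominus> cscale A (?c (s * s)) (cadj A p \<otimes> ip x x \<otimes> p))"
      by (simp add: ip_diff ip_scale scale_scale scale_diff_right)
    then have 1: "ip y y \<ominus> cscale A (?c s) ?q \<ominus> (cscale A (?c s) ?q \<ominus> cscale A (?c (s * s)) (cadj A p \<otimes> ip x x \<otimes> p)) \<in> npos A"
      using ip_npos[of "y \<ominus> cscale A (?c s) (x \<otimes> p)"] by simp
    have "cadj A p \<otimes> (creal A a \<ominus> ip x x) \<otimes> p \<in> npos A"
      using a(1) by (intro npos_conj real_minus_npos npos_csa) auto
    also have "cadj A p \<otimes> (creal A a \<ominus> ip x x) \<otimes> p = cscale A (?c a) ?q \<ominus> cadj A p \<otimes> ip x x \<otimes> p"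
      by (simp add: minus_eq r_distr l_distr r_minus l_minus scale_one_mult flip: scale_mult_left)
    finally have "cscale A (?c (s * s)) (cscale A (?c a) ?q \<ominus> cadj A p \<otimes> ip x x \<otimes> p) \<in> npos A"
      by (intro npos_scale) auto
    then have 2: "cscale A (?c (s * s * a)) ?q \<ominus> cscale A (?c (s * s)) (cadj A p \<otimes> ip x x \<otimes> p) \<in> npos A"
      by (simp add: scale_diff_right scale_scale)
    have gen: "(Y \<ominus> S \<ominus> (S \<ominus> X)) \<oplus> (T \<ominus> X) = Y \<ominus> (S \<oplus> S \<ominus> T)"
      if "Y \<in> carrier A" "S \<in> carrier A" "X \<in> carrier A" "T \<in> carrier A" for Y S X T
      using that by algebra
    have "cscale A (?c (2 * s - s\<^sup>2 * a)) ?q = cscale A (?c s) ?q \<oplus> cscale A (?c s) ?q \<ominus> cscale A (?c (s * s * a)) ?q"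
      using scale_add_left[of ?q "?c s" "?c s"] by (simp add: scale_diff_left power2_eq_square)
    then have "ip y y \<ominus> cscale A (?c (2 * s - s\<^sup>2 * a)) ?q \<in> npos A"
      using npos_add[OF 1 2] by (simp add: gen)
    then have "cnorm A (cscale A (?c (2 * s - s\<^sup>2 * a)) ?q) \<le> cnorm A (ip y y)"
      using s by (intro npos_norm_mono npos_scale star_npos) auto
    moreover have "cnorm A (cscale A (?c (2 * s - s\<^sup>2 * a)) ?q) = (2 * s - s\<^sup>2 * a) * (cnorm A p)\<^sup>2"
      using s by (simp only: norm_scale norm_of_real cstar_identity p m_closed adj_closed abs_of_nonneg)
    ultimately show ?thesis by (simp add: en_sq)
  qed
  have "(cnorm A p)\<^sup>2 \<le> a * (en y)\<^sup>2"
  \<comment> \<open>For a > 0 the value s = 1/a maximises 2 s - s^2 a. For a = 0 the estimate holds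
    for every s \<ge> 0, and s is chosen to make its left side exceed the right one by 1 unless p =
    0.\<close>
  proof (cases "a = 0")
    case False
    then have "a > 0" using a(2) by linarith
    then show ?thesis using key[of "1/a"] by (simp add: power2_eq_square field_simps)
  next
    case True
    have "(cnorm A p)\<^sup>2 \<le> 0"
    proof (rule ccontr)
      assume n: "\<not> ?thesis"
      then have "(2 * (((en y)\<^sup>2 + 1) / (2 * (cnorm A p)\<^sup>2))) * (cnorm A p)\<^sup>2 \<le> (en y)\<^sup>2"
        using key[of "((en y)\<^sup>2 + 1) / (2 * (cnorm A p)\<^sup>2)"] True by (simp add: add_nonneg_nonneg)
      then show False using n by (simp add: field_simps split: if_splits)
    qed
    then show ?thesis using True by simp
  qed
  then have "(cnorm A p)\<^sup>2 \<le> (en x * en y)\<^sup>2" by (simp add: a_def power_mult_distrib)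
  then show ?thesis unfolding p_def by (rule power2_le_imp_le) simp
qed

lemma en_triangle:
  assumes [simp]: "x \<in> carrier A" "y \<in> carrier A" shows "en (x \<oplus> y) \<le> en x + en y"
proof -
  have "ip (x \<oplus> y) (x \<oplus> y) = (ip x x \<oplus> ip y x) \<oplus> (ip x y \<oplus> ip y y)" by (simp add: ip_add)
  then have "cnorm A (ip (x \<oplus> y) (x \<oplus> y)) \<le> (cnorm A (ip x x) + cnorm A (ip y x)) + (cnorm A (ip x y) + cnorm A (ip y y))"
    using norm_triangle[of "ip x x \<oplus> ip y x" "ip x y \<oplus> ip y y"] norm_triangle[of "ip x x" "ip y x"]
      norm_triangle[of "ip x y" "ip y y"] by simp
  then have "(en (x \<oplus> y))\<^sup>2 \<le> (en x)\<^sup>2 + en y * en x + (en x * en y + (en y)\<^sup>2)"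
    using cauchy_schwarz[OF assms] cauchy_schwarz[OF assms(2,1)] en_sq[OF assms(1)] en_sq[OF assms(2)]
      en_sq[OF a_closed[OF assms]] by linarith
  then have "(en (x \<oplus> y))\<^sup>2 \<le> (en x + en y)\<^sup>2" by (simp add: power2_sum algebra_simps)
  then show ?thesis by (rule power2_le_imp_le) simp
qed

lemma en_scale: "x \<in> carrier A \<Longrightarrow> en (cscale A c x) = cmod c * en x"
proof -
  assume x: "x \<in> carrier A"
  have "(en (cscale A c x))\<^sup>2 = cmod c * (cmod c * cnorm A (ip x x))"
    using x by (simp add: en_sq ip_scale norm_scale)
  also have "\<dots> = (cmod c * en x)\<^sup>2"
    using x by (simp add: en_sq power_mult_distrib) (simp add: power2_eq_square)
  finally show ?thesis using x by (simp add: power2_eq_iff_nonneg)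
qed

text \<open>The constant comparing the two norms in \<open>norm_le_en\<close>. The summand 1 makes
  it positive, since estimates below divide by it.\<close>

definition M :: real where "M = (\<Sum>j<N. cnorm A (u j) * cnorm A (v j)) + 1"

lemma M_pos: "0 < M" unfolding M_def by (intro add_nonneg_pos sum_nonneg) auto

text \<open>The quasi-basis rebuilds x from the coefficients E(v j x), and Cauchy-Schwarz bounds
  each of them by the module norm of x. So finite index makes the two norms equivalent, and the
  completion adds no points to A.\<close>

lemma norm_le_en: assumes x [simp]: "x \<in> carrier A" shows "cnorm A x \<le> M * en x"
proof -
  have "cnorm A x = cnorm A (\<Oplus>j\<in>{..<N}. u j \<otimes> E (v j \<otimes> x))" by (simp add: qb_left)
  also have "\<dots> \<le> (\<Sum>j<N. cnorm A (u j \<otimes> E (v j \<otimes> x)))" by (rule finsum_norm) auto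
  also have "\<dots> \<le> (\<Sum>j<N. cnorm A (u j) * cnorm A (v j) * en x)"
  proof (rule sum_mono)
    fix j assume "j \<in> {..<N}"
    then have j [simp]: "u j \<in> carrier A" "v j \<in> carrier A" by auto
    have "cnorm A (E (v j \<otimes> x)) \<le> en (cadj A (v j)) * en x"
      using cauchy_schwarz[of "cadj A (v j)" x] by (simp add: ip_def)
    also have "\<dots> \<le> cnorm A (v j) * en x" using en_le[of "cadj A (v j)"] by (intro mult_right_mono) auto
    finally show "cnorm A (u j \<otimes> E (v j \<otimes> x)) \<le> cnorm A (u j) * cnorm A (v j) * en x"
      using norm_mult_le[of "u j" "E (v j \<otimes> x)" "cnorm A (u j)"] by (simp add: mult.assoc)
  qed
  also have "\<dots> \<le> M * en x" by (simp add: M_def sum_distrib_right distrib_right)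
  finally show ?thesis .
qed

lemma en_zero_iff: "x \<in> carrier A \<Longrightarrow> en x = 0 \<longleftrightarrow> x = \<zero>"
  using norm_le_en[of x] en_le[of x] norm_eq_zero[of x] norm_nonneg[of x] en_nonneg[of x]
  by (auto simp del: norm_nonneg en_nonneg intro: antisym)

lemma ip_faithful:
  assumes [simp]: "x \<in> carrier A" "y \<in> carrier A" and eq: "\<And>z. z \<in> carrier A \<Longrightarrow> ip z x = ip z y"
  shows "x = y"
proof -
  have "ip (x \<ominus> y) (x \<ominus> y) = \<zero>" using eq[of "x \<ominus> y"] by (simp add: ip_diff(1)[of "x \<ominus> y" x y] diff_eq_zero)
  then have "en (x \<ominus> y) = 0" using en_sq[of "x \<ominus> y"] by simp
  then show ?thesis by (simp add: en_zero_iff diff_eq_zero)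
qed

subsection \<open>The Hilbert module\<close>

lemma en_tendsto_iff:
  assumes "\<And>n. x n \<in> carrier A"
  shows "((\<lambda>n. en (x n)) \<longlonglongrightarrow> 0) \<longleftrightarrow> ((\<lambda>n. cnorm A (x n)) \<longlonglongrightarrow> 0)"
proof
  assume "(\<lambda>n. en (x n)) \<longlonglongrightarrow> 0"
  then have "(\<lambda>n. M * en (x n)) \<longlonglongrightarrow> 0" by (rule tendsto_mult_right_zero)
  then show "(\<lambda>n. cnorm A (x n)) \<longlonglongrightarrow> 0"
    by (rule tendsto_sandwich[of "\<lambda>_. 0", rotated 3]) (use assms norm_le_en in auto)
next
  assume "(\<lambda>n. cnorm A (x n)) \<longlonglongrightarrow> 0"
  then show "(\<lambda>n. en (x n)) \<longlonglongrightarrow> 0"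
    by (rule tendsto_sandwich[of "\<lambda>_. 0", rotated 3]) (use assms en_le in auto)
qed

text \<open>The point of the completion that corresponds to a: the norms being equivalent, the
  Cauchy sequences equivalent to the constant sequence a are those converging to a in A.\<close>

definition conv_seqs :: "'a \<Rightarrow> (nat \<Rightarrow> 'a) set" where
  "conv_seqs a = {x. (\<forall>n. x n \<in> carrier A) \<and> ctendsto A x a}"

lemma convergent_ecauchy:
  assumes "x \<in> conv_seqs a" "a \<in> carrier A" shows "x \<in> ecauchy A E"
proof -
  have x: "\<And>n. x n \<in> carrier A" "(\<lambda>n. cnorm A (x n \<ominus> a)) \<longlonglongrightarrow> 0"
    using assms by (auto simp: conv_seqs_def ctendsto_def)
  have "\<exists>N. \<forall>m\<ge>N. \<forall>n\<ge>N. en (x m \<ominus> x n) < \<epsilon>" if "\<epsilon> > 0" for \<epsilon>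
  proof -
    have "\<forall>\<^sub>F n in sequentially. cnorm A (x n \<ominus> a) < \<epsilon>/2"
      using order_tendstoD(2)[OF x(2), of "\<epsilon>/2"] that by simp
    then obtain N where N: "\<And>n. n \<ge> N \<Longrightarrow> cnorm A (x n \<ominus> a) < \<epsilon>/2" by (auto simp: eventually_sequentially)
    have "en (x m \<ominus> x n) < \<epsilon>" if "m \<ge> N" "n \<ge> N" for m n
      using en_le[of "x m \<ominus> x n"] norm_diff_triangle[of "x m" a "x n"] N[of m] N[of n] that x(1) assms
        norm_minus_commute[of a "x n"] by simp
    then show ?thesis by blast
  qed
  then show ?thesis using x by (simp add: ecauchy_def)
qed

lemma ecauchy_convergent:
  assumes "x \<in> ecauchy A E" shows "\<exists>a\<in>carrier A. x \<in> conv_seqs a"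
proof -
  have x: "\<And>n. x n \<in> carrier A" using assms by (simp add: ecauchy_def)
  have "\<exists>a\<in>carrier A. ctendsto A x a"
  proof (rule complete[OF x])
    fix \<epsilon> :: real assume "0 < \<epsilon>"
    then have "0 < \<epsilon> / M" using M_pos by simp
    then obtain N where N: "\<And>m n. \<lbrakk>m \<ge> N; n \<ge> N\<rbrakk> \<Longrightarrow> en (x m \<ominus> x n) < \<epsilon> / M"
      using assms unfolding ecauchy_def by blast
    have "cnorm A (x m \<ominus> x n) < \<epsilon>" if "m \<ge> N" "n \<ge> N" for m n
      using norm_le_en[of "x m \<ominus> x n"] N[OF that] M_pos x by (simp add: pos_less_divide_eq mult.commute)
    then show "\<exists>N. \<forall>m\<ge>N. \<forall>n\<ge>N. cnorm A (x m \<ominus> x n) < \<epsilon>" by blast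
  qed
  then show ?thesis using x by (auto simp: conv_seqs_def)
qed

lemma erel_class:
  assumes x: "x \<in> conv_seqs a" and a: "a \<in> carrier A" shows "erel A E `` {x} = conv_seqs a"
proof -
  have xc: "\<And>n. x n \<in> carrier A" "ctendsto A x a" using x by (auto simp: conv_seqs_def)
  have "(x, y) \<in> erel A E \<longleftrightarrow> y \<in> conv_seqs a" for y
  proof
    assume "(x, y) \<in> erel A E"
    then have y: "y \<in> ecauchy A E" and lim: "(\<lambda>n. en (x n \<ominus> y n)) \<longlonglongrightarrow> 0" by (auto simp: erel_def)
    have yc: "\<And>n. y n \<in> carrier A" using y by (simp add: ecauchy_def)
    have "(\<lambda>n. cnorm A (x n \<ominus> y n)) \<longlonglongrightarrow> 0" using lim en_tendsto_iff[of "\<lambda>n. x n \<ominus> y n"] xc yc by simp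
    then have "ctendsto A (\<lambda>n. x n \<ominus> y n) \<zero>" using xc yc by (simp add: ctendsto_def minus_eq)
    then have "ctendsto A (\<lambda>n. x n \<ominus> (x n \<ominus> y n)) (a \<ominus> \<zero>)" using xc yc a by (intro ctendsto_diff) auto
    moreover have "x n \<ominus> (x n \<ominus> y n) = y n" for n using xc(1)[of n] yc[of n] by algebra
    ultimately show "y \<in> conv_seqs a" using yc a by (simp add: conv_seqs_def minus_eq)
  next
    assume y: "y \<in> conv_seqs a"
    then have yc: "\<And>n. y n \<in> carrier A" "ctendsto A y a" by (auto simp: conv_seqs_def)
    have "ctendsto A (\<lambda>n. x n \<ominus> y n) (a \<ominus> a)" using xc yc a by (intro ctendsto_diff) auto
    then have "(\<lambda>n. cnorm A (x n \<ominus> y n)) \<longlonglongrightarrow> 0" using ctendsto_norm[of "\<lambda>n. x n \<ominus> y n" "a \<ominus> a"] xc yc a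
      by (simp add: minus_eq r_neg)
    then have "(\<lambda>n. en (x n \<ominus> y n)) \<longlonglongrightarrow> 0" using en_tendsto_iff[of "\<lambda>n. x n \<ominus> y n"] xc yc by simp
    then show "(x, y) \<in> erel A E" using convergent_ecauchy x y a by (simp add: erel_def)
  qed
  then show ?thesis by auto
qed

abbreviation "H \<equiv> emodule A E"

lemma conv_seqs_const: "a \<in> carrier A \<Longrightarrow> (\<lambda>_. a) \<in> conv_seqs a"
  by (simp add: conv_seqs_def ctendsto_const)

lemma conv_seqs_inj: "\<lbrakk>a \<in> carrier A; b \<in> carrier A; conv_seqs a = conv_seqs b\<rbrakk> \<Longrightarrow> a = b"
  using conv_seqs_const[of a] ctendsto_unique[of "\<lambda>_. a" a b] by (auto simp: conv_seqs_def ctendsto_const)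

lemma H_carrier: "hcarrier H = conv_seqs ` carrier A"
proof
  show "hcarrier H \<subseteq> conv_seqs ` carrier A"
    using ecauchy_convergent erel_class by (fastforce simp: emodule_def quotient_def)
  show "conv_seqs ` carrier A \<subseteq> hcarrier H"
  proof safe
    fix a assume "a \<in> carrier A"
    then have "erel A E `` {\<lambda>_. a} = conv_seqs a" "(\<lambda>_. a) \<in> ecauchy A E"
      using conv_seqs_const[of a] convergent_ecauchy[of _ a] erel_class[of _ a] by simp_all
    then have "conv_seqs a = erel A E `` {\<lambda>_. a}" "(\<lambda>_. a) \<in> ecauchy A E" by simp_all
    then show "conv_seqs a \<in> hcarrier H" by (auto simp: emodule_def intro: quotientI)
  qed
qed

lemma H_zero: "hzero H = conv_seqs \<zero>"
  using erel_class conv_seqs_const by (simp add: emodule_def)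

lemma H_add: assumes "a \<in> carrier A" "b \<in> carrier A"
  shows "hadd H (conv_seqs a) (conv_seqs b) = conv_seqs (a \<oplus> b)"
proof -
  have "erel A E `` {\<lambda>n. x n \<oplus> y n} = conv_seqs (a \<oplus> b)" if "x \<in> conv_seqs a" "y \<in> conv_seqs b" for x y
    using that assms by (intro erel_class) (auto simp: conv_seqs_def ctendsto_add)
  then have "(\<Union>x\<in>conv_seqs a. \<Union>y\<in>conv_seqs b. erel A E `` {\<lambda>n. x n \<oplus> y n}) = conv_seqs (a \<oplus> b)"
    by (intro UN_constant_on[OF conv_seqs_const[OF assms(1)]] UN_constant_on[OF conv_seqs_const[OF assms(2)]])
  then show ?thesis by (simp add: emodule_def)
qed

lemma H_scale: assumes "a \<in> carrier A"
  shows "hscale H c (conv_seqs a) = conv_seqs (cscale A c a)"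
proof -
  have "erel A E `` {\<lambda>n. cscale A c (x n)} = conv_seqs (cscale A c a)" if "x \<in> conv_seqs a" for x
    using that assms by (intro erel_class) (auto simp: conv_seqs_def ctendsto_scale)
  then have "(\<Union>x\<in>conv_seqs a. erel A E `` {\<lambda>n. cscale A c (x n)}) = conv_seqs (cscale A c a)"
    by (rule UN_constant_on[OF conv_seqs_const[OF assms]])
  then show ?thesis by (simp add: emodule_def)
qed

lemma bounded_map_ctendsto:
  assumes f: "\<And>x. x \<in> carrier A \<Longrightarrow> f x \<in> carrier A"
      "\<And>x y. \<lbrakk>x \<in> carrier A; y \<in> carrier A\<rbrakk> \<Longrightarrow> f (x \<ominus> y) = f x \<ominus> f y"
      "\<And>x. x \<in> carrier A \<Longrightarrow> cnorm A (f x) \<le> K * cnorm A x"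
    and x: "\<And>n. x n \<in> carrier A" "ctendsto A x a" "a \<in> carrier A"
  shows "ctendsto A (\<lambda>n. f (x n)) (f a)"
proof (rule ctendstoI)
  show "cnorm A (f (x n) \<ominus> f a) \<le> K * cnorm A (x n \<ominus> a)" for n using f x by (simp flip: f(2))
  show "(\<lambda>n. K * cnorm A (x n \<ominus> a)) \<longlonglongrightarrow> 0"
    using x(2) by (intro tendsto_mult_right_zero) (simp add: ctendsto_def)
qed (use f x in auto)

lemma E_ctendsto: "\<lbrakk>\<And>n. x n \<in> carrier A; ctendsto A x a; a \<in> carrier A\<rbrakk> \<Longrightarrow> ctendsto A (\<lambda>n. E (x n)) (E a)"
  by (rule bounded_map_ctendsto[of E 1]) (auto simp: E_diff E_norm)

lemma H_inner: assumes a: "a \<in> carrier A" and b: "b \<in> carrier A"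
  shows "hinner H (conv_seqs a) (conv_seqs b) = ip a b"
proof -
  have lim: "ctendsto A (\<lambda>n. E (cadj A (x n) \<otimes> y n)) (ip a b)" if "x \<in> conv_seqs a" "y \<in> conv_seqs b" for x y
    using that a b unfolding conv_seqs_def ip_def by (auto intro!: E_ctendsto ctendsto_mult ctendsto_adj)
  have "(THE p. p \<in> carrier A \<and> (\<forall>x\<in>conv_seqs a. \<forall>y\<in>conv_seqs b. ctendsto A (\<lambda>n. E (cadj A (x n) \<otimes> y n)) p)) = ip a b"
  proof (rule the_equality)
    fix p assume p: "p \<in> carrier A \<and> (\<forall>x\<in>conv_seqs a. \<forall>y\<in>conv_seqs b. ctendsto A (\<lambda>n. E (cadj A (x n) \<otimes> y n)) p)"
    then have "ctendsto A (\<lambda>n. E (cadj A a \<otimes> b)) p" using conv_seqs_const[OF a] conv_seqs_const[OF b] by auto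
    then show "p = ip a b"
      using ctendsto_unique[OF _ ctendsto_const[of "ip a b"]] a b p unfolding ip_def by simp
  qed (use lim a b in simp)
  then show ?thesis by (simp add: emodule_def)
qed

lemma H_norm: "a \<in> carrier A \<Longrightarrow> hnorm A H (conv_seqs a) = en a"
  by (simp add: hnorm_def H_inner enorm_def ip_def)

lemma eextend_class:
  assumes f: "\<And>x. x \<in> carrier A \<Longrightarrow> f x \<in> carrier A"
      "\<And>x y. \<lbrakk>x \<in> carrier A; y \<in> carrier A\<rbrakk> \<Longrightarrow> f (x \<ominus> y) = f x \<ominus> f y"
      "\<And>x. x \<in> carrier A \<Longrightarrow> cnorm A (f x) \<le> K * cnorm A x"
    and a: "a \<in> carrier A"
  shows "eextend A E f (conv_seqs a) = conv_seqs (f a)"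
proof -
  have "erel A E `` {\<lambda>n. f (x n)} = conv_seqs (f a)" if "x \<in> conv_seqs a" for x
  proof (rule erel_class)
    show "(\<lambda>n. f (x n)) \<in> conv_seqs (f a)"
      using that bounded_map_ctendsto[of f K x a, OF f] a f(1) by (auto simp: conv_seqs_def)
  qed (use f a in auto)
  then have "(\<Union>x\<in>conv_seqs a. erel A E `` {\<lambda>n. f (x n)}) = conv_seqs (f a)"
    by (rule UN_constant_on[OF conv_seqs_const[OF a]])
  then show ?thesis using a by (simp add: eextend_def H_carrier)
qed

subsection \<open>Adjointable operators\<close>

text \<open>The adjoint relation alone carries everything else: faithfulness of \<open>ip\<close>
  makes \<phi> linear over the scalars and over P, and the quasi-basis then makes it
  bounded.\<close>

definition adjm :: "('a \<Rightarrow> 'a) \<Rightarrow> ('a \<Rightarrow> 'a) \<Rightarrow> bool" where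
  "adjm \<phi> \<psi> \<longleftrightarrow> (\<forall>x\<in>carrier A. \<phi> x \<in> carrier A \<and> \<psi> x \<in> carrier A) \<and>
     (\<forall>x\<in>carrier A. \<forall>y\<in>carrier A. ip (\<phi> x) y = ip x (\<psi> y))"

text \<open>Carries a map of A to the module along \<open>conv_seqs\<close>. Operators are
  extensional on \<open>hcarrier H\<close>, so equality of operators becomes equality of maps on
  A.\<close>

definition op :: "('a \<Rightarrow> 'a) \<Rightarrow> (nat \<Rightarrow> 'a) set \<Rightarrow> (nat \<Rightarrow> 'a) set" where
  "op \<phi> = (\<lambda>X\<in>hcarrier H. conv_seqs (\<phi> (the_inv_into (carrier A) conv_seqs X)))"

lemma conv_seqs_inj_on: "inj_on conv_seqs (carrier A)"
  using conv_seqs_inj by (auto simp: inj_on_def)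

lemma op_apply [simp]: "a \<in> carrier A \<Longrightarrow> op \<phi> (conv_seqs a) = conv_seqs (\<phi> a)"
  by (simp add: op_def H_carrier the_inv_into_f_f[OF conv_seqs_inj_on])

lemma op_extensional: "op \<phi> \<in> extensional (hcarrier H)" by (simp add: op_def)

lemma op_eqI:
  assumes "T \<in> extensional (hcarrier H)" "\<And>a. a \<in> carrier A \<Longrightarrow> T (conv_seqs a) = conv_seqs (\<phi> a)"
  shows "T = op \<phi>"
  by (rule extensionalityI[OF assms(1) op_extensional]) (use assms(2) in \<open>auto simp: H_carrier\<close>)

lemma op_eq_iff:
  assumes "\<And>a. a \<in> carrier A \<Longrightarrow> \<phi> a \<in> carrier A" "\<And>a. a \<in> carrier A \<Longrightarrow> \<psi> a \<in> carrier A"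
  shows "op \<phi> = op \<psi> \<longleftrightarrow> (\<forall>a\<in>carrier A. \<phi> a = \<psi> a)"
proof
  assume eq: "op \<phi> = op \<psi>"
  show "\<forall>a\<in>carrier A. \<phi> a = \<psi> a"
  proof
    fix a assume a: "a \<in> carrier A"
    have "conv_seqs (\<phi> a) = conv_seqs (\<psi> a)" using op_apply[OF a, of \<phi>] op_apply[OF a, of \<psi>] eq by simp
    then show "\<phi> a = \<psi> a" using assms[OF a] conv_seqs_inj by blast
  qed
next
  assume "\<forall>a\<in>carrier A. \<phi> a = \<psi> a"
  then show "op \<phi> = op \<psi>" by (intro op_eqI op_extensional) simp
qed

lemma op_funcset: "(\<And>a. a \<in> carrier A \<Longrightarrow> \<phi> a \<in> carrier A) \<Longrightarrow> op \<phi> \<in> hcarrier H \<rightarrow>\<^sub>E hcarrier H"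
  by (simp add: PiE_iff op_extensional) (auto simp: H_carrier)

lemma op_surj:
  assumes T: "T \<in> hcarrier H \<rightarrow>\<^sub>E hcarrier H"
  shows "\<exists>\<phi>. (\<forall>a\<in>carrier A. \<phi> a \<in> carrier A) \<and> T = op \<phi>"
proof -
  define \<phi> where "\<phi> a = the_inv_into (carrier A) conv_seqs (T (conv_seqs a))" for a
  have "\<phi> a \<in> carrier A \<and> conv_seqs (\<phi> a) = T (conv_seqs a)" if "a \<in> carrier A" for a
  proof -
    have "T (conv_seqs a) \<in> conv_seqs ` carrier A" using T that by (auto simp: PiE_iff H_carrier)
    then show ?thesis unfolding \<phi>_def
      using the_inv_into_into[OF conv_seqs_inj_on _ order_refl] f_the_inv_into_f[OF conv_seqs_inj_on] by blast
  qed
  then show ?thesis using T by (intro exI[of _ \<phi>]) (auto simp: PiE_iff intro!: op_eqI)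
qed

lemma adjmD: "adjm \<phi> \<psi> \<Longrightarrow> x \<in> carrier A \<Longrightarrow> \<phi> x \<in> carrier A" "adjm \<phi> \<psi> \<Longrightarrow> x \<in> carrier A \<Longrightarrow> \<psi> x \<in> carrier A"
  "\<lbrakk>adjm \<phi> \<psi>; x \<in> carrier A; y \<in> carrier A\<rbrakk> \<Longrightarrow> ip (\<phi> x) y = ip x (\<psi> y)"
  by (auto simp: adjm_def)

lemma adjm_sym: assumes "adjm \<phi> \<psi>" shows "adjm \<psi> \<phi>"
proof -
  have "ip (\<psi> x) y = ip x (\<phi> y)" if xy: "x \<in> carrier A" "y \<in> carrier A" for x y
  proof -
    have "ip (\<psi> x) y = cadj A (ip y (\<psi> x))" using adjmD(2)[OF assms] xy by (simp add: ip_adj)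
    also have "\<dots> = cadj A (ip (\<phi> y) x)" using adjmD(3)[OF assms xy(2,1)] by simp
    also have "\<dots> = ip x (\<phi> y)" using adjmD(1)[OF assms] xy by (simp add: ip_adj)
    finally show ?thesis .
  qed
  then show ?thesis using assms by (simp add: adjm_def)
qed

lemma adjm_add: assumes "adjm \<phi> \<psi>" "x \<in> carrier A" "y \<in> carrier A" shows "\<phi> (x \<oplus> y) = \<phi> x \<oplus> \<phi> y"
  by (rule ip_faithful)
    (use assms adjmD(1,2)[OF assms(1)] in \<open>simp_all add: ip_add flip: adjmD(3)[OF adjm_sym[OF assms(1)]]\<close>)

lemma adjm_scale: assumes "adjm \<phi> \<psi>" "x \<in> carrier A" shows "\<phi> (cscale A c x) = cscale A c (\<phi> x)"
  by (rule ip_faithful)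
    (use assms adjmD(1,2)[OF assms(1)] in \<open>simp_all add: ip_scale flip: adjmD(3)[OF adjm_sym[OF assms(1)]]\<close>)

lemma adjm_mult: assumes "adjm \<phi> \<psi>" "x \<in> carrier A" "p \<in> P" shows "\<phi> (x \<otimes> p) = \<phi> x \<otimes> p"
  by (rule ip_faithful)
    (use assms adjmD(1,2)[OF assms(1)] P_carrier[OF assms(3)] in \<open>simp_all add: ip_mult flip: adjmD(3)[OF adjm_sym[OF assms(1)]]\<close>)

lemma adjm_zero: assumes "adjm \<phi> \<psi>" shows "\<phi> \<zero> = \<zero>"
  using adjm_scale[OF assms, of \<zero> 0] adjmD(1)[OF assms, of \<zero>] by simp

lemma adjm_finsum:
  assumes "adjm \<phi> \<psi>" "finite I" "\<And>i. i \<in> I \<Longrightarrow> f i \<in> carrier A"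
  shows "\<phi> (\<Oplus>i\<in>I. f i) = (\<Oplus>i\<in>I. \<phi> (f i))"
  using assms(2,3) by (induction I rule: finite_induct)
    (auto simp: adjm_zero[OF assms(1)] adjm_add[OF assms(1)] Pi_def adjmD[OF assms(1)])

text \<open>A right P-linear map is determined by its values on the u j. This is why every
  adjointable operator is a finite sum of terms x e y.\<close>

lemma adjm_expand:
  assumes a: "adjm \<phi> \<psi>" and x: "x \<in> carrier A"
  shows "\<phi> x = (\<Oplus>j\<in>{..<N}. \<phi> (u j) \<otimes> E (v j \<otimes> x))"
proof -
  have "\<phi> x = \<phi> (\<Oplus>j\<in>{..<N}. u j \<otimes> E (v j \<otimes> x))" using x by (simp add: qb_left)
  also have "\<dots> = (\<Oplus>j\<in>{..<N}. \<phi> (u j \<otimes> E (v j \<otimes> x)))" using x by (intro adjm_finsum[OF a]) auto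
  also have "\<dots> = (\<Oplus>j\<in>{..<N}. \<phi> (u j) \<otimes> E (v j \<otimes> x))"
    using x adjmD[OF a] by (intro finsum_cong') (auto simp: adjm_mult[OF a])
  finally show ?thesis .
qed

lemma adjm_bounded:
  assumes a: "adjm \<phi> \<psi>"
  shows "\<exists>K\<ge>0. \<forall>x\<in>carrier A. cnorm A (\<phi> x) \<le> K * cnorm A x"
proof (intro exI conjI ballI)
  let ?K = "\<Sum>j<N. cnorm A (\<phi> (u j)) * cnorm A (v j)"
  show "0 \<le> ?K" using adjmD[OF a] by (intro sum_nonneg) auto
  fix x assume x [simp]: "x \<in> carrier A"
  have "cnorm A (\<phi> x) \<le> (\<Sum>j<N. cnorm A (\<phi> (u j) \<otimes> E (v j \<otimes> x)))"
    unfolding adjm_expand[OF a x] using adjmD[OF a] by (intro finsum_norm) auto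
  also have "\<dots> \<le> (\<Sum>j<N. cnorm A (\<phi> (u j)) * (cnorm A (v j) * cnorm A x))"
    using adjmD(1)[OF a] by (intro sum_mono norm_mult_le order_trans[OF E_norm norm_mult]) auto
  finally show "cnorm A (\<phi> x) \<le> ?K * cnorm A x" by (simp add: sum_distrib_right mult.assoc)
qed

definition opn :: "('a \<Rightarrow> 'a) \<Rightarrow> real" where
  "opn \<phi> = (SUP a\<in>{a \<in> carrier A. en a \<le> 1}. en (\<phi> a))"

lemma en_zero [simp]: "en \<zero> = 0" by (simp add: en_zero_iff)

lemma opn_bound:
  assumes a: "adjm \<phi> \<psi>" and x: "x \<in> carrier A"
  shows "en (\<phi> x) \<le> opn \<phi> * en x" "0 \<le> opn \<phi>"
proof -
  obtain K where K: "K \<ge> 0" "\<And>x. x \<in> carrier A \<Longrightarrow> cnorm A (\<phi> x) \<le> K * cnorm A x" using adjm_bounded[OF a] by blast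
  have bdd: "bdd_above ((\<lambda>a. en (\<phi> a)) ` {a \<in> carrier A. en a \<le> 1})"
  proof (rule bdd_aboveI2)
    fix y assume y: "y \<in> {a \<in> carrier A. en a \<le> 1}"
    have "en (\<phi> y) \<le> cnorm A (\<phi> y)" using y adjmD[OF a] en_le by auto
    also have "\<dots> \<le> K * cnorm A y" using K y by auto
    also have "\<dots> \<le> K * (M * en y)" using K y norm_le_en by (intro mult_left_mono) auto
    also have "\<dots> \<le> K * (M * 1)" using K y M_pos by (intro mult_left_mono) auto
    finally show "en (\<phi> y) \<le> K * (M * 1)" .
  qed
  have le: "en (\<phi> y) \<le> opn \<phi>" if "y \<in> carrier A" "en y \<le> 1" for y
    unfolding opn_def using that by (intro cSUP_upper[OF _ bdd]) auto
  show "0 \<le> opn \<phi>" using le[of \<zero>] adjm_zero[OF a] by simp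
  show "en (\<phi> x) \<le> opn \<phi> * en x"
  proof (cases "en x = 0")
    case True
    then have "x = \<zero>" using x by (simp add: en_zero_iff)
    then show ?thesis using adjm_zero[OF a] by simp
  next
    case False
    then have e: "en x > 0" using en_nonneg[OF x] by linarith
    let ?y = "cscale A (complex_of_real (1 / en x)) x"
    have "en ?y \<le> 1" using x e by (simp add: en_scale norm_divide)
    then have "en (\<phi> ?y) \<le> opn \<phi>" using le x by simp
    then show ?thesis using e x adjmD[OF a] by (simp add: adjm_scale[OF a] en_scale norm_divide field_simps)
  qed
qed

lemma opn_le:
  assumes "c \<ge> 0" "\<And>x. x \<in> carrier A \<Longrightarrow> en (\<phi> x) \<le> c * en x"
  shows "opn \<phi> \<le> c"
  unfolding opn_def
proof (rule cSUP_least)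
  show "{a \<in> carrier A. en a \<le> 1} \<noteq> {}" using en_zero by (auto intro!: exI[of _ \<zero>])
  fix x assume "x \<in> {a \<in> carrier A. en a \<le> 1}"
  then have x: "x \<in> carrier A" "en x \<le> 1" by auto
  then show "en (\<phi> x) \<le> c" using assms(2)[OF x(1)] mult_left_mono[OF x(2) assms(1)] by simp
qed

abbreviation "LL \<equiv> adjointable_operators A H"

lemma LL_simps:
  "S \<otimes>\<^bsub>LL\<^esub> T = compose (hcarrier H) S T" "\<one>\<^bsub>LL\<^esub> = (\<lambda>X\<in>hcarrier H. X)"
  "\<zero>\<^bsub>LL\<^esub> = (\<lambda>X\<in>hcarrier H. hzero H)" "S \<oplus>\<^bsub>LL\<^esub> T = (\<lambda>X\<in>hcarrier H. hadd H (S X) (T X))"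
  "cscale LL c T = (\<lambda>X\<in>hcarrier H. hscale H c (T X))"
  "cadj LL T = (THE S. S \<in> hcarrier H \<rightarrow>\<^sub>E hcarrier H \<and> is_adjoint H T S)"
  "cnorm LL T = (SUP X\<in>{X \<in> hcarrier H. hnorm A H X \<le> 1}. hnorm A H (T X))"
  by (simp_all add: adjointable_operators_def)

lemma is_adjoint_op:
  assumes "\<And>a. a \<in> carrier A \<Longrightarrow> \<phi> a \<in> carrier A" "\<And>a. a \<in> carrier A \<Longrightarrow> \<psi> a \<in> carrier A"
  shows "is_adjoint H (op \<phi>) (op \<psi>) \<longleftrightarrow> adjm \<phi> \<psi>"
  unfolding is_adjoint_def adjm_def H_carrier using assms by (simp add: H_inner)

lemma LL_carrier: "carrier LL = {op \<phi> | \<phi>. \<exists>\<psi>. adjm \<phi> \<psi>}"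
proof
  show "carrier LL \<subseteq> {op \<phi> | \<phi>. \<exists>\<psi>. adjm \<phi> \<psi>}"
  proof
    fix T assume "T \<in> carrier LL"
    then obtain S where T: "T \<in> hcarrier H \<rightarrow>\<^sub>E hcarrier H" "S \<in> hcarrier H \<rightarrow>\<^sub>E hcarrier H" "is_adjoint H T S"
      by (auto simp: adjointable_operators_def)
    obtain \<phi> where \<phi>: "\<forall>a\<in>carrier A. \<phi> a \<in> carrier A" "T = op \<phi>" using op_surj[OF T(1)] by blast
    obtain \<psi> where \<psi>: "\<forall>a\<in>carrier A. \<psi> a \<in> carrier A" "S = op \<psi>" using op_surj[OF T(2)] by blast
    have "adjm \<phi> \<psi>" using T(3) is_adjoint_op[of \<phi> \<psi>] \<phi> \<psi> by simp
    then show "T \<in> {op \<phi> | \<phi>. \<exists>\<psi>. adjm \<phi> \<psi>}" using \<phi> by blast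
  qed
  show "{op \<phi> | \<phi>. \<exists>\<psi>. adjm \<phi> \<psi>} \<subseteq> carrier LL"
  proof safe
    fix \<phi> \<psi> assume a: "adjm \<phi> \<psi>"
    then have "op \<phi> \<in> hcarrier H \<rightarrow>\<^sub>E hcarrier H" "op \<psi> \<in> hcarrier H \<rightarrow>\<^sub>E hcarrier H" "is_adjoint H (op \<phi>) (op \<psi>)"
      using op_funcset adjmD[OF a] is_adjoint_op by auto
    then show "op \<phi> \<in> carrier LL" by (auto simp: adjointable_operators_def)
  qed
qed

lemma op_LL: "adjm \<phi> \<psi> \<Longrightarrow> op \<phi> \<in> carrier LL" using LL_carrier by blast

lemma LL_obtain: assumes "T \<in> carrier LL" obtains \<phi> \<psi> where "adjm \<phi> \<psi>" "T = op \<phi>"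
  using assms LL_carrier by blast

lemma LL_mult: "(\<And>a. a \<in> carrier A \<Longrightarrow> \<psi> a \<in> carrier A) \<Longrightarrow> op \<phi> \<otimes>\<^bsub>LL\<^esub> op \<psi> = op (\<lambda>x. \<phi> (\<psi> x))"
  unfolding LL_simps by (intro op_eqI) (auto simp: compose_eq H_carrier)

lemma LL_one: "\<one>\<^bsub>LL\<^esub> = op (\<lambda>x. x)"
  unfolding LL_simps by (intro op_eqI) (auto simp: H_carrier)

lemma LL_zero: "\<zero>\<^bsub>LL\<^esub> = op (\<lambda>x. \<zero>)"
  unfolding LL_simps by (intro op_eqI) (auto simp: H_carrier H_zero)

lemma LL_add:
  "\<lbrakk>\<And>a. a \<in> carrier A \<Longrightarrow> \<phi> a \<in> carrier A; \<And>a. a \<in> carrier A \<Longrightarrow> \<psi> a \<in> carrier A\<rbrakk>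
    \<Longrightarrow> op \<phi> \<oplus>\<^bsub>LL\<^esub> op \<psi> = op (\<lambda>x. \<phi> x \<oplus> \<psi> x)"
  unfolding LL_simps by (intro op_eqI) (auto simp: H_carrier H_add)

lemma LL_scale: "(\<And>a. a \<in> carrier A \<Longrightarrow> \<phi> a \<in> carrier A) \<Longrightarrow> cscale LL c (op \<phi>) = op (\<lambda>x. cscale A c (\<phi> x))"
  unfolding LL_simps by (intro op_eqI) (auto simp: H_carrier H_scale)

lemma LL_adj: assumes a: "adjm \<phi> \<psi>" shows "cadj LL (op \<phi>) = op \<psi>"
  unfolding LL_simps
proof (rule the_equality)
  show "op \<psi> \<in> hcarrier H \<rightarrow>\<^sub>E hcarrier H \<and> is_adjoint H (op \<phi>) (op \<psi>)"
    using op_funcset adjmD[OF a] is_adjoint_op a by auto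
  fix S assume S: "S \<in> hcarrier H \<rightarrow>\<^sub>E hcarrier H \<and> is_adjoint H (op \<phi>) S"
  then obtain \<chi> where \<chi>: "\<forall>a\<in>carrier A. \<chi> a \<in> carrier A" "S = op \<chi>" using op_surj by blast
  then have b: "adjm \<phi> \<chi>" using S is_adjoint_op[of \<phi> \<chi>] adjmD[OF a] by simp
  have "\<chi> x = \<psi> x" if "x \<in> carrier A" for x
    by (rule ip_faithful)
      (use that adjmD(1,2)[OF a] adjmD(1,2)[OF b] in \<open>auto simp flip: adjmD(3)[OF a] adjmD(3)[OF b]\<close>)
  then show "S = op \<psi>" using \<chi> adjmD[OF a] op_eq_iff[of \<chi> \<psi>] by simp
qed

lemma LL_norm: assumes a: "adjm \<phi> \<psi>" shows "cnorm LL (op \<phi>) = opn \<phi>"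
proof -
  have "{X \<in> hcarrier H. hnorm A H X \<le> 1} = conv_seqs ` {a \<in> carrier A. en a \<le> 1}"
    by (auto simp: H_carrier H_norm)
  then show ?thesis unfolding LL_simps opn_def using adjmD[OF a]
    by (auto simp: image_image H_norm intro!: arg_cong[where f = Sup] image_cong)
qed

lemma adjm_comp: "\<lbrakk>adjm \<phi> \<psi>; adjm \<phi>' \<psi>'\<rbrakk> \<Longrightarrow> adjm (\<lambda>x. \<phi> (\<phi>' x)) (\<lambda>x. \<psi>' (\<psi> x))"
  by (simp add: adjm_def)
lemma adjm_plus: "\<lbrakk>adjm \<phi> \<psi>; adjm \<phi>' \<psi>'\<rbrakk> \<Longrightarrow> adjm (\<lambda>x. \<phi> x \<oplus> \<phi>' x) (\<lambda>x. \<psi> x \<oplus> \<psi>' x)"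
  by (simp add: adjm_def ip_add)
lemma adjm_scaled: "adjm \<phi> \<psi> \<Longrightarrow> adjm (\<lambda>x. cscale A c (\<phi> x)) (\<lambda>x. cscale A (cnj c) (\<psi> x))"
  by (simp add: adjm_def ip_scale)
lemma adjm_id: "adjm (\<lambda>x. x) (\<lambda>x. x)" by (simp add: adjm_def)
lemma adjm_null: "adjm (\<lambda>x. \<zero>) (\<lambda>x. \<zero>)"
  by (simp add: adjm_def ip_def)

text \<open>Both inequalities come from Cauchy-Schwarz applied to the adjoint relation; together
  they give the C*-identity of the operator norm.\<close>

lemma opn_adj_le: assumes a: "adjm \<phi> \<psi>" shows "opn \<psi> \<le> opn \<phi>" "(opn \<phi>)\<^sup>2 \<le> opn (\<lambda>x. \<psi> (\<phi> x))"
proof -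
  note b = adjm_sym[OF a]
  have c: "adjm (\<lambda>x. \<psi> (\<phi> x)) (\<lambda>x. \<psi> (\<phi> x))" using adjm_comp[OF b a] .
  note n = opn_bound(2)[OF a zero_closed] opn_bound(2)[OF b zero_closed] opn_bound(2)[OF c zero_closed]
  show "opn \<psi> \<le> opn \<phi>"
  proof (rule opn_le[OF n(1)])
    fix x assume x: "x \<in> carrier A"
    have y: "\<psi> x \<in> carrier A" "\<phi> (\<psi> x) \<in> carrier A" using adjmD[OF a] x by auto
    have "(en (\<psi> x))\<^sup>2 = cnorm A (ip (\<phi> (\<psi> x)) x)" using x y adjmD(3)[OF a] by (simp add: en_sq)
    also have "\<dots> \<le> en (\<phi> (\<psi> x)) * en x" using x y by (intro cauchy_schwarz)
    also have "\<dots> \<le> (opn \<phi> * en (\<psi> x)) * en x" using opn_bound(1)[OF a y(1)] x by (intro mult_right_mono) auto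
    finally have "en (\<psi> x) * en (\<psi> x) \<le> (opn \<phi> * en x) * en (\<psi> x)" by (simp add: power2_eq_square ac_simps)
    then show "en (\<psi> x) \<le> opn \<phi> * en x"
      using en_nonneg[OF y(1)] n(1) en_nonneg[OF x] by (cases "en (\<psi> x) = 0") auto
  qed
  have "opn \<phi> \<le> sqrt (opn (\<lambda>x. \<psi> (\<phi> x)))"
  proof (rule opn_le)
    fix x assume x: "x \<in> carrier A"
    have y: "\<phi> x \<in> carrier A" "\<psi> (\<phi> x) \<in> carrier A" using adjmD[OF a] x by auto
    have "(en (\<phi> x))\<^sup>2 = cnorm A (ip x (\<psi> (\<phi> x)))" using x y adjmD(3)[OF a] by (simp add: en_sq)
    also have "\<dots> \<le> en x * en (\<psi> (\<phi> x))" using x y by (intro cauchy_schwarz)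
    also have "\<dots> \<le> en x * (opn (\<lambda>x. \<psi> (\<phi> x)) * en x)" using opn_bound(1)[OF c x] x by (intro mult_left_mono) auto
    finally have "(en (\<phi> x))\<^sup>2 \<le> (sqrt (opn (\<lambda>x. \<psi> (\<phi> x))) * en x)\<^sup>2" using n(3) by (simp add: power_mult_distrib power2_eq_square ac_simps)
    then show "en (\<phi> x) \<le> sqrt (opn (\<lambda>x. \<psi> (\<phi> x))) * en x" by (rule power2_le_imp_le) (use n(3) x in simp)
  qed (use n(3) in simp)
  then show "(opn \<phi>)\<^sup>2 \<le> opn (\<lambda>x. \<psi> (\<phi> x))" using n by (metis power_mono real_sqrt_pow2)
qed

lemma LL_ring: "ring LL"
proof (rule ringI)
  note ad = adjmD adjm_comp adjm_plus adjm_scaled adjm_id adjm_null op_LL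
  have neg: "op (\<lambda>x. \<ominus> \<phi> x) \<in> carrier LL" if "adjm \<phi> \<psi>" for \<phi> \<psi>
    using op_LL[OF adjm_scaled[OF that, of "-1"]] op_eq_iff[of "\<lambda>x. \<ominus> \<phi> x" "\<lambda>x. cscale A (-1) (\<phi> x)"] adjmD[OF that]
    by (simp add: scale_minus1)
  show "abelian_group LL"
  proof (rule abelian_groupI)
    show "\<zero>\<^bsub>LL\<^esub> \<in> carrier LL" unfolding LL_zero using adjm_null op_LL by blast
    fix S assume "S \<in> carrier LL"
    then obtain \<phi> \<psi> where S: "adjm \<phi> \<psi>" "S = op \<phi>" by (rule LL_obtain)
    note Sc [simp] = adjmD(1)[OF S(1)]
    show "\<zero>\<^bsub>LL\<^esub> \<oplus>\<^bsub>LL\<^esub> S = S" unfolding S(2) LL_zero by (simp add: LL_add op_eq_iff)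
    show "\<exists>y\<in>carrier LL. y \<oplus>\<^bsub>LL\<^esub> S = \<zero>\<^bsub>LL\<^esub>"
      using neg[OF S(1)] unfolding S(2) LL_zero by (intro bexI[of _ "op (\<lambda>x. \<ominus> \<phi> x)"]) (simp_all add: LL_add op_eq_iff l_neg)
    fix T assume "T \<in> carrier LL"
    then obtain \<phi>' \<psi>' where T: "adjm \<phi>' \<psi>'" "T = op \<phi>'" by (rule LL_obtain)
    note Tc [simp] = adjmD(1)[OF T(1)]
    show "S \<oplus>\<^bsub>LL\<^esub> T \<in> carrier LL" unfolding S(2) T(2) using op_LL[OF adjm_plus[OF S(1) T(1)]] by (simp add: LL_add)
    show "S \<oplus>\<^bsub>LL\<^esub> T = T \<oplus>\<^bsub>LL\<^esub> S" unfolding S(2) T(2) by (simp add: LL_add op_eq_iff a_comm)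
    fix R assume "R \<in> carrier LL"
    then obtain \<phi>'' \<psi>'' where R: "adjm \<phi>'' \<psi>''" "R = op \<phi>''" by (rule LL_obtain)
    note Rc [simp] = adjmD(1)[OF R(1)]
    show "S \<oplus>\<^bsub>LL\<^esub> T \<oplus>\<^bsub>LL\<^esub> R = S \<oplus>\<^bsub>LL\<^esub> (T \<oplus>\<^bsub>LL\<^esub> R)"
      unfolding S(2) T(2) R(2) by (simp add: LL_add op_eq_iff a_assoc)
  qed
  show "monoid LL"
  proof (rule monoidI)
    show "\<one>\<^bsub>LL\<^esub> \<in> carrier LL" unfolding LL_one using adjm_id op_LL by blast
    fix S assume "S \<in> carrier LL"
    then obtain \<phi> \<psi> where S: "adjm \<phi> \<psi>" "S = op \<phi>" by (rule LL_obtain)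
    note Sc [simp] = adjmD(1)[OF S(1)]
    show "\<one>\<^bsub>LL\<^esub> \<otimes>\<^bsub>LL\<^esub> S = S" "S \<otimes>\<^bsub>LL\<^esub> \<one>\<^bsub>LL\<^esub> = S" unfolding S(2) LL_one by (simp_all add: LL_mult)
    fix T assume "T \<in> carrier LL"
    then obtain \<phi>' \<psi>' where T: "adjm \<phi>' \<psi>'" "T = op \<phi>'" by (rule LL_obtain)
    note Tc [simp] = adjmD(1)[OF T(1)]
    show "S \<otimes>\<^bsub>LL\<^esub> T \<in> carrier LL" unfolding S(2) T(2) using op_LL[OF adjm_comp[OF S(1) T(1)]] by (simp add: LL_mult)
    fix R assume "R \<in> carrier LL"
    then obtain \<phi>'' \<psi>'' where R: "adjm \<phi>'' \<psi>''" "R = op \<phi>''" by (rule LL_obtain)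
    note Rc [simp] = adjmD(1)[OF R(1)]
    show "S \<otimes>\<^bsub>LL\<^esub> T \<otimes>\<^bsub>LL\<^esub> R = S \<otimes>\<^bsub>LL\<^esub> (T \<otimes>\<^bsub>LL\<^esub> R)"
      unfolding S(2) T(2) R(2) by (simp add: LL_mult)
  qed
  fix S T R assume "S \<in> carrier LL" "T \<in> carrier LL" "R \<in> carrier LL"
  then obtain \<phi> \<psi> \<phi>' \<psi>' \<phi>'' \<psi>'' where S: "adjm \<phi> \<psi>" "S = op \<phi>" and T: "adjm \<phi>' \<psi>'" "T = op \<phi>'"
    and R: "adjm \<phi>'' \<psi>''" "R = op \<phi>''" by (meson LL_obtain)
  note [simp] = adjmD(1)[OF S(1)] adjmD(1)[OF T(1)] adjmD(1)[OF R(1)]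
  show "(S \<oplus>\<^bsub>LL\<^esub> T) \<otimes>\<^bsub>LL\<^esub> R = S \<otimes>\<^bsub>LL\<^esub> R \<oplus>\<^bsub>LL\<^esub> T \<otimes>\<^bsub>LL\<^esub> R"
    unfolding S(2) T(2) R(2) by (simp add: LL_mult LL_add)
  show "R \<otimes>\<^bsub>LL\<^esub> (S \<oplus>\<^bsub>LL\<^esub> T) = R \<otimes>\<^bsub>LL\<^esub> S \<oplus>\<^bsub>LL\<^esub> R \<otimes>\<^bsub>LL\<^esub> T"
    unfolding S(2) T(2) R(2) by (simp add: LL_mult LL_add op_eq_iff adjm_add[OF R(1)])
qed

lemma LL_diff:
  assumes "adjm \<phi> \<psi>" "adjm \<phi>' \<psi>'" shows "op \<phi> \<ominus>\<^bsub>LL\<^esub> op \<phi>' = op (\<lambda>x. \<phi> x \<ominus> \<phi>' x)" "adjm (\<lambda>x. \<phi> x \<ominus> \<phi>' x) (\<lambda>x. \<psi> x \<ominus> \<psi>' x)"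
proof -
  interpret L: ring LL by (rule LL_ring)
  note [simp] = adjmD(1,2)[OF assms(1)] adjmD(1,2)[OF assms(2)]
  show a: "adjm (\<lambda>x. \<phi> x \<ominus> \<phi>' x) (\<lambda>x. \<psi> x \<ominus> \<psi>' x)"
    using assms unfolding adjm_def by (simp add: ip_diff)
  have "op \<phi> = op (\<lambda>x. \<phi> x \<ominus> \<phi>' x) \<oplus>\<^bsub>LL\<^esub> op \<phi>'"
    by (simp add: LL_add op_eq_iff minus_eq a_assoc l_neg)
  then have "op \<phi> \<ominus>\<^bsub>LL\<^esub> op \<phi>' = (op (\<lambda>x. \<phi> x \<ominus> \<phi>' x) \<oplus>\<^bsub>LL\<^esub> op \<phi>') \<ominus>\<^bsub>LL\<^esub> op \<phi>'" by simp
  also have "\<dots> = op (\<lambda>x. \<phi> x \<ominus> \<phi>' x)"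
    using op_LL[OF a] op_LL[OF assms(2)] by (simp add: L.minus_eq L.a_assoc L.r_neg)
  finally show "op \<phi> \<ominus>\<^bsub>LL\<^esub> op \<phi>' = op (\<lambda>x. \<phi> x \<ominus> \<phi>' x)" .
qed

text \<open>A limit operator must again have an adjoint, so the adjoints are carried along: by
  \<open>opn_adj_le\<close> they are Cauchy at the same rate, and the adjoint relation passes to the
  two pointwise limits.\<close>

lemma LL_complete:
  assumes s: "\<And>n. s n \<in> carrier LL"
    and C: "\<And>\<epsilon>. 0 < \<epsilon> \<Longrightarrow> \<exists>N. \<forall>m\<ge>N. \<forall>n\<ge>N. cnorm LL (s m \<ominus>\<^bsub>LL\<^esub> s n) < \<epsilon>"
  shows "\<exists>T\<in>carrier LL. ctendsto LL s T"
proof -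
  have "\<exists>\<phi> \<psi>. adjm \<phi> \<psi> \<and> s n = op \<phi>" for n using s[of n] unfolding LL_carrier by blast
  then obtain \<phi> \<psi> where a: "\<And>n. adjm (\<phi> n) (\<psi> n)" "\<And>n. s n = op (\<phi> n)" by metis
  note [simp] = adjmD(1,2)[OF a(1)]
  have nd: "cnorm LL (s m \<ominus>\<^bsub>LL\<^esub> s n) = opn (\<lambda>x. \<phi> m x \<ominus> \<phi> n x)" for m n
    unfolding a(2) using LL_diff[OF a(1) a(1)] LL_norm by metis
  have od: "opn (\<lambda>x. \<psi> m x \<ominus> \<psi> n x) \<le> opn (\<lambda>x. \<phi> m x \<ominus> \<phi> n x)" for m n
    using opn_adj_le(1)[OF LL_diff(2)[OF a(1) a(1)]] .
  have lim: "\<exists>y\<in>carrier A. ctendsto A (\<lambda>n. \<chi> n x) y"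
    if x: "x \<in> carrier A" and \<chi>: "\<And>n. adjm (\<chi> n) (\<chi>' n)" and le: "\<And>m n. opn (\<lambda>x. \<chi> m x \<ominus> \<chi> n x) \<le> opn (\<lambda>x. \<phi> m x \<ominus> \<phi> n x)"
    for \<chi> \<chi>' x
  proof (rule complete)
    show "\<chi> n x \<in> carrier A" for n using adjmD[OF \<chi>] x by blast
    fix \<epsilon> :: real assume "0 < \<epsilon>"
    have p: "M * (en x + 1) > 0" using M_pos en_nonneg[OF x] by (simp add: add_nonneg_pos)
    then have "0 < \<epsilon> / (M * (en x + 1))" using \<open>0 < \<epsilon>\<close> by simp
    then obtain N where N: "\<And>m n. \<lbrakk>m \<ge> N; n \<ge> N\<rbrakk> \<Longrightarrow> opn (\<lambda>x. \<phi> m x \<ominus> \<phi> n x) < \<epsilon> / (M * (en x + 1))"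
      using C unfolding nd by blast
    have "cnorm A (\<chi> m x \<ominus> \<chi> n x) < \<epsilon>" if "m \<ge> N" "n \<ge> N" for m n
    proof -
      have c: "\<chi> m x \<ominus> \<chi> n x \<in> carrier A" using adjmD[OF \<chi>] x by blast
      have "cnorm A (\<chi> m x \<ominus> \<chi> n x) \<le> M * en (\<chi> m x \<ominus> \<chi> n x)" by (rule norm_le_en[OF c])
      also have "\<dots> \<le> M * (opn (\<lambda>x. \<chi> m x \<ominus> \<chi> n x) * en x)"
        using opn_bound(1)[OF LL_diff(2)[OF \<chi> \<chi>] x] M_pos by (intro mult_left_mono) auto
      also have "\<dots> \<le> M * (opn (\<lambda>x. \<phi> m x \<ominus> \<phi> n x) * (en x + 1))"
        using le M_pos x opn_bound(2)[OF LL_diff(2)[OF a(1) a(1)] x] by (intro mult_left_mono mult_mono) auto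
      also have "\<dots> < \<epsilon>" using N[OF that] p by (simp add: pos_less_divide_eq ac_simps)
      finally show ?thesis .
    qed
    then show "\<exists>N. \<forall>m\<ge>N. \<forall>n\<ge>N. cnorm A (\<chi> m x \<ominus> \<chi> n x) < \<epsilon>" by blast
  qed
  have "\<exists>y\<in>carrier A. ctendsto A (\<lambda>n. \<phi> n x) y" if "x \<in> carrier A" for x
    using lim[OF that a(1)] by simp
  then obtain \<phi>0 where f: "\<And>x. x \<in> carrier A \<Longrightarrow> \<phi>0 x \<in> carrier A" "\<And>x. x \<in> carrier A \<Longrightarrow> ctendsto A (\<lambda>n. \<phi> n x) (\<phi>0 x)"
    by metis
  have "\<exists>y\<in>carrier A. ctendsto A (\<lambda>n. \<psi> n x) y" if "x \<in> carrier A" for x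
    using lim[OF that adjm_sym[OF a(1)]] od by simp
  then obtain \<psi>0 where g: "\<And>x. x \<in> carrier A \<Longrightarrow> \<psi>0 x \<in> carrier A" "\<And>x. x \<in> carrier A \<Longrightarrow> ctendsto A (\<lambda>n. \<psi> n x) (\<psi>0 x)"
    by metis
  have ad: "adjm \<phi>0 \<psi>0"
    unfolding adjm_def
  proof (intro conjI ballI f g)
    fix x y assume x: "x \<in> carrier A" and y: "y \<in> carrier A"
    have "ctendsto A (\<lambda>n. ip (\<phi> n x) y) (ip (\<phi>0 x) y)"
      unfolding ip_def using f x y by (intro E_ctendsto ctendsto_mult ctendsto_adj ctendsto_const) auto
    moreover have "ctendsto A (\<lambda>n. ip (\<phi> n x) y) (ip x (\<psi>0 y))"
      unfolding adjmD(3)[OF a(1) x y] unfolding ip_def using g x y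
      by (intro E_ctendsto ctendsto_mult ctendsto_const) auto
    ultimately show "ip (\<phi>0 x) y = ip x (\<psi>0 y)"
      by (rule ctendsto_unique) (use x y f g in auto)
  qed
  have "(\<lambda>n. cnorm LL (s n \<ominus>\<^bsub>LL\<^esub> op \<phi>0)) \<longlonglongrightarrow> 0"
  proof (rule LIMSEQ_I)
    fix \<epsilon> :: real assume e: "0 < \<epsilon>"
    then obtain N where N: "\<And>m n. \<lbrakk>m \<ge> N; n \<ge> N\<rbrakk> \<Longrightarrow> opn (\<lambda>x. \<phi> m x \<ominus> \<phi> n x) < \<epsilon>/2"
      using C[of "\<epsilon>/2"] unfolding nd by auto
    have "norm (cnorm LL (s n \<ominus>\<^bsub>LL\<^esub> op \<phi>0) - 0) < \<epsilon>" if n: "n \<ge> N" for n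
    proof -
      have d: "adjm (\<lambda>x. \<phi> n x \<ominus> \<phi>0 x) (\<lambda>x. \<psi> n x \<ominus> \<psi>0 x)" by (rule LL_diff(2)[OF a(1) ad])
      have "opn (\<lambda>x. \<phi> n x \<ominus> \<phi>0 x) \<le> \<epsilon>/2"
      proof (rule opn_le)
        fix x assume x: "x \<in> carrier A"
        have "ctendsto A (\<lambda>m. \<phi> n x \<ominus> \<phi> m x) (\<phi> n x \<ominus> \<phi>0 x)"
          using f x by (intro ctendsto_diff ctendsto_const) auto
        then have "ctendsto A (\<lambda>m. ip (\<phi> n x \<ominus> \<phi> m x) (\<phi> n x \<ominus> \<phi> m x)) (ip (\<phi> n x \<ominus> \<phi>0 x) (\<phi> n x \<ominus> \<phi>0 x))"
          unfolding ip_def using f x by (intro E_ctendsto ctendsto_mult ctendsto_adj) auto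
        then have "(\<lambda>m. (en (\<phi> n x \<ominus> \<phi> m x))\<^sup>2) \<longlonglongrightarrow> (en (\<phi> n x \<ominus> \<phi>0 x))\<^sup>2"
          using ctendsto_norm[of "\<lambda>m. ip (\<phi> n x \<ominus> \<phi> m x) (\<phi> n x \<ominus> \<phi> m x)"] f x by (simp add: en_sq)
        moreover have "(en (\<phi> n x \<ominus> \<phi> m x))\<^sup>2 \<le> (\<epsilon>/2 * en x)\<^sup>2" if "m \<ge> N" for m
        proof (rule power_mono)
          have "en (\<phi> n x \<ominus> \<phi> m x) \<le> opn (\<lambda>x. \<phi> n x \<ominus> \<phi> m x) * en x"
            by (rule opn_bound(1)[OF LL_diff(2)[OF a(1) a(1)] x])
          also have "\<dots> \<le> \<epsilon>/2 * en x" using N[OF n that] x by (intro mult_right_mono) auto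
          finally show "en (\<phi> n x \<ominus> \<phi> m x) \<le> \<epsilon>/2 * en x" .
        qed (use x f in auto)
        ultimately have "(en (\<phi> n x \<ominus> \<phi>0 x))\<^sup>2 \<le> (\<epsilon>/2 * en x)\<^sup>2"
          by (intro LIMSEQ_le_const2) auto
        then show "en (\<phi> n x \<ominus> \<phi>0 x) \<le> \<epsilon>/2 * en x" by (rule power2_le_imp_le) (use e x in auto)
      qed (use e in simp)
      moreover have "cnorm LL (s n \<ominus>\<^bsub>LL\<^esub> op \<phi>0) = opn (\<lambda>x. \<phi> n x \<ominus> \<phi>0 x)"
        unfolding a(2) LL_diff(1)[OF a(1) ad] by (rule LL_norm[OF d])
      moreover have "0 \<le> opn (\<lambda>x. \<phi> n x \<ominus> \<phi>0 x)" using opn_bound(2)[OF d zero_closed] .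
      ultimately show ?thesis using e by simp
    qed
    then show "\<exists>no. \<forall>n\<ge>no. norm (cnorm LL (s n \<ominus>\<^bsub>LL\<^esub> op \<phi>0) - 0) < \<epsilon>" by blast
  qed
  then show ?thesis using op_LL[OF ad] by (intro bexI[of _ "op \<phi>0"]) (auto simp: ctendsto_def)
qed

lemma LL_cstar: "cstar_algebra LL"
proof (intro cstar_algebra.intro cstar_algebra_axioms.intro LL_ring, goal_cases)
  case (1 x c)
  then show ?case using op_LL[OF adjm_scaled] by (auto elim!: LL_obtain simp: LL_scale adjmD)
next
  case (2 x)
  then show ?case by (auto elim!: LL_obtain simp: LL_scale adjmD op_eq_iff)
next
  case (3 x c d)
  then show ?case by (auto elim!: LL_obtain simp: LL_scale adjmD op_eq_iff scale_scale)
next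
  case (4 x c d)
  then show ?case by (auto elim!: LL_obtain simp: LL_scale LL_add adjmD op_eq_iff scale_add_left)
next
  case (5 x y c)
  then obtain \<phi> \<psi> \<phi>' \<psi>' where S: "adjm \<phi> \<psi>" "x = op \<phi>" "adjm \<phi>' \<psi>'" "y = op \<phi>'" by (meson LL_obtain)
  show ?case using adjmD[OF S(1)] adjmD[OF S(3)] unfolding S by (simp add: LL_scale LL_add op_eq_iff scale_add_right)
next
  case (6 x y c)
  then obtain \<phi> \<psi> \<phi>' \<psi>' where S: "adjm \<phi> \<psi>" "x = op \<phi>" "adjm \<phi>' \<psi>'" "y = op \<phi>'" by (meson LL_obtain)
  show ?case using adjmD[OF S(1)] adjmD[OF S(3)] unfolding S by (simp add: LL_scale LL_mult)
next
  case (7 x y c)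
  then obtain \<phi> \<psi> \<phi>' \<psi>' where S: "adjm \<phi> \<psi>" "x = op \<phi>" "adjm \<phi>' \<psi>'" "y = op \<phi>'" by (meson LL_obtain)
  show ?case using adjmD[OF S(1)] adjmD[OF S(3)] unfolding S
    by (simp add: LL_scale LL_mult op_eq_iff adjm_scale[OF S(1)])
next
  case (8 x)
  then obtain \<phi> \<psi> where S: "adjm \<phi> \<psi>" "x = op \<phi>" by (meson LL_obtain)
  show ?case unfolding S LL_adj[OF S(1)] by (rule op_LL[OF adjm_sym[OF S(1)]])
next
  case (9 x)
  then obtain \<phi> \<psi> where S: "adjm \<phi> \<psi>" "x = op \<phi>" by (meson LL_obtain)
  show ?case unfolding S LL_adj[OF S(1)] LL_adj[OF adjm_sym[OF S(1)]] ..
next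
  case (10 x y)
  then obtain \<phi> \<psi> \<phi>' \<psi>' where S: "adjm \<phi> \<psi>" "x = op \<phi>" "adjm \<phi>' \<psi>'" "y = op \<phi>'" by (meson LL_obtain)
  show ?case using adjmD[OF S(1)] adjmD[OF S(3)] unfolding S LL_adj[OF S(1)] LL_adj[OF S(3)]
    by (simp add: LL_add LL_adj[OF adjm_plus[OF S(1,3)]])
next
  case (11 x y)
  then obtain \<phi> \<psi> \<phi>' \<psi>' where S: "adjm \<phi> \<psi>" "x = op \<phi>" "adjm \<phi>' \<psi>'" "y = op \<phi>'" by (meson LL_obtain)
  show ?case using adjmD[OF S(1)] adjmD[OF S(3)] unfolding S LL_adj[OF S(1)] LL_adj[OF S(3)]
    by (simp add: LL_mult LL_adj[OF adjm_comp[OF S(1,3)]])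
next
  case (12 x c)
  then obtain \<phi> \<psi> where S: "adjm \<phi> \<psi>" "x = op \<phi>" by (meson LL_obtain)
  show ?case using adjmD[OF S(1)] unfolding S LL_adj[OF S(1)]
    by (simp add: LL_scale LL_adj[OF adjm_scaled[OF S(1)]])
next
  case (13 x)
  then obtain \<phi> \<psi> where S: "adjm \<phi> \<psi>" "x = op \<phi>" by (meson LL_obtain)
  show ?case unfolding S LL_norm[OF S(1)] by (rule opn_bound(2)[OF S(1) zero_closed])
next
  case (14 x)
  then obtain \<phi> \<psi> where S: "adjm \<phi> \<psi>" "x = op \<phi>" by (meson LL_obtain)
  have "\<phi> y = \<zero>" if "opn \<phi> = 0" "y \<in> carrier A" for y
    using opn_bound(1)[OF S(1) that(2)] that(1) en_nonneg[OF adjmD(1)[OF S(1) that(2)]]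
      en_zero_iff[OF adjmD(1)[OF S(1) that(2)]] by simp
  then have "opn \<phi> = 0 \<Longrightarrow> op \<phi> = op (\<lambda>_. \<zero>)" using adjmD[OF S(1)] by (simp add: op_eq_iff)
  moreover have "opn \<phi> = 0" if "op \<phi> = op (\<lambda>_. \<zero>)"
  proof -
    have "opn \<phi> \<le> 0" using that adjmD[OF S(1)] by (intro opn_le) (simp_all add: op_eq_iff)
    then show ?thesis using opn_bound(2)[OF S(1) zero_closed] by simp
  qed
  ultimately show ?case unfolding S LL_norm[OF S(1)] LL_zero by blast
next
  case (15 x c)
  then obtain \<phi> \<psi> where S: "adjm \<phi> \<psi>" "x = op \<phi>" by (meson LL_obtain)
  have sc: "adjm (\<lambda>x. cscale A c (\<phi> x)) (\<lambda>x. cscale A (cnj c) (\<psi> x))" by (rule adjm_scaled[OF S(1)])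
  note [simp] = adjmD(1)[OF S(1)]
  have 1: "opn (\<lambda>x. cscale A c (\<phi> x)) \<le> cmod c * opn \<phi>"
    using opn_bound[OF S(1)] by (intro opn_le) (auto simp: en_scale mult.assoc intro!: mult_left_mono mult_nonneg_nonneg)
  have "cmod c * opn \<phi> \<le> opn (\<lambda>x. cscale A c (\<phi> x))"
  proof (cases "c = 0")
    case False
    have "opn \<phi> \<le> opn (\<lambda>x. cscale A c (\<phi> x)) / cmod c"
    proof (rule opn_le)
      show "0 \<le> opn (\<lambda>x. cscale A c (\<phi> x)) / cmod c" using opn_bound(2)[OF sc zero_closed] by simp
      fix x assume x: "x \<in> carrier A"
      show "en (\<phi> x) \<le> opn (\<lambda>x. cscale A c (\<phi> x)) / cmod c * en x"
        using opn_bound(1)[OF sc x] x False by (simp add: en_scale field_simps)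
    qed
    then show ?thesis using False by (simp add: field_simps)
  qed (use opn_bound(2)[OF sc zero_closed] in simp)
  then show ?case using 1 unfolding S LL_norm[OF S(1)] by (simp add: LL_scale LL_norm[OF sc])
next
  case (16 x y)
  then obtain \<phi> \<psi> \<phi>' \<psi>' where S: "adjm \<phi> \<psi>" "x = op \<phi>" "adjm \<phi>' \<psi>'" "y = op \<phi>'" by (meson LL_obtain)
  note [simp] = adjmD(1)[OF S(1)] adjmD(1)[OF S(3)]
  have "opn (\<lambda>x. \<phi> x \<oplus> \<phi>' x) \<le> opn \<phi> + opn \<phi>'"
  proof (rule opn_le)
    show "0 \<le> opn \<phi> + opn \<phi>'" using opn_bound(2)[OF S(1) zero_closed] opn_bound(2)[OF S(3) zero_closed] by simp
    fix x assume x: "x \<in> carrier A"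
    show "en (\<phi> x \<oplus> \<phi>' x) \<le> (opn \<phi> + opn \<phi>') * en x"
      using en_triangle[of "\<phi> x" "\<phi>' x"] opn_bound(1)[OF S(1) x] opn_bound(1)[OF S(3) x] x
      by (simp add: distrib_right)
  qed
  then show ?case unfolding S by (simp add: LL_add LL_norm[OF S(1)] LL_norm[OF S(3)] LL_norm[OF adjm_plus[OF S(1,3)]])
next
  case (17 x y)
  then obtain \<phi> \<psi> \<phi>' \<psi>' where S: "adjm \<phi> \<psi>" "x = op \<phi>" "adjm \<phi>' \<psi>'" "y = op \<phi>'" by (meson LL_obtain)
  note [simp] = adjmD(1)[OF S(1)] adjmD(1)[OF S(3)]
  note nn = opn_bound(2)[OF S(1) zero_closed] opn_bound(2)[OF S(3) zero_closed]
  have "opn (\<lambda>x. \<phi> (\<phi>' x)) \<le> opn \<phi> * opn \<phi>'"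
  proof (rule opn_le)
    show "0 \<le> opn \<phi> * opn \<phi>'" using nn by simp
    fix x assume x: "x \<in> carrier A"
    have "en (\<phi> (\<phi>' x)) \<le> opn \<phi> * en (\<phi>' x)" using opn_bound(1)[OF S(1)] x by simp
    also have "\<dots> \<le> opn \<phi> * (opn \<phi>' * en x)" using opn_bound(1)[OF S(3) x] nn by (intro mult_left_mono)
    finally show "en (\<phi> (\<phi>' x)) \<le> opn \<phi> * opn \<phi>' * en x" by (simp add: mult.assoc)
  qed
  then show ?case unfolding S by (simp add: LL_mult LL_norm[OF S(1)] LL_norm[OF S(3)] LL_norm[OF adjm_comp[OF S(1,3)]])
next
  case (18 x)
  then obtain \<phi> \<psi> where S: "adjm \<phi> \<psi>" "x = op \<phi>" by (meson LL_obtain)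
  note T = adjm_sym[OF S(1)]
  note [simp] = adjmD(1)[OF S(1)] adjmD(1)[OF T]
  note nn = opn_bound(2)[OF S(1) zero_closed] opn_bound(2)[OF T zero_closed]
  have "opn (\<lambda>x. \<psi> (\<phi> x)) \<le> opn \<psi> * opn \<phi>"
  proof (rule opn_le)
    show "0 \<le> opn \<psi> * opn \<phi>" using nn by simp
    fix x assume x: "x \<in> carrier A"
    have "en (\<psi> (\<phi> x)) \<le> opn \<psi> * en (\<phi> x)" using opn_bound(1)[OF T] x by simp
    also have "\<dots> \<le> opn \<psi> * (opn \<phi> * en x)" using opn_bound(1)[OF S(1) x] nn by (intro mult_left_mono)
    finally show "en (\<psi> (\<phi> x)) \<le> opn \<psi> * opn \<phi> * en x" by (simp add: mult.assoc)
  qed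
  also have "\<dots> \<le> opn \<phi> * opn \<phi>" using opn_adj_le(1)[OF S(1)] nn by (intro mult_right_mono)
  finally have "opn (\<lambda>x. \<psi> (\<phi> x)) = (opn \<phi>)\<^sup>2" using opn_adj_le(2)[OF S(1)] by (simp add: power2_eq_square)
  then show ?case unfolding S LL_adj[OF S(1)] by (simp add: LL_mult LL_norm[OF S(1)] LL_norm[OF adjm_comp[OF T S(1)]])
next
  case (19 s)
  then show ?case by (rule LL_complete)
qed

end

section \<open>Finite sums, inverse square roots and comparison of powers\<close>

lemma (in cstar_algebra) finsum_swap:
  assumes "finite I" "finite J" "\<And>i j. \<lbrakk>i \<in> I; j \<in> J\<rbrakk> \<Longrightarrow> f i j \<in> carrier A"
  shows "(\<Oplus>i\<in>I. \<Oplus>j\<in>J. f i j) = (\<Oplus>j\<in>J. \<Oplus>i\<in>I. f i j)"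
  using assms(1,3)
proof (induction I rule: finite_induct)
  case empty
  have "(\<Oplus>j\<in>J. \<zero>) = \<zero>" by (rule finsum_zero)
  then show ?case by simp
next
  case (insert i I)
  have "(\<Oplus>j\<in>J. \<Oplus>i\<in>insert i I. f i j) = (\<Oplus>j\<in>J. f i j \<oplus> (\<Oplus>i\<in>I. f i j))"
    using insert by (intro finsum_cong') (auto simp: Pi_def)
  also have "\<dots> = (\<Oplus>j\<in>J. f i j) \<oplus> (\<Oplus>j\<in>J. \<Oplus>i\<in>I. f i j)"
    using insert by (intro finsum_addf) auto
  finally show ?case using insert by (simp add: Pi_def)
qed

lemma (in cstar_algebra) npos_summand_le:
  assumes "finite I" "\<And>i. i \<in> I \<Longrightarrow> f i \<in> npos A" "j \<in> I"
  shows "cnorm A (f j) \<le> cnorm A (\<Oplus>i\<in>I. f i)"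
proof -
  have I: "I = insert j (I - {j})" using assms(3) by auto
  have rest: "(\<Oplus>i\<in>I - {j}. f i) \<in> npos A" using assms by (intro npos_finsum) auto
  have "(\<Oplus>i\<in>I. f i) = f j \<oplus> (\<Oplus>i\<in>I - {j}. f i)"
    by (subst I, subst finsum_insert) (use assms in auto)
  moreover have "(f j \<oplus> (\<Oplus>i\<in>I - {j}. f i)) \<ominus> f j = (\<Oplus>i\<in>I - {j}. f i)"
    using npos_closed[OF rest] npos_closed[OF assms(2)[OF assms(3)]] by algebra
  ultimately show ?thesis using assms rest by (intro npos_norm_mono) auto
qed

text \<open>That R - 1 is positive puts R/s within 1 - 1/s of the unit, so R is invertible, hence
  its root is too, and K is the inverse of the root. It serves to normalise a sum of squares to
  1.\<close>

lemma (in cstar_algebra) inverse_sqrt: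
  assumes R: "R \<in> npos A" and R1: "R \<ominus> \<one> \<in> npos A"
  shows "\<exists>K\<in>csa A. K \<otimes> R \<otimes> K = \<one>"
proof -
  have Rc [simp]: "R \<in> carrier A" using R by simp
  define s where "s = cnorm A R + 1"
  have s: "s > 0" "s \<ge> 1" "cnorm A R \<le> s" using norm_nonneg[OF Rc] by (auto simp: s_def simp del: norm_nonneg)
  let ?c = "complex_of_real (1/s)"
  have "\<one> \<ominus> cscale A ?c R = cscale A ?c (creal A s \<ominus> R)"
    using s by (simp add: scale_diff_right scale_scale)
  then have p: "\<one> \<ominus> cscale A ?c R \<in> npos A"
    using npos_scale[OF real_minus_npos[OF npos_csa[OF R] s(3)], of "1/s"] s by simp
  have gen: "(y \<ominus> c) \<ominus> (y \<ominus> r) = r \<ominus> c" if "y \<in> carrier A" "c \<in> carrier A" "r \<in> carrier A" for y c r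
    using that by algebra
  have "creal A (1 - 1/s) \<ominus> (\<one> \<ominus> cscale A ?c R) = cscale A ?c (R \<ominus> \<one>)"
    by (simp add: scale_diff_left scale_diff_right gen)
  then have "creal A (1 - 1/s) \<ominus> (\<one> \<ominus> cscale A ?c R) \<in> npos A"
    using npos_scale[OF R1, of "1/s"] s by simp
  then have "cnorm A (\<one> \<ominus> cscale A ?c R) \<le> 1 - 1/s" using p s by (intro npos_le_real) auto
  then have "cnorm A (\<one> \<ominus> cscale A ?c R) < 1"
    using s by (smt (verit) divide_pos_pos)
  then have "cscale A ?c R \<in> Units A" by (intro invertible_near_one) auto
  then obtain y where y [simp]: "y \<in> carrier A" and yR: "y \<otimes> cscale A ?c R = \<one>" "cscale A ?c R \<otimes> y = \<one>"
    unfolding Units_def by blast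
  obtain k where k: "k \<in> npos A" "k \<otimes> k = R" using npos_sqrt[OF R] by blast
  have kc [simp]: "k \<in> carrier A" and ks: "cadj A k = k" using k by (auto simp: csa_adj npos_csa)
  have l: "(cscale A ?c y \<otimes> k) \<otimes> k = \<one>" and r: "k \<otimes> (k \<otimes> cscale A ?c y) = \<one>"
    using yR k(2) by (simp_all add: m_assoc flip: scale_mult_left scale_mult_right) (simp flip: m_assoc)
  have "k \<in> Units A"
  proof -
    have "cscale A ?c y \<otimes> k = (cscale A ?c y \<otimes> k) \<otimes> (k \<otimes> (k \<otimes> cscale A ?c y))" unfolding r by simp
    also have "\<dots> = ((cscale A ?c y \<otimes> k) \<otimes> k) \<otimes> (k \<otimes> cscale A ?c y)" by (simp add: m_assoc)
    also have "\<dots> = k \<otimes> cscale A ?c y" unfolding l by simp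
    finally have "k \<otimes> (cscale A ?c y \<otimes> k) = \<one>" using r by simp
    then show ?thesis using l unfolding Units_def by (auto intro!: bexI[of _ "cscale A ?c y \<otimes> k"])
  qed
  then have i: "inv k \<in> carrier A" "inv k \<otimes> k = \<one>" "k \<otimes> inv k = \<one>" by auto
  have "cadj A (inv k) \<otimes> k = \<one>" using i adj_mult[of k "inv k"] ks by simp
  then have "cadj A (inv k) \<otimes> k \<otimes> inv k = inv k" using i by simp
  then have "cadj A (inv k) = inv k" using i by (simp add: m_assoc)
  then have "inv k \<in> csa A" using i by (intro csaI) auto
  moreover have "inv k \<otimes> R \<otimes> inv k = \<one>"
    unfolding k(2)[symmetric] using i by (simp add: m_assoc)
  ultimately show ?thesis by blast
qed

text \<open>The constant C disappears under high powers. Applied to the powers \<open>2^j\<close> of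
  a self-adjoint element it turns an equivalence of C*-norms into equality.\<close>

lemma (in cstar_algebra) pow_le_imp_le:
  fixes r s C :: real
  assumes r: "0 \<le> r" and s: "0 \<le> s" and C: "0 \<le> C" and le: "\<And>j::nat. r ^ (2^j) \<le> C * s ^ (2^j)"
  shows "r \<le> s"
proof (cases "s = 0")
  case True
  then show ?thesis using le[of 0] by simp
next
  case False
  then have s: "s > 0" using s by simp
  have "r / s \<le> 1"
  proof (rule pow_bounded_imp_le_one[of _ C])
    show "0 \<le> r / s" using r s by simp
    fix j :: nat
    have "(r / s) ^ (2^j) \<le> C" using le[of j] s by (simp add: power_divide field_simps)
    also have "C \<le> 1 + 2^j * C" using mult_right_mono[of 1 "2^j" C] C by simp
    finally show "(r / s) ^ (2^j) \<le> 1 + 2^j * C" .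
  qed
  then show ?thesis using s by simp
qed

section \<open>The Jones projection and the basic construction\<close>

context finite_index
begin

sublocale B: cstar_algebra LL by (rule LL_cstar)

abbreviation "\<iota> \<equiv> left_mult A E"
abbreviation "e \<equiv> jones A E"
abbreviation bmult (infixl "\<star>" 70) where "S \<star> T \<equiv> S \<otimes>\<^bsub>LL\<^esub> T"

lemma adjm_lm: "a \<in> carrier A \<Longrightarrow> adjm (\<lambda>x. a \<otimes> x) (\<lambda>x. cadj A a \<otimes> x)"
  by (simp add: adjm_def ip_def adj_mult m_assoc)

lemma adjm_E: "adjm E E"
  by (simp add: adjm_def ip_def E_right E_left flip: E_adj)

lemma eextend_extensional: "eextend A E f \<in> extensional (hcarrier H)"
  by (simp add: eextend_def)

lemma iota_op: assumes a: "a \<in> carrier A" shows "\<iota> a = op (\<lambda>x. a \<otimes> x)"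
  unfolding left_mult_def
proof (rule op_eqI[OF eextend_extensional])
  fix x assume "x \<in> carrier A"
  then show "eextend A E (\<lambda>x. a \<otimes> x) (conv_seqs x) = conv_seqs (a \<otimes> x)"
    using a norm_mult by (intro eextend_class) (auto simp: minus_eq r_distr r_minus)
qed

lemma jones_op: "e = op E"
  unfolding jones_def
proof (rule op_eqI[OF eextend_extensional])
  fix x assume "x \<in> carrier A"
  then show "eextend A E E (conv_seqs x) = conv_seqs (E x)"
    by (intro eextend_class[of E 1]) (auto simp: E_diff E_norm)
qed

lemma iota_closed [simp]: "a \<in> carrier A \<Longrightarrow> \<iota> a \<in> carrier LL"
  using op_LL[OF adjm_lm] by (simp add: iota_op)

lemma e_closed [simp]: "e \<in> carrier LL"
  using op_LL[OF adjm_E] by (simp add: jones_op)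

lemma iota_mult: "\<lbrakk>a \<in> carrier A; b \<in> carrier A\<rbrakk> \<Longrightarrow> \<iota> (a \<otimes> b) = \<iota> a \<star> \<iota> b"
  by (simp add: iota_op LL_mult op_eq_iff m_assoc)

lemma iota_add: "\<lbrakk>a \<in> carrier A; b \<in> carrier A\<rbrakk> \<Longrightarrow> \<iota> (a \<oplus> b) = \<iota> a \<oplus>\<^bsub>LL\<^esub> \<iota> b"
  by (simp add: iota_op LL_add op_eq_iff l_distr)

lemma iota_scale: "a \<in> carrier A \<Longrightarrow> \<iota> (cscale A c a) = cscale LL c (\<iota> a)"
  by (simp add: iota_op LL_scale op_eq_iff scale_mult_left)

lemma iota_one: "\<iota> \<one> = \<one>\<^bsub>LL\<^esub>"
  by (simp add: iota_op LL_one op_eq_iff)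

lemma iota_adj: "a \<in> carrier A \<Longrightarrow> \<iota> (cadj A a) = cadj LL (\<iota> a)"
  by (simp add: iota_op LL_adj[OF adjm_lm])

lemma iota_zero: "\<iota> \<zero> = \<zero>\<^bsub>LL\<^esub>"
  using iota_scale[of \<zero> 0] by simp

lemma iota_neg: "a \<in> carrier A \<Longrightarrow> \<iota> (\<ominus> a) = \<ominus>\<^bsub>LL\<^esub> \<iota> a"
  using iota_scale[of a "-1"] by (simp add: scale_minus1 B.scale_minus1)

lemma iota_diff: "\<lbrakk>a \<in> carrier A; b \<in> carrier A\<rbrakk> \<Longrightarrow> \<iota> (a \<ominus> b) = \<iota> a \<ominus>\<^bsub>LL\<^esub> \<iota> b"
  by (simp add: minus_eq B.minus_eq iota_add iota_neg)

lemma iota_finsum: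
  "\<lbrakk>finite I; \<And>i. i \<in> I \<Longrightarrow> f i \<in> carrier A\<rbrakk> \<Longrightarrow> \<iota> (\<Oplus>i\<in>I. f i) = (\<Oplus>\<^bsub>LL\<^esub>i\<in>I. \<iota> (f i))"
  by (induction I rule: finite_induct) (auto simp: iota_add iota_zero Pi_def)

lemma iota_pow: "a \<in> carrier A \<Longrightarrow> \<iota> (a [^] (n::nat)) = \<iota> a [^]\<^bsub>LL\<^esub> n"
  by (induction n) (auto simp: iota_mult iota_one)

lemma e_idem: "e \<star> e = e" by (simp add: jones_op LL_mult op_eq_iff)

lemma e_adj: "cadj LL e = e" by (simp add: jones_op LL_adj[OF adjm_E])

lemma e_compress: "a \<in> carrier A \<Longrightarrow> e \<star> \<iota> a \<star> e = \<iota> (E a) \<star> e"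
  by (simp add: jones_op iota_op LL_mult op_eq_iff E_right)

lemma e_commute: "p \<in> P \<Longrightarrow> \<iota> p \<star> e = e \<star> \<iota> p"
  by (simp add: jones_op iota_op LL_mult op_eq_iff P_carrier E_left)

lemma sandwich_op: "\<lbrakk>a \<in> carrier A; b \<in> carrier A\<rbrakk> \<Longrightarrow> \<iota> a \<star> e \<star> \<iota> b = op (\<lambda>z. a \<otimes> E (b \<otimes> z))"
  by (simp add: jones_op iota_op LL_mult op_eq_iff)

lemma adjm_sandwich: "\<lbrakk>a \<in> carrier A; b \<in> carrier A\<rbrakk> \<Longrightarrow> adjm (\<lambda>z. a \<otimes> E (b \<otimes> z)) (\<lambda>z. cadj A b \<otimes> E (cadj A a \<otimes> z))"
  using adjm_comp[OF adjm_lm adjm_comp[OF adjm_E adjm_lm]] by simp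

lemma LL_finsum:
  assumes "finite I" "\<And>i. i \<in> I \<Longrightarrow> adjm (\<phi> i) (\<psi> i)"
  shows "(\<Oplus>\<^bsub>LL\<^esub>i\<in>I. op (\<phi> i)) = op (\<lambda>z. \<Oplus>i\<in>I. \<phi> i z) \<and> adjm (\<lambda>z. \<Oplus>i\<in>I. \<phi> i z) (\<lambda>z. \<Oplus>i\<in>I. \<psi> i z)"
  using assms
proof (induction I rule: finite_induct)
  case empty
  then show ?case using adjm_null by (simp add: LL_zero)
next
  case (insert i I)
  have fin: "adjm (\<phi> i) (\<psi> i)" "adjm (\<lambda>z. \<Oplus>i\<in>I. \<phi> i z) (\<lambda>z. \<Oplus>i\<in>I. \<psi> i z)" using insert by auto
  have c: "\<And>z j. z \<in> carrier A \<Longrightarrow> j \<in> insert i I \<Longrightarrow> \<phi> j z \<in> carrier A \<and> \<psi> j z \<in> carrier A"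
    using insert.prems adjmD by blast
  have "(\<Oplus>\<^bsub>LL\<^esub>i\<in>insert i I. op (\<phi> i)) = op (\<phi> i) \<oplus>\<^bsub>LL\<^esub> (\<Oplus>\<^bsub>LL\<^esub>i\<in>I. op (\<phi> i))"
    using insert op_LL by (intro B.finsum_insert) auto
  also have "\<dots> = op (\<phi> i) \<oplus>\<^bsub>LL\<^esub> op (\<lambda>z. \<Oplus>i\<in>I. \<phi> i z)" using insert by simp
  also have "\<dots> = op (\<lambda>z. \<phi> i z \<oplus> (\<Oplus>i\<in>I. \<phi> i z))"
    using c by (intro LL_add) auto
  also have "\<dots> = op (\<lambda>z. \<Oplus>i\<in>insert i I. \<phi> i z)"
    using c insert.hyps by (subst op_eq_iff) (auto simp: Pi_def)
  finally have 1: "(\<Oplus>\<^bsub>LL\<^esub>i\<in>insert i I. op (\<phi> i)) = op (\<lambda>z. \<Oplus>i\<in>insert i I. \<phi> i z)" .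
  have 2: "adjm (\<lambda>z. \<phi> i z \<oplus> (\<Oplus>i\<in>I. \<phi> i z)) (\<lambda>z. \<psi> i z \<oplus> (\<Oplus>i\<in>I. \<psi> i z))" by (rule adjm_plus[OF fin])
  have "adjm (\<lambda>z. \<Oplus>i\<in>insert i I. \<phi> i z) (\<lambda>z. \<Oplus>i\<in>insert i I. \<psi> i z)"
    using 2 c insert.hyps unfolding adjm_def by (simp add: Pi_def)
  then show ?case using 1 by blast
qed

lemma jones_sum_eq: "jones_sum A E n x y = (\<Oplus>\<^bsub>LL\<^esub>i\<in>{..<n}. \<iota> (x i) \<star> e \<star> \<iota> (y i))"
  by (simp add: jones_sum_def Let_def)

lemma jones_sum_op:
  assumes "\<And>i. i < n \<Longrightarrow> x i \<in> carrier A \<and> y i \<in> carrier A"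
  shows "jones_sum A E n x y = op (\<lambda>z. \<Oplus>i\<in>{..<n}. x i \<otimes> E (y i \<otimes> z))"
    "adjm (\<lambda>z. \<Oplus>i\<in>{..<n}. x i \<otimes> E (y i \<otimes> z)) (\<lambda>z. \<Oplus>i\<in>{..<n}. cadj A (y i) \<otimes> E (cadj A (x i) \<otimes> z))"
proof -
  have "jones_sum A E n x y = (\<Oplus>\<^bsub>LL\<^esub>i\<in>{..<n}. op (\<lambda>z. x i \<otimes> E (y i \<otimes> z)))"
    unfolding jones_sum_eq using assms op_LL[OF adjm_sandwich]
    by (intro B.finsum_cong') (auto simp: sandwich_op)
  then show "jones_sum A E n x y = op (\<lambda>z. \<Oplus>i\<in>{..<n}. x i \<otimes> E (y i \<otimes> z))"
    "adjm (\<lambda>z. \<Oplus>i\<in>{..<n}. x i \<otimes> E (y i \<otimes> z)) (\<lambda>z. \<Oplus>i\<in>{..<n}. cadj A (y i) \<otimes> E (cadj A (x i) \<otimes> z))"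
    using LL_finsum[of "{..<n}" "\<lambda>i z. x i \<otimes> E (y i \<otimes> z)" "\<lambda>i z. cadj A (y i) \<otimes> E (cadj A (x i) \<otimes> z)"]
      assms adjm_sandwich by auto
qed

lemma op_expand:
  assumes a: "adjm \<phi> \<psi>" shows "op \<phi> = jones_sum A E N (\<lambda>j. \<phi> (u j)) v"
proof -
  note [simp] = adjmD(1)[OF a]
  have "jones_sum A E N (\<lambda>j. \<phi> (u j)) v = op (\<lambda>z. \<Oplus>i\<in>{..<N}. \<phi> (u i) \<otimes> E (v i \<otimes> z))"
    by (rule jones_sum_op) auto
  also have "\<dots> = op \<phi>" by (subst op_eq_iff) (auto simp: adjm_expand[OF a, symmetric])
  finally show ?thesis by simp
qed

text \<open>Expansion along the quasi-basis exhausts the adjointable operators by sums x e y. So the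
  linear span in the definition is already a C*-algebra, and all that was shown for
  \<open>LL\<close> applies to it.\<close>

lemma basic_construction_eq: "basic_construction A E = LL"
proof -
  have "{jones_sum A E n x y | n x y. \<forall>i<n. x i \<in> carrier A \<and> y i \<in> carrier A} = carrier LL"
  proof
    show "{jones_sum A E n x y | n x y. \<forall>i<n. x i \<in> carrier A \<and> y i \<in> carrier A} \<subseteq> carrier LL"
    proof safe
      fix n :: nat and x y :: "nat \<Rightarrow> 'a" assume "\<forall>i<n. x i \<in> carrier A \<and> y i \<in> carrier A"
      then show "jones_sum A E n x y \<in> carrier LL"
        using jones_sum_op[of n x y] op_LL by simp
    qed
    show "carrier LL \<subseteq> {jones_sum A E n x y | n x y. \<forall>i<n. x i \<in> carrier A \<and> y i \<in> carrier A}"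
    proof
      fix T assume "T \<in> carrier LL"
      then obtain \<phi> \<psi> where a: "adjm \<phi> \<psi>" "T = op \<phi>" by (rule LL_obtain)
      then have "T = jones_sum A E N (\<lambda>j. \<phi> (u j)) v" "\<forall>i<N. \<phi> (u i) \<in> carrier A \<and> v i \<in> carrier A"
        using op_expand[OF a(1)] adjmD(1)[OF a(1)] by auto
      then show "T \<in> {jones_sum A E n x y | n x y. \<forall>i<n. x i \<in> carrier A \<and> y i \<in> carrier A}" by blast
    qed
  qed
  then show ?thesis by (simp add: basic_construction_def)
qed

text \<open>Right P-linearity takes the factor E(z) out of \<phi>. In front of e an operator can
  thus be replaced by an element of A.\<close>

lemma op_e: assumes a: "adjm \<phi> \<psi>" "x \<in> carrier A" shows "op \<phi> \<star> \<iota> x \<star> e = \<iota> (\<phi> x) \<star> e"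
proof -
  note [simp] = adjmD(1)[OF a(1)]
  show ?thesis using a(2)
    by (simp add: jones_op iota_op LL_mult op_eq_iff adjm_mult[OF a(1)])
qed

text \<open>Evaluation at the vector 1 recovers y from y e. With the comparison of norms this is the
  estimate that leads from the basic construction back to A.\<close>

lemma norm_le_iota_e: assumes y [simp]: "y \<in> carrier A" shows "cnorm A y \<le> M * cnorm LL (\<iota> y \<star> e)"
proof -
  have ye: "\<iota> y \<star> e = op (\<lambda>z. y \<otimes> E z)" by (simp add: jones_op iota_op LL_mult op_eq_iff)
  have a: "adjm (\<lambda>z. y \<otimes> E z) (\<lambda>z. E (cadj A y \<otimes> z))" by (rule adjm_comp[OF adjm_lm[OF y] adjm_E])
  have "en y \<le> opn (\<lambda>z. y \<otimes> E z) * en \<one>" using opn_bound(1)[OF a one_closed] by simp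
  also have "\<dots> \<le> opn (\<lambda>z. y \<otimes> E z) * 1"
    using opn_bound(2)[OF a one_closed] en_le[of \<one>] norm_one_le by (intro mult_left_mono) auto
  finally have "en y \<le> cnorm LL (\<iota> y \<star> e)" unfolding ye LL_norm[OF a] by simp
  then show ?thesis using norm_le_en[OF y] M_pos by (meson mult_left_mono less_imp_le order_trans)
qed

lemma norm_e_le: "cnorm LL e \<le> 1"
proof -
  have "(cnorm LL e)\<^sup>2 = cnorm LL e" using B.cstar_identity[of e] by (simp add: e_adj e_idem)
  then show ?thesis by (metis order_refl power2_eq_square mult_cancel_left2 zero_le_one)
qed

text \<open>The equivalence of norms gives both inequalities up to the factor M. For the powers
  \<open>2^j\<close> of h = a* a the factor is removed by \<open>pow_le_imp_le\<close>.\<close>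

lemma iota_norm: assumes a: "a \<in> carrier A" shows "cnorm LL (\<iota> a) = cnorm A a"
proof -
  have up: "cnorm LL (\<iota> x) \<le> M * cnorm A x" if x: "x \<in> carrier A" for x
  proof -
    have "opn (\<lambda>z. x \<otimes> z) \<le> M * cnorm A x"
    proof (rule opn_le)
      show "0 \<le> M * cnorm A x" using M_pos x by simp
      fix z assume z: "z \<in> carrier A"
      have "en (x \<otimes> z) \<le> cnorm A x * cnorm A z" using en_le[of "x \<otimes> z"] norm_mult[of x z] x z by simp
      also have "\<dots> \<le> cnorm A x * (M * en z)" using norm_le_en[OF z] x by (intro mult_left_mono) auto
      finally show "en (x \<otimes> z) \<le> M * cnorm A x * en z" by (simp add: ac_simps)
    qed
    then show ?thesis using x by (simp add: iota_op LL_norm[OF adjm_lm])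
  qed
  have low: "cnorm A x \<le> M * cnorm LL (\<iota> x)" if x: "x \<in> carrier A" for x
  proof -
    have "cnorm LL (\<iota> x \<star> e) \<le> cnorm LL (\<iota> x) * 1" using x norm_e_le by (intro B.norm_mult_le) auto
    then show ?thesis using norm_le_iota_e[OF x] M_pos by (smt (verit) mult_left_mono)
  qed
  define h where "h = cadj A a \<otimes> a"
  have h: "h \<in> csa A" "h \<in> carrier A" unfolding h_def using a csa_star by auto
  have ih: "\<iota> h \<in> csa LL" unfolding h_def using a by (simp add: iota_mult iota_adj B.csa_star)
  have "cnorm A h \<le> cnorm LL (\<iota> h)"
  proof (rule pow_le_imp_le[of _ _ M])
    fix j :: nat
    show "cnorm A h ^ (2^j) \<le> M * cnorm LL (\<iota> h) ^ (2^j)"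
      using low[of "h [^] ((2::nat)^j)"] h ih by (simp add: csa_pow2_norm iota_pow B.csa_pow2_norm)
  qed (use M_pos h in auto)
  moreover have "cnorm LL (\<iota> h) \<le> cnorm A h"
  proof (rule pow_le_imp_le[of _ _ M])
    fix j :: nat
    show "cnorm LL (\<iota> h) ^ (2^j) \<le> M * cnorm A h ^ (2^j)"
      using up[of "h [^] ((2::nat)^j)"] h ih by (simp add: csa_pow2_norm iota_pow B.csa_pow2_norm)
  qed (use M_pos h in auto)
  ultimately have "(cnorm LL (\<iota> a))\<^sup>2 = (cnorm A a)\<^sup>2"
    using cstar_identity[OF a] B.cstar_identity[of "\<iota> a"] a by (simp add: h_def iota_mult iota_adj)
  then show ?thesis using a by (simp add: power2_eq_iff_nonneg)
qed

lemma iota_inj: "\<lbrakk>a \<in> carrier A; b \<in> carrier A; \<iota> a = \<iota> b\<rbrakk> \<Longrightarrow> a = b"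
  using iota_norm[of "a \<ominus> b"] by (simp add: iota_diff B.minus_eq B.r_neg norm_eq_zero diff_eq_zero)

text \<open>Polarisation of \<open>1 = \<Sum> u\<^sub>j e v\<^sub>j\<close>, followed by normalisation in the basic construction.\<close>

lemma selfadjoint_quasi_basis:
  "\<exists>n t. quasi_basis A E n t (\<lambda>j. cadj A (t j))"
proof -
  let ?I = "{..<N}"
  define w where "w j = cadj A (v j)" for j
  define s where "s j = u j \<oplus> w j" for j
  have c [simp]: "j < N \<Longrightarrow> w j \<in> carrier A" "j < N \<Longrightarrow> s j \<in> carrier A" for j by (auto simp: w_def s_def)
  let ?q = "\<lambda>x y. \<iota> x \<star> e \<star> cadj LL (\<iota> y)"
  have one: "\<one>\<^bsub>LL\<^esub> = (\<Oplus>\<^bsub>LL\<^esub>j\<in>?I. ?q (u j) (w j))"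
  proof -
    have "\<one>\<^bsub>LL\<^esub> = jones_sum A E N u v" unfolding LL_one using op_expand[OF adjm_id] by simp
    then show ?thesis unfolding jones_sum_eq
      by (simp add: w_def iota_adj cong: B.finsum_cong)
  qed
  have qadj: "cadj LL (?q x y) = ?q y x" if "x \<in> carrier A" "y \<in> carrier A" for x y
    using that by (simp add: B.adj_mult e_adj B.m_assoc)
  have "cadj LL \<one>\<^bsub>LL\<^esub> = (\<Oplus>\<^bsub>LL\<^esub>j\<in>?I. cadj LL (?q (u j) (w j)))"
    unfolding one by (rule B.finsum_adj) auto
  also have "\<dots> = (\<Oplus>\<^bsub>LL\<^esub>j\<in>?I. ?q (w j) (u j))" by (intro B.finsum_cong') (auto simp: qadj)
  finally have one': "\<one>\<^bsub>LL\<^esub> = (\<Oplus>\<^bsub>LL\<^esub>j\<in>?I. ?q (w j) (u j))" by simp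
  have qpos: "?q x x \<in> npos LL" if "x \<in> carrier A" for x
  proof -
    have "?q x x = (\<iota> x \<star> e) \<star> cadj LL (\<iota> x \<star> e)"
      using that e_idem by (simp add: B.adj_mult e_adj B.m_assoc) (simp flip: B.m_assoc add: e_idem)
    then show ?thesis using B.star_npos'[of "\<iota> x \<star> e"] that by simp
  qed
  define X where "X = (\<Oplus>\<^bsub>LL\<^esub>j\<in>?I. ?q (u j) (u j)) \<oplus>\<^bsub>LL\<^esub> (\<Oplus>\<^bsub>LL\<^esub>j\<in>?I. ?q (w j) (w j))"
  have X: "X \<in> npos LL" unfolding X_def using qpos by (intro B.npos_add B.npos_finsum) auto
  have "(\<Oplus>\<^bsub>LL\<^esub>j\<in>?I. ?q (s j) (s j))
      = (\<Oplus>\<^bsub>LL\<^esub>j\<in>?I. (?q (u j) (u j) \<oplus>\<^bsub>LL\<^esub> ?q (w j) (w j)) \<oplus>\<^bsub>LL\<^esub> (?q (u j) (w j) \<oplus>\<^bsub>LL\<^esub> ?q (w j) (u j)))"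
    by (intro B.finsum_cong') (auto simp: s_def iota_add B.adj_add B.l_distr B.r_distr B.a_ac)
  also have "\<dots> = X \<oplus>\<^bsub>LL\<^esub> (\<one>\<^bsub>LL\<^esub> \<oplus>\<^bsub>LL\<^esub> \<one>\<^bsub>LL\<^esub>)"
  proof -
    have "(\<Oplus>\<^bsub>LL\<^esub>j\<in>?I. (?q (u j) (u j) \<oplus>\<^bsub>LL\<^esub> ?q (w j) (w j)) \<oplus>\<^bsub>LL\<^esub> (?q (u j) (w j) \<oplus>\<^bsub>LL\<^esub> ?q (w j) (u j)))
       = X \<oplus>\<^bsub>LL\<^esub> ((\<Oplus>\<^bsub>LL\<^esub>j\<in>?I. ?q (u j) (w j)) \<oplus>\<^bsub>LL\<^esub> (\<Oplus>\<^bsub>LL\<^esub>j\<in>?I. ?q (w j) (u j)))"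
      unfolding X_def by (simp add: B.finsum_addf Pi_def)
    then show ?thesis using one one' by simp
  qed
  finally have S: "(\<Oplus>\<^bsub>LL\<^esub>j\<in>?I. ?q (s j) (s j)) = X \<oplus>\<^bsub>LL\<^esub> (\<one>\<^bsub>LL\<^esub> \<oplus>\<^bsub>LL\<^esub> \<one>\<^bsub>LL\<^esub>)" .
  \<comment> \<open>The mixed terms add up to 1 + 1, one half for each of the two expansions of the
    unit, so R is 1 plus a positive element and has an inverse square root K.\<close>
  define R where "R = cscale LL (1/2) (\<Oplus>\<^bsub>LL\<^esub>j\<in>?I. ?q (s j) (s j))"
  have Req: "R = cscale LL (1/2) X \<oplus>\<^bsub>LL\<^esub> \<one>\<^bsub>LL\<^esub>"
    unfolding R_def S using X by (simp add: B.scale_add_right B.half_double flip: B.scale_add_left)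
  have Xh: "cscale LL (1/2) X \<in> npos LL" using B.npos_scale[OF X, of "1/2"] by simp
  have R: "R \<in> npos LL" unfolding Req using Xh by (intro B.npos_add) auto
  have "R \<ominus>\<^bsub>LL\<^esub> \<one>\<^bsub>LL\<^esub> = cscale LL (1/2) X" unfolding Req using X by (simp add: B.minus_eq B.a_assoc B.r_neg)
  then have "R \<ominus>\<^bsub>LL\<^esub> \<one>\<^bsub>LL\<^esub> \<in> npos LL" using Xh by simp
  then obtain K where K: "K \<in> csa LL" "K \<star> R \<star> K = \<one>\<^bsub>LL\<^esub>" using B.inverse_sqrt[OF R] by blast
  have Kc [simp]: "K \<in> carrier LL" using K by simp
  obtain \<phi> \<psi> where a: "adjm \<phi> \<psi>" "K = op \<phi>" using Kc by (rule LL_obtain)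
  note [simp] = adjmD(1)[OF a(1)]
  \<comment> \<open>Absorbs the factor 1/2 of R, divided evenly between \<open>t j\<close> and its
    adjoint.\<close>
  define c where "c = complex_of_real (sqrt (1/2))"
  have cc: "c * c = 1/2" unfolding c_def by (simp flip: of_real_mult add: real_sqrt_mult_self)
  have cnj: "cnj c = c" by (simp add: c_def)
  define t where "t j = cscale A c (\<phi> (s j))" for j
  have tc [simp]: "j < N \<Longrightarrow> t j \<in> carrier A" for j by (simp add: t_def)
  have "K \<star> R \<star> K = (\<Oplus>\<^bsub>LL\<^esub>j\<in>?I. ?q (t j) (t j))"
  proof -
    have "R = (\<Oplus>\<^bsub>LL\<^esub>j\<in>?I. cscale LL (1/2) (?q (s j) (s j)))"
      unfolding R_def by (rule B.finsum_scale) auto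
    then have "K \<star> R = (\<Oplus>\<^bsub>LL\<^esub>j\<in>?I. K \<star> cscale LL (1/2) (?q (s j) (s j)))"
      by (simp add: B.finsum_rdistr Pi_def)
    then have "K \<star> R \<star> K = (\<Oplus>\<^bsub>LL\<^esub>j\<in>?I. K \<star> cscale LL (1/2) (?q (s j) (s j)) \<star> K)"
      by (simp add: B.finsum_ldistr Pi_def)
    also have "\<dots> = (\<Oplus>\<^bsub>LL\<^esub>j\<in>?I. ?q (t j) (t j))"
    proof (intro B.finsum_cong')
      fix j assume "j \<in> ?I"
      then have j [simp]: "s j \<in> carrier A" "t j \<in> carrier A" "\<phi> (s j) \<in> carrier A" by auto
      have Ks: "K \<star> \<iota> (s j) \<star> e = \<iota> (\<phi> (s j)) \<star> e" unfolding a(2) by (rule op_e[OF a(1) j(1)])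
      have "e \<star> cadj LL (\<iota> (s j)) \<star> K = cadj LL (K \<star> \<iota> (s j) \<star> e)"
        using K by (simp add: B.adj_mult e_adj B.csa_adj B.m_assoc)
      also have "\<dots> = e \<star> cadj LL (\<iota> (\<phi> (s j)))" unfolding Ks by (simp add: B.adj_mult e_adj)
      finally have sK: "e \<star> cadj LL (\<iota> (s j)) \<star> K = e \<star> cadj LL (\<iota> (\<phi> (s j)))" .
      have "K \<star> ?q (s j) (s j) \<star> K = (K \<star> \<iota> (s j) \<star> e) \<star> (e \<star> cadj LL (\<iota> (s j)) \<star> K)"
        using e_idem by (simp add: B.m_assoc) (simp flip: B.m_assoc add: e_idem)
      also have "\<dots> = ?q (\<phi> (s j)) (\<phi> (s j))"
        unfolding Ks sK using e_idem by (simp add: B.m_assoc) (simp flip: B.m_assoc add: e_idem)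
      finally have "K \<star> ?q (s j) (s j) \<star> K = ?q (\<phi> (s j)) (\<phi> (s j))" .
      moreover have "?q (t j) (t j) = cscale LL (1/2) (?q (\<phi> (s j)) (\<phi> (s j)))"
        unfolding t_def by (simp add: cc cnj iota_scale B.adj_scale B.scale_scale flip: B.scale_mult_left B.scale_mult_right)
      ultimately show "K \<star> cscale LL (1/2) (?q (s j) (s j)) \<star> K = ?q (t j) (t j)"
        by (simp flip: B.scale_mult_left B.scale_mult_right)
    qed auto
    finally show ?thesis .
  qed
  then have "\<one>\<^bsub>LL\<^esub> = (\<Oplus>\<^bsub>LL\<^esub>j\<in>?I. ?q (t j) (t j))" using K(2) by simp
  also have "\<dots> = jones_sum A E N t (\<lambda>j. cadj A (t j))" unfolding jones_sum_eq
    by (intro B.finsum_cong') (auto simp: iota_adj)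
  also have "\<dots> = op (\<lambda>z. \<Oplus>i\<in>?I. t i \<otimes> E (cadj A (t i) \<otimes> z))" by (rule jones_sum_op) auto
  finally have "op (\<lambda>x. x) = op (\<lambda>z. \<Oplus>i\<in>?I. t i \<otimes> E (cadj A (t i) \<otimes> z))" by (simp add: LL_one)
  then have l: "x = (\<Oplus>i\<in>?I. t i \<otimes> E (cadj A (t i) \<otimes> x))" if "x \<in> carrier A" for x
    using that by (subst (asm) op_eq_iff) auto
  have r: "x = (\<Oplus>i\<in>?I. E (x \<otimes> t i) \<otimes> cadj A (t i))" if x: "x \<in> carrier A" for x
  proof -
    have "x = cadj A (cadj A x)" using x by simp
    also have "cadj A x = (\<Oplus>i\<in>?I. t i \<otimes> E (cadj A (t i) \<otimes> cadj A x))" using x by (intro l) auto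
    also have "cadj A \<dots> = (\<Oplus>i\<in>?I. cadj A (t i \<otimes> E (cadj A (t i) \<otimes> cadj A x)))" using x by (intro finsum_adj) auto
    also have "\<dots> = (\<Oplus>i\<in>?I. E (x \<otimes> t i) \<otimes> cadj A (t i))"
      using x by (intro finsum_cong') (auto simp: adj_mult simp flip: E_adj)
    finally show ?thesis .
  qed
  have "quasi_basis A E N t (\<lambda>j. cadj A (t j))"
    unfolding quasi_basis_def using l r by simp
  then show ?thesis by blast
qed

text \<open>Expanding every y i along the quasi-basis and exchanging the sums leaves an expression
  in \<phi> alone. Hence the dual expectation is well defined, and for the identity operator the
  index does not depend on the quasi-basis.\<close>

lemma dual_sum_unique:
  assumes "\<And>i. i < n \<Longrightarrow> x i \<in> carrier A \<and> y i \<in> carrier A"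
    and a: "adjm \<phi> \<psi>" and eq: "op \<phi> = jones_sum A E n x y"
  shows "(\<Oplus>i\<in>{..<n}. x i \<otimes> y i) = (\<Oplus>j\<in>{..<N}. \<phi> (u j) \<otimes> v j)"
proof -
  note [simp] = adjmD(1)[OF a]
  have xy [simp]: "i < n \<Longrightarrow> x i \<in> carrier A" "i < n \<Longrightarrow> y i \<in> carrier A" for i using assms(1) by auto
  have "op \<phi> = op (\<lambda>z. \<Oplus>i\<in>{..<n}. x i \<otimes> E (y i \<otimes> z))" using eq jones_sum_op(1)[OF assms(1)] by simp
  then have \<phi>: "\<phi> z = (\<Oplus>i\<in>{..<n}. x i \<otimes> E (y i \<otimes> z))" if "z \<in> carrier A" for z
    using that by (subst (asm) op_eq_iff) auto
  have "(\<Oplus>i\<in>{..<n}. x i \<otimes> y i) = (\<Oplus>i\<in>{..<n}. x i \<otimes> (\<Oplus>j\<in>{..<N}. E (y i \<otimes> u j) \<otimes> v j))"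
    by (intro finsum_cong') (auto simp: qb_right)
  also have "\<dots> = (\<Oplus>i\<in>{..<n}. \<Oplus>j\<in>{..<N}. x i \<otimes> E (y i \<otimes> u j) \<otimes> v j)"
  proof (rule finsum_cong')
    fix i assume i: "i \<in> {..<n}"
    then have "x i \<otimes> (\<Oplus>j\<in>{..<N}. E (y i \<otimes> u j) \<otimes> v j) = (\<Oplus>j\<in>{..<N}. x i \<otimes> (E (y i \<otimes> u j) \<otimes> v j))"
      by (intro finsum_rdistr) auto
    also have "\<dots> = (\<Oplus>j\<in>{..<N}. x i \<otimes> E (y i \<otimes> u j) \<otimes> v j)"
      using i by (intro finsum_cong') (auto simp: m_assoc)
    finally show "x i \<otimes> (\<Oplus>j\<in>{..<N}. E (y i \<otimes> u j) \<otimes> v j) = (\<Oplus>j\<in>{..<N}. x i \<otimes> E (y i \<otimes> u j) \<otimes> v j)" .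
  qed auto
  also have "\<dots> = (\<Oplus>j\<in>{..<N}. \<Oplus>i\<in>{..<n}. x i \<otimes> E (y i \<otimes> u j) \<otimes> v j)"
    by (rule finsum_swap) auto
  also have "\<dots> = (\<Oplus>j\<in>{..<N}. \<phi> (u j) \<otimes> v j)"
    by (intro finsum_cong') (auto simp: \<phi> finsum_ldistr Pi_def)
  finally show ?thesis .
qed

lemma Index_eq: "Index A E = (\<Oplus>j\<in>{..<N}. u j \<otimes> v j)"
proof -
  have "z = (\<Oplus>j\<in>{..<N}. u j \<otimes> v j)" if "quasi_basis A E n u' v'" "z = (\<Oplus>j\<in>{..<n}. u' j \<otimes> v' j)" for n u' v' z
  proof -
    interpret F: finite_index A P E n u' v' using P E that(1) by unfold_locales
    have "\<one>\<^bsub>LL\<^esub> = jones_sum A E n u' v'" unfolding LL_one using F.op_expand[OF F.adjm_id] by (simp add: F.LL_one[symmetric] LL_one[symmetric])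
    then have "op (\<lambda>x. x) = jones_sum A E n u' v'" by (simp add: LL_one)
    from dual_sum_unique[OF _ adjm_id this] show ?thesis using that(2) F.uv by simp
  qed
  then show ?thesis unfolding Index_def using qb by (intro the_equality) blast+
qed

lemma dual_expectation_eq:
  assumes a: "adjm \<phi> \<psi>"
  shows "dual_expectation A E (op \<phi>) = \<iota> (inv (Index A E) \<otimes> (\<Oplus>j\<in>{..<N}. \<phi> (u j) \<otimes> v j))"
proof -
  have "(THE z. \<exists>n x y. (\<forall>i<n. x i \<in> carrier A \<and> y i \<in> carrier A) \<and> op \<phi> = jones_sum A E n x y \<and>
      z = inv (Index A E) \<otimes> (\<Oplus>i\<in>{..<n}. x i \<otimes> y i)) = inv (Index A E) \<otimes> (\<Oplus>j\<in>{..<N}. \<phi> (u j) \<otimes> v j)"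
  proof (rule the_equality)
    show "\<exists>n x y. (\<forall>i<n. x i \<in> carrier A \<and> y i \<in> carrier A) \<and> op \<phi> = jones_sum A E n x y \<and>
      inv (Index A E) \<otimes> (\<Oplus>j\<in>{..<N}. \<phi> (u j) \<otimes> v j) = inv (Index A E) \<otimes> (\<Oplus>i\<in>{..<n}. x i \<otimes> y i)"
      using op_expand[OF a] adjmD(1)[OF a] by (intro exI[of _ N] exI[of _ "\<lambda>j. \<phi> (u j)"] exI[of _ v]) auto
    fix z assume "\<exists>n x y. (\<forall>i<n. x i \<in> carrier A \<and> y i \<in> carrier A) \<and> op \<phi> = jones_sum A E n x y \<and>
      z = inv (Index A E) \<otimes> (\<Oplus>i\<in>{..<n}. x i \<otimes> y i)"
    then show "z = inv (Index A E) \<otimes> (\<Oplus>j\<in>{..<N}. \<phi> (u j) \<otimes> v j)"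
      using dual_sum_unique[OF _ a] by fastforce
  qed
  then show ?thesis by (simp add: dual_expectation_def)
qed

end

text \<open>Inserting the frame sum on the left of X turns X into the matrix with entries \<alpha>
  i* X \<alpha> j. These pass through y, after which the frame sum on the right is recognised again
  as 1.\<close>

lemma (in cstar_algebra) amplification_commutes:
  assumes I: "finite I" and \<alpha>: "\<And>i. i \<in> I \<Longrightarrow> \<alpha> i \<in> carrier A" and one: "(\<Oplus>i\<in>I. \<alpha> i \<otimes> cadj A (\<alpha> i)) = \<one>"
    and X [simp]: "X \<in> carrier A" and y [simp]: "y \<in> carrier A"
    and comm: "\<And>i j. \<lbrakk>i \<in> I; j \<in> I\<rbrakk> \<Longrightarrow> (cadj A (\<alpha> i) \<otimes> X \<otimes> \<alpha> j) \<otimes> y = y \<otimes> (cadj A (\<alpha> i) \<otimes> X \<otimes> \<alpha> j)"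
  shows "X \<otimes> (\<Oplus>j\<in>I. \<alpha> j \<otimes> y \<otimes> cadj A (\<alpha> j)) = (\<Oplus>j\<in>I. \<alpha> j \<otimes> y \<otimes> cadj A (\<alpha> j)) \<otimes> X"
proof -
  let ?S = "\<Oplus>j\<in>I. \<alpha> j \<otimes> y \<otimes> cadj A (\<alpha> j)"
  have S: "?S \<in> carrier A" using \<alpha> by (intro finsum_closed) auto
  have "X \<otimes> ?S = (\<Oplus>i\<in>I. \<alpha> i \<otimes> cadj A (\<alpha> i)) \<otimes> (X \<otimes> ?S)" unfolding one using S by simp
  also have "\<dots> = (\<Oplus>i\<in>I. \<alpha> i \<otimes> cadj A (\<alpha> i) \<otimes> (X \<otimes> ?S))" using I \<alpha> S by (intro finsum_ldistr) auto
  also have "\<dots> = (\<Oplus>i\<in>I. \<Oplus>j\<in>I. \<alpha> i \<otimes> y \<otimes> (cadj A (\<alpha> i) \<otimes> X \<otimes> (\<alpha> j \<otimes> cadj A (\<alpha> j))))"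
  proof (rule finsum_cong')
    fix i assume i: "i \<in> I"
    have "\<alpha> i \<otimes> cadj A (\<alpha> i) \<otimes> (X \<otimes> ?S) = (\<alpha> i \<otimes> cadj A (\<alpha> i) \<otimes> X) \<otimes> ?S" using i \<alpha> S by (simp add: m_assoc)
    also have "\<dots> = (\<Oplus>j\<in>I. (\<alpha> i \<otimes> cadj A (\<alpha> i) \<otimes> X) \<otimes> (\<alpha> j \<otimes> y \<otimes> cadj A (\<alpha> j)))"
      using I i \<alpha> by (intro finsum_rdistr) auto
    also have "\<dots> = (\<Oplus>j\<in>I. \<alpha> i \<otimes> y \<otimes> (cadj A (\<alpha> i) \<otimes> X \<otimes> (\<alpha> j \<otimes> cadj A (\<alpha> j))))"
    proof (rule finsum_cong')
      fix j assume j: "j \<in> I"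
      note [simp] = \<alpha>[OF i] \<alpha>[OF j]
      have "(\<alpha> i \<otimes> cadj A (\<alpha> i) \<otimes> X) \<otimes> (\<alpha> j \<otimes> y \<otimes> cadj A (\<alpha> j))
          = \<alpha> i \<otimes> ((cadj A (\<alpha> i) \<otimes> X \<otimes> \<alpha> j) \<otimes> y) \<otimes> cadj A (\<alpha> j)" by (simp add: m_assoc)
      also have "\<dots> = \<alpha> i \<otimes> y \<otimes> (cadj A (\<alpha> i) \<otimes> X \<otimes> (\<alpha> j \<otimes> cadj A (\<alpha> j)))"
        unfolding comm[OF i j] by (simp add: m_assoc)
      finally show "(\<alpha> i \<otimes> cadj A (\<alpha> i) \<otimes> X) \<otimes> (\<alpha> j \<otimes> y \<otimes> cadj A (\<alpha> j))
          = \<alpha> i \<otimes> y \<otimes> (cadj A (\<alpha> i) \<otimes> X \<otimes> (\<alpha> j \<otimes> cadj A (\<alpha> j)))" .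
    qed (use i \<alpha> in auto)
    finally show "\<alpha> i \<otimes> cadj A (\<alpha> i) \<otimes> (X \<otimes> ?S) = (\<Oplus>j\<in>I. \<alpha> i \<otimes> y \<otimes> (cadj A (\<alpha> i) \<otimes> X \<otimes> (\<alpha> j \<otimes> cadj A (\<alpha> j))))" .
  qed (use \<alpha> in \<open>auto intro!: finsum_closed\<close>)
  also have "\<dots> = (\<Oplus>i\<in>I. \<alpha> i \<otimes> y \<otimes> cadj A (\<alpha> i) \<otimes> X)"
  proof (rule finsum_cong')
    fix i assume i: "i \<in> I"
    note [simp] = \<alpha>[OF i]
    have "(\<Oplus>j\<in>I. \<alpha> i \<otimes> y \<otimes> (cadj A (\<alpha> i) \<otimes> X \<otimes> (\<alpha> j \<otimes> cadj A (\<alpha> j))))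
        = (\<Oplus>j\<in>I. (\<alpha> i \<otimes> y \<otimes> cadj A (\<alpha> i) \<otimes> X) \<otimes> (\<alpha> j \<otimes> cadj A (\<alpha> j)))"
      using \<alpha> by (intro finsum_cong') (auto simp: m_assoc)
    also have "\<dots> = (\<alpha> i \<otimes> y \<otimes> cadj A (\<alpha> i) \<otimes> X) \<otimes> (\<Oplus>j\<in>I. \<alpha> j \<otimes> cadj A (\<alpha> j))"
      using I \<alpha> by (intro finsum_rdistr[symmetric]) auto
    finally show "(\<Oplus>j\<in>I. \<alpha> i \<otimes> y \<otimes> (cadj A (\<alpha> i) \<otimes> X \<otimes> (\<alpha> j \<otimes> cadj A (\<alpha> j)))) = \<alpha> i \<otimes> y \<otimes> cadj A (\<alpha> i) \<otimes> X"
      unfolding one by simp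
  qed (use \<alpha> in auto)
  also have "\<dots> = ?S \<otimes> X" using I \<alpha> by (intro finsum_ldistr[symmetric]) auto
  finally show ?thesis .
qed

text \<open>Vanishing cross terms let one conjugation, by the sum of the g i, produce all h i
  together. This turns several comparisons with b into a single one.\<close>

lemma (in cstar_algebra) orthogonal_sum:
  assumes I: "finite I" and g: "\<And>i. i \<in> I \<Longrightarrow> g i \<in> carrier A" and b [simp]: "b \<in> carrier A"
    and h: "\<And>i. i \<in> I \<Longrightarrow> h i \<in> carrier A"
    and gg: "\<And>i j. \<lbrakk>i \<in> I; j \<in> I\<rbrakk> \<Longrightarrow> g i \<otimes> b \<otimes> cadj A (g j) = (if i = j then h i else \<zero>)"
  shows "(\<Oplus>i\<in>I. g i) \<otimes> b \<otimes> cadj A (\<Oplus>i\<in>I. g i) = (\<Oplus>i\<in>I. h i)"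
proof -
  have G: "(\<Oplus>i\<in>I. g i) \<in> carrier A" using g by (intro finsum_closed) auto
  have ga: "cadj A (\<Oplus>j\<in>I. g j) = (\<Oplus>j\<in>I. cadj A (g j))" using I g by (rule finsum_adj)
  have "(\<Oplus>i\<in>I. g i) \<otimes> b \<otimes> cadj A (\<Oplus>i\<in>I. g i) = (\<Oplus>i\<in>I. g i) \<otimes> (b \<otimes> cadj A (\<Oplus>i\<in>I. g i))"
    using G by (simp add: m_assoc)
  also have "\<dots> = (\<Oplus>i\<in>I. g i \<otimes> (b \<otimes> cadj A (\<Oplus>i\<in>I. g i)))" using I g G by (intro finsum_ldistr) auto
  also have "\<dots> = (\<Oplus>i\<in>I. h i)"
  proof (rule finsum_cong')
    fix i assume i: "i \<in> I"
    have "g i \<otimes> (b \<otimes> cadj A (\<Oplus>i\<in>I. g i)) = (g i \<otimes> b) \<otimes> (\<Oplus>j\<in>I. cadj A (g j))"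
      using g[OF i] G unfolding ga[symmetric] by (simp add: m_assoc)
    also have "\<dots> = (\<Oplus>j\<in>I. g i \<otimes> b \<otimes> cadj A (g j))" using I g i by (intro finsum_rdistr) auto
    also have "\<dots> = (\<Oplus>j\<in>I. if i = j then h i else \<zero>)" using gg[OF i] h[OF i] by (intro finsum_cong') auto
    also have "\<dots> = h i" using finsum_singleton[OF i I, of "\<lambda>_. h i"] h[OF i] by (simp add: Pi_def)
    finally show "g i \<otimes> (b \<otimes> cadj A (\<Oplus>i\<in>I. g i)) = h i" .
  qed (use h in auto)
  finally show ?thesis .
qed

section \<open>Compression by outerness and orthogonal copies in ultrapowers\<close>

context cstar_ultra
begin

lemma uc_npos: assumes y: "y \<in> carrier L" and p: "\<And>n. y n \<in> npos A" shows "uc y \<in> npos A\<omega>"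
proof -
  obtain K where K: "\<And>n. cnorm A (y n) \<le> K" using bdseq_bound[OF y] by blast
  show ?thesis
  proof (rule U.nposI)
    show "uc y \<in> csa A\<omega>" using y p by (intro U.csaI) (simp_all add: csa_adj npos_csa)
    have "creal A\<omega> K \<ominus>\<^bsub>A\<omega>\<^esub> uc y = uc (\<lambda>n. creal A K \<ominus> y n)" using y by (simp add: U_one)
    then show "cnorm A\<omega> (creal A\<omega> K \<ominus>\<^bsub>A\<omega>\<^esub> uc y) \<le> K"
      using y npos_norm[OF p K] by (simp add: uc_norm_le)
  qed
qed

lemma U_npos_lift:
  assumes "X \<in> npos A\<omega>" shows "\<exists>x\<in>carrier L. X = uc (\<lambda>n. cadj A (x n) \<otimes> x n)"
proof -
  obtain Y where "Y \<in> carrier A\<omega>" "X = cadj A\<omega> Y \<otimes>\<^bsub>A\<omega>\<^esub> Y" using assms U.cpos_eq_npos by (auto simp: cpos_def)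
  moreover from this obtain x where "x \<in> carrier L" "Y = uc x" by (auto elim: U_obtain)
  ultimately show ?thesis by auto
qed

lemma inverse_tendsto: "((\<lambda>n. 1 / real (Suc n)) \<longlongrightarrow> 0) \<omega>"
  using LIMSEQ_inverse_real_of_nat by (intro tendsto_omega) (simp add: inverse_eq_divide)

text \<open>\<open>outer_cut\<close> in each coordinate with tolerance 1/(n+1). The map F is general
  because the lemma serves E on A and the dual expectation on B. The bound with C is of Pimsner-Popa
  type and keeps d nonzero: if F(y n) tended to 0 along \<omega>, so would y n.\<close>

lemma outer_ultra:
  assumes P: "unital_cstar_subalgebra P A" and out: "outer A P F"
    and FP: "\<And>x. x \<in> carrier A \<Longrightarrow> F x \<in> P" and Fpos: "\<And>x. x \<in> carrier A \<Longrightarrow> F (cadj A x \<otimes> x) \<in> npos A"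
    and Fbd: "\<And>x. x \<in> carrier A \<Longrightarrow> cnorm A (F x) \<le> K * cnorm A x"
    and low: "\<And>x. x \<in> carrier A \<Longrightarrow> (cnorm A x)\<^sup>2 \<le> C * cnorm A (F (cadj A x \<otimes> x))"
    and b: "b \<in> npos A\<omega>" "b \<noteq> \<zero>\<^bsub>A\<omega>\<^esub>"
  shows "\<exists>c d. c \<in> carrier L \<and> d \<in> carrier L \<and> (\<forall>n. c n \<in> P \<and> d n \<in> P \<and> d n \<in> npos A) \<and>
    uc c \<otimes>\<^bsub>A\<omega>\<^esub> b \<otimes>\<^bsub>A\<omega>\<^esub> uc c = uc d \<and> cadj A\<omega> (uc c) = uc c \<and> uc d \<noteq> \<zero>\<^bsub>A\<omega>\<^esub>"
proof -
  obtain x where x: "x \<in> carrier L" "b = uc (\<lambda>n. cadj A (x n) \<otimes> x n)" using U_npos_lift[OF b(1)] by blast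
  define y where "y n = cadj A (x n) \<otimes> x n" for n
  have xc [simp]: "x n \<in> carrier A" for n using x bdseqD by blast
  have yL: "y \<in> carrier L" unfolding y_def using x by simp
  have yc [simp]: "y n \<in> carrier A" for n by (simp add: y_def)
  have PA: "z \<in> carrier A" if "z \<in> P" for z using P that by (auto simp: unital_cstar_subalgebra_def cstar_subalgebra_def)
  have "\<exists>c\<in>P. c \<in> csa A \<and> cnorm A c \<le> 1 \<and> cnorm A (c \<otimes> y n \<otimes> c \<ominus> c \<otimes> F (y n) \<otimes> c) < 1 / real (Suc n) \<and>
      cnorm A (F (y n)) - 1 / real (Suc n) \<le> cnorm A (c \<otimes> F (y n) \<otimes> c)" for n
    using Fpos FP by (intro outer_cut[OF P out]) (auto simp: y_def)
  then obtain c where c: "\<And>n. c n \<in> P" "\<And>n. c n \<in> csa A" "\<And>n. cnorm A (c n) \<le> 1"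
      "\<And>n. cnorm A (c n \<otimes> y n \<otimes> c n \<ominus> c n \<otimes> F (y n) \<otimes> c n) < 1 / real (Suc n)"
      "\<And>n. cnorm A (F (y n)) - 1 / real (Suc n) \<le> cnorm A (c n \<otimes> F (y n) \<otimes> c n)"
    by metis
  have cc [simp]: "c n \<in> carrier A" for n using c by simp
  have cL: "c \<in> carrier L" using c by (intro bdseqI[of _ _ 1]) auto
  define d where "d n = c n \<otimes> F (y n) \<otimes> c n" for n
  have Fc [simp]: "F (y n) \<in> carrier A" for n using FP PA by simp
  have FL: "(\<lambda>n. F (y n)) \<in> carrier L"
  proof -
    obtain B where B: "\<And>n. cnorm A (y n) \<le> B" using bdseq_bound[OF yL] by blast
    have "cnorm A (F (y n)) \<le> \<bar>K\<bar> * B" for n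
    proof -
      have "cnorm A (F (y n)) \<le> K * cnorm A (y n)" by (rule Fbd) simp
      also have "\<dots> \<le> \<bar>K\<bar> * cnorm A (y n)" by (intro mult_right_mono) auto
      also have "\<dots> \<le> \<bar>K\<bar> * B" using B by (intro mult_left_mono) auto
      finally show ?thesis .
    qed
    then show ?thesis by (intro bdseqI) auto
  qed
  have dL: "d \<in> carrier L" unfolding d_def using cL FL by simp
  have "uc c \<otimes>\<^bsub>A\<omega>\<^esub> b \<otimes>\<^bsub>A\<omega>\<^esub> uc c = uc (\<lambda>n. c n \<otimes> y n \<otimes> c n)" using cL yL x by (simp add: y_def)
  also have "\<dots> = uc d"
  proof (subst uc_eq_iff)
    show "((\<lambda>n. cnorm A (c n \<otimes> y n \<otimes> c n \<ominus> d n)) \<longlongrightarrow> 0) \<omega>"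
      by (rule tendsto_zero_le[OF inverse_tendsto]) (use c(4) in \<open>auto simp: d_def less_imp_le\<close>)
  qed (use cL yL dL in auto)
  finally have 1: "uc c \<otimes>\<^bsub>A\<omega>\<^esub> b \<otimes>\<^bsub>A\<omega>\<^esub> uc c = uc d" .
  have 2: "cadj A\<omega> (uc c) = uc c" using cL c(2) by (simp add: csa_adj)
  have 3: "d n \<in> P \<and> d n \<in> npos A" for n
    using c(1) FP P npos_conj_csa[OF Fpos[OF xc] c(2)] unfolding d_def y_def
    by (auto simp: unital_cstar_subalgebra_def cstar_subalgebra_def)
  have "uc d \<noteq> \<zero>\<^bsub>A\<omega>\<^esub>"
  proof
    assume "uc d = \<zero>\<^bsub>A\<omega>\<^esub>"
    then have "((\<lambda>n. cnorm A (d n)) \<longlongrightarrow> 0) \<omega>" using uc_norm[OF dL] by simp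
    then have "((\<lambda>n. cnorm A (d n) + 1 / real (Suc n)) \<longlongrightarrow> 0 + 0) \<omega>" by (intro tendsto_add inverse_tendsto)
    then have lim: "((\<lambda>n. \<bar>C\<bar> * (cnorm A (d n) + 1 / real (Suc n))) \<longlongrightarrow> 0) \<omega>"
      by (intro tendsto_mult_right_zero) simp
    have "((\<lambda>n. cnorm A (y n)) \<longlongrightarrow> 0) \<omega>"
    proof (rule tendsto_zero_le[OF lim])
      fix n
      have "cnorm A (y n) = (cnorm A (x n))\<^sup>2" unfolding y_def by (rule cstar_identity[OF xc])
      also have "\<dots> \<le> C * cnorm A (F (y n))" using low[OF xc] by (simp add: y_def)
      also have "\<dots> \<le> \<bar>C\<bar> * (cnorm A (d n) + 1 / real (Suc n))"
        using c(5)[of n] by (intro mult_mono) (auto simp: d_def)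
      finally show "cnorm A (y n) \<le> \<bar>C\<bar> * (cnorm A (d n) + 1 / real (Suc n))" .
    qed simp
    then have "uc y = uc (\<lambda>_. \<zero>)" using yL by (subst uc_eq_iff) (auto simp: minus_eq)
    moreover have "y = (\<lambda>n. cadj A (x n) \<otimes> x n)" by (simp add: y_def fun_eq_iff)
    ultimately show False using b(2) x(2) by (simp add: U_zero)
  qed
  then show ?thesis using 1 2 3 cL dL c(1) by blast
qed

text \<open>Coordinatewise with tolerance 1/(n+1). The common value in coordinate n is an element of
  norm 1 multiplied by the norm of d n, so its class has the norm of the class of d and is
  nonzero.\<close>

lemma orthogonal_copies_ultra:
  assumes s: "csimple A" and inf: "\<not> cfinite_dimensional A"
    and d: "d \<in> carrier L" "\<And>n. d n \<in> npos A" "uc d \<noteq> \<zero>\<^bsub>A\<omega>\<^esub>"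
  shows "\<exists>z a. a \<in> npos A\<omega> \<and> a \<noteq> \<zero>\<^bsub>A\<omega>\<^esub> \<and> (\<forall>i<m. z i \<in> carrier A\<omega>) \<and>
    (\<forall>i<m::nat. \<forall>j<m. z i \<otimes>\<^bsub>A\<omega>\<^esub> uc d \<otimes>\<^bsub>A\<omega>\<^esub> cadj A\<omega> (z j) = (if i = j then a else \<zero>\<^bsub>A\<omega>\<^esub>))"
proof -
  have one0: "\<one> \<noteq> \<zero>" using s by (simp add: csimple_def)
  have ex: "\<exists>z a. a \<in> npos A \<and> cnorm A a = 1 \<and> (\<forall>i<m. z i \<in> carrier A \<and> cnorm A (z i) \<le> 1) \<and>
    (\<forall>i<m. \<forall>j<m. cnorm A (z i \<otimes> d n \<otimes> cadj A (z j) \<ominus> (if i = j then cscale A (complex_of_real (cnorm A (d n))) a else \<zero>)) \<le> 1 / real (Suc n))"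
    for n
  \<comment> \<open>Where d vanishes, both sides of the estimate are zero and any contractions do;
    copies for h = 1 are taken so that a still has norm 1.\<close>
  proof (cases "d n = \<zero>")
    case True
    obtain z a where "a \<in> npos A" "cnorm A a = 1" "\<forall>i<m. z i \<in> carrier A \<and> cnorm A (z i) \<le> 1 \<and> z i \<otimes> cadj A (z i) = a"
      using simple_orthogonal_copies[OF s inf npos_one one0 zero_less_one, of m] by (elim exE conjE)
    then show ?thesis using True by (intro exI[of _ z] exI[of _ a]) (auto simp: minus_eq)
  next
    case False
    have "0 < 1 / real (Suc n)" by simp
    from simple_orthogonal_copies[OF s inf d(2) False this, of m]
    obtain z a where z: "a \<in> npos A" "cnorm A a = 1" "\<forall>i<m. z i \<in> carrier A \<and> cnorm A (z i) \<le> 1 \<and> z i \<otimes> cadj A (z i) = a"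
       "\<forall>i<m. \<forall>j<m. i \<noteq> j \<longrightarrow> z i \<otimes> cadj A (z j) = \<zero>"
       "\<forall>i<m. \<forall>j<m. cnorm A (z i \<otimes> d n \<otimes> cadj A (z j) \<ominus> cscale A (complex_of_real (cnorm A (d n))) (z i \<otimes> cadj A (z j))) \<le> 1 / real (Suc n)"
      by (elim exE conjE)
    have "cnorm A (z i \<otimes> d n \<otimes> cadj A (z j) \<ominus> (if i = j then cscale A (complex_of_real (cnorm A (d n))) a else \<zero>)) \<le> 1 / real (Suc n)"
      if "i < m" "j < m" for i j
      using z(3,4) z(5)[rule_format, OF that] that by (cases "i = j") auto
    then show ?thesis using z(1-3) by (intro exI[of _ z] exI[of _ a]) auto
  qed
  define Q where "Q n z a \<longleftrightarrow> a \<in> npos A \<and> cnorm A a = 1 \<and> (\<forall>i<m. z i \<in> carrier A \<and> cnorm A (z i) \<le> 1) \<and>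
    (\<forall>i<m. \<forall>j<m. cnorm A (z i \<otimes> d n \<otimes> cadj A (z j) \<ominus> (if i = j then cscale A (complex_of_real (cnorm A (d n))) a else \<zero>)) \<le> 1 / real (Suc n))"
    for n z a
  have "\<forall>n. \<exists>z a. Q n z a" unfolding Q_def using ex by blast
  then obtain z a where Q: "\<And>n. Q n (z n) (a n)" by metis
  have a: "a n \<in> npos A" "cnorm A (a n) = 1" for n using Q[of n] by (simp_all add: Q_def)
  have z: "z n i \<in> carrier A" "cnorm A (z n i) \<le> 1" if "i < m" for n i using Q[of n] that by (simp_all add: Q_def)
  have zd: "cnorm A (z n i \<otimes> d n \<otimes> cadj A (z n j) \<ominus> (if i = j then cscale A (complex_of_real (cnorm A (d n))) (a n) else \<zero>)) \<le> 1 / real (Suc n)"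
    if "i < m" "j < m" for n i j using Q[of n] that by (simp add: Q_def)
  have dc [simp]: "d n \<in> carrier A" "a n \<in> carrier A" for n using d a by auto
  define Z where "Z i = uc (\<lambda>n. z n i)" for i
  have zL [simp]: "(\<lambda>n. z n i) \<in> carrier L" if "i < m" for i using z that by (intro bdseqI[of _ _ 1]) auto
  define y where "y n = cscale A (complex_of_real (cnorm A (d n))) (a n)" for n
  have yn: "cnorm A (y n) = cnorm A (d n)" for n by (simp add: y_def norm_scale a)
  have yp: "y n \<in> npos A" for n unfolding y_def using a by (intro npos_scale) auto
  have yL [simp]: "y \<in> carrier L"
    using bdseq_bound[OF d(1)] yp yn by (auto intro!: bdseqI)
  have "cnorm A\<omega> (uc y) = cnorm A\<omega> (uc d)" using uc_norm[OF d(1)] by (intro uc_norm_eqI) (auto simp: yn)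
  then have y0: "uc y \<noteq> \<zero>\<^bsub>A\<omega>\<^esub>" using d(1,3) U.norm_eq_zero by (metis U.norm_zero uc_closed)
  have "Z i \<otimes>\<^bsub>A\<omega>\<^esub> uc d \<otimes>\<^bsub>A\<omega>\<^esub> cadj A\<omega> (Z j) = (if i = j then uc y else \<zero>\<^bsub>A\<omega>\<^esub>)" if ij: "i < m" "j < m" for i j
  proof -
    have "Z i \<otimes>\<^bsub>A\<omega>\<^esub> uc d \<otimes>\<^bsub>A\<omega>\<^esub> cadj A\<omega> (Z j) = uc (\<lambda>n. z n i \<otimes> d n \<otimes> cadj A (z n j))"
      unfolding Z_def using ij d(1) by simp
    also have "\<dots> = uc (\<lambda>n. if i = j then y n else \<zero>)"
    proof (subst uc_eq_iff)
      show "((\<lambda>n. cnorm A (z n i \<otimes> d n \<otimes> cadj A (z n j) \<ominus> (if i = j then y n else \<zero>))) \<longlongrightarrow> 0) \<omega>"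
        by (rule tendsto_zero_le[OF inverse_tendsto])
          (use zd[OF ij] z(1)[OF ij(1)] z(1)[OF ij(2)] yp in \<open>auto simp: y_def\<close>)
    qed (use ij d(1) in \<open>cases "i = j"; simp\<close>)+
    finally show ?thesis by (auto simp: U_zero)
  qed
  moreover have "Z i \<in> carrier A\<omega>" if "i < m" for i unfolding Z_def using that by simp
  ultimately show ?thesis using uc_npos[OF yL yp] y0 by (intro exI[of _ Z] exI[of _ "uc y"]) auto
qed

end

section \<open>The dual expectation\<close>

text \<open>From here on v j is the adjoint of u j. The index is then a sum of positive elements,
  and the unit of the basic construction is a sum of squares of the form x e x*.\<close>

locale simple_index = finite_index A P E N u "\<lambda>j. cadj A (u j)" for A :: "'a cstar" (structure) and P E N u +
  assumes simple: "csimple A"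
begin

lemma one_nonzero: "\<one> \<noteq> \<zero>" using simple by (simp add: csimple_def)

definition k :: real where "k = cnorm A (Index A E)"

lemma Index_sum: "Index A E = (\<Oplus>j\<in>{..<N}. u j \<otimes> cadj A (u j))"
  using Index_eq .

lemma Index_npos: "Index A E \<in> npos A"
  unfolding Index_sum by (intro npos_finsum) (auto intro: star_npos')

lemma LL_one_sum: "\<one>\<^bsub>LL\<^esub> = (\<Oplus>\<^bsub>LL\<^esub>j\<in>{..<N}. \<iota> (u j) \<star> e \<star> \<iota> (cadj A (u j)))"
  using op_expand[OF adjm_id] by (simp add: LL_one jones_sum_eq)

text \<open>Multiplying the expansion of the unit by a on the left and on the right gives two
  expansions of the same operator, and \<open>dual_sum_unique\<close> equates the two sums.\<close>

lemma Index_central: assumes a: "a \<in> carrier A" shows "Index A E \<otimes> a = a \<otimes> Index A E"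
proof -

  have "\<iota> a = (\<Oplus>\<^bsub>LL\<^esub>j\<in>{..<N}. \<iota> (a \<otimes> u j) \<star> e \<star> \<iota> (cadj A (u j)))"
  proof -
    have "\<iota> a = \<iota> a \<star> (\<Oplus>\<^bsub>LL\<^esub>j\<in>{..<N}. \<iota> (u j) \<star> e \<star> \<iota> (cadj A (u j)))"
      unfolding LL_one_sum[symmetric] using a by simp
    also have "\<dots> = (\<Oplus>\<^bsub>LL\<^esub>j\<in>{..<N}. \<iota> a \<star> (\<iota> (u j) \<star> e \<star> \<iota> (cadj A (u j))))"
      using a by (intro B.finsum_rdistr) auto
    also have "\<dots> = (\<Oplus>\<^bsub>LL\<^esub>j\<in>{..<N}. \<iota> (a \<otimes> u j) \<star> e \<star> \<iota> (cadj A (u j)))"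
      using a by (intro B.finsum_cong') (auto simp: iota_mult B.m_assoc)
    finally show ?thesis .
  qed
  then have l: "op (\<lambda>x. a \<otimes> x) = jones_sum A E N (\<lambda>j. a \<otimes> u j) (\<lambda>j. cadj A (u j))"
    using a by (simp add: jones_sum_eq iota_op[symmetric])
  have "\<iota> a = (\<Oplus>\<^bsub>LL\<^esub>j\<in>{..<N}. \<iota> (u j) \<star> e \<star> \<iota> (cadj A (u j) \<otimes> a))"
  proof -
    have "\<iota> a = (\<Oplus>\<^bsub>LL\<^esub>j\<in>{..<N}. \<iota> (u j) \<star> e \<star> \<iota> (cadj A (u j))) \<star> \<iota> a"
      unfolding LL_one_sum[symmetric] using a by simp
    also have "\<dots> = (\<Oplus>\<^bsub>LL\<^esub>j\<in>{..<N}. \<iota> (u j) \<star> e \<star> \<iota> (cadj A (u j)) \<star> \<iota> a)"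
      using a by (intro B.finsum_ldistr) auto
    also have "\<dots> = (\<Oplus>\<^bsub>LL\<^esub>j\<in>{..<N}. \<iota> (u j) \<star> e \<star> \<iota> (cadj A (u j) \<otimes> a))"
      using a by (intro B.finsum_cong') (auto simp: iota_mult B.m_assoc)
    finally show ?thesis .
  qed
  then have r: "op (\<lambda>x. a \<otimes> x) = jones_sum A E N u (\<lambda>j. cadj A (u j) \<otimes> a)"
    using a by (simp add: jones_sum_eq iota_op[symmetric])
  have "(\<Oplus>j\<in>{..<N}. (a \<otimes> u j) \<otimes> cadj A (u j)) = (\<Oplus>j\<in>{..<N}. u j \<otimes> (cadj A (u j) \<otimes> a))"
    using dual_sum_unique[OF _ adjm_lm[OF a] l] dual_sum_unique[OF _ adjm_lm[OF a] r] a by simp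
  moreover have "(\<Oplus>j\<in>{..<N}. (a \<otimes> u j) \<otimes> cadj A (u j)) = a \<otimes> Index A E"
  proof -
    have "a \<otimes> Index A E = (\<Oplus>j\<in>{..<N}. a \<otimes> (u j \<otimes> cadj A (u j)))"
      unfolding Index_sum using a by (intro finsum_rdistr) auto
    also have "\<dots> = (\<Oplus>j\<in>{..<N}. (a \<otimes> u j) \<otimes> cadj A (u j))"
      using a by (intro finsum_cong') (auto simp: m_assoc)
    finally show ?thesis by simp
  qed
  moreover have "(\<Oplus>j\<in>{..<N}. u j \<otimes> (cadj A (u j) \<otimes> a)) = Index A E \<otimes> a"
  proof -
    have "Index A E \<otimes> a = (\<Oplus>j\<in>{..<N}. (u j \<otimes> cadj A (u j)) \<otimes> a)"
      unfolding Index_sum using a by (intro finsum_ldistr) auto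
    also have "\<dots> = (\<Oplus>j\<in>{..<N}. u j \<otimes> (cadj A (u j) \<otimes> a))"
      using a by (intro finsum_cong') (auto simp: m_assoc)
    finally show ?thesis by simp
  qed
  ultimately show ?thesis by simp
qed

lemma Index_scalar: "Index A E = creal A k"
  unfolding k_def by (rule central_npos_scalar[OF simple Index_npos Index_central])

text \<open>Each u j u j* is a positive summand of the index. If the index had norm 0, all u j would
  vanish and the expansion of 1 would give 1 = 0.\<close>

lemma k_pos: "k > 0"
proof (rule ccontr)
  assume "\<not> k > 0"
  then have k0: "k \<le> 0" by simp
  have "u j = \<zero>" if j: "j < N" for j
  proof -
    have "cnorm A (u j \<otimes> cadj A (u j)) \<le> k"
      unfolding k_def Index_sum using j by (intro npos_summand_le) (auto intro: star_npos')
    then have "(cnorm A (u j))\<^sup>2 \<le> 0" using cstar_identity'[OF uv(1)[OF j]] k0 by linarith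
    then show ?thesis using norm_eq_zero[of "u j"] uv(1)[OF j] by simp
  qed
  then have "(\<Oplus>j\<in>{..<N}. u j \<otimes> E (cadj A (u j) \<otimes> \<one>)) = (\<Oplus>j\<in>{..<N}. \<zero>)"
    by (intro finsum_cong') auto
  then have "\<one> = \<zero>" using qb_left[of \<one>] by simp
  then show False using one_nonzero by simp
qed

abbreviation "F \<equiv> dual_expectation A E"

lemma inv_Index: "inv (Index A E) = creal A (1/k)"
proof -
  have "creal A k \<otimes> creal A (1/k) = \<one>" "creal A (1/k) \<otimes> creal A k = \<one>"
    using k_pos by (simp_all add: scale_one_mult scale_scale)
  then show ?thesis unfolding Index_scalar by (metis inv_char scale_closed one_closed)
qed

lemma F_op:
  assumes "adjm \<phi> \<psi>"
  shows "F (op \<phi>) = \<iota> (cscale A (complex_of_real (1/k)) (\<Oplus>j\<in>{..<N}. \<phi> (u j) \<otimes> cadj A (u j)))"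
proof -
  have "(\<Oplus>j\<in>{..<N}. \<phi> (u j) \<otimes> cadj A (u j)) \<in> carrier A" using adjmD(1)[OF assms] by (intro finsum_closed) auto
  then show ?thesis using dual_expectation_eq[OF assms] unfolding inv_Index by (simp only: scale_one_mult)
qed

lemma F_jones_sum:
  assumes xy: "\<And>i. i < n \<Longrightarrow> x i \<in> carrier A \<and> y i \<in> carrier A"
  shows "F (jones_sum A E n x y) = \<iota> (cscale A (complex_of_real (1/k)) (\<Oplus>i\<in>{..<n}. x i \<otimes> y i))"
proof -
  note js = jones_sum_op[of n x y, OF xy]
  have "F (jones_sum A E n x y) = F (op (\<lambda>z. \<Oplus>i\<in>{..<n}. x i \<otimes> E (y i \<otimes> z)))"
    by (rule arg_cong[OF js(1)]) simp
  also have "\<dots> = \<iota> (cscale A (complex_of_real (1/k)) (\<Oplus>j\<in>{..<N}. (\<Oplus>i\<in>{..<n}. x i \<otimes> E (y i \<otimes> u j)) \<otimes> cadj A (u j)))"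
    by (rule F_op[OF js(2)]) simp
  also have "\<dots> = \<iota> (cscale A (complex_of_real (1/k)) (\<Oplus>i\<in>{..<n}. x i \<otimes> y i))"
    using dual_sum_unique[of n x y, OF xy js(2) js(1)[symmetric]] by simp
  finally show ?thesis .
qed

lemma F_sandwich:
  assumes "a \<in> carrier A" shows "F (\<iota> a \<star> e) = \<iota> (cscale A (complex_of_real (1/k)) a)"
proof -
  have "jones_sum A E 1 (\<lambda>_. a) (\<lambda>_. \<one>) = \<iota> a \<star> e"
    unfolding jones_sum_eq using assms by (simp add: iota_one lessThan_Suc)
  then show ?thesis using F_jones_sum[of 1 "\<lambda>_. a" "\<lambda>_. \<one>"] assms by (simp add: lessThan_Suc)
qed

lemma F_iota: "T \<in> carrier LL \<Longrightarrow> F T \<in> \<iota> ` carrier A"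
  by (auto elim!: LL_obtain simp: F_op adjmD intro!: imageI scale_closed finsum_closed)

lemma iota_npos: "a \<in> npos A \<Longrightarrow> \<iota> a \<in> npos LL"
proof -
  assume "a \<in> npos A"
  then obtain b where "b \<in> npos A" "b \<otimes> b = a" using npos_sqrt by blast
  then show ?thesis using B.star_npos[of "\<iota> b"] by (simp add: csa_adj npos_csa flip: iota_adj iota_mult)
qed

text \<open>The expansion of the unit is inserted between T and T*, and \<open>op_e\<close> moves T
  onto the u j. With equal outer factors, the dual expectation of T T* becomes a sum of positive
  elements.\<close>

lemma star_expand:
  assumes T: "T \<in> carrier LL"
  shows "\<exists>x. (\<forall>j<N. x j \<in> carrier A) \<and> T \<star> cadj LL T = jones_sum A E N x (\<lambda>j. cadj A (x j))"
proof -
  obtain \<phi> \<psi> where a: "adjm \<phi> \<psi>" "T = op \<phi>" using T by (rule LL_obtain)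
  note [simp] = adjmD(1)[OF a(1)] T
  have "T \<star> cadj LL T = T \<star> \<one>\<^bsub>LL\<^esub> \<star> cadj LL T" by simp
  also have "\<one>\<^bsub>LL\<^esub> = (\<Oplus>\<^bsub>LL\<^esub>j\<in>{..<N}. \<iota> (u j) \<star> e \<star> \<iota> (cadj A (u j)))"
    by (rule LL_one_sum)
  also have "T \<star> \<dots> = (\<Oplus>\<^bsub>LL\<^esub>j\<in>{..<N}. T \<star> (\<iota> (u j) \<star> e \<star> \<iota> (cadj A (u j))))"
    by (intro B.finsum_rdistr) auto
  also have "\<dots> \<star> cadj LL T = (\<Oplus>\<^bsub>LL\<^esub>j\<in>{..<N}. T \<star> (\<iota> (u j) \<star> e \<star> \<iota> (cadj A (u j))) \<star> cadj LL T)"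
    by (intro B.finsum_ldistr) auto
  also have "\<dots> = (\<Oplus>\<^bsub>LL\<^esub>j\<in>{..<N}. \<iota> (\<phi> (u j)) \<star> e \<star> \<iota> (cadj A (\<phi> (u j))))"
  proof (intro B.finsum_cong')
    fix j assume "j \<in> {..<N}"
    then have j [simp]: "u j \<in> carrier A" by simp
    have Tu: "T \<star> \<iota> (u j) \<star> e = \<iota> (\<phi> (u j)) \<star> e" unfolding a(2) by (rule op_e[OF a(1) j])
    have "T \<star> (\<iota> (u j) \<star> e \<star> \<iota> (cadj A (u j))) \<star> cadj LL T = (T \<star> \<iota> (u j) \<star> e) \<star> cadj LL (T \<star> \<iota> (u j) \<star> e)"
      by (simp add: B.adj_mult e_adj iota_adj B.m_assoc) (simp flip: B.m_assoc add: e_idem)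
    also have "\<dots> = \<iota> (\<phi> (u j)) \<star> e \<star> \<iota> (cadj A (\<phi> (u j)))"
      unfolding Tu by (simp add: B.adj_mult e_adj iota_adj B.m_assoc) (simp flip: B.m_assoc add: e_idem)
    finally show "T \<star> (\<iota> (u j) \<star> e \<star> \<iota> (cadj A (u j))) \<star> cadj LL T = \<iota> (\<phi> (u j)) \<star> e \<star> \<iota> (cadj A (\<phi> (u j)))" .
  qed auto
  finally show ?thesis unfolding jones_sum_eq by (intro exI[of _ "\<lambda>j. \<phi> (u j)"]) auto
qed

text \<open>The second inequality is of Pimsner-Popa type. T* T is a sum of N terms x e x*, each
  with norm at most that of s, and its image under F is s/k; this is the origin of the constant N
  k.\<close>

lemma F_star:
  assumes T: "T \<in> carrier LL"
  shows "F (cadj LL T \<star> T) \<in> npos LL" "(cnorm LL T)\<^sup>2 \<le> (real N * k) * cnorm LL (F (cadj LL T \<star> T))"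
proof -
  obtain x where x: "\<And>j. j < N \<Longrightarrow> x j \<in> carrier A" "cadj LL T \<star> T = jones_sum A E N x (\<lambda>j. cadj A (x j))"
    using star_expand[of "cadj LL T"] T by auto
  define s where "s = (\<Oplus>j\<in>{..<N}. x j \<otimes> cadj A (x j))"
  have s: "s \<in> npos A" unfolding s_def using x(1) by (intro npos_finsum) (auto intro: star_npos')
  have Fs: "F (cadj LL T \<star> T) = \<iota> (cscale A (complex_of_real (1/k)) s)"
    unfolding x(2) s_def using x(1) by (intro F_jones_sum) auto
  show "F (cadj LL T \<star> T) \<in> npos LL" unfolding Fs using s k_pos by (intro iota_npos npos_scale) auto
  have "(cnorm LL T)\<^sup>2 = cnorm LL (\<Oplus>\<^bsub>LL\<^esub>j\<in>{..<N}. \<iota> (x j) \<star> e \<star> \<iota> (cadj A (x j)))"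
    using B.cstar_identity[OF T] x(2) by (simp add: jones_sum_eq)
  also have "\<dots> \<le> (\<Sum>j<N. cnorm LL (\<iota> (x j) \<star> e \<star> \<iota> (cadj A (x j))))"
    using x(1) by (intro B.finsum_norm) auto
  also have "\<dots> \<le> (\<Sum>j<N. cnorm A s)"
  proof (rule sum_mono)
    fix j assume "j \<in> {..<N}"
    then have j [simp]: "x j \<in> carrier A" "j < N" using x by auto
    have "cnorm LL (\<iota> (x j) \<star> e \<star> \<iota> (cadj A (x j))) \<le> (cnorm A (x j) * 1) * cnorm A (x j)"
      using norm_e_le by (intro B.norm_mult_le) (auto simp: iota_norm)
    also have "\<dots> = cnorm A (x j \<otimes> cadj A (x j))" using cstar_identity'[OF j(1)] by (simp add: power2_eq_square)
    also have "\<dots> \<le> cnorm A s"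
      unfolding s_def using x(1) by (intro npos_summand_le) (auto intro: star_npos')
    finally show "cnorm LL (\<iota> (x j) \<star> e \<star> \<iota> (cadj A (x j))) \<le> cnorm A s" .
  qed
  also have "\<dots> = (real N * k) * cnorm LL (F (cadj LL T \<star> T))"
    unfolding Fs using s k_pos by (simp add: iota_norm norm_scale norm_divide)
  finally show "(cnorm LL T)\<^sup>2 \<le> (real N * k) * cnorm LL (F (cadj LL T \<star> T))" .
qed

lemma F_bounded: "\<exists>K. \<forall>T\<in>carrier LL. cnorm LL (F T) \<le> K * cnorm LL T"
proof (intro exI ballI)
  let ?K = "1/k * (\<Sum>j<N. M * en (u j) * cnorm A (u j))"
  fix T assume "T \<in> carrier LL"
  then obtain \<phi> \<psi> where a: "adjm \<phi> \<psi>" "T = op \<phi>" by (rule LL_obtain)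
  note [simp] = adjmD(1)[OF a(1)]
  have c: "(\<Oplus>j\<in>{..<N}. \<phi> (u j) \<otimes> cadj A (u j)) \<in> carrier A" by (intro finsum_closed) auto
  have "cnorm A (\<Oplus>j\<in>{..<N}. \<phi> (u j) \<otimes> cadj A (u j)) \<le> (\<Sum>j<N. cnorm A (\<phi> (u j) \<otimes> cadj A (u j)))"
    by (intro finsum_norm) auto
  also have "\<dots> \<le> (\<Sum>j<N. M * (opn \<phi> * en (u j)) * cnorm A (u j))"
  proof (rule sum_mono)
    fix j assume "j \<in> {..<N}"
    then have j [simp]: "u j \<in> carrier A" by simp
    have "cnorm A (\<phi> (u j)) \<le> M * en (\<phi> (u j))" by (intro norm_le_en) simp
    also have "\<dots> \<le> M * (opn \<phi> * en (u j))" using opn_bound(1)[OF a(1) j] M_pos by (intro mult_left_mono) auto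
    finally show "cnorm A (\<phi> (u j) \<otimes> cadj A (u j)) \<le> M * (opn \<phi> * en (u j)) * cnorm A (u j)"
      by (intro norm_mult_le) auto
  qed
  finally have "cnorm LL (F T) \<le> 1/k * (\<Sum>j<N. M * (opn \<phi> * en (u j)) * cnorm A (u j))"
    unfolding a(2) F_op[OF a(1)] using c k_pos by (simp add: iota_norm norm_scale norm_divide divide_right_mono)
  also have "\<dots> = ?K * cnorm LL T"
    unfolding a(2) LL_norm[OF a(1)] by (simp add: sum_distrib_left sum_distrib_right ac_simps)
  finally show "cnorm LL (F T) \<le> ?K * cnorm LL T" .
qed

lemma iota_subalgebra: "unital_cstar_subalgebra (\<iota> ` carrier A) LL"
  unfolding unital_cstar_subalgebra_def cstar_subalgebra_def
proof (intro conjI ballI allI)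
  show "cclosed LL (\<iota> ` carrier A)" unfolding cclosed_def
  proof (intro allI impI)
    fix x T assume *: "(\<forall>n. x n \<in> \<iota> ` carrier A) \<and> T \<in> carrier LL \<and> ctendsto LL x T"
    then have "\<forall>n. \<exists>a. a \<in> carrier A \<and> x n = \<iota> a" by blast
    then obtain a where a: "\<And>n. a n \<in> carrier A" "\<And>n. x n = \<iota> (a n)" by metis
    have "\<exists>b\<in>carrier A. ctendsto A a b"
    proof (rule complete[OF a(1)])
      fix \<epsilon> :: real assume "0 < \<epsilon>"
      have "\<forall>\<^sub>F n in sequentially. cnorm LL (x n \<ominus>\<^bsub>LL\<^esub> T) < \<epsilon>/2"
        using * \<open>0 < \<epsilon>\<close> order_tendstoD(2)[of "\<lambda>n. cnorm LL (x n \<ominus>\<^bsub>LL\<^esub> T)" 0 sequentially "\<epsilon>/2"] by (simp add: ctendsto_def)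
      then obtain N where N: "\<And>n. n \<ge> N \<Longrightarrow> cnorm LL (x n \<ominus>\<^bsub>LL\<^esub> T) < \<epsilon>/2" by (auto simp: eventually_sequentially)
      have "cnorm A (a m \<ominus> a n) < \<epsilon>" if "m \<ge> N" "n \<ge> N" for m n
      proof -
        have "cnorm A (a m \<ominus> a n) = cnorm LL (x m \<ominus>\<^bsub>LL\<^esub> x n)"
          using a by (simp add: iota_norm[symmetric] iota_diff)
        also have "\<dots> \<le> cnorm LL (x m \<ominus>\<^bsub>LL\<^esub> T) + cnorm LL (T \<ominus>\<^bsub>LL\<^esub> x n)"
          using * a by (intro B.norm_diff_triangle) auto
        finally show ?thesis using N[OF that(1)] N[OF that(2)] B.norm_minus_commute[of T "x n"] * a by simp
      qed
      then show "\<exists>N. \<forall>m\<ge>N. \<forall>n\<ge>N. cnorm A (a m \<ominus> a n) < \<epsilon>" by blast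
    qed
    then obtain b where b: "b \<in> carrier A" "ctendsto A a b" by blast
    have "ctendsto LL x (\<iota> b)" using b a by (simp add: ctendsto_def iota_norm flip: iota_diff)
    then have "T = \<iota> b" using B.ctendsto_unique[of x T "\<iota> b"] * a b by simp
    then show "T \<in> \<iota> ` carrier A" using b by blast
  qed
qed (auto simp: iota_one[symmetric] iota_zero[symmetric] simp flip: iota_add iota_mult iota_adj iota_scale)

end

section \<open>Ultrapowers of the basic construction\<close>

locale tower = simple_index A P E N u for A :: "'a cstar" (structure) and P E N u +
  fixes \<omega> :: "nat filter"
  assumes free: "free_ultrafilter \<omega>"
begin

sublocale AU: cstar_ultra A \<omega> by unfold_locales (rule free)
sublocale BU: cstar_ultra LL \<omega> by unfold_locales (rule free)

abbreviation "A\<omega> \<equiv> ultrapower \<omega> A"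
abbreviation "B\<omega> \<equiv> ultrapower \<omega> LL"
abbreviation "uA \<equiv> ultra_class \<omega> A"
abbreviation "uB \<equiv> ultra_class \<omega> LL"
abbreviation "J \<equiv> ultra_map \<omega> LL \<iota>"
abbreviation "EU \<equiv> ultra_map \<omega> A E"
abbreviation "kA \<equiv> \<lambda>a. ultra_const \<omega> A a"
abbreviation "kB \<equiv> \<lambda>T. ultra_const \<omega> LL T"
abbreviation "e\<omega> \<equiv> kB e"
abbreviation umultA (infixl "\<cdot>" 70) where "X \<cdot> Y \<equiv> X \<otimes>\<^bsub>A\<omega>\<^esub> Y"
abbreviation umultB (infixl "\<bullet>" 70) where "X \<bullet> Y \<equiv> X \<otimes>\<^bsub>B\<omega>\<^esub> Y"

lemma J_uc:
  assumes "x \<in> bdseq A"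
  shows "(\<lambda>n. \<iota> (x n)) \<in> bdseq LL" "J (uA x) = uB (\<lambda>n. \<iota> (x n))"
proof -
  have *: "\<And>a. a \<in> carrier A \<Longrightarrow> cnorm LL (\<iota> a) \<le> 1 * cnorm A a"
    by (simp add: iota_norm)
  note m = ultra_map_class[OF AU.cstar_ultra_axioms BU.cstar_ultra_axioms, of \<iota> 1, OF _ _ * assms]
  show "(\<lambda>n. \<iota> (x n)) \<in> bdseq LL" "J (uA x) = uB (\<lambda>n. \<iota> (x n))"
    by (intro m; simp add: iota_diff)+
qed

lemma EU_uc:
  assumes "x \<in> bdseq A"
  shows "(\<lambda>n. E (x n)) \<in> bdseq A" "EU (uA x) = uA (\<lambda>n. E (x n))"
proof -
  have *: "\<And>a. a \<in> carrier A \<Longrightarrow> cnorm A (E a) \<le> 1 * cnorm A a"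
    by (simp add: E_norm)
  note m = ultra_map_class[OF AU.cstar_ultra_axioms AU.cstar_ultra_axioms, of E 1, OF _ _ * assms]
  show "(\<lambda>n. E (x n)) \<in> bdseq A" "EU (uA x) = uA (\<lambda>n. E (x n))"
    by (intro m; simp add: E_diff)+
qed

lemma J_closed [simp]: "X \<in> carrier A\<omega> \<Longrightarrow> J X \<in> carrier B\<omega>"
  by (auto elim!: AU.U_obtain simp: J_uc)

lemma EU_closed [simp]: "X \<in> carrier A\<omega> \<Longrightarrow> EU X \<in> carrier A\<omega>"
  by (auto elim!: AU.U_obtain simp: EU_uc)

lemma J_mult: "\<lbrakk>X \<in> carrier A\<omega>; Y \<in> carrier A\<omega>\<rbrakk> \<Longrightarrow> J (X \<cdot> Y) = J X \<bullet> J Y"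
  by (auto elim!: AU.U_obtain simp: J_uc iota_mult bdseqD)

lemma J_add: "\<lbrakk>X \<in> carrier A\<omega>; Y \<in> carrier A\<omega>\<rbrakk> \<Longrightarrow> J (X \<oplus>\<^bsub>A\<omega>\<^esub> Y) = J X \<oplus>\<^bsub>B\<omega>\<^esub> J Y"
  by (auto elim!: AU.U_obtain simp: J_uc iota_add bdseqD)

lemma J_diff: "\<lbrakk>X \<in> carrier A\<omega>; Y \<in> carrier A\<omega>\<rbrakk> \<Longrightarrow> J (X \<ominus>\<^bsub>A\<omega>\<^esub> Y) = J X \<ominus>\<^bsub>B\<omega>\<^esub> J Y"
  by (auto elim!: AU.U_obtain simp: J_uc iota_diff bdseqD)

lemma J_scale: "X \<in> carrier A\<omega> \<Longrightarrow> J (cscale A\<omega> c X) = cscale B\<omega> c (J X)"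
  by (auto elim!: AU.U_obtain simp: J_uc iota_scale bdseqD)

lemma J_adj: "X \<in> carrier A\<omega> \<Longrightarrow> J (cadj A\<omega> X) = cadj B\<omega> (J X)"
  by (auto elim!: AU.U_obtain simp: J_uc iota_adj bdseqD)

lemma J_const: "a \<in> carrier A \<Longrightarrow> J (kA a) = kB (\<iota> a)"
  by (simp add: J_uc)

lemma J_one: "J \<one>\<^bsub>A\<omega>\<^esub> = \<one>\<^bsub>B\<omega>\<^esub>"
  unfolding AU.U_one BU.U_one by (simp add: J_const iota_one)

lemma J_zero: "J \<zero>\<^bsub>A\<omega>\<^esub> = \<zero>\<^bsub>B\<omega>\<^esub>"
  unfolding AU.U_zero BU.U_zero by (simp add: J_const iota_zero)

lemma J_norm: assumes "X \<in> carrier A\<omega>" shows "cnorm B\<omega> (J X) = cnorm A\<omega> X"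
proof -
  obtain x where x: "x \<in> bdseq A" "X = uA x" using assms by (rule AU.U_obtain)
  show ?thesis unfolding x(2) J_uc(2)[OF x(1)]
    by (rule BU.uc_norm_eqI[OF J_uc(1)[OF x(1)]]) (use AU.uc_norm[OF x(1)] in \<open>simp add: iota_norm bdseqD[OF x(1)]\<close>)
qed

lemma J_inj: "\<lbrakk>X \<in> carrier A\<omega>; Y \<in> carrier A\<omega>; J X = J Y\<rbrakk> \<Longrightarrow> X = Y"
  using J_norm[of "X \<ominus>\<^bsub>A\<omega>\<^esub> Y"] AU.U.norm_eq_zero[of "X \<ominus>\<^bsub>A\<omega>\<^esub> Y"] AU.U.diff_eq_zero[of X Y] BU.U.diff_eq_zero[of "J X" "J Y"]
  by (simp add: J_diff)

lemma J_npos: assumes "X \<in> npos A\<omega>" shows "J X \<in> npos B\<omega>"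
proof -
  note s = AU.U.csqroot_props[OF assms]
  have "cadj B\<omega> (J (csqroot A\<omega> X)) \<bullet> J (csqroot A\<omega> X) = J X"
    using s(1,2) AU.U.csa_adj[OF AU.U.npos_csa[OF s(1)]] by (simp flip: J_mult J_adj)
  then show ?thesis using BU.U.star_npos[of "J (csqroot A\<omega> X)"] s(1) by simp
qed

text \<open>J is unital and isometric and positivity is a norm condition, so the witness t for J X
  is one for X.\<close>

lemma J_npos_imp: assumes X [simp]: "X \<in> carrier A\<omega>" and "J X \<in> npos B\<omega>" shows "X \<in> npos A\<omega>"
proof -
  obtain t where t: "t > 0" "cnorm B\<omega> (creal B\<omega> t \<ominus>\<^bsub>B\<omega>\<^esub> J X) \<le> t" using assms(2) by (rule BU.U.nposE)
  have "J (cadj A\<omega> X) = J X" using BU.U.csa_adj[OF BU.U.npos_csa[OF assms(2)]] by (simp add: J_adj)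
  then have "X \<in> csa A\<omega>" by (intro AU.U.csaI X J_inj) (auto simp: AU.U.adj_closed)
  moreover have "creal B\<omega> t \<ominus>\<^bsub>B\<omega>\<^esub> J X = J (creal A\<omega> t \<ominus>\<^bsub>A\<omega>\<^esub> X)"
    by (simp add: J_diff J_scale J_one AU.U.scale_closed)
  then have "cnorm A\<omega> (creal A\<omega> t \<ominus>\<^bsub>A\<omega>\<^esub> X) \<le> t" using t(2) by (simp add: J_norm AU.U.scale_closed)
  ultimately show ?thesis by (rule AU.U.nposI)
qed

lemma J_csqroot: assumes "X \<in> npos A\<omega>" shows "csqroot B\<omega> (J X) = J (csqroot A\<omega> X)"
  using AU.U.csqroot_props(1,2)[OF assms]
  by (intro BU.U.csqroot_unique J_npos) (auto simp flip: J_mult)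

lemma e\<omega>_closed: "e\<omega> \<in> carrier B\<omega>" by simp

lemma e\<omega>_idem: "e\<omega> \<bullet> e\<omega> = e\<omega>" by (simp add: e_idem)

lemma e\<omega>_adj: "cadj B\<omega> e\<omega> = e\<omega>" by (simp add: e_adj)

lemma e\<omega>_compress: "X \<in> carrier A\<omega> \<Longrightarrow> e\<omega> \<bullet> J X \<bullet> e\<omega> = J (EU X) \<bullet> e\<omega>"
  by (auto elim!: AU.U_obtain simp: J_uc EU_uc e_compress bdseqD)

lemma e\<omega>_commute:
  assumes "x \<in> bdseq A" "\<And>n. x n \<in> P" shows "J (uA x) \<bullet> e\<omega> = e\<omega> \<bullet> J (uA x)"
  using assms by (simp add: J_uc e_commute)

lemma EU_lift: assumes "X \<in> carrier A\<omega>" shows "\<exists>x\<in>bdseq A. EU X = uA x \<and> (\<forall>n. x n \<in> P)"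
  using assms by (auto elim!: AU.U_obtain simp: EU_uc bdseqD intro!: bexI[of _ "\<lambda>n. E (_ n)"])

lemma EU_commute: assumes "X \<in> carrier A\<omega>" shows "J (EU X) \<bullet> e\<omega> = e\<omega> \<bullet> J (EU X)"
  using EU_lift[OF assms] e\<omega>_commute by metis

lemma const_finsum:
  assumes "finite I" "\<And>i. i \<in> I \<Longrightarrow> f i \<in> carrier LL"
  shows "kB (\<Oplus>\<^bsub>LL\<^esub>i\<in>I. f i) = (\<Oplus>\<^bsub>B\<omega>\<^esub>i\<in>I. kB (f i))"
  using assms by (induction I) (auto simp: BU.U_zero Pi_def simp flip: BU.uc_add)

lemma low_bound: assumes "Y \<in> carrier A\<omega>" shows "cnorm A\<omega> Y \<le> M * cnorm B\<omega> (J Y \<bullet> e\<omega>)"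
proof -
  obtain y where y: "y \<in> bdseq A" "Y = uA y" using assms by (rule AU.U_obtain)
  have b: "(\<lambda>n. \<iota> (y n) \<star> e) \<in> bdseq LL" using J_uc(1)[OF y(1)] by simp
  have "((\<lambda>n. M * cnorm LL (\<iota> (y n) \<star> e)) \<longlongrightarrow> M * cnorm B\<omega> (uB (\<lambda>n. \<iota> (y n) \<star> e))) \<omega>"
    by (intro tendsto_mult_left BU.uc_norm b)
  moreover have "uB (\<lambda>n. \<iota> (y n) \<star> e) = J Y \<bullet> e\<omega>" using y J_uc[OF y(1)] by simp
  ultimately show ?thesis
    using tendsto_le[OF AU.omega_nontrivial _ AU.uc_norm[OF y(1)], of "\<lambda>n. M * cnorm LL (\<iota> (y n) \<star> e)"]
    by (simp add: y(2) norm_le_iota_e bdseqD[OF y(1)])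
qed

text \<open>In each coordinate the element of A is the value of the operator at 1. It is determined
  by its product with e, and \<open>norm_le_iota_e\<close> keeps the resulting sequence
  bounded.\<close>

lemma push_down: assumes "X \<in> carrier B\<omega>" shows "\<exists>Y\<in>carrier A\<omega>. X \<bullet> e\<omega> = J Y \<bullet> e\<omega>"
proof -
  obtain x where x: "x \<in> bdseq LL" "X = uB x" using assms by (rule BU.U_obtain)
  obtain K where K: "\<And>n. cnorm LL (x n) \<le> K" using bdseq_bound[OF x(1)] by blast
  have "\<exists>y. y \<in> carrier A \<and> x n \<star> e = \<iota> y \<star> e" for n
  proof -
    obtain \<phi> \<psi> where a: "adjm \<phi> \<psi>" "x n = op \<phi>" using bdseqD[OF x(1)] by (rule LL_obtain)
    show ?thesis using op_e[OF a(1) one_closed] adjmD(1)[OF a(1) one_closed] a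
      by (intro exI[of _ "\<phi> \<one>"]) (simp add: iota_one op_LL)
  qed
  then obtain y where y: "\<And>n. y n \<in> carrier A" "\<And>n. x n \<star> e = \<iota> (y n) \<star> e" by metis
  have "cnorm A (y n) \<le> M * (K * 1)" for n
  proof -
    have "cnorm A (y n) \<le> M * cnorm LL (x n \<star> e)" unfolding y(2) by (rule norm_le_iota_e[OF y(1)])
    also have "\<dots> \<le> M * (K * 1)"
      using M_pos K[of n] norm_e_le bdseqD[OF x(1)] by (intro mult_left_mono B.norm_mult_le) auto
    finally show ?thesis .
  qed
  then have yb: "y \<in> bdseq A" using y(1) by (intro bdseqI)
  have "X \<bullet> e\<omega> = J (uA y) \<bullet> e\<omega>" using J_uc[OF yb] x y(2) by simp
  then show ?thesis using yb by (intro bexI[of _ "uA y"]) auto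
qed

section \<open>The frame u j e and the amplification of central sequences\<close>

text \<open>These elements act like one column of matrix units over P: the products \<alpha> j
  \<alpha> j* add up to 1, and \<alpha> i* T \<alpha> j is in P e for every T in B.\<close>

definition \<alpha> where "\<alpha> j = kB (\<iota> (u j) \<star> e)"

lemma alpha_closed [simp]: "j < N \<Longrightarrow> \<alpha> j \<in> carrier B\<omega>" unfolding \<alpha>_def by simp

lemma alpha_eq: "j < N \<Longrightarrow> \<alpha> j = J (kA (u j)) \<bullet> e\<omega>"
  unfolding \<alpha>_def by (simp add: J_const)

lemma alpha_absorb: "j < N \<Longrightarrow> \<alpha> j \<bullet> e\<omega> = \<alpha> j"
  unfolding \<alpha>_def by (simp add: B.m_assoc e_idem)

lemma alpha_absorb': "j < N \<Longrightarrow> e\<omega> \<bullet> cadj B\<omega> (\<alpha> j) = cadj B\<omega> (\<alpha> j)"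
  unfolding \<alpha>_def by (simp add: B.adj_mult e_adj iota_adj e_idem flip: B.m_assoc)

lemma alpha_sum: "(\<Oplus>\<^bsub>B\<omega>\<^esub>j\<in>{..<N}. \<alpha> j \<bullet> cadj B\<omega> (\<alpha> j)) = \<one>\<^bsub>B\<omega>\<^esub>"
proof -
  have "\<alpha> j \<bullet> cadj B\<omega> (\<alpha> j) = kB (\<iota> (u j) \<star> e \<star> \<iota> (cadj A (u j)))" if "j < N" for j
    using that unfolding \<alpha>_def
    by (simp add: B.adj_mult e_adj iota_adj B.m_assoc) (simp add: e_idem flip: B.m_assoc)
  then have "(\<Oplus>\<^bsub>B\<omega>\<^esub>j\<in>{..<N}. \<alpha> j \<bullet> cadj B\<omega> (\<alpha> j)) = (\<Oplus>\<^bsub>B\<omega>\<^esub>j\<in>{..<N}. kB (\<iota> (u j) \<star> e \<star> \<iota> (cadj A (u j))))"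
    by (intro BU.U.finsum_cong') auto
  also have "\<dots> = \<one>\<^bsub>B\<omega>\<^esub>"
    unfolding BU.U_one LL_one_sum by (rule const_finsum[symmetric]) auto
  finally show ?thesis .
qed

lemma alpha_compress:
  assumes T: "T \<in> carrier LL" and ij: "i < N" "j < N"
  shows "\<exists>c\<in>P. cadj B\<omega> (\<alpha> i) \<bullet> kB T \<bullet> \<alpha> j = J (kA c) \<bullet> e\<omega>"
proof -
  obtain \<phi> \<psi> where a: "adjm \<phi> \<psi>" "T = op \<phi>" using T by (rule LL_obtain)
  note [simp] = ij T adjmD(1)[OF a(1)] P_carrier
  define c where "c = E (cadj A (u i) \<otimes> \<phi> (u j))"
  have c: "c \<in> P" unfolding c_def by (simp add: adj_closed)
  have Tu: "T \<star> \<iota> (u j) \<star> e = \<iota> (\<phi> (u j)) \<star> e" unfolding a(2) by (rule op_e[OF a(1)]) simp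
  have "e \<star> \<iota> (cadj A (u i)) \<star> T \<star> (\<iota> (u j) \<star> e) = e \<star> \<iota> (cadj A (u i)) \<star> (T \<star> \<iota> (u j) \<star> e)"
    by (simp add: B.m_assoc adj_closed)
  also have "\<dots> = e \<star> \<iota> (cadj A (u i) \<otimes> \<phi> (u j)) \<star> e"
    unfolding Tu by (simp add: B.m_assoc adj_closed iota_mult)
  also have "\<dots> = \<iota> c \<star> e" unfolding c_def by (intro e_compress) (simp add: adj_closed)
  finally have "cadj LL (\<iota> (u i) \<star> e) \<star> T \<star> (\<iota> (u j) \<star> e) = \<iota> c \<star> e"
    by (simp add: B.adj_mult e_adj flip: iota_adj)
  then have "cadj B\<omega> (\<alpha> i) \<bullet> kB T \<bullet> \<alpha> j = J (kA c) \<bullet> e\<omega>"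
    unfolding \<alpha>_def using c by (simp add: J_const)
  then show ?thesis using c by blast
qed

declare AU.uc_mult [simp del] BU.uc_mult [simp del]

abbreviation "central_seqs \<equiv> ultra_commutant \<omega> A (carrier A)"

lemma central_closed [simp]: "X \<in> central_seqs \<Longrightarrow> X \<in> carrier A\<omega>"
  unfolding ultra_commutant_def by blast

lemma central_commute: "\<lbrakk>X \<in> central_seqs; a \<in> carrier A\<rbrakk> \<Longrightarrow> X \<cdot> kA a = kA a \<cdot> X"
  unfolding ultra_commutant_def by blast

lemma central_J_commute:
  assumes X: "X \<in> central_seqs" and a: "a \<in> carrier A"
  shows "J X \<bullet> J (kA a) = J (kA a) \<bullet> J X"
  using J_mult[of X "kA a"] J_mult[of "kA a" X] X a
  unfolding central_commute[OF X a] by simp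

lemma central_sqrt: assumes "X \<in> npos A\<omega>" "X \<in> central_seqs" shows "csqroot A\<omega> X \<in> central_seqs"
  unfolding ultra_commutant_def
proof (intro CollectI conjI ballI)
  fix a assume a: "a \<in> carrier A"
  have "kA a \<cdot> X = X \<cdot> kA a" using central_commute[OF assms(2) a] by simp
  then show "csqroot A\<omega> X \<cdot> kA a = kA a \<cdot> csqroot A\<omega> X"
    using AU.U.csqroot_props(3)[OF assms(1), of "kA a"] a by simp
qed (use AU.U.csqroot_props(1)[OF assms(1)] in simp)

text \<open>The map \<open>X \<mapsto> \<Sigma> \<alpha>\<^sub>j X \<alpha>\<^sub>j*\<close>; it sends \<open>A\<^sub>\<omega> \<inter> A'\<close> into the commutant of the basic construction.\<close>

definition amp where "amp X = (\<Oplus>\<^bsub>B\<omega>\<^esub>j\<in>{..<N}. \<alpha> j \<bullet> J X \<bullet> cadj B\<omega> (\<alpha> j))"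

lemma amp_closed [simp]: "X \<in> carrier A\<omega> \<Longrightarrow> amp X \<in> carrier B\<omega>"
  unfolding amp_def by (intro BU.U.finsum_closed) auto

lemma amp_one: "amp \<one>\<^bsub>A\<omega>\<^esub> = \<one>\<^bsub>B\<omega>\<^esub>"
proof -
  have "amp \<one>\<^bsub>A\<omega>\<^esub> = (\<Oplus>\<^bsub>B\<omega>\<^esub>j\<in>{..<N}. \<alpha> j \<bullet> cadj B\<omega> (\<alpha> j))"
    unfolding amp_def by (intro BU.U.finsum_cong') (auto simp: J_one)
  then show ?thesis by (simp add: alpha_sum)
qed

lemma amp_scale: "X \<in> carrier A\<omega> \<Longrightarrow> amp (cscale A\<omega> c X) = cscale B\<omega> c (amp X)"
proof -
  assume X [simp]: "X \<in> carrier A\<omega>"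
  have "cscale B\<omega> c (amp X) = (\<Oplus>\<^bsub>B\<omega>\<^esub>j\<in>{..<N}. cscale B\<omega> c (\<alpha> j \<bullet> J X \<bullet> cadj B\<omega> (\<alpha> j)))"
    unfolding amp_def by (intro BU.U.finsum_scale) auto
  also have "\<dots> = amp (cscale A\<omega> c X)"
    unfolding amp_def
    by (intro BU.U.finsum_cong') (auto simp: J_scale BU.U.scale_mult_left BU.U.scale_closed simp flip: BU.U.scale_mult_right)
  finally show ?thesis by simp
qed

lemma amp_add: "\<lbrakk>X \<in> carrier A\<omega>; Y \<in> carrier A\<omega>\<rbrakk> \<Longrightarrow> amp (X \<oplus>\<^bsub>A\<omega>\<^esub> Y) = amp X \<oplus>\<^bsub>B\<omega>\<^esub> amp Y"
proof -
  assume X [simp]: "X \<in> carrier A\<omega>" "Y \<in> carrier A\<omega>"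
  have "amp X \<oplus>\<^bsub>B\<omega>\<^esub> amp Y = (\<Oplus>\<^bsub>B\<omega>\<^esub>j\<in>{..<N}. \<alpha> j \<bullet> J X \<bullet> cadj B\<omega> (\<alpha> j) \<oplus>\<^bsub>B\<omega>\<^esub> \<alpha> j \<bullet> J Y \<bullet> cadj B\<omega> (\<alpha> j))"
    unfolding amp_def by (intro BU.U.finsum_addf[symmetric]) auto
  also have "\<dots> = amp (X \<oplus>\<^bsub>A\<omega>\<^esub> Y)"
    unfolding amp_def by (intro BU.U.finsum_cong') (auto simp: J_add BU.U.r_distr BU.U.l_distr)
  finally show ?thesis by simp
qed

lemma amp_diff: "\<lbrakk>X \<in> carrier A\<omega>; Y \<in> carrier A\<omega>\<rbrakk> \<Longrightarrow> amp (X \<ominus>\<^bsub>A\<omega>\<^esub> Y) = amp X \<ominus>\<^bsub>B\<omega>\<^esub> amp Y"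
  using amp_add[of X "cscale A\<omega> (-1) Y"] amp_scale[of Y "-1"]
  by (simp add: a_minus_def AU.U.scale_minus1 BU.U.scale_minus1)

lemma amp_bounded: "\<exists>K\<ge>0. \<forall>X\<in>carrier A\<omega>. cnorm B\<omega> (amp X) \<le> K * cnorm A\<omega> X"
proof (intro exI conjI ballI)
  let ?K = "\<Sum>j<N. cnorm B\<omega> (\<alpha> j) * cnorm B\<omega> (\<alpha> j)"
  show "0 \<le> ?K" by (intro sum_nonneg) simp
  fix X assume X [simp]: "X \<in> carrier A\<omega>"
  have "cnorm B\<omega> (amp X) \<le> (\<Sum>j<N. cnorm B\<omega> (\<alpha> j \<bullet> J X \<bullet> cadj B\<omega> (\<alpha> j)))"
    unfolding amp_def by (intro BU.U.finsum_norm) auto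
  also have "\<dots> \<le> (\<Sum>j<N. (cnorm B\<omega> (\<alpha> j) * cnorm A\<omega> X) * cnorm B\<omega> (\<alpha> j))"
    by (intro sum_mono BU.U.norm_mult_le) (auto simp: J_norm)
  also have "\<dots> = ?K * cnorm A\<omega> X" by (simp add: sum_distrib_left sum_distrib_right ac_simps)
  finally show "cnorm B\<omega> (amp X) \<le> ?K * cnorm A\<omega> X" .
qed

lemma amp_npos: "X \<in> npos A\<omega> \<Longrightarrow> amp X \<in> npos B\<omega>"
  unfolding amp_def by (intro BU.U.npos_finsum BU.U.npos_conj' J_npos) auto

text \<open>Since \<alpha> j = \<alpha> j e, only the compression e X e = E(X) e of X
  enters.\<close>

lemma amp_E: assumes X [simp]: "X \<in> carrier A\<omega>" shows "amp (EU X) = amp X"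
  unfolding amp_def
proof (intro BU.U.finsum_cong')
  fix j assume "j \<in> {..<N}"
  then have j [simp]: "j < N" by simp
  have m: "\<alpha> j \<bullet> Z \<bullet> cadj B\<omega> (\<alpha> j) = \<alpha> j \<bullet> (e\<omega> \<bullet> Z \<bullet> e\<omega>) \<bullet> cadj B\<omega> (\<alpha> j)" if "Z \<in> carrier B\<omega>" for Z
  proof -
    have "\<alpha> j \<bullet> Z \<bullet> cadj B\<omega> (\<alpha> j) = (\<alpha> j \<bullet> e\<omega>) \<bullet> Z \<bullet> (e\<omega> \<bullet> cadj B\<omega> (\<alpha> j))"
      by (simp only: alpha_absorb[OF j] alpha_absorb'[OF j])
    then show ?thesis using that by (simp add: BU.U.m_assoc)
  qed
  have "e\<omega> \<bullet> J (EU X) \<bullet> e\<omega> = J (EU X) \<bullet> e\<omega> \<bullet> e\<omega>" by (simp only: EU_commute[OF X])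
  also have "\<dots> = e\<omega> \<bullet> J X \<bullet> e\<omega>"
    by (simp add: BU.U.m_assoc e\<omega>_idem) (simp add: e\<omega>_compress flip: BU.U.m_assoc)
  finally show "\<alpha> j \<bullet> J (EU X) \<bullet> cadj B\<omega> (\<alpha> j) = \<alpha> j \<bullet> J X \<bullet> cadj B\<omega> (\<alpha> j)"
    using m[of "J X"] m[of "J (EU X)"] by simp
qed auto

text \<open>\<open>amplification_commutes\<close> with y = e X e: the matrix entries of T are c e
  with c in P, and such c commutes with e, and also with X because X commutes with A.\<close>

lemma amp_commutes:
  assumes X: "X \<in> central_seqs" and T: "T \<in> carrier LL"
  shows "kB T \<bullet> amp X = amp X \<bullet> kB T"
proof -
  have X' [simp]: "X \<in> carrier A\<omega>" using X by simp
  define y where "y = e\<omega> \<bullet> J X \<bullet> e\<omega>"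
  have y [simp]: "y \<in> carrier B\<omega>" unfolding y_def by simp
  have "amp X = (\<Oplus>\<^bsub>B\<omega>\<^esub>j\<in>{..<N}. \<alpha> j \<bullet> y \<bullet> cadj B\<omega> (\<alpha> j))"
    unfolding amp_def y_def
  proof (intro BU.U.finsum_cong')
    fix j assume "j \<in> {..<N}"
    then have j [simp]: "j < N" by simp
    have "\<alpha> j \<bullet> J X \<bullet> cadj B\<omega> (\<alpha> j) = (\<alpha> j \<bullet> e\<omega>) \<bullet> J X \<bullet> (e\<omega> \<bullet> cadj B\<omega> (\<alpha> j))"
      by (simp only: alpha_absorb[OF j] alpha_absorb'[OF j])
    then show "\<alpha> j \<bullet> J X \<bullet> cadj B\<omega> (\<alpha> j) = \<alpha> j \<bullet> (e\<omega> \<bullet> J X \<bullet> e\<omega>) \<bullet> cadj B\<omega> (\<alpha> j)"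
      by (simp add: BU.U.m_assoc)
  qed auto
  moreover have "kB T \<bullet> (\<Oplus>\<^bsub>B\<omega>\<^esub>j\<in>{..<N}. \<alpha> j \<bullet> y \<bullet> cadj B\<omega> (\<alpha> j)) =
    (\<Oplus>\<^bsub>B\<omega>\<^esub>j\<in>{..<N}. \<alpha> j \<bullet> y \<bullet> cadj B\<omega> (\<alpha> j)) \<bullet> kB T"
  proof (rule BU.U.amplification_commutes)
    fix i j assume ij: "i \<in> {..<N}" "j \<in> {..<N}"
    obtain c where c: "c \<in> P" and eq: "cadj B\<omega> (\<alpha> i) \<bullet> kB T \<bullet> \<alpha> j = J (kA c) \<bullet> e\<omega>"
      using alpha_compress[OF T, of i j] ij by auto
    define z where "z = J (kA c)"
    have zc: "z \<in> carrier B\<omega>" using c by (simp add: z_def P_carrier)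
    have ze: "z \<bullet> e\<omega> = e\<omega> \<bullet> z" unfolding z_def using c by (intro e\<omega>_commute) (auto simp: P_carrier)
    have zX: "J X \<bullet> z = z \<bullet> J X" unfolding z_def using c by (intro central_J_commute X) (simp add: P_carrier)
    have "z \<bullet> e\<omega> \<bullet> y = z \<bullet> e\<omega> \<bullet> J X \<bullet> e\<omega>"
      unfolding y_def using zc by (simp add: BU.U.m_assoc) (simp add: e\<omega>_idem flip: BU.U.m_assoc)
    also have "\<dots> = e\<omega> \<bullet> (z \<bullet> J X) \<bullet> e\<omega>" unfolding ze using zc by (simp add: BU.U.m_assoc)
    also have "\<dots> = e\<omega> \<bullet> J X \<bullet> (z \<bullet> e\<omega>)" unfolding zX[symmetric] using zc by (simp add: BU.U.m_assoc)
    also have "\<dots> = e\<omega> \<bullet> J X \<bullet> (e\<omega> \<bullet> e\<omega> \<bullet> z)" unfolding ze by (simp add: e\<omega>_idem)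
    also have "\<dots> = y \<bullet> (e\<omega> \<bullet> z)" unfolding y_def using zc by (simp add: BU.U.m_assoc)
    also have "\<dots> = y \<bullet> (z \<bullet> e\<omega>)" unfolding ze ..
    finally show "cadj B\<omega> (\<alpha> i) \<bullet> kB T \<bullet> \<alpha> j \<bullet> y = y \<bullet> (cadj B\<omega> (\<alpha> i) \<bullet> kB T \<bullet> \<alpha> j)"
      unfolding eq z_def .
  qed (auto simp: alpha_sum T)
  ultimately show ?thesis by simp
qed

text \<open>In each summand the coefficient E of the adjoint of u j commutes with X and with e, so
  it can be moved to the left, next to u j. What remains in front of e X e is the quasi-basis
  expansion of 1.\<close>

lemma amp_compress: assumes X: "X \<in> central_seqs" shows "amp X \<bullet> e\<omega> = J (EU X) \<bullet> e\<omega>"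
proof -
  have X' [simp]: "X \<in> carrier A\<omega>" using X by simp
  define w where "w j = J (kA (u j \<otimes> E (cadj A (u j))))" for j
  have w [simp]: "w j \<in> carrier B\<omega>" if "j < N" for j using that unfolding w_def by (simp add: adj_closed)
  have step: "\<alpha> j \<bullet> J X \<bullet> cadj B\<omega> (\<alpha> j) \<bullet> e\<omega> = w j \<bullet> (e\<omega> \<bullet> J X \<bullet> e\<omega>)" if j [simp]: "j < N" for j
  proof -
    define z where "z = J (kA (E (cadj A (u j))))"
    have zc: "z \<in> carrier B\<omega>" by (simp add: z_def adj_closed)
    have ze: "z \<bullet> e\<omega> = e\<omega> \<bullet> z" unfolding z_def by (intro e\<omega>_commute) (auto simp: adj_closed)
    have zX: "J X \<bullet> z = z \<bullet> J X" unfolding z_def by (intro central_J_commute X) (simp add: adj_closed)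
    have "cadj B\<omega> (\<alpha> j) \<bullet> e\<omega> = e\<omega> \<bullet> J (kA (cadj A (u j))) \<bullet> e\<omega>"
      by (simp add: alpha_eq BU.U.adj_mult e\<omega>_adj adj_closed flip: J_adj)
    also have "\<dots> = z \<bullet> e\<omega>" unfolding z_def by (simp add: e\<omega>_compress EU_uc adj_closed)
    finally have d: "cadj B\<omega> (\<alpha> j) \<bullet> e\<omega> = z \<bullet> e\<omega>" .
    have "\<alpha> j \<bullet> J X \<bullet> cadj B\<omega> (\<alpha> j) \<bullet> e\<omega> = \<alpha> j \<bullet> J X \<bullet> (cadj B\<omega> (\<alpha> j) \<bullet> e\<omega>)"
      by (simp add: BU.U.m_assoc)
    also have "\<dots> = \<alpha> j \<bullet> J X \<bullet> (z \<bullet> e\<omega>)" unfolding d ..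
    also have "\<dots> = \<alpha> j \<bullet> (J X \<bullet> z) \<bullet> e\<omega>" using zc by (simp add: BU.U.m_assoc)
    also have "\<dots> = J (kA (u j)) \<bullet> (e\<omega> \<bullet> z) \<bullet> J X \<bullet> e\<omega>"
      unfolding zX using zc by (simp add: alpha_eq BU.U.m_assoc)
    also have "\<dots> = (J (kA (u j)) \<bullet> z) \<bullet> (e\<omega> \<bullet> J X \<bullet> e\<omega>)"
      unfolding ze[symmetric] using zc by (simp add: BU.U.m_assoc)
    also have "J (kA (u j)) \<bullet> z = w j"
      unfolding w_def z_def by (simp add: adj_closed AU.uc_mult flip: J_mult)
    finally show ?thesis .
  qed
  have ws: "(\<Oplus>\<^bsub>B\<omega>\<^esub>j\<in>{..<N}. w j) = \<one>\<^bsub>B\<omega>\<^esub>"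
  proof -
    have "(\<Oplus>\<^bsub>B\<omega>\<^esub>j\<in>{..<N}. w j) = (\<Oplus>\<^bsub>B\<omega>\<^esub>j\<in>{..<N}. kB (\<iota> (u j \<otimes> E (cadj A (u j)))))"
      by (intro BU.U.finsum_cong') (auto simp: w_def J_const adj_closed)
    also have "\<dots> = kB (\<iota> (\<Oplus>j\<in>{..<N}. u j \<otimes> E (cadj A (u j))))"
      by (subst iota_finsum, simp, simp add: adj_closed) (rule const_finsum[symmetric]; simp add: adj_closed)
    also have "(\<Oplus>j\<in>{..<N}. u j \<otimes> E (cadj A (u j))) = (\<Oplus>j\<in>{..<N}. u j \<otimes> E (cadj A (u j) \<otimes> \<one>))"
      by (intro finsum_cong') (auto simp: adj_closed)
    finally show ?thesis by (simp add: qb_left[OF one_closed] iota_one BU.U_one)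
  qed
  have "amp X \<bullet> e\<omega> = (\<Oplus>\<^bsub>B\<omega>\<^esub>j\<in>{..<N}. \<alpha> j \<bullet> J X \<bullet> cadj B\<omega> (\<alpha> j) \<bullet> e\<omega>)"
    unfolding amp_def by (intro BU.U.finsum_ldistr) auto
  also have "\<dots> = (\<Oplus>\<^bsub>B\<omega>\<^esub>j\<in>{..<N}. w j \<bullet> (e\<omega> \<bullet> J X \<bullet> e\<omega>))"
    by (intro BU.U.finsum_cong') (auto simp: step)
  also have "\<dots> = (\<Oplus>\<^bsub>B\<omega>\<^esub>j\<in>{..<N}. w j) \<bullet> (e\<omega> \<bullet> J X \<bullet> e\<omega>)"
    by (intro BU.U.finsum_ldistr[symmetric]) auto
  also have "\<dots> = J (EU X) \<bullet> e\<omega>" unfolding ws by (simp add: e\<omega>_compress)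
  finally show ?thesis .
qed

section \<open>Elements of the relative commutant that satisfy the Rokhlin equation\<close>

abbreviation "kc \<equiv> complex_of_real k"

definition rokhlin_eq where
  "rokhlin_eq p \<longleftrightarrow> cscale B\<omega> kc (J (csqroot A\<omega> p) \<bullet> e\<omega> \<bullet> J (csqroot A\<omega> p)) = J p"

definition index_amp where "index_amp p = cscale B\<omega> kc (amp p)"

lemma kc_cancel: "X \<in> carrier B\<omega> \<Longrightarrow> cscale B\<omega> (1/kc) (cscale B\<omega> kc X) = X"
  using k_pos by (simp add: BU.U.scale_scale BU.U.scale_one)

lemma norm_e\<omega>: "cnorm B\<omega> e\<omega> \<le> 1"
  by (rule BU.uc_norm_le) (simp_all add: norm_e_le)

context
  fixes p q
  assumes p: "p \<in> npos A\<omega>" "p \<in> central_seqs" and q_def: "q = csqroot A\<omega> p"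
begin

lemma q_props: "q \<in> npos A\<omega>" "q \<cdot> q = p" "q \<in> central_seqs" "J q \<bullet> J q = J p"
proof -
  show q: "q \<in> npos A\<omega>" "q \<cdot> q = p" "q \<in> central_seqs"
    unfolding q_def using AU.U.csqroot_props(1,2)[OF p(1)] central_sqrt[OF p] by auto
  show "J q \<bullet> J q = J p" using q(1) unfolding q(2)[symmetric] by (simp add: J_mult)
qed

lemma pq_closed [simp]: "p \<in> carrier A\<omega>" "q \<in> carrier A\<omega>"
  using p q_props by auto

lemma index_amp_closed [simp]: "index_amp p \<in> carrier B\<omega>"
  unfolding index_amp_def by (simp add: BU.U.scale_closed)

lemma index_amp_npos: "index_amp p \<in> npos B\<omega>"
  unfolding index_amp_def using k_pos by (intro BU.U.npos_scale amp_npos p) simp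

lemma index_amp_commutes: "T \<in> carrier LL \<Longrightarrow> kB T \<bullet> index_amp p = index_amp p \<bullet> kB T"
  unfolding index_amp_def using amp_commutes[OF p(2), of T]
  by (simp flip: BU.U.scale_mult_left BU.U.scale_mult_right)

text \<open>The amplification is unital and sees p only through E(p). So the error term of
  representability is the amplification of the error term of the Rokhlin property, which carries the
  comparison from A to B.\<close>

lemma one_minus_index_amp: "\<one>\<^bsub>B\<omega>\<^esub> \<ominus>\<^bsub>B\<omega>\<^esub> index_amp p = amp (\<one>\<^bsub>A\<omega>\<^esub> \<ominus>\<^bsub>A\<omega>\<^esub> cscale A\<omega> kc (EU p))"
  unfolding index_amp_def by (simp add: amp_diff amp_scale amp_one amp_E AU.U.scale_closed)

lemma one_minus_index_amp_compress: "(\<one>\<^bsub>B\<omega>\<^esub> \<ominus>\<^bsub>B\<omega>\<^esub> index_amp p) \<bullet> e\<omega> = J (\<one>\<^bsub>A\<omega>\<^esub> \<ominus>\<^bsub>A\<omega>\<^esub> cscale A\<omega> kc (EU p)) \<bullet> e\<omega>"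
proof -
  have "index_amp p \<bullet> e\<omega> = J (cscale A\<omega> kc (EU p)) \<bullet> e\<omega>"
    unfolding index_amp_def using amp_compress[OF p(2)]
    by (simp add: J_scale flip: BU.U.scale_mult_left)
  moreover have "(X \<ominus>\<^bsub>B\<omega>\<^esub> Y) \<bullet> Z = X \<bullet> Z \<ominus>\<^bsub>B\<omega>\<^esub> Y \<bullet> Z" if "X \<in> carrier B\<omega>" "Y \<in> carrier B\<omega>" "Z \<in> carrier B\<omega>" for X Y Z
    using that by (simp add: a_minus_def BU.U.l_distr BU.U.l_minus)
  ultimately show ?thesis by (simp add: J_diff J_one AU.U.scale_closed)
qed

lemma commuting_sandwich:
  assumes [simp]: "x \<in> carrier B\<omega>" "a \<in> carrier A" "b \<in> carrier A"
  shows "J q \<bullet> (J (kA a) \<bullet> x \<bullet> J (kA b)) \<bullet> J q =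
    J (kA a) \<bullet> (J q \<bullet> x \<bullet> J q) \<bullet> J (kA b)"
proof -
  have "J q \<bullet> (J (kA a) \<bullet> x \<bullet> J (kA b)) \<bullet> J q =
    (J q \<bullet> J (kA a)) \<bullet> x \<bullet> (J (kA b) \<bullet> J q)"
    by (simp add: BU.U.m_assoc)
  also have "\<dots> = (J (kA a) \<bullet> J q) \<bullet> x \<bullet> (J q \<bullet> J (kA b))"
    by (simp only: central_J_commute[OF q_props(3) assms(2)] central_J_commute[OF q_props(3) assms(3)])
  also have "\<dots> = J (kA a) \<bullet> (J q \<bullet> x \<bullet> J q) \<bullet> J (kA b)"
    by (simp add: BU.U.m_assoc)
  finally show ?thesis .
qed

context
  assumes rok: "rokhlin_eq p"
begin

lemma rok': "J q \<bullet> e\<omega> \<bullet> J q = cscale B\<omega> (1/kc) (J p)"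
proof -
  have "cscale B\<omega> kc (J q \<bullet> e\<omega> \<bullet> J q) = J p" using rok unfolding rokhlin_eq_def q_def .
  then show ?thesis using kc_cancel[of "J q \<bullet> e\<omega> \<bullet> J q"] by simp
qed

text \<open>Expand T along the quasi-basis. The coefficients lie in A and pass through q, so each
  summand contains q e q = p/k, and the coefficients left over add up to the dual expectation of
  T.\<close>

lemma rokhlin_compress:
  assumes T: "T \<in> carrier LL"
  shows "J q \<bullet> kB T \<bullet> J q = kB (F T) \<bullet> J p"
proof -
  obtain \<phi> \<psi> where a: "adjm \<phi> \<psi>" "T = op \<phi>" using T by (rule LL_obtain)
  note [simp] = adjmD(1)[OF a(1)]
  let ?c = "\<lambda>a. J (kA a)"
  define s where "s j = cscale A (1/kc) (\<phi> (u j) \<otimes> cadj A (u j))" for j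
  have s [simp]: "s j \<in> carrier A" if "j < N" for j unfolding s_def using that by (simp add: scale_closed adj_closed)
  have "kB T = kB (\<Oplus>\<^bsub>LL\<^esub>j\<in>{..<N}. \<iota> (\<phi> (u j)) \<star> e \<star> \<iota> (cadj A (u j)))"
    unfolding a(2) op_expand[OF a(1)] jones_sum_eq ..
  also have "\<dots> = (\<Oplus>\<^bsub>B\<omega>\<^esub>j\<in>{..<N}. kB (\<iota> (\<phi> (u j)) \<star> e \<star> \<iota> (cadj A (u j))))"
    by (rule const_finsum) (auto simp: adj_closed)
  also have "\<dots> = (\<Oplus>\<^bsub>B\<omega>\<^esub>j\<in>{..<N}. ?c (\<phi> (u j)) \<bullet> e\<omega> \<bullet> ?c (cadj A (u j)))"
    by (intro BU.U.finsum_cong') (auto simp: J_const adj_closed BU.uc_mult)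
  finally have Ts: "kB T = (\<Oplus>\<^bsub>B\<omega>\<^esub>j\<in>{..<N}. ?c (\<phi> (u j)) \<bullet> e\<omega> \<bullet> ?c (cadj A (u j)))" .
  have "J q \<bullet> kB T = (\<Oplus>\<^bsub>B\<omega>\<^esub>j\<in>{..<N}. J q \<bullet> (?c (\<phi> (u j)) \<bullet> e\<omega> \<bullet> ?c (cadj A (u j))))"
    unfolding Ts by (intro BU.U.finsum_rdistr) (auto simp: adj_closed)
  then have "J q \<bullet> kB T \<bullet> J q = (\<Oplus>\<^bsub>B\<omega>\<^esub>j\<in>{..<N}. J q \<bullet> (?c (\<phi> (u j)) \<bullet> e\<omega> \<bullet> ?c (cadj A (u j)))) \<bullet> J q"
    by simp
  also have "\<dots> = (\<Oplus>\<^bsub>B\<omega>\<^esub>j\<in>{..<N}. J q \<bullet> (?c (\<phi> (u j)) \<bullet> e\<omega> \<bullet> ?c (cadj A (u j))) \<bullet> J q)"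
    by (intro BU.U.finsum_ldistr) (auto simp: adj_closed)
  also have "\<dots> = (\<Oplus>\<^bsub>B\<omega>\<^esub>j\<in>{..<N}. ?c (s j) \<bullet> J p)"
  proof (intro BU.U.finsum_cong')
    fix j assume "j \<in> {..<N}"
    then have j [simp]: "j < N" "cadj A (u j) \<in> carrier A" by (auto simp: adj_closed)
    have "J q \<bullet> (?c (\<phi> (u j)) \<bullet> e\<omega> \<bullet> ?c (cadj A (u j))) \<bullet> J q = ?c (\<phi> (u j)) \<bullet> cscale B\<omega> (1/kc) (J p) \<bullet> ?c (cadj A (u j))"
      by (subst commuting_sandwich) (simp_all add: rok')
    also have "\<dots> = cscale B\<omega> (1/kc) (?c (\<phi> (u j)) \<bullet> (J p \<bullet> ?c (cadj A (u j))))"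
      by (simp add: BU.U.m_assoc flip: BU.U.scale_mult_left BU.U.scale_mult_right)
    also have "\<dots> = cscale B\<omega> (1/kc) (?c (\<phi> (u j)) \<bullet> ?c (cadj A (u j)) \<bullet> J p)"
      by (simp add: central_J_commute[OF p(2)] BU.U.m_assoc)
    also have "\<dots> = cscale B\<omega> (1/kc) (?c (\<phi> (u j)) \<bullet> ?c (cadj A (u j))) \<bullet> J p"
      by (intro BU.U.scale_mult_left) auto
    also have "cscale B\<omega> (1/kc) (?c (\<phi> (u j)) \<bullet> ?c (cadj A (u j))) = ?c (s j)"
      by (simp add: s_def AU.uc_mult scale_closed flip: J_mult J_scale)
    finally show "J q \<bullet> (?c (\<phi> (u j)) \<bullet> e\<omega> \<bullet> ?c (cadj A (u j))) \<bullet> J q = ?c (s j) \<bullet> J p" .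
  qed (auto simp: adj_closed)
  also have "\<dots> = (\<Oplus>\<^bsub>B\<omega>\<^esub>j\<in>{..<N}. ?c (s j)) \<bullet> J p"
    by (intro BU.U.finsum_ldistr[symmetric]) auto
  also have "(\<Oplus>\<^bsub>B\<omega>\<^esub>j\<in>{..<N}. ?c (s j)) = kB (F T)"
  proof -
    have "F T = \<iota> (\<Oplus>j\<in>{..<N}. s j)" unfolding a(2) F_op[OF a(1)] s_def
      by (subst finsum_scale) (auto simp: adj_closed)
    also have "\<dots> = (\<Oplus>\<^bsub>LL\<^esub>j\<in>{..<N}. \<iota> (s j))" by (rule iota_finsum) auto
    finally have "kB (F T) = kB (\<Oplus>\<^bsub>LL\<^esub>j\<in>{..<N}. \<iota> (s j))" by simp
    also have "\<dots> = (\<Oplus>\<^bsub>B\<omega>\<^esub>j\<in>{..<N}. kB (\<iota> (s j)))" by (rule const_finsum) auto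
    also have "\<dots> = (\<Oplus>\<^bsub>B\<omega>\<^esub>j\<in>{..<N}. ?c (s j))" by (intro BU.U.finsum_cong') (auto simp: J_const)
    finally show ?thesis by simp
  qed
  finally show ?thesis .
qed

text \<open>In each summand q commutes with u j, which brings q e q = p/k into being. The resulting
  powers of q commute with u j and leave the sum on the left, and the frame sum 1 remains.\<close>

lemma index_amp_sqrt: "J q \<bullet> index_amp p = J q \<bullet> J q \<bullet> J q" "index_amp p \<bullet> J q = J q \<bullet> J q \<bullet> J q"
proof -
  let ?c = "\<lambda>a. J (kA a)"
  have "J q \<bullet> amp p = (\<Oplus>\<^bsub>B\<omega>\<^esub>j\<in>{..<N}. J q \<bullet> (\<alpha> j \<bullet> J p \<bullet> cadj B\<omega> (\<alpha> j)))"
    unfolding amp_def by (intro BU.U.finsum_rdistr) auto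
  also have "\<dots> = (\<Oplus>\<^bsub>B\<omega>\<^esub>j\<in>{..<N}. cscale B\<omega> (1/kc) (J q \<bullet> J q \<bullet> J q) \<bullet> (\<alpha> j \<bullet> cadj B\<omega> (\<alpha> j)))"
  proof (intro BU.U.finsum_cong')
    fix j assume "j \<in> {..<N}"
    then have j [simp]: "j < N" by simp
    have "J q \<bullet> (\<alpha> j \<bullet> J p \<bullet> cadj B\<omega> (\<alpha> j)) = (J q \<bullet> ?c (u j)) \<bullet> e\<omega> \<bullet> J q \<bullet> J q \<bullet> cadj B\<omega> (\<alpha> j)"
      by (simp add: alpha_eq BU.U.m_assoc flip: q_props(4))
    also have "\<dots> = ?c (u j) \<bullet> (J q \<bullet> e\<omega> \<bullet> J q) \<bullet> J q \<bullet> cadj B\<omega> (\<alpha> j)"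
      unfolding central_J_commute[OF q_props(3) uv(1)[OF j]] by (simp add: BU.U.m_assoc)
    also have "\<dots> = cscale B\<omega> (1/kc) (?c (u j) \<bullet> (J p \<bullet> J q \<bullet> cadj B\<omega> (\<alpha> j)))"
      unfolding rok' by (simp add: BU.U.m_assoc flip: BU.U.scale_mult_left BU.U.scale_mult_right)
    also have "?c (u j) \<bullet> (J p \<bullet> J q \<bullet> cadj B\<omega> (\<alpha> j)) = ((?c (u j) \<bullet> J p) \<bullet> J q) \<bullet> cadj B\<omega> (\<alpha> j)"
      by (simp add: BU.U.m_assoc)
    also have "\<dots> = (J p \<bullet> (?c (u j) \<bullet> J q)) \<bullet> cadj B\<omega> (\<alpha> j)"
      unfolding central_J_commute[OF p(2) uv(1)[OF j], symmetric] by (simp add: BU.U.m_assoc)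
    also have "\<dots> = (J p \<bullet> J q) \<bullet> (?c (u j) \<bullet> cadj B\<omega> (\<alpha> j))"
      unfolding central_J_commute[OF q_props(3) uv(1)[OF j], symmetric] by (simp add: BU.U.m_assoc)
    \<comment> \<open>The adjoint of \<alpha> j begins with e, so in front of it u j and \<alpha> j
      = u j e act alike.\<close>
    also have "?c (u j) \<bullet> cadj B\<omega> (\<alpha> j) = \<alpha> j \<bullet> cadj B\<omega> (\<alpha> j)"
      using alpha_absorb'[OF j] by (simp add: alpha_eq BU.U.m_assoc)
    finally show "J q \<bullet> (\<alpha> j \<bullet> J p \<bullet> cadj B\<omega> (\<alpha> j)) = cscale B\<omega> (1/kc) (J q \<bullet> J q \<bullet> J q) \<bullet> (\<alpha> j \<bullet> cadj B\<omega> (\<alpha> j))"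
      by (simp add: q_props(4) flip: BU.U.scale_mult_left)
  qed (auto simp: BU.U.scale_closed)
  also have "\<dots> = cscale B\<omega> (1/kc) (J q \<bullet> J q \<bullet> J q) \<bullet> (\<Oplus>\<^bsub>B\<omega>\<^esub>j\<in>{..<N}. \<alpha> j \<bullet> cadj B\<omega> (\<alpha> j))"
    by (intro BU.U.finsum_rdistr[symmetric]) (auto simp: BU.U.scale_closed)
  finally have "J q \<bullet> amp p = cscale B\<omega> (1/kc) (J q \<bullet> J q \<bullet> J q)"
    by (simp add: alpha_sum BU.U.scale_closed)
  then show 1: "J q \<bullet> index_amp p = J q \<bullet> J q \<bullet> J q"
    unfolding index_amp_def using k_pos
    by (simp add: BU.U.scale_scale BU.U.scale_one flip: BU.U.scale_mult_right)
  have sa: "cadj B\<omega> (J q) = J q" "cadj B\<omega> (index_amp p) = index_amp p"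
    using BU.U.csa_adj[OF BU.U.npos_csa] J_npos[OF q_props(1)] index_amp_npos by auto
  then show "index_amp p \<bullet> J q = J q \<bullet> J q \<bullet> J q"
    using arg_cong[OF 1, of "cadj B\<omega>"] by (simp add: BU.U.adj_mult BU.U.m_assoc)
qed

lemma index_amp_J: "index_amp p \<bullet> J p = J p \<bullet> J p"
proof -
  have "index_amp p \<bullet> J p = (index_amp p \<bullet> J q) \<bullet> J q" by (simp add: BU.U.m_assoc flip: q_props(4))
  then show ?thesis unfolding index_amp_sqrt by (simp add: BU.U.m_assoc flip: q_props(4))
qed

text \<open>Multiplication by \<open>index_amp p\<close> passes \<alpha> j, and on powers of p it
  acts as p does by \<open>index_amp_J\<close>. Exponents start at 1: for 0 the two sides would be 1
  and k.\<close>

lemma index_amp_pow: "index_amp p [^]\<^bsub>B\<omega>\<^esub> Suc n = cscale B\<omega> kc (amp (p [^]\<^bsub>A\<omega>\<^esub> Suc n))"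
proof (induction n)
  case 0 show ?case by (simp add: index_amp_def BU.U.scale_closed)
next
  case (Suc n)
  define x where "x = p [^]\<^bsub>A\<omega>\<^esub> Suc n"
  have x [simp]: "x \<in> carrier A\<omega>" unfolding x_def by simp
  have px: "p \<cdot> x = p [^]\<^bsub>A\<omega>\<^esub> Suc (Suc n)" unfolding x_def by (rule AU.U.nat_pow_Suc2[symmetric]) simp
  have rx: "index_amp p \<bullet> J x = J (p \<cdot> x)"
  proof -
    have "index_amp p \<bullet> J x = (index_amp p \<bullet> J p) \<bullet> J (p [^]\<^bsub>A\<omega>\<^esub> n)"
      unfolding x_def AU.U.nat_pow_Suc2[OF pq_closed(1)] by (simp add: J_mult BU.U.m_assoc)
    also have "\<dots> = J (p \<cdot> x)"
      unfolding index_amp_J x_def AU.U.nat_pow_Suc2[OF pq_closed(1)] by (simp add: J_mult BU.U.m_assoc)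
    finally show ?thesis .
  qed
  have "index_amp p \<bullet> amp x = (\<Oplus>\<^bsub>B\<omega>\<^esub>j\<in>{..<N}. index_amp p \<bullet> (\<alpha> j \<bullet> J x \<bullet> cadj B\<omega> (\<alpha> j)))"
    unfolding amp_def by (intro BU.U.finsum_rdistr) auto
  also have "\<dots> = amp (p \<cdot> x)" unfolding amp_def
  proof (intro BU.U.finsum_cong')
    fix j assume "j \<in> {..<N}"
    then have j [simp]: "j < N" by simp
    have c: "index_amp p \<bullet> \<alpha> j = \<alpha> j \<bullet> index_amp p"
      unfolding \<alpha>_def by (rule index_amp_commutes[symmetric]) simp
    have "index_amp p \<bullet> (\<alpha> j \<bullet> J x \<bullet> cadj B\<omega> (\<alpha> j)) = (index_amp p \<bullet> \<alpha> j) \<bullet> J x \<bullet> cadj B\<omega> (\<alpha> j)" by (simp add: BU.U.m_assoc)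
    also have "\<dots> = \<alpha> j \<bullet> (index_amp p \<bullet> J x) \<bullet> cadj B\<omega> (\<alpha> j)" unfolding c by (simp add: BU.U.m_assoc)
    finally show "index_amp p \<bullet> (\<alpha> j \<bullet> J x \<bullet> cadj B\<omega> (\<alpha> j)) = \<alpha> j \<bullet> J (p \<cdot> x) \<bullet> cadj B\<omega> (\<alpha> j)" unfolding rx .
  qed auto
  finally have "index_amp p \<bullet> amp x = amp (p \<cdot> x)" .
  then show ?case
    unfolding BU.U.nat_pow_Suc2[OF index_amp_closed, of "Suc n"] Suc.IH x_def[symmetric] px[symmetric]
    by (simp flip: BU.U.scale_mult_right)
qed

text \<open>A direct estimate leaves a constant k K. By \<open>index_amp_pow\<close> the same
  constant bounds all positive powers, and bounded powers of a self-adjoint element force norm at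
  most 1.\<close>

lemma index_amp_norm: assumes le: "cnorm A\<omega> p \<le> 1" shows "cnorm B\<omega> (index_amp p) \<le> 1"
proof -
  obtain K where K: "K \<ge> 0" "\<And>X. X \<in> carrier A\<omega> \<Longrightarrow> cnorm B\<omega> (amp X) \<le> K * cnorm A\<omega> X"
    using amp_bounded by blast
  show ?thesis
  proof (rule BU.U.norm_le_one_of_powers[where K = "k * K"])
    show "index_amp p \<in> csa B\<omega>" using index_amp_npos by (rule BU.U.npos_csa)
    fix j :: nat
    \<comment> \<open>Writes the exponent \<open>2^j\<close> as a successor, since the formula for
      powers starts at exponent 1.\<close>
    define n where "n = (2::nat)^j - 1"
    have n: "2^j = Suc n" unfolding n_def by simp
    have "cnorm B\<omega> (index_amp p [^]\<^bsub>B\<omega>\<^esub> Suc n) = k * cnorm B\<omega> (amp (p [^]\<^bsub>A\<omega>\<^esub> Suc n))"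
      unfolding index_amp_pow using k_pos by (simp add: BU.U.norm_scale del: AU.U.nat_pow_Suc)
    also have "\<dots> \<le> k * (K * 1)"
    proof (intro mult_left_mono order.trans[OF K(2)])
      show "cnorm A\<omega> (p [^]\<^bsub>A\<omega>\<^esub> Suc n) \<le> 1" using le by (intro AU.U.norm_pow_le) auto
    qed (use k_pos K(1) in auto)
    also have "\<dots> \<le> 1 + 2^j * (k * K)"
    proof -
      have "1 * (k * K) \<le> 2^j * (k * K)" by (rule mult_right_mono) (use k_pos K(1) in auto)
      then show ?thesis by simp
    qed
    finally show "cnorm B\<omega> (index_amp p [^]\<^bsub>B\<omega>\<^esub> ((2::nat)^j)) \<le> 1 + 2^j * (k * K)" unfolding n .
  qed
qed

end

end

end

lemma (in cstar_algebra) diff_square: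
  "\<lbrakk>x \<in> carrier A; y \<in> carrier A\<rbrakk> \<Longrightarrow> (x \<ominus> y) \<otimes> (x \<ominus> y) = (x \<otimes> x \<ominus> x \<otimes> y) \<ominus> (y \<otimes> x \<ominus> y \<otimes> y)"
  by algebra

section \<open>The two implications\<close>

context tower
begin

text \<open>The sum in approximate representability carries no scalar, so the factor k is shared as
  a square root by the coefficient and its adjoint.\<close>

lemma sqrt_amp_term:
  assumes "j < N" "X \<in> carrier A\<omega>"
  shows "kB (cscale LL (complex_of_real (sqrt k)) (\<iota> (u j) \<star> e)) \<bullet> J X \<bullet>
      cadj B\<omega> (kB (cscale LL (complex_of_real (sqrt k)) (\<iota> (u j) \<star> e))) =
    cscale B\<omega> kc (\<alpha> j \<bullet> J X \<bullet> cadj B\<omega> (\<alpha> j))"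
proof -
  have "kB (cscale LL (complex_of_real (sqrt k)) (\<iota> (u j) \<star> e)) = cscale B\<omega> (complex_of_real (sqrt k)) (\<alpha> j)"
    unfolding \<alpha>_def using assms by simp
  moreover have "complex_of_real (sqrt k) * complex_of_real (sqrt k) = kc"
    using k_pos by (simp flip: of_real_mult)
  ultimately show ?thesis using assms
    by (simp add: BU.U.adj_scale BU.U.scale_scale BU.U.scale_closed
        flip: BU.U.scale_mult_left BU.U.scale_mult_right)
qed

lemma index_amp_sum:
  assumes "p \<in> carrier A\<omega>"
  shows "(\<Oplus>\<^bsub>B\<omega>\<^esub>j\<in>{..<N}. kB (cscale LL (complex_of_real (sqrt k)) (\<iota> (u j) \<star> e)) \<bullet> J p \<bullet>
      cadj B\<omega> (kB (cscale LL (complex_of_real (sqrt k)) (\<iota> (u j) \<star> e)))) = index_amp p"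
proof -
  have "index_amp p = (\<Oplus>\<^bsub>B\<omega>\<^esub>j\<in>{..<N}. cscale B\<omega> kc (\<alpha> j \<bullet> J p \<bullet> cadj B\<omega> (\<alpha> j)))"
    unfolding index_amp_def amp_def using assms by (intro BU.U.finsum_scale) auto
  also have "\<dots> = (\<Oplus>\<^bsub>B\<omega>\<^esub>j\<in>{..<N}. kB (cscale LL (complex_of_real (sqrt k)) (\<iota> (u j) \<star> e)) \<bullet> J p \<bullet>
      cadj B\<omega> (kB (cscale LL (complex_of_real (sqrt k)) (\<iota> (u j) \<star> e))))"
    using assms by (intro BU.U.finsum_cong' refl sqrt_amp_term[symmetric]) (auto simp: BU.U.adj_closed simp del: BU.uc_adj)
  finally show ?thesis by simp
qed

text \<open>The d in A with d p = 0 form an ideal, because p commutes with A. It does not contain 1,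
  as p is nonzero, so it is zero by simplicity.\<close>

lemma const_mult_inj:
  assumes p: "p \<in> central_seqs" "p \<noteq> \<zero>\<^bsub>A\<omega>\<^esub>" and ab: "a \<in> carrier A" "b \<in> carrier A"
    and eq: "kB (\<iota> a) \<bullet> J p = kB (\<iota> b) \<bullet> J p"
  shows "a = b"
proof (rule ccontr)
  let ?c = "ultra_const \<omega> A"
  let ?I = "{d \<in> carrier A. ?c d \<cdot> p = \<zero>\<^bsub>A\<omega>\<^esub>}"
  have pc [simp]: "p \<in> carrier A\<omega>" using p by simp
  assume "a \<noteq> b"
  then have nz: "a \<ominus> b \<noteq> \<zero>" using ab by (simp add: diff_eq_zero)
  have "J (?c a \<cdot> p) = J (?c b \<cdot> p)" using eq ab by (simp add: J_mult J_const)
  then have "?c a \<cdot> p = ?c b \<cdot> p" using ab by (intro J_inj) auto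
  moreover have "?c (a \<ominus> b) \<cdot> p = ?c a \<cdot> p \<ominus>\<^bsub>A\<omega>\<^esub> ?c b \<cdot> p"
  proof -
    have eq: "?c (a \<ominus> b) = ?c a \<ominus>\<^bsub>A\<omega>\<^esub> ?c b" using ab by simp
    have gen: "(X \<ominus>\<^bsub>A\<omega>\<^esub> Y) \<cdot> p = X \<cdot> p \<ominus>\<^bsub>A\<omega>\<^esub> Y \<cdot> p" if "X \<in> carrier A\<omega>" "Y \<in> carrier A\<omega>" for X Y
      using that by (simp add: a_minus_def AU.U.l_distr AU.U.l_minus)
    show ?thesis unfolding eq using ab by (intro gen) auto
  qed
  ultimately have "a \<ominus> b \<in> ?I" using ab AU.U.diff_eq_zero[of "?c b \<cdot> p" "?c b \<cdot> p"] by simp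
  moreover have "ideal ?I A"
  proof (rule idealI')
    show "\<zero> \<in> ?I" by (simp flip: AU.U_zero)
  next
    fix x y assume x: "x \<in> ?I" and y: "y \<in> ?I"
    have "?c (x \<oplus> y) = ?c x \<oplus>\<^bsub>A\<omega>\<^esub> ?c y" using x y by simp
    then show "x \<oplus> y \<in> ?I" using x y by (simp add: AU.U.l_distr del: AU.uc_add)
  next
    fix x y assume x: "x \<in> ?I" and y: "y \<in> carrier A"
    have "?c (y \<otimes> x) = ?c y \<cdot> ?c x" using x y by (simp add: AU.uc_mult)
    then show "y \<otimes> x \<in> ?I" using x y by (simp add: AU.U.m_assoc)
    have "?c (x \<otimes> y) \<cdot> p = ?c x \<cdot> (?c y \<cdot> p)" using x y by (simp add: AU.U.m_assoc flip: AU.uc_mult)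
    also have "\<dots> = ?c x \<cdot> (p \<cdot> ?c y)" by (simp only: central_commute[OF p(1) y])
    also have "\<dots> = (?c x \<cdot> p) \<cdot> ?c y" using x y by (intro AU.U.m_assoc[symmetric]) auto
    finally show "x \<otimes> y \<in> ?I" using x y by simp
  qed auto
  ultimately have "\<one> \<in> ?I" using nz by (intro simple_dense_ideal[OF simple])
  then show False using p(2) by (simp flip: AU.U_one)
qed

text \<open>Each conjugator of a to an approximation of f = 1 - k E(p) is combined with z i, which
  separates the N copies, and with \<alpha> i, which places the i-th copy in the i-th summand of the
  amplification. Their sum conjugates b to the amplification of the approximation, and amp is
  continuous.\<close>

lemma exists_representing:
  assumes inf: "\<not> cfinite_dimensional A" and out: "outer LL (\<iota> ` carrier A) F"
    and rok: "\<And>a. \<lbrakk>a \<in> npos A\<omega>; a \<noteq> \<zero>\<^bsub>A\<omega>\<^esub>\<rbrakk> \<Longrightarrow> \<exists>p\<in>central_seqs. p \<in> npos A\<omega> \<and> p \<noteq> \<zero>\<^bsub>A\<omega>\<^esub> \<and> cnorm A\<omega> p \<le> 1 \<and> rokhlin_eq p \<and>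
      cuntz_le A\<omega> (\<one>\<^bsub>A\<omega>\<^esub> \<ominus>\<^bsub>A\<omega>\<^esub> cscale A\<omega> kc (EU p)) a"
    and b: "b \<in> npos B\<omega>" "b \<noteq> \<zero>\<^bsub>B\<omega>\<^esub>"
  shows "\<exists>p\<in>central_seqs. p \<in> npos A\<omega> \<and> p \<noteq> \<zero>\<^bsub>A\<omega>\<^esub> \<and> cnorm A\<omega> p \<le> 1 \<and> rokhlin_eq p \<and> cuntz_le B\<omega> (\<one>\<^bsub>B\<omega>\<^esub> \<ominus>\<^bsub>B\<omega>\<^esub> index_amp p) b"
proof -
  have bc [simp]: "b \<in> carrier B\<omega>" using b by simp
  obtain K where K: "\<And>T. T \<in> carrier LL \<Longrightarrow> cnorm LL (F T) \<le> K * cnorm LL T" using F_bounded by blast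
  have "\<exists>c d. c \<in> bdseq LL \<and> d \<in> bdseq LL \<and> (\<forall>n. c n \<in> \<iota> ` carrier A \<and> d n \<in> \<iota> ` carrier A \<and> d n \<in> npos LL) \<and>
    uB c \<bullet> b \<bullet> uB c = uB d \<and> cadj B\<omega> (uB c) = uB c \<and> uB d \<noteq> \<zero>\<^bsub>B\<omega>\<^esub>"
    by (rule BU.outer_ultra[OF iota_subalgebra out F_iota F_star(1) K F_star(2) b])
  then obtain c d where cd: "c \<in> bdseq LL" "d \<in> bdseq LL" "\<And>n. d n \<in> \<iota> ` carrier A" "\<And>n. d n \<in> npos LL"
    "uB c \<bullet> b \<bullet> uB c = uB d" "cadj B\<omega> (uB c) = uB c" "uB d \<noteq> \<zero>\<^bsub>B\<omega>\<^esub>" by blast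
  have "\<forall>n. \<exists>a. a \<in> carrier A \<and> d n = \<iota> a" using cd(3) by blast
  then obtain d' where d': "\<And>n. d' n \<in> carrier A" "\<And>n. d n = \<iota> (d' n)" by metis
  obtain K' where "\<And>n. cnorm LL (d n) \<le> K'" using bdseq_bound[OF cd(2)] by blast
  then have d'b: "d' \<in> bdseq A" using d' by (intro bdseqI) (auto simp: iota_norm)
  have Jd: "J (uA d') = uB d" unfolding J_uc(2)[OF d'b] by (simp flip: d'(2))
  \<comment> \<open>Coordinates that are positive in A are recovered from the class: it is positive
    in A, hence of the form x* x.\<close>
  have "uB d \<in> npos B\<omega>" using cd by (intro BU.uc_npos)
  then have "uA d' \<in> npos A\<omega>" using d'b by (intro J_npos_imp) (simp_all add: Jd)
  then obtain x where x: "x \<in> bdseq A" "uA d' = uA (\<lambda>n. cadj A (x n) \<otimes> x n)" using AU.U_npos_lift by blast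
  define d'' where "d'' = (\<lambda>n. cadj A (x n) \<otimes> x n)"
  have d'': "d'' \<in> bdseq A" "\<And>n. d'' n \<in> npos A" "uA d'' = uA d'"
    unfolding d''_def using x by (auto simp: bdseqD star_npos)
  have nz: "uA d'' \<noteq> \<zero>\<^bsub>A\<omega>\<^esub>" using cd(7) Jd J_zero d''(3) by metis
  have dc [simp]: "uA d'' \<in> carrier A\<omega>" using d''(1) by simp
  obtain z a where a: "a \<in> npos A\<omega>" "a \<noteq> \<zero>\<^bsub>A\<omega>\<^esub>" and z: "\<And>i. i < N \<Longrightarrow> z i \<in> carrier A\<omega>"
    and zd: "\<And>i j. \<lbrakk>i < N; j < N\<rbrakk> \<Longrightarrow> z i \<cdot> uA d'' \<cdot> cadj A\<omega> (z j) = (if i = j then a else \<zero>\<^bsub>A\<omega>\<^esub>)"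
    using AU.orthogonal_copies_ultra[OF simple inf d''(1,2) nz, of N] by blast
  obtain p where p: "p \<in> central_seqs" "p \<in> npos A\<omega>" "p \<noteq> \<zero>\<^bsub>A\<omega>\<^esub>" "cnorm A\<omega> p \<le> 1" "rokhlin_eq p"
    and cz: "cuntz_le A\<omega> (\<one>\<^bsub>A\<omega>\<^esub> \<ominus>\<^bsub>A\<omega>\<^esub> cscale A\<omega> kc (EU p)) a"
    using rok[OF a] by blast
  define f where "f = \<one>\<^bsub>A\<omega>\<^esub> \<ominus>\<^bsub>A\<omega>\<^esub> cscale A\<omega> kc (EU p)"
  have f [simp]: "f \<in> carrier A\<omega>" unfolding f_def using p(1) by (simp add: AU.U.scale_closed)
  obtain y where y: "\<And>m. y m \<in> carrier A\<omega>" "ctendsto A\<omega> (\<lambda>m. y m \<cdot> a \<cdot> cadj A\<omega> (y m)) f"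
    using cz unfolding cuntz_le_def f_def by blast
  note [simp] = y(1) z
  have ac [simp]: "a \<in> carrier A\<omega>" using a(1) by simp
  define g where "g m i = \<alpha> i \<bullet> J (y m) \<bullet> J (z i) \<bullet> uB c" for m i
  have cc [simp]: "uB c \<in> carrier B\<omega>" using cd by simp
  have gc [simp]: "g m i \<in> carrier B\<omega>" if "i < N" for m i unfolding g_def using that by simp
  have Jdd: "J (uA d'') = uB c \<bullet> b \<bullet> uB c" using cd(5) Jd d''(3) by simp
  have gg: "g m i \<bullet> b \<bullet> cadj B\<omega> (g m j) = (if i = j then \<alpha> i \<bullet> J (y m \<cdot> a \<cdot> cadj A\<omega> (y m)) \<bullet> cadj B\<omega> (\<alpha> i) else \<zero>\<^bsub>B\<omega>\<^esub>)"
    if ij: "i < N" "j < N" for m i j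
  proof -
    have "g m i \<bullet> b \<bullet> cadj B\<omega> (g m j) =
      \<alpha> i \<bullet> J (y m) \<bullet> (J (z i) \<bullet> J (uA d'') \<bullet> J (cadj A\<omega> (z j))) \<bullet> J (cadj A\<omega> (y m)) \<bullet> cadj B\<omega> (\<alpha> j)"
      unfolding Jdd g_def using ij
      by (simp add: BU.U.adj_mult cd(6) J_adj BU.U.m_assoc BU.U.adj_closed)
    also have "J (z i) \<bullet> J (uA d'') \<bullet> J (cadj A\<omega> (z j)) = J (z i \<cdot> uA d'' \<cdot> cadj A\<omega> (z j))"
      using ij by (simp add: J_mult AU.U.adj_closed)
    also have "\<dots> = (if i = j then J a else \<zero>\<^bsub>B\<omega>\<^esub>)" using zd[OF ij] by (simp add: J_zero)
    finally show ?thesis using ij by (auto simp: J_mult BU.U.m_assoc AU.U.adj_closed)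
  qed
  have "(\<Oplus>\<^bsub>B\<omega>\<^esub>i\<in>{..<N}. g m i) \<bullet> b \<bullet> cadj B\<omega> (\<Oplus>\<^bsub>B\<omega>\<^esub>i\<in>{..<N}. g m i) = amp (y m \<cdot> a \<cdot> cadj A\<omega> (y m))" for m
    unfolding amp_def
    by (rule BU.U.orthogonal_sum) (auto simp: gg AU.U.adj_closed)
  moreover have "ctendsto B\<omega> (\<lambda>m. amp (y m \<cdot> a \<cdot> cadj A\<omega> (y m))) (amp f)"
  proof -
    obtain K where K: "\<And>X. X \<in> carrier A\<omega> \<Longrightarrow> cnorm B\<omega> (amp X) \<le> K * cnorm A\<omega> X" using amp_bounded by blast
    show ?thesis
    proof (rule BU.U.ctendstoI)
      show "cnorm B\<omega> (amp (y m \<cdot> a \<cdot> cadj A\<omega> (y m)) \<ominus>\<^bsub>B\<omega>\<^esub> amp f) \<le> K * cnorm A\<omega> (y m \<cdot> a \<cdot> cadj A\<omega> (y m) \<ominus>\<^bsub>A\<omega>\<^esub> f)" for m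
        using K[of "y m \<cdot> a \<cdot> cadj A\<omega> (y m) \<ominus>\<^bsub>A\<omega>\<^esub> f"] by (simp add: amp_diff AU.U.adj_closed)
      show "(\<lambda>m. K * cnorm A\<omega> (y m \<cdot> a \<cdot> cadj A\<omega> (y m) \<ominus>\<^bsub>A\<omega>\<^esub> f)) \<longlonglongrightarrow> 0"
        using tendsto_mult_left[OF y(2)[unfolded ctendsto_def], of K] by simp
    qed (auto simp: AU.U.adj_closed)
  qed
  ultimately have "cuntz_le B\<omega> (amp f) b"
    unfolding cuntz_le_def by (intro exI[of _ "\<lambda>m. \<Oplus>\<^bsub>B\<omega>\<^esub>i\<in>{..<N}. g m i"]) (auto intro!: BU.U.finsum_closed)
  then have "cuntz_le B\<omega> (\<one>\<^bsub>B\<omega>\<^esub> \<ominus>\<^bsub>B\<omega>\<^esub> index_amp p) b"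
    unfolding f_def one_minus_index_amp[OF p(2,1) refl] .
  then show ?thesis using p by blast
qed

text \<open>Both elements commute with the basic construction and multiply \<open>p\<close> to \<open>p\<^sup>2\<close>, which forces
  \<open>(r - index_amp p)\<^sup>2 = 0\<close>.\<close>

lemma representing_unique:
  assumes p: "p \<in> npos A\<omega>" "p \<in> central_seqs" and rok: "rokhlin_eq p" and r: "r \<in> npos B\<omega>"
    and rC: "r \<in> ultra_commutant \<omega> LL (carrier LL)" and w [simp]: "\<And>i. i < n \<Longrightarrow> w i \<in> carrier LL"
    and rs: "(\<Oplus>\<^bsub>B\<omega>\<^esub>i\<in>{..<n::nat}. kB (w i) \<bullet> J p \<bullet> cadj B\<omega> (kB (w i))) = r"
    and rq: "r \<bullet> J (csqroot A\<omega> p) = J (csqroot A\<omega> p) \<bullet> J (csqroot A\<omega> p) \<bullet> J (csqroot A\<omega> p)"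
  shows "r = index_amp p"
proof -
  note pp = p refl
  note q = q_props[OF pp]
  have pc [simp]: "p \<in> carrier A\<omega>" "csqroot A\<omega> p \<in> carrier A\<omega>" and rc [simp]: "r \<in> carrier B\<omega>"
    and rrc [simp]: "index_amp p \<in> carrier B\<omega>"
    using p(1) q(1) r index_amp_closed[OF pp] by auto
  have rcomm: "r \<bullet> kB T = kB T \<bullet> r" if "T \<in> carrier LL" for T
    using rC that unfolding ultra_commutant_def by blast
  note rrJ = index_amp_J[OF pp rok]
  have rJ: "r \<bullet> J p = J p \<bullet> J p"
  proof -
    have "r \<bullet> J p = (r \<bullet> J (csqroot A\<omega> p)) \<bullet> J (csqroot A\<omega> p)" by (simp add: BU.U.m_assoc flip: q(4))
    then show ?thesis unfolding rq by (simp add: BU.U.m_assoc flip: q(4))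
  qed
  \<comment> \<open>The right side does not involve X. Used for X = r and for X =
    \<open>index_amp p\<close>, it equates their products with r; claim 2 does the same for products
    with \<open>index_amp p\<close>.\<close>
  have left: "X \<bullet> r = (\<Oplus>\<^bsub>B\<omega>\<^esub>i\<in>{..<n}. kB (w i) \<bullet> (J p \<bullet> J p) \<bullet> cadj B\<omega> (kB (w i)))"
    if X [simp]: "X \<in> carrier B\<omega>" and XJ: "X \<bullet> J p = J p \<bullet> J p"
      and Xc: "\<And>T. T \<in> carrier LL \<Longrightarrow> X \<bullet> kB T = kB T \<bullet> X" for X
  proof -
    have "X \<bullet> r = (\<Oplus>\<^bsub>B\<omega>\<^esub>i\<in>{..<n}. X \<bullet> (kB (w i) \<bullet> J p \<bullet> cadj B\<omega> (kB (w i))))"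
      unfolding rs[symmetric] by (intro BU.U.finsum_rdistr) (auto simp: BU.U.adj_closed)
    also have "\<dots> = (\<Oplus>\<^bsub>B\<omega>\<^esub>i\<in>{..<n}. kB (w i) \<bullet> (J p \<bullet> J p) \<bullet> cadj B\<omega> (kB (w i)))"
    proof (intro BU.U.finsum_cong')
      fix i assume "i \<in> {..<n}"
      then have i [simp]: "w i \<in> carrier LL" by simp
      have "X \<bullet> (kB (w i) \<bullet> J p \<bullet> cadj B\<omega> (kB (w i))) =
        (X \<bullet> kB (w i)) \<bullet> J p \<bullet> cadj B\<omega> (kB (w i))"
        by (simp add: BU.U.m_assoc BU.U.adj_closed)
      also have "\<dots> = kB (w i) \<bullet> (X \<bullet> J p) \<bullet> cadj B\<omega> (kB (w i))"
        unfolding Xc[OF i] by (simp add: BU.U.m_assoc BU.U.adj_closed)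
      finally show "X \<bullet> (kB (w i) \<bullet> J p \<bullet> cadj B\<omega> (kB (w i))) =
        kB (w i) \<bullet> (J p \<bullet> J p) \<bullet> cadj B\<omega> (kB (w i))" unfolding XJ .
    qed (auto simp: BU.U.adj_closed)
    finally show ?thesis .
  qed
  have index_amp_c: "index_amp p \<bullet> kB T = kB T \<bullet> index_amp p" if "T \<in> carrier LL" for T
    using index_amp_commutes[OF pp that] by simp
  have 1: "index_amp p \<bullet> r = r \<bullet> r"
    using left[OF rrc rrJ index_amp_c] left[OF rc rJ rcomm] by simp
  have 2: "X \<bullet> index_amp p = cscale B\<omega> kc (amp (p \<cdot> p))"
    if X [simp]: "X \<in> carrier B\<omega>" and XJ: "X \<bullet> J p = J p \<bullet> J p"
      and Xc: "\<And>T. T \<in> carrier LL \<Longrightarrow> X \<bullet> kB T = kB T \<bullet> X" for X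
  proof -
    have "X \<bullet> amp p = (\<Oplus>\<^bsub>B\<omega>\<^esub>j\<in>{..<N}. X \<bullet> (\<alpha> j \<bullet> J p \<bullet> cadj B\<omega> (\<alpha> j)))"
      unfolding amp_def by (intro BU.U.finsum_rdistr) auto
    also have "\<dots> = amp (p \<cdot> p)" unfolding amp_def
    proof (intro BU.U.finsum_cong')
      fix j assume "j \<in> {..<N}"
      then have j [simp]: "j < N" by simp
      have Xa: "X \<bullet> \<alpha> j = \<alpha> j \<bullet> X" unfolding \<alpha>_def by (rule Xc) simp
      have "X \<bullet> (\<alpha> j \<bullet> J p \<bullet> cadj B\<omega> (\<alpha> j)) = (X \<bullet> \<alpha> j) \<bullet> J p \<bullet> cadj B\<omega> (\<alpha> j)" by (simp add: BU.U.m_assoc)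
      also have "\<dots> = \<alpha> j \<bullet> (X \<bullet> J p) \<bullet> cadj B\<omega> (\<alpha> j)" unfolding Xa by (simp add: BU.U.m_assoc)
      finally show "X \<bullet> (\<alpha> j \<bullet> J p \<bullet> cadj B\<omega> (\<alpha> j)) = \<alpha> j \<bullet> J (p \<cdot> p) \<bullet> cadj B\<omega> (\<alpha> j)"
        unfolding XJ by (simp add: J_mult)
    qed auto
    finally show ?thesis unfolding index_amp_def by (simp flip: BU.U.scale_mult_right)
  qed
  have 3: "index_amp p \<bullet> index_amp p = r \<bullet> index_amp p"
    using 2[OF rrc rrJ index_amp_c] 2[OF rc rJ rcomm] by simp
  have sa: "r \<in> csa B\<omega>" "index_amp p \<in> csa B\<omega>"
    using BU.U.npos_csa[OF r] BU.U.npos_csa[OF index_amp_npos[OF pp]] by auto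
  have 4: "r \<bullet> index_amp p = r \<bullet> r"
    using arg_cong[OF 1, of "cadj B\<omega>"] BU.U.csa_adj[OF sa(1)] BU.U.csa_adj[OF sa(2)] by (simp add: BU.U.adj_mult)
  have "(r \<ominus>\<^bsub>B\<omega>\<^esub> index_amp p) \<bullet> (r \<ominus>\<^bsub>B\<omega>\<^esub> index_amp p) = \<zero>\<^bsub>B\<omega>\<^esub>"
    unfolding BU.U.diff_square[OF rc rrc] 1 3 4 by (simp add: BU.U.diff_eq_zero)
  then have "r \<ominus>\<^bsub>B\<omega>\<^esub> index_amp p = \<zero>\<^bsub>B\<omega>\<^esub>" by (rule BU.U.csa_sq_zero[OF BU.U.csa_diff[OF sa]])
  then show "r = index_amp p" using BU.U.diff_eq_zero[of r "index_amp p"] by simp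
qed

text \<open>The test element is b = d e with d coming from P. A conjugator X of b compresses to e X
  e = V e with V in the image of E, so the compression of X b X* is V d V* e. Multiplication by e is
  bounded below on the ultrapower of A, so the convergence descends to it. The hypothesis
  \<open>rep\<close> is representability with its element already pulled back to A.\<close>

lemma exists_rokhlin:
  assumes out: "outer A P E" and a: "a \<in> npos A\<omega>" "a \<noteq> \<zero>\<^bsub>A\<omega>\<^esub>"
    and rep: "\<And>b. \<lbrakk>b \<in> npos B\<omega>; b \<noteq> \<zero>\<^bsub>B\<omega>\<^esub>\<rbrakk> \<Longrightarrow> \<exists>p\<in>central_seqs. \<exists>r n w. p \<in> npos A\<omega> \<and> p \<noteq> \<zero>\<^bsub>A\<omega>\<^esub> \<and> cnorm A\<omega> p \<le> 1 \<and>
      J (csqroot A\<omega> p) \<bullet> e\<omega> \<bullet> J (csqroot A\<omega> p) = kB (F e) \<bullet> J p \<and>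
      r \<in> npos B\<omega> \<and> (\<forall>i<n::nat. w i \<in> carrier LL) \<and>
      (\<Oplus>\<^bsub>B\<omega>\<^esub>i\<in>{..<n}. kB (w i) \<bullet> J p \<bullet> cadj B\<omega> (kB (w i))) = r \<and>
      r \<in> ultra_commutant \<omega> LL (carrier LL) \<and>
      r \<bullet> J (csqroot A\<omega> p) = J (csqroot A\<omega> p) \<bullet> J (csqroot A\<omega> p) \<bullet> J (csqroot A\<omega> p) \<and>
      cuntz_le B\<omega> (\<one>\<^bsub>B\<omega>\<^esub> \<ominus>\<^bsub>B\<omega>\<^esub> r) b"
  shows "\<exists>p\<in>central_seqs. p \<in> npos A\<omega> \<and> p \<noteq> \<zero>\<^bsub>A\<omega>\<^esub> \<and> cnorm A\<omega> p \<le> 1 \<and> rokhlin_eq p \<and>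
    cuntz_le A\<omega> (\<one>\<^bsub>A\<omega>\<^esub> \<ominus>\<^bsub>A\<omega>\<^esub> cscale A\<omega> kc (EU p)) a"
proof -
  have ac [simp]: "a \<in> carrier A\<omega>" using a by simp
  \<comment> \<open>The comparison of norms, squared, is the Pimsner-Popa type inequality for E,
    with constant M^2.\<close>
  have low: "(cnorm A x)\<^sup>2 \<le> M\<^sup>2 * cnorm A (E (cadj A x \<otimes> x))" if "x \<in> carrier A" for x
    using power_mono[OF norm_le_en[OF that] norm_nonneg[OF that], of 2] en_sq[OF that]
    by (simp add: power_mult_distrib ip_def)
  have "\<exists>c d. c \<in> bdseq A \<and> d \<in> bdseq A \<and> (\<forall>n. c n \<in> P \<and> d n \<in> P \<and> d n \<in> npos A) \<and>
    uA c \<cdot> a \<cdot> uA c = uA d \<and> cadj A\<omega> (uA c) = uA c \<and> uA d \<noteq> \<zero>\<^bsub>A\<omega>\<^esub>"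
  proof (rule AU.outer_ultra[OF P out _ _ _ low a])
    show "cnorm A (E x) \<le> 1 * cnorm A x" if "x \<in> carrier A" for x using E_norm[OF that] by simp
  qed (auto intro: E_npos star_npos)
  then obtain c d where cd: "c \<in> bdseq A" "d \<in> bdseq A" "\<And>n. d n \<in> P" "\<And>n. d n \<in> npos A"
    "uA c \<cdot> a \<cdot> uA c = uA d" "cadj A\<omega> (uA c) = uA c" "uA d \<noteq> \<zero>\<^bsub>A\<omega>\<^esub>" by blast
  have cc [simp]: "uA c \<in> carrier A\<omega>" "uA d \<in> carrier A\<omega>" using cd by auto
  have dpos: "uA d \<in> npos A\<omega>" using cd by (intro AU.uc_npos)
  have de: "J (uA d) \<bullet> e\<omega> = e\<omega> \<bullet> J (uA d)" by (rule e\<omega>_commute[OF cd(2,3)])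
  define b where "b = e\<omega> \<bullet> J (uA d) \<bullet> e\<omega>"
  have eps: "e\<omega> \<in> csa B\<omega>" by (intro BU.U.csaI e\<omega>_closed e\<omega>_adj)
  have bpos: "b \<in> npos B\<omega>" unfolding b_def by (intro BU.U.npos_conj_csa J_npos dpos eps)
  have be: "b = J (uA d) \<bullet> e\<omega>" unfolding b_def de[symmetric] by (simp add: BU.U.m_assoc e\<omega>_idem)
  have bnz: "b \<noteq> \<zero>\<^bsub>B\<omega>\<^esub>"
  proof
    assume "b = \<zero>\<^bsub>B\<omega>\<^esub>"
    then have "cnorm A\<omega> (uA d) \<le> 0" using low_bound[OF cc(2)] be by simp
    then show False using cd(7) AU.U.norm_nonneg[OF cc(2)] AU.U.norm_eq_zero[OF cc(2)] by simp
  qed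
  have bc [simp]: "b \<in> carrier B\<omega>" using bpos by simp
  from rep[OF bpos bnz] obtain p r n w where
    p: "p \<in> central_seqs" "p \<in> npos A\<omega>" "p \<noteq> \<zero>\<^bsub>A\<omega>\<^esub>" "cnorm A\<omega> p \<le> 1"
    and comp: "J (csqroot A\<omega> p) \<bullet> e\<omega> \<bullet> J (csqroot A\<omega> p) = kB (F e) \<bullet> J p"
    and r: "r \<in> npos B\<omega>" and w0: "\<forall>i<n::nat. w i \<in> carrier LL"
    and rs: "(\<Oplus>\<^bsub>B\<omega>\<^esub>i\<in>{..<n}. kB (w i) \<bullet> J p \<bullet> cadj B\<omega> (kB (w i))) = r"
    and rC: "r \<in> ultra_commutant \<omega> LL (carrier LL)"
    and rq: "r \<bullet> J (csqroot A\<omega> p) = J (csqroot A\<omega> p) \<bullet> J (csqroot A\<omega> p) \<bullet> J (csqroot A\<omega> p)"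
    and cz: "cuntz_le B\<omega> (\<one>\<^bsub>B\<omega>\<^esub> \<ominus>\<^bsub>B\<omega>\<^esub> r) b"
    by (elim bexE exE conjE) (rule that; assumption)
  have rcomm: "r \<bullet> kB T = kB T \<bullet> r" if "T \<in> carrier LL" for T
    using rC that unfolding ultra_commutant_def by blast
  have w [simp]: "w i \<in> carrier LL" if "i < n" for i using w0 that by blast
  note pp = p(2,1) refl
  have pc [simp]: "p \<in> carrier A\<omega>" and rc [simp]: "r \<in> carrier B\<omega>" and rrc [simp]: "index_amp p \<in> carrier B\<omega>"
    using p r index_amp_closed[OF pp] by auto
  note q = q_props[OF pp]
  have qc [simp]: "csqroot A\<omega> p \<in> carrier A\<omega>" using q(1) by simp
  have rok: "rokhlin_eq p"
  proof -
    \<comment> \<open>The dual expectation of e is 1/k, so the compression condition, taken at e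
      alone, is the Rokhlin equation for p.\<close>
    have "F e = \<iota> (cscale A (1/kc) \<one>)" using F_sandwich[OF one_closed] by (simp add: iota_one)
    then have "kB (F e) = cscale B\<omega> (1/kc) \<one>\<^bsub>B\<omega>\<^esub>"
      by (simp add: iota_scale iota_one BU.U_one)
    then have "J (csqroot A\<omega> p) \<bullet> e\<omega> \<bullet> J (csqroot A\<omega> p) = cscale B\<omega> (1/kc) (J p)"
      unfolding comp by (simp add: BU.U.scale_one_mult)
    then show ?thesis unfolding rokhlin_eq_def using k_pos by (simp add: BU.U.scale_scale BU.U.scale_one)
  qed
  have r_eq: "r = index_amp p" by (rule representing_unique[OF p(2,1) rok r rC w rs rq])
  define f where "f = \<one>\<^bsub>A\<omega>\<^esub> \<ominus>\<^bsub>A\<omega>\<^esub> cscale A\<omega> kc (EU p)"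
  have f [simp]: "f \<in> carrier A\<omega>" unfolding f_def by (simp add: AU.U.scale_closed)
  obtain X where X [simp]: "\<And>m. X m \<in> carrier B\<omega>"
    and lim: "ctendsto B\<omega> (\<lambda>m. X m \<bullet> b \<bullet> cadj B\<omega> (X m)) (\<one>\<^bsub>B\<omega>\<^esub> \<ominus>\<^bsub>B\<omega>\<^esub> r)"
    using cz unfolding cuntz_le_def by blast
  have "\<forall>m. \<exists>Y. Y \<in> carrier A\<omega> \<and> X m \<bullet> e\<omega> = J Y \<bullet> e\<omega>" using push_down[OF X] by blast
  then obtain Y where Y [simp]: "\<And>m. Y m \<in> carrier A\<omega>" and XY: "\<And>m. X m \<bullet> e\<omega> = J (Y m) \<bullet> e\<omega>" by metis
  define V where "V m = EU (Y m)" for m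
  have V [simp]: "V m \<in> carrier A\<omega>" for m unfolding V_def by simp
  have Ve: "J (V m) \<bullet> e\<omega> = e\<omega> \<bullet> J (V m)" for m unfolding V_def by (rule EU_commute) simp
  have Vse: "J (cadj A\<omega> (V m)) \<bullet> e\<omega> = e\<omega> \<bullet> J (cadj A\<omega> (V m))" for m
    using arg_cong[OF Ve[of m], of "cadj B\<omega>"] by (simp add: BU.U.adj_mult e\<omega>_adj J_adj)
  have eXe: "e\<omega> \<bullet> X m \<bullet> e\<omega> = J (V m) \<bullet> e\<omega>" for m
    unfolding V_def by (simp add: BU.U.m_assoc XY) (simp add: e\<omega>_compress flip: BU.U.m_assoc)
  have comp_b: "e\<omega> \<bullet> (X m \<bullet> b \<bullet> cadj B\<omega> (X m)) \<bullet> e\<omega> = J (V m \<cdot> uA d \<cdot> cadj A\<omega> (V m)) \<bullet> e\<omega>" for m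
  proof -
    have eXe': "e\<omega> \<bullet> cadj B\<omega> (X m) \<bullet> e\<omega> = e\<omega> \<bullet> J (cadj A\<omega> (V m))"
      using arg_cong[OF eXe[of m], of "cadj B\<omega>"] by (simp add: BU.U.adj_mult e\<omega>_adj J_adj BU.U.m_assoc BU.U.adj_closed)
    have "e\<omega> \<bullet> (X m \<bullet> b \<bullet> cadj B\<omega> (X m)) \<bullet> e\<omega> = (e\<omega> \<bullet> X m \<bullet> e\<omega>) \<bullet> J (uA d) \<bullet> (e\<omega> \<bullet> cadj B\<omega> (X m) \<bullet> e\<omega>)"
      unfolding b_def by (simp add: BU.U.m_assoc BU.U.adj_closed)
    also have "\<dots> = J (V m) \<bullet> (e\<omega> \<bullet> J (uA d)) \<bullet> (e\<omega> \<bullet> J (cadj A\<omega> (V m)))"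
      unfolding eXe eXe' by (simp add: BU.U.m_assoc AU.U.adj_closed)
    also have "\<dots> = J (V m) \<bullet> J (uA d) \<bullet> (e\<omega> \<bullet> e\<omega>) \<bullet> J (cadj A\<omega> (V m))"
      unfolding de[symmetric] by (simp add: BU.U.m_assoc AU.U.adj_closed)
    also have "\<dots> = J (V m) \<bullet> J (uA d) \<bullet> (e\<omega> \<bullet> J (cadj A\<omega> (V m)))"
      unfolding e\<omega>_idem by (simp add: BU.U.m_assoc AU.U.adj_closed)
    also have "\<dots> = J (V m \<cdot> uA d \<cdot> cadj A\<omega> (V m)) \<bullet> e\<omega>"
      unfolding Vse[symmetric] by (simp add: J_mult BU.U.m_assoc AU.U.adj_closed)
    finally show ?thesis .
  qed
  have comp_r: "e\<omega> \<bullet> (\<one>\<^bsub>B\<omega>\<^esub> \<ominus>\<^bsub>B\<omega>\<^esub> r) \<bullet> e\<omega> = J f \<bullet> e\<omega>"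
  proof -
    have "e\<omega> \<bullet> (\<one>\<^bsub>B\<omega>\<^esub> \<ominus>\<^bsub>B\<omega>\<^esub> r) = (\<one>\<^bsub>B\<omega>\<^esub> \<ominus>\<^bsub>B\<omega>\<^esub> r) \<bullet> e\<omega>"
      using rcomm[OF e_closed] by (simp add: a_minus_def BU.U.l_distr BU.U.r_distr BU.U.l_minus BU.U.r_minus)
    then have "e\<omega> \<bullet> (\<one>\<^bsub>B\<omega>\<^esub> \<ominus>\<^bsub>B\<omega>\<^esub> r) \<bullet> e\<omega> = (\<one>\<^bsub>B\<omega>\<^esub> \<ominus>\<^bsub>B\<omega>\<^esub> r) \<bullet> e\<omega>"
      by (simp add: BU.U.m_assoc e\<omega>_idem)
    then show ?thesis unfolding r_eq one_minus_index_amp_compress[OF pp] f_def .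
  qed
  have "ctendsto A\<omega> (\<lambda>m. V m \<cdot> uA d \<cdot> cadj A\<omega> (V m)) f"
  proof (rule AU.U.ctendstoI)
    fix m
    let ?D = "X m \<bullet> b \<bullet> cadj B\<omega> (X m) \<ominus>\<^bsub>B\<omega>\<^esub> (\<one>\<^bsub>B\<omega>\<^esub> \<ominus>\<^bsub>B\<omega>\<^esub> r)"
    have D: "?D \<in> carrier B\<omega>" by (simp add: BU.U.adj_closed)
    have dist: "e\<omega> \<bullet> (S \<ominus>\<^bsub>B\<omega>\<^esub> T) \<bullet> e\<omega> = e\<omega> \<bullet> S \<bullet> e\<omega> \<ominus>\<^bsub>B\<omega>\<^esub> e\<omega> \<bullet> T \<bullet> e\<omega>" if "S \<in> carrier B\<omega>" "T \<in> carrier B\<omega>" for S T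
      using that by (simp add: a_minus_def BU.U.l_distr BU.U.r_distr BU.U.l_minus BU.U.r_minus)
    have dist': "(S \<ominus>\<^bsub>B\<omega>\<^esub> T) \<bullet> e\<omega> = S \<bullet> e\<omega> \<ominus>\<^bsub>B\<omega>\<^esub> T \<bullet> e\<omega>" if "S \<in> carrier B\<omega>" "T \<in> carrier B\<omega>" for S T
      using that by (simp add: a_minus_def BU.U.l_distr BU.U.l_minus)
    have "J (V m \<cdot> uA d \<cdot> cadj A\<omega> (V m) \<ominus>\<^bsub>A\<omega>\<^esub> f) \<bullet> e\<omega> = e\<omega> \<bullet> ?D \<bullet> e\<omega>"
      by (simp add: dist comp_b comp_r J_diff dist' AU.U.adj_closed BU.U.adj_closed)
    then have "cnorm A\<omega> (V m \<cdot> uA d \<cdot> cadj A\<omega> (V m) \<ominus>\<^bsub>A\<omega>\<^esub> f) \<le> M * cnorm B\<omega> (e\<omega> \<bullet> ?D \<bullet> e\<omega>)"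
      using low_bound[of "V m \<cdot> uA d \<cdot> cadj A\<omega> (V m) \<ominus>\<^bsub>A\<omega>\<^esub> f"] by (simp add: AU.U.adj_closed)
    also have "\<dots> \<le> M * (1 * cnorm B\<omega> ?D * 1)"
      using M_pos norm_e\<omega> D by (intro mult_left_mono BU.U.norm_mult_le) auto
    finally show "cnorm A\<omega> (V m \<cdot> uA d \<cdot> cadj A\<omega> (V m) \<ominus>\<^bsub>A\<omega>\<^esub> f) \<le> M * cnorm B\<omega> ?D" by simp
  next
    show "(\<lambda>m. M * cnorm B\<omega> (X m \<bullet> b \<bullet> cadj B\<omega> (X m) \<ominus>\<^bsub>B\<omega>\<^esub> (\<one>\<^bsub>B\<omega>\<^esub> \<ominus>\<^bsub>B\<omega>\<^esub> r))) \<longlonglongrightarrow> 0"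
      using tendsto_mult_left[OF lim[unfolded ctendsto_def], of M] by simp
  qed (auto simp: AU.U.adj_closed)
  \<comment> \<open>Since d = c a c with c self-adjoint, conjugating d by V is conjugating a by V
    c.\<close>
  moreover have "V m \<cdot> uA d \<cdot> cadj A\<omega> (V m) = (V m \<cdot> uA c) \<cdot> a \<cdot> cadj A\<omega> (V m \<cdot> uA c)" for m
    unfolding cd(5)[symmetric] by (simp add: AU.U.adj_mult cd(6) AU.U.m_assoc AU.U.adj_closed)
  ultimately have "cuntz_le A\<omega> f a"
    unfolding cuntz_le_def by (intro exI[of _ "\<lambda>m. V m \<cdot> uA c"]) simp
  then show ?thesis using p rok unfolding f_def by blast
qed

text \<open>As the index is the scalar k, multiplying by its constant sequence is scaling by k, in B
  as well as in A.\<close>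

lemma rokhlin_iff:
  "weak_tracial_Rokhlin \<omega> A E \<longleftrightarrow> (\<forall>a\<in>npos A\<omega> - {\<zero>\<^bsub>A\<omega>\<^esub>}. \<exists>p\<in>central_seqs. p \<in> npos A\<omega> \<and> p \<noteq> \<zero>\<^bsub>A\<omega>\<^esub> \<and> cnorm A\<omega> p \<le> 1 \<and>
    rokhlin_eq p \<and> cuntz_le A\<omega> (\<one>\<^bsub>A\<omega>\<^esub> \<ominus>\<^bsub>A\<omega>\<^esub> cscale A\<omega> kc (EU p)) a)"
proof -
  let ?ind = "kA (Index A E)"
  have ind: "?ind = cscale A\<omega> kc \<one>\<^bsub>A\<omega>\<^esub>" unfolding Index_scalar by (simp add: AU.U_one)
  have Jind: "J ?ind = cscale B\<omega> kc \<one>\<^bsub>B\<omega>\<^esub>" unfolding ind by (simp add: J_scale J_one)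
  have 1: "J ?ind \<bullet> (J (csqroot A\<omega> p) \<bullet> e\<omega> \<bullet> J (csqroot A\<omega> p)) = cscale B\<omega> kc (J (csqroot A\<omega> p) \<bullet> e\<omega> \<bullet> J (csqroot A\<omega> p))"
    if "p \<in> npos A\<omega>" for p
    unfolding Jind using AU.U.csqroot_props(1)[OF that] by (intro BU.U.scale_one_mult) simp
  have 2: "?ind \<cdot> EU p = cscale A\<omega> kc (EU p)" if "p \<in> npos A\<omega>" for p
    unfolding ind using that by (intro AU.U.scale_one_mult) simp
  show ?thesis
    unfolding weak_tracial_Rokhlin_def Let_def basic_construction_eq AU.U.cpos_eq_npos rokhlin_eq_def
    by (intro ball_cong bex_cong refl conj_cong) (simp_all only: 1 2)
qed

lemma pow3: "x \<in> carrier B\<omega> \<Longrightarrow> x [^]\<^bsub>B\<omega>\<^esub> (3::nat) = x \<bullet> x \<bullet> x"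
  by (simp add: numeral_3_eq_3)

lemma representable_if_rokhlin:
  assumes inf: "\<not> cfinite_dimensional A" and out: "outer LL (\<iota> ` carrier A) F"
    and rok: "weak_tracial_Rokhlin \<omega> A E"
  shows "weakly_tracially_approx_representable \<omega> LL (\<iota> ` carrier A) F"
  unfolding weakly_tracially_approx_representable_def Let_def BU.U.cpos_eq_npos
proof (intro ballI)
  fix b assume "b \<in> npos B\<omega> - {\<zero>\<^bsub>B\<omega>\<^esub>}"
  then have b: "b \<in> npos B\<omega>" "b \<noteq> \<zero>\<^bsub>B\<omega>\<^esub>" by auto
  have "\<exists>p\<in>central_seqs. p \<in> npos A\<omega> \<and> p \<noteq> \<zero>\<^bsub>A\<omega>\<^esub> \<and> cnorm A\<omega> p \<le> 1 \<and> rokhlin_eq p \<and> cuntz_le B\<omega> (\<one>\<^bsub>B\<omega>\<^esub> \<ominus>\<^bsub>B\<omega>\<^esub> index_amp p) b"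
    by (rule exists_representing[OF inf out _ b]) (use rok in \<open>auto simp: rokhlin_iff\<close>)
  then obtain p where p: "p \<in> central_seqs" "p \<in> npos A\<omega>" "p \<noteq> \<zero>\<^bsub>A\<omega>\<^esub>" "cnorm A\<omega> p \<le> 1" "rokhlin_eq p"
    and cz: "cuntz_le B\<omega> (\<one>\<^bsub>B\<omega>\<^esub> \<ominus>\<^bsub>B\<omega>\<^esub> index_amp p) b" by blast
  note pp = p(2,1) refl
  note q = q_props[OF pp]
  let ?w = "\<lambda>j. cscale LL (complex_of_real (sqrt k)) (\<iota> (u j) \<star> e)"
  have s: "csqroot B\<omega> (J p) = J (csqroot A\<omega> p)" by (rule J_csqroot[OF p(2)])
  show "\<exists>e\<in>ultra_sub \<omega> LL (\<iota> ` carrier A) \<inter> ultra_commutant \<omega> LL (\<iota> ` carrier A).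
    \<exists>r\<in>ultra_commutant \<omega> LL (carrier LL). \<exists>n u. (\<forall>i<n. u i \<in> carrier LL) \<and>
      e \<in> npos B\<omega> \<and> cnorm B\<omega> e \<le> 1 \<and> r \<in> npos B\<omega> \<and> cnorm B\<omega> r \<le> 1 \<and>
      (\<forall>x\<in>carrier LL. csqroot B\<omega> e \<bullet> kB x \<bullet> csqroot B\<omega> e = kB (F x) \<bullet> e) \<and>
      (\<Oplus>\<^bsub>B\<omega>\<^esub>i\<in>{..<n::nat}. kB (u i) \<bullet> e \<bullet> cadj B\<omega> (kB (u i))) = r \<and>
      r \<bullet> csqroot B\<omega> e = csqroot B\<omega> e [^]\<^bsub>B\<omega>\<^esub> (3::nat) \<and>
      csqroot B\<omega> e [^]\<^bsub>B\<omega>\<^esub> (3::nat) = csqroot B\<omega> e \<bullet> r \<and>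
      cuntz_le B\<omega> (\<one>\<^bsub>B\<omega>\<^esub> \<ominus>\<^bsub>B\<omega>\<^esub> r) b \<and> inj_on (\<lambda>x. kB x \<bullet> e) (\<iota> ` carrier A)"
  proof (rule bexI[of _ "J p"], rule bexI[of _ "index_amp p"], rule exI[of _ N], rule exI[of _ ?w], intro conjI allI impI ballI)
    show "?w i \<in> carrier LL" if "i < N" for i using that by (simp add: B.scale_closed)
    show "J p \<in> npos B\<omega>" by (rule J_npos[OF p(2)])
    show "cnorm B\<omega> (J p) \<le> 1" using p by (simp add: J_norm)
    show "index_amp p \<in> npos B\<omega>" by (rule index_amp_npos[OF pp])
    show "cnorm B\<omega> (index_amp p) \<le> 1" by (rule index_amp_norm[OF pp p(5,4)])
    show "csqroot B\<omega> (J p) \<bullet> kB T \<bullet> csqroot B\<omega> (J p) = kB (F T) \<bullet> J p" if "T \<in> carrier LL" for T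
      unfolding s by (rule rokhlin_compress[OF pp p(5) that])
    show "(\<Oplus>\<^bsub>B\<omega>\<^esub>i\<in>{..<N}. kB (?w i) \<bullet> J p \<bullet> cadj B\<omega> (kB (?w i))) = index_amp p"
      by (rule index_amp_sum) (rule central_closed[OF p(1)])
    show "index_amp p \<bullet> csqroot B\<omega> (J p) = csqroot B\<omega> (J p) [^]\<^bsub>B\<omega>\<^esub> (3::nat)"
      "csqroot B\<omega> (J p) [^]\<^bsub>B\<omega>\<^esub> (3::nat) = csqroot B\<omega> (J p) \<bullet> index_amp p"
      unfolding s index_amp_sqrt[OF pp p(5)] using q(1) by (simp_all add: pow3)
    show "cuntz_le B\<omega> (\<one>\<^bsub>B\<omega>\<^esub> \<ominus>\<^bsub>B\<omega>\<^esub> index_amp p) b" by (rule cz)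
    show "inj_on (\<lambda>x. kB x \<bullet> J p) (\<iota> ` carrier A)"
      by (rule inj_onI) (auto intro: arg_cong[OF const_mult_inj[OF p(1,3)]])
    show "index_amp p \<in> ultra_commutant \<omega> LL (carrier LL)"
      unfolding ultra_commutant_def
      using index_amp_closed[OF pp] index_amp_commutes[OF pp, symmetric] by (intro CollectI conjI ballI)
    obtain x where x: "x \<in> bdseq A" "p = uA x" using central_closed[OF p(1)] by (rule AU.U_obtain)
    have "J p \<in> ultra_sub \<omega> LL (\<iota> ` carrier A)"
      unfolding ultra_sub_def x(2) J_uc(2)[OF x(1)] using J_uc(1)[OF x(1)] x(1) by (auto simp: bdseqD)
    moreover have "J p \<in> ultra_commutant \<omega> LL (\<iota> ` carrier A)"
      unfolding ultra_commutant_def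
    proof (intro CollectI conjI ballI)
      show "J p \<in> carrier B\<omega>" using p(1) by simp
      fix T assume "T \<in> \<iota> ` carrier A"
      then obtain a where a: "a \<in> carrier A" "T = \<iota> a" by blast
      show "J p \<bullet> kB T = kB T \<bullet> J p"
        unfolding a(2) J_const[OF a(1), symmetric] by (rule central_J_commute[OF p(1) a(1)])
    qed
    ultimately show "J p \<in> ultra_sub \<omega> LL (\<iota> ` carrier A) \<inter> ultra_commutant \<omega> LL (\<iota> ` carrier A)" by (rule IntI)
  qed
qed

lemma rokhlin_if_representable:
  assumes out: "outer A P E"
    and rep: "weakly_tracially_approx_representable \<omega> LL (\<iota> ` carrier A) F"
  shows "weak_tracial_Rokhlin \<omega> A E"
  unfolding rokhlin_iff
proof (intro ballI)
  fix a assume "a \<in> npos A\<omega> - {\<zero>\<^bsub>A\<omega>\<^esub>}"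
  then have a: "a \<in> npos A\<omega>" "a \<noteq> \<zero>\<^bsub>A\<omega>\<^esub>" by auto
  show "\<exists>p\<in>central_seqs. p \<in> npos A\<omega> \<and> p \<noteq> \<zero>\<^bsub>A\<omega>\<^esub> \<and> cnorm A\<omega> p \<le> 1 \<and>
    rokhlin_eq p \<and> cuntz_le A\<omega> (\<one>\<^bsub>A\<omega>\<^esub> \<ominus>\<^bsub>A\<omega>\<^esub> cscale A\<omega> kc (EU p)) a"
  proof (rule exists_rokhlin[OF out a])
    fix b assume "b \<in> npos B\<omega>" "b \<noteq> \<zero>\<^bsub>B\<omega>\<^esub>"
    then have b: "b \<in> npos B\<omega> - {\<zero>\<^bsub>B\<omega>\<^esub>}" by simp
    from bspec[OF rep[unfolded weakly_tracially_approx_representable_def Let_def BU.U.cpos_eq_npos] b]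
    obtain f r n w where f: "f \<in> ultra_sub \<omega> LL (\<iota> ` carrier A)" "f \<in> ultra_commutant \<omega> LL (\<iota> ` carrier A)"
      and r: "r \<in> ultra_commutant \<omega> LL (carrier LL)" and w: "\<forall>i<n::nat. w i \<in> carrier LL"
      and fp: "f \<in> npos B\<omega>" "cnorm B\<omega> f \<le> 1" and rp: "r \<in> npos B\<omega>" "cnorm B\<omega> r \<le> 1"
      and comp: "\<forall>x\<in>carrier LL. csqroot B\<omega> f \<bullet> kB x \<bullet> csqroot B\<omega> f = kB (F x) \<bullet> f"
      and rs: "(\<Oplus>\<^bsub>B\<omega>\<^esub>i\<in>{..<n}. kB (w i) \<bullet> f \<bullet> cadj B\<omega> (kB (w i))) = r"
      and rf: "r \<bullet> csqroot B\<omega> f = csqroot B\<omega> f [^]\<^bsub>B\<omega>\<^esub> (3::nat)" "csqroot B\<omega> f [^]\<^bsub>B\<omega>\<^esub> (3::nat) = csqroot B\<omega> f \<bullet> r"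
      and cz: "cuntz_le B\<omega> (\<one>\<^bsub>B\<omega>\<^esub> \<ominus>\<^bsub>B\<omega>\<^esub> r) b"
      and inj: "inj_on (\<lambda>x. kB x \<bullet> f) (\<iota> ` carrier A)"
      by (elim bexE exE conjE IntE) (rule that; assumption)
    from f(1) obtain x where x: "x \<in> bdseq LL" "\<forall>n. x n \<in> \<iota> ` carrier A" "f = uB x"
      unfolding ultra_sub_def by blast
    have "\<forall>n. \<exists>a. a \<in> carrier A \<and> x n = \<iota> a" using x(2) by blast
    then obtain y where y: "\<And>n. y n \<in> carrier A" "\<And>n. x n = \<iota> (y n)" by metis
    obtain K where "\<And>n. cnorm LL (x n) \<le> K" using bdseq_bound[OF x(1)] by blast
    then have yb: "y \<in> bdseq A" using y by (intro bdseqI) (auto simp: iota_norm)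
    define p where "p = uA y"
    have pc [simp]: "p \<in> carrier A\<omega>" unfolding p_def using yb by simp
    have fJ: "f = J p" unfolding p_def x(3) J_uc(2)[OF yb] by (simp flip: y(2))
    have pp: "p \<in> npos A\<omega>" using fp(1) unfolding fJ by (intro J_npos_imp) simp_all
    have pC: "p \<in> central_seqs" unfolding ultra_commutant_def
    proof (intro CollectI conjI ballI pc)
      fix a assume a: "a \<in> carrier A"
      have "J p \<bullet> kB (\<iota> a) = kB (\<iota> a) \<bullet> J p"
        using f(2) a unfolding fJ ultra_commutant_def by blast
      then have "J (p \<cdot> kA a) = J (kA a \<cdot> p)" using a by (simp add: J_mult J_const)
      then show "p \<cdot> kA a = kA a \<cdot> p" using a by (intro J_inj) auto
    qed
    \<comment> \<open>Nonvanishing comes from condition (4): for p = 0 the injective map would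
      identify the distinct elements 1 and 0.\<close>
    have pnz: "p \<noteq> \<zero>\<^bsub>A\<omega>\<^esub>"
    proof
      assume "p = \<zero>\<^bsub>A\<omega>\<^esub>"
      then have "kB (\<iota> \<one>) \<bullet> f = kB (\<iota> \<zero>) \<bullet> f" unfolding fJ by (simp add: J_zero)
      then have "\<iota> \<one> = \<iota> \<zero>" using inj_onD[OF inj] by blast
      then show False using iota_inj[of \<one> \<zero>] one_nonzero by simp
    qed
    have s: "csqroot B\<omega> f = J (csqroot A\<omega> p)" unfolding fJ by (rule J_csqroot[OF pp])
    have qc: "csqroot A\<omega> p \<in> carrier A\<omega>" using AU.U.csqroot_props(1)[OF pp] by simp
    show "\<exists>p\<in>central_seqs. \<exists>r n w. p \<in> npos A\<omega> \<and> p \<noteq> \<zero>\<^bsub>A\<omega>\<^esub> \<and> cnorm A\<omega> p \<le> 1 \<and>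
      J (csqroot A\<omega> p) \<bullet> e\<omega> \<bullet> J (csqroot A\<omega> p) = kB (F e) \<bullet> J p \<and>
      r \<in> npos B\<omega> \<and> (\<forall>i<n::nat. w i \<in> carrier LL) \<and>
      (\<Oplus>\<^bsub>B\<omega>\<^esub>i\<in>{..<n}. kB (w i) \<bullet> J p \<bullet> cadj B\<omega> (kB (w i))) = r \<and>
      r \<in> ultra_commutant \<omega> LL (carrier LL) \<and>
      r \<bullet> J (csqroot A\<omega> p) = J (csqroot A\<omega> p) \<bullet> J (csqroot A\<omega> p) \<bullet> J (csqroot A\<omega> p) \<and>
      cuntz_le B\<omega> (\<one>\<^bsub>B\<omega>\<^esub> \<ominus>\<^bsub>B\<omega>\<^esub> r) b"
    proof (rule bexI[OF _ pC], rule exI[of _ r], rule exI[of _ n], rule exI[of _ w], intro conjI)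
      show "cnorm A\<omega> p \<le> 1" using fp(2) unfolding fJ by (simp add: J_norm)
      show "J (csqroot A\<omega> p) \<bullet> e\<omega> \<bullet> J (csqroot A\<omega> p) = kB (F e) \<bullet> J p"
        using bspec[OF comp e_closed] unfolding s unfolding fJ .
      show "r \<bullet> J (csqroot A\<omega> p) = J (csqroot A\<omega> p) \<bullet> J (csqroot A\<omega> p) \<bullet> J (csqroot A\<omega> p)"
        using rf(1) qc unfolding s by (simp add: pow3)
    qed (fact pp pnz rp(1) w rs[unfolded fJ] r cz)+
  qed
qed

end

theorem theorem5p5:
  fixes A :: "'a cstar" and P :: "'a set" and E :: "'a \<Rightarrow> 'a" and \<omega> :: "nat filter"
  assumes "free_ultrafilter \<omega>"
    and "cstar_algebra A" and "cseparable A" and "\<not> cfinite_dimensional A"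
    and "unital_cstar_subalgebra P A"
    and "cseparable (A\<lparr>carrier := P\<rparr>)" and "\<not> cfinite_dimensional (A\<lparr>carrier := P\<rparr>)"
    and "conditional_expectation A P E" and "index_finite_type A E" and "outer A P E"
    and "csimple A"
    and "outer (basic_construction A E) (left_mult A E ` carrier A) (dual_expectation A E)"
  shows "weak_tracial_Rokhlin \<omega> A E \<longleftrightarrow>
    weakly_tracially_approx_representable \<omega> (basic_construction A E)
      (left_mult A E ` carrier A) (dual_expectation A E)"
proof -
  interpret cstar_algebra A by (rule assms(2))
  obtain n u v where "quasi_basis A E n u v" using assms(9) unfolding index_finite_type_def by blast
  then interpret fi: finite_index A P E n u v by unfold_locales (use assms in auto)
  \<comment> \<open>The given quasi-basis supplies the module theory from which a self-adjoint one
    is obtained; the comparison of the two properties is carried out with the latter.\<close>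
  obtain m t where "quasi_basis A E m t (\<lambda>j. cadj A (t j))" using fi.selfadjoint_quasi_basis by blast
  then interpret tower A P E m t \<omega> by unfold_locales (use assms in auto)
  show ?thesis
    using representable_if_rokhlin rokhlin_if_representable assms(4,10,12)
    unfolding basic_construction_eq by blast
qed

end
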